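(* Assume: (i) $\|g\|_\infty\le C$ with $C>0$; (ii) $Y_i-g(X_i)$ is $\sigma^2$-subgaussian given $X_i$ for $1\le i\le n$, with $\sigma>0$; (iii) $S\subseteq\mathbb R^d$ with $d\ge1$, and $\mathcal K=\{k_\gamma:\gamma\in\Gamma\}$ with $k_\gamma(x_1,x_2)=\gamma^{-d}\exp(-\|x_1-x_2\|_2^2/\gamma^2)$ for $x_1,x_2\in S$, where $\Gamma\subseteq[u,v]$ is non-empty and $v\ge u>0$; (iv) for some $\alpha\in[u,v]$, $\beta\in(0,1)$ and $B>0$, $H_\alpha$ is dense in $C(S)$ and $g\in[C(S),H_\alpha]_{\beta,\infty}$ with $\|g\|_{\beta,\infty}\le B$. Let $\nu>0$. Assume also that either (1) $R=[0,\infty)$, $\Gamma=[u,v]$, and $\hat r$ and $\hat\gamma$ are well-defined random variables on $(\Omega,\mathcal F)$; or (2) $R=\{bi:0\le i\le I-1\}\cup\{an^{1/2}\}$ with $a,b>0$ and $I=\lceil an^{1/2}/b\rceil$, and $\Gamma=\{uc^i:0\le i\le L-1\}\cup\{v\}$ with $c>1$ and $L=\lceil\log(v/u)/\log(c)\rceil$. Then there are constants $D_1,D_2>0$, not depending on $n$ or $\tau$, such that the following holds. Let $\tau\ge84J\sigma$ and $t=\left(\frac{\tau}{84J\sigma}\right)^2\ge1$. Then $\mathbb P(A_{3,t}\cap A_{4,t})\ge1-2e^{-t}$, and on the set $A_{3,t}\cap A_{4,t}\in\mathcal F$ we have $$\|V\hat h_{\hat\gamma,\hat r}-g\|_{L^2(P)}^2\le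 D_1\tau n^{-\beta/(1+\beta)}+D_2\tau^2n^{-(1+3\beta)/(2(1+\beta))}.$$
   Context: Setting. $S$ carries its Borel $\sigma$-algebra $\mathcal S$. $(X_i,Y_i)$, $1\le i\le n$, are i.i.d. $(S\times\mathbb R,\mathcal S\otimes\mathcal B(\mathbb R))$-valued random variables on a probability space $(\Omega,\mathcal F,\mathbb P)$ with $X_i\sim P$ and $\mathbb E(Y_i^2)<\infty$; $g:S\to\mathbb R$ is measurable with $\mathbb E(Y_i\mid X_i)=g(X_i)$ a.s. $P_n$ is the empirical distribution of $X_1,\dots,X_n$, so $\|f\|_{L^2(P_n)}^2=\frac1n\sum_if(X_i)^2$; $\|\cdot\|_\infty$ is the supremum norm. $U$ is $\sigma^2$-subgaussian given $W$ if $\mathbb E(\exp(sU)\mid W)\le\exp(\sigma^2s^2/2)$ a.s. for all $s\in\mathbb R$. $C(S)$ is the space of continuous functions on $S$ with the supremum norm. RKHSs and estimators. For $\gamma\in[u,v]$, $H_\gamma$ is the RKHS on $S$ with kernel $k_\gamma$ (given by the formula in the claim) and $B_\gamma$ its closed unit ball. For $\gamma\in\Gamma$ and $r>0$, $\hat h_{\gamma,r}$ is the minimiser of $\frac1n\sum_{i=1}^n(f(X_i)-Y_i)^2$ over $f\in rB_\gamma$, made unique by requiring $\hat h_{\gamma,r}\in\mathrm{span}\{k_\gamma(X_i,\cdot):1\le i\le n\}$; $\hat h_{\gamma,0}=0$. $V:\mathbb R\to[-C,C]$ is $V(s)=\max(-C,\min(s,C))$, and $Vf=V\circ f$. For $R\subseteq[0,\infty)$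 non-empty and $\tau,\nu>0$, $(\hat\gamma,\hat r)$ is a minimiser over $(\gamma,r)\in\Gamma\times R$ of $$\sup_{\eta\in\Gamma,\,\eta\le\gamma}\ \sup_{s\in R,\,s\ge r}\left(\|\hat h_{\gamma,r}-\hat h_{\eta,s}\|_{L^2(P_n)}^2-\frac{\tau(\gamma^{-d/2}r+\eta^{-d/2}s)}{n^{1/2}}\right)+\frac{2(1+\nu)\tau\gamma^{-d/2}r}{n^{1/2}}.$$ Complexity. $\mathcal L=\{f_\gamma:\gamma\in\Gamma\}\cup\{0\}$ with $f_\gamma(x_1,x_2)=\exp(-\|x_1-x_2\|_2^2/\gamma^2)$ on $S\times S$; $D=\sup_{f_1,f_2\in\mathcal L}\|f_1-f_2\|_\infty$; $N(a,M,\mathrm d)$ is the minimum size of an $a$-cover of a metric space $(M,\mathrm d)$; $J=\left(162\int_0^{D/2}\log(2N(a,\mathcal L,\|\cdot\|_\infty))\,da+1\right)^{1/2}$. Interpolation space. For a Banach space $(Z,\|\cdot\|_Z)$ with dense subspace $(W,\|\cdot\|_W)$, $K(z,s)=\inf_{w\in W}(\|z-w\|_Z+s\|w\|_W)$ for $s>0$, $\|z\|_{\beta,\infty}=\sup_{s>0}s^{-\beta}K(z,s)$, and $[Z,W]_{\beta,\infty}=\{z\in Z:\|z\|_{\beta,\infty}<\infty\}$. Events. For $t\ge1$, $A_{3,t}\in\mathcal F$ is an event with $\mathbb P(A_{3,t})\ge1-e^{-t}$ on which, simultaneously for all $\gamma\in\Gamma$, $r\ge0$ and $h_{\gamma,r}\in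 rB_\gamma$, $$\|\hat h_{\gamma,r}-h_{\gamma,r}\|_{L^2(P_n)}^2\le\frac{21J\gamma^{-d/2}\sigma rt^{1/2}}{n^{1/2}}+4\|h_{\gamma,r}-g\|_\infty^2$$ (such an event exists), and $A_{4,t}$ is the set on which, simultaneously for all $\gamma\in\Gamma$ and $r\ge0$, $$\sup_{f_1,f_2\in rB_\gamma}\left|\|Vf_1-Vf_2\|_{L^2(P_n)}^2-\|Vf_1-Vf_2\|_{L^2(P)}^2\right|\le\frac{151J\gamma^{-d/2}Crt^{1/2}}{n^{1/2}}+\frac{8\gamma^{-d/2}Crt}{3n}.$$ *)

theory Defs
  imports "HOL-Probability.Probability"
begin

text \<open>Functions on a set \<open>S\<close> are represented by total functions of which only the values on
  \<open>S\<close> matter. The real supremum below is the supremum norm only for functions bounded on \<open>S\<close>;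
  it is not applied to any others.\<close>

definition sup_norm :: "'a set \<Rightarrow> ('a \<Rightarrow> real) \<Rightarrow> real" where
  "sup_norm S f = (SUP x\<in>S. \<bar>f x\<bar>)"

text \<open>Boundedness is what makes the supremum norm a norm on \<open>C(S)\<close>; it is automatic for
  compact \<open>S\<close>.\<close>

definition cont_funs :: "'a::topological_space set \<Rightarrow> ('a \<Rightarrow> real) set" where
  "cont_funs S = {f. continuous_on S f \<and> bounded (f ` S)}"

definition dense_subset :: "('z::minus \<Rightarrow> real) \<Rightarrow> 'z set \<Rightarrow> 'z set \<Rightarrow> bool" where
  "dense_subset nZ Z W \<longleftrightarrow> W \<subseteq> Z \<and> (\<forall>z\<in>Z. \<forall>\<epsilon>>0. \<exists>w\<in>W. nZ (z - w) < \<epsilon>)"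

definition covering_number :: "real \<Rightarrow> 'm set \<Rightarrow> ('m \<Rightarrow> 'm \<Rightarrow> real) \<Rightarrow> nat" where
  "covering_number a M d =
     (LEAST N. \<exists>A\<subseteq>M. finite A \<and> card A = N \<and> (\<forall>x\<in>M. \<exists>y\<in>A. d x y \<le> a))"

definition K_functional ::
  "('z::minus \<Rightarrow> real) \<Rightarrow> 'z set \<Rightarrow> ('z \<Rightarrow> real) \<Rightarrow> 'z \<Rightarrow> real \<Rightarrow> real" where
  "K_functional nZ W nW z s = (INF w\<in>W. nZ (z - w) + s * nW w)"

definition interp_norm ::
  "('z::minus \<Rightarrow> real) \<Rightarrow> 'z set \<Rightarrow> ('z \<Rightarrow> real) \<Rightarrow> real \<Rightarrow> 'z \<Rightarrow> ennreal" where
  "interp_norm nZ W nW \<beta> z =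
     (SUP s\<in>{0<..}. ennreal (s powr (- \<beta>) * K_functional nZ W nW z s))"

definition interp_space ::
  "('z::minus \<Rightarrow> real) \<Rightarrow> 'z set \<Rightarrow> 'z set \<Rightarrow> ('z \<Rightarrow> real) \<Rightarrow> real \<Rightarrow> 'z set" where
  "interp_space nZ Z W nW \<beta> = {z \<in> Z. interp_norm nZ W nW \<beta> z < \<infinity>}"

text \<open>Elements of a space of functions on \<open>S\<close> are extended by \<open>0\<close> outside \<open>S\<close>, so that equality
  of elements is equality of HOL functions.\<close>

definition kernel_section :: "'a set \<Rightarrow> ('a \<Rightarrow> 'a \<Rightarrow> real) \<Rightarrow> 'a \<Rightarrow> 'a \<Rightarrow> real" where
  "kernel_section S k x = (\<lambda>y. if y \<in> S then k x y else 0)"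

definition ip_norm :: "('f \<Rightarrow> 'f \<Rightarrow> real) \<Rightarrow> 'f \<Rightarrow> real" where
  "ip_norm ip f = sqrt (ip f f)"

definition function_hilbert_space ::
  "'a set \<Rightarrow> ('a \<Rightarrow> real) set \<Rightarrow> (('a \<Rightarrow> real) \<Rightarrow> ('a \<Rightarrow> real) \<Rightarrow> real) \<Rightarrow> bool" where
  "function_hilbert_space S H ip \<longleftrightarrow>
     (\<forall>f\<in>H. \<forall>x. x \<notin> S \<longrightarrow> f x = 0) \<and>
     (\<lambda>x. 0) \<in> H \<and>
     (\<forall>f\<in>H. \<forall>h\<in>H. (\<lambda>x. f x + h x) \<in> H) \<and>
     (\<forall>c. \<forall>f\<in>H. (\<lambda>x. c * f x) \<in> H) \<and>
     (\<forall>f\<in>H. \<forall>h\<in>H. ip f h = ip h f) \<and>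
     (\<forall>f1\<in>H. \<forall>f2\<in>H. \<forall>h\<in>H. ip (\<lambda>x. f1 x + f2 x) h = ip f1 h + ip f2 h) \<and>
     (\<forall>c. \<forall>f\<in>H. \<forall>h\<in>H. ip (\<lambda>x. c * f x) h = c * ip f h) \<and>
     (\<forall>f\<in>H. 0 \<le> ip f f \<and> (ip f f = 0 \<longrightarrow> f = (\<lambda>x. 0))) \<and>
     (\<forall>F::nat \<Rightarrow> 'a \<Rightarrow> real.
        (\<forall>m. F m \<in> H) \<and> (\<forall>\<epsilon>>0. \<exists>N. \<forall>m\<ge>N. \<forall>l\<ge>N. ip_norm ip (F m - F l) < \<epsilon>) \<longrightarrow>
        (\<exists>f\<in>H. (\<lambda>m. ip_norm ip (F m - f)) \<longlonglongrightarrow> 0))"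

text \<open>For a given kernel the pair \<open>(H, ip)\<close> is unique (\<open>ip\<close> on \<open>H\<close>), and it exists exactly when
  the kernel is symmetric and positive semidefinite on \<open>S\<close>.\<close>

definition is_rkhs ::
  "'a set \<Rightarrow> ('a \<Rightarrow> 'a \<Rightarrow> real) \<Rightarrow> ('a \<Rightarrow> real) set \<Rightarrow>
   (('a \<Rightarrow> real) \<Rightarrow> ('a \<Rightarrow> real) \<Rightarrow> real) \<Rightarrow> bool" where
  "is_rkhs S k H ip \<longleftrightarrow>
     function_hilbert_space S H ip \<and>
     (\<forall>x\<in>S. kernel_section S k x \<in> H \<and> (\<forall>f\<in>H. ip f (kernel_section S k x) = f x))"

definition rkhs_ball ::
  "('a \<Rightarrow> real) set \<Rightarrow> (('a \<Rightarrow> real) \<Rightarrow> ('a \<Rightarrow> real) \<Rightarrow> real) \<Rightarrow> real \<Rightarrow> ('a \<Rightarrow> real) set" where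
  "rkhs_ball H ip r = {f \<in> H. ip_norm ip f \<le> r}"

definition gauss_kernel :: "real \<Rightarrow> real^'d \<Rightarrow> real^'d \<Rightarrow> real" where
  "gauss_kernel \<gamma> x1 x2 =
     \<gamma> powr (- real CARD('d)) * exp (- (norm (x1 - x2))\<^sup>2 / \<gamma>\<^sup>2)"

definition kernel_class :: "real set \<Rightarrow> ((real^'d) \<times> (real^'d) \<Rightarrow> real) set" where
  "kernel_class \<Gamma> =
     (\<lambda>\<gamma> (x1, x2). exp (- (norm (x1 - x2))\<^sup>2 / \<gamma>\<^sup>2)) ` \<Gamma> \<union> {\<lambda>_. 0}"

definition complexity_J :: "(real^'d) set \<Rightarrow> real set \<Rightarrow> real" where
  "complexity_J S \<Gamma> =
     (let L = kernel_class \<Gamma>;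
          dist_sup = (\<lambda>f1 f2. sup_norm (S \<times> S) (f1 - f2));
          D = (SUP (f1, f2)\<in>L \<times> L. dist_sup f1 f2)
      in sqrt (162 * (LBINT a:{0..D / 2}. ln (2 * real (covering_number a L dist_sup))) + 1))"

abbreviation borel_on :: "'a::topological_space set \<Rightarrow> 'a measure" where
  "borel_on S \<equiv> restrict_space borel S"

definition sigma_gen :: "'w measure \<Rightarrow> 's measure \<Rightarrow> ('w \<Rightarrow> 's) \<Rightarrow> 'w measure" where
  "sigma_gen M N W = vimage_algebra (space M) W N"

text \<open>The nonnegative conditional expectation is used because it is meaningful without assuming
  that the exponentials are integrable.\<close>

definition subgaussian_given ::
  "'w measure \<Rightarrow> 's measure \<Rightarrow> real \<Rightarrow> ('w \<Rightarrow> real) \<Rightarrow> ('w \<Rightarrow> 's) \<Rightarrow> bool" where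
  "subgaussian_given M N \<sigma>2 U W \<longleftrightarrow>
     (\<forall>s::real. AE \<omega> in M.
        nn_cond_exp M (sigma_gen M N W) (\<lambda>\<omega>. ennreal (exp (s * U \<omega>))) \<omega>
          \<le> ennreal (exp (\<sigma>2 * s\<^sup>2 / 2)))"

text \<open>\<open>Q\<close> is the common law of the pairs \<open>(X i, Y i)\<close>, \<open>1 \<le> i \<le> n\<close>.\<close>

definition regression_sample ::
  "'w measure \<Rightarrow> 'a::topological_space set \<Rightarrow> ('a \<times> real) measure \<Rightarrow> ('a \<Rightarrow> real) \<Rightarrow> nat \<Rightarrow>
   (nat \<Rightarrow> 'w \<Rightarrow> 'a) \<Rightarrow> (nat \<Rightarrow> 'w \<Rightarrow> real) \<Rightarrow> bool" where
  "regression_sample M S Q g n X Y \<longleftrightarrow>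
     prob_space M \<and>
     prob_space.indep_vars M (\<lambda>_. borel_on S \<Otimes>\<^sub>M borel) (\<lambda>i \<omega>. (X i \<omega>, Y i \<omega>)) {1..n} \<and>
     (\<forall>i\<in>{1..n}.
        distr M (borel_on S \<Otimes>\<^sub>M borel) (\<lambda>\<omega>. (X i \<omega>, Y i \<omega>)) = Q \<and>
        integrable M (\<lambda>\<omega>. (Y i \<omega>)\<^sup>2) \<and>
        (AE \<omega> in M. real_cond_exp M (sigma_gen M (borel_on S) (X i)) (Y i) \<omega> = g (X i \<omega>)))"

text \<open>Here and below \<open>x\<close> is a realisation \<open>x 1, \<dots>, x n\<close> of the covariates.\<close>

definition emp_norm2 :: "nat \<Rightarrow> (nat \<Rightarrow> 'a) \<Rightarrow> ('a \<Rightarrow> real) \<Rightarrow> real" where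
  "emp_norm2 n x f = (1 / real n) * (\<Sum>i=1..n. (f (x i))\<^sup>2)"

definition L2_norm2 :: "'a measure \<Rightarrow> ('a \<Rightarrow> real) \<Rightarrow> real" where
  "L2_norm2 P f = (LINT z|P. (f z)\<^sup>2)"

definition clip :: "real \<Rightarrow> real \<Rightarrow> real" where
  "clip C s = max (- C) (min s C)"

definition is_constrained_lse ::
  "'a set \<Rightarrow> ('a \<Rightarrow> 'a \<Rightarrow> real) \<Rightarrow> ('a \<Rightarrow> real) set \<Rightarrow> (('a \<Rightarrow> real) \<Rightarrow> ('a \<Rightarrow> real) \<Rightarrow> real) \<Rightarrow>
   nat \<Rightarrow> (nat \<Rightarrow> 'a) \<Rightarrow> (nat \<Rightarrow> real) \<Rightarrow> real \<Rightarrow> ('a \<Rightarrow> real) \<Rightarrow> bool" where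
  "is_constrained_lse S k H ip n x y r h \<longleftrightarrow>
     (if r = 0 then h = (\<lambda>z. 0)
      else h \<in> rkhs_ball H ip r \<and>
           (\<exists>c. h = (\<lambda>z. \<Sum>i=1..n. c i * kernel_section S k (x i) z)) \<and>
           (\<forall>f\<in>rkhs_ball H ip r.
              (1 / real n) * (\<Sum>i=1..n. (h (x i) - y i)\<^sup>2)
                \<le> (1 / real n) * (\<Sum>i=1..n. (f (x i) - y i)\<^sup>2)))"

text \<open>The suprema are over non-empty sets that are bounded above when \<open>h \<gamma> r\<close> are the constrained
  least-squares estimators, since their empirical norms are bounded in terms of the data.\<close>

definition gl_objective ::
  "real set \<Rightarrow> real set \<Rightarrow> real \<Rightarrow> real \<Rightarrow> nat \<Rightarrow> (nat \<Rightarrow> real^'d) \<Rightarrow>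
   (real \<Rightarrow> real \<Rightarrow> real^'d \<Rightarrow> real) \<Rightarrow> real \<Rightarrow> real \<Rightarrow> real" where
  "gl_objective \<Gamma> R \<tau> \<nu> n x h \<gamma> r =
     (SUP \<eta>\<in>{\<eta>\<in>\<Gamma>. \<eta> \<le> \<gamma>}. SUP s\<in>{s\<in>R. r \<le> s}.
        emp_norm2 n x (h \<gamma> r - h \<eta> s)
        - \<tau> * (\<gamma> powr (- real CARD('d) / 2) * r + \<eta> powr (- real CARD('d) / 2) * s)
            / sqrt (real n))
     + 2 * (1 + \<nu>) * \<tau> * \<gamma> powr (- real CARD('d) / 2) * r / sqrt (real n)"

definition is_gl_minimiser ::
  "real set \<Rightarrow> real set \<Rightarrow> real \<Rightarrow> real \<Rightarrow> nat \<Rightarrow> (nat \<Rightarrow> real^'d) \<Rightarrow>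
   (real \<Rightarrow> real \<Rightarrow> real^'d \<Rightarrow> real) \<Rightarrow> real \<Rightarrow> real \<Rightarrow> bool" where
  "is_gl_minimiser \<Gamma> R \<tau> \<nu> n x h \<gamma> r \<longleftrightarrow>
     \<gamma> \<in> \<Gamma> \<and> r \<in> R \<and>
     (\<forall>\<gamma>'\<in>\<Gamma>. \<forall>r'\<in>R.
        gl_objective \<Gamma> R \<tau> \<nu> n x h \<gamma> r \<le> gl_objective \<Gamma> R \<tau> \<nu> n x h \<gamma>' r')"

definition radius_grid :: "real \<Rightarrow> real \<Rightarrow> nat \<Rightarrow> real set" where
  "radius_grid a b n =
     (\<lambda>i. b * real i) ` {i. i < nat \<lceil>a * sqrt (real n) / b\<rceil>} \<union> {a * sqrt (real n)}"

definition width_grid :: "real \<Rightarrow> real \<Rightarrow> real \<Rightarrow> real set" where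
  "width_grid u v c = (\<lambda>i. u * c ^ i) ` {i. i < nat \<lceil>ln (v / u) / ln c\<rceil>} \<union> {v}"

text \<open>\<open>h \<gamma> r\<close> are the estimators computed from the realised sample.\<close>

definition event3_bound ::
  "(real^'d) set \<Rightarrow> real set \<Rightarrow> (real \<Rightarrow> (real^'d \<Rightarrow> real) set) \<Rightarrow>
   (real \<Rightarrow> (real^'d \<Rightarrow> real) \<Rightarrow> (real^'d \<Rightarrow> real) \<Rightarrow> real) \<Rightarrow> (real^'d \<Rightarrow> real) \<Rightarrow> real \<Rightarrow>
   nat \<Rightarrow> real \<Rightarrow> (nat \<Rightarrow> real^'d) \<Rightarrow> (real \<Rightarrow> real \<Rightarrow> real^'d \<Rightarrow> real) \<Rightarrow> bool" where
  "event3_bound S \<Gamma> H ip g \<sigma> n t x h \<longleftrightarrow>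
     (\<forall>\<gamma>\<in>\<Gamma>. \<forall>r\<ge>0. \<forall>f\<in>rkhs_ball (H \<gamma>) (ip \<gamma>) r.
        emp_norm2 n x (h \<gamma> r - f)
          \<le> 21 * complexity_J S \<Gamma> * \<gamma> powr (- real CARD('d) / 2) * \<sigma> * r * sqrt t
               / sqrt (real n)
             + 4 * (sup_norm S (f - g))\<^sup>2)"

definition event4 ::
  "'w measure \<Rightarrow> (real^'d) set \<Rightarrow> (real^'d) measure \<Rightarrow> real set \<Rightarrow>
   (real \<Rightarrow> (real^'d \<Rightarrow> real) set) \<Rightarrow>
   (real \<Rightarrow> (real^'d \<Rightarrow> real) \<Rightarrow> (real^'d \<Rightarrow> real) \<Rightarrow> real) \<Rightarrow> real \<Rightarrow>
   nat \<Rightarrow> real \<Rightarrow> (nat \<Rightarrow> 'w \<Rightarrow> real^'d) \<Rightarrow> 'w set" where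
  "event4 M S P \<Gamma> H ip C n t X =
     {\<omega> \<in> space M. \<forall>\<gamma>\<in>\<Gamma>. \<forall>r\<ge>0.
        (SUP (f1, f2)\<in>rkhs_ball (H \<gamma>) (ip \<gamma>) r \<times> rkhs_ball (H \<gamma>) (ip \<gamma>) r.
           \<bar>emp_norm2 n (\<lambda>i. X i \<omega>) ((clip C \<circ> f1) - (clip C \<circ> f2))
             - L2_norm2 P ((clip C \<circ> f1) - (clip C \<circ> f2))\<bar>)
        \<le> 151 * complexity_J S \<Gamma> * \<gamma> powr (- real CARD('d) / 2) * C * r * sqrt t
             / sqrt (real n)
           + 8 * \<gamma> powr (- real CARD('d) / 2) * C * r * t / (3 * real n)}"

end

theory Submission imports Defs begin

text \<open>The argument is run at the smallest width \<open>u\<close>, which belongs to \<Gamma> in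
  both settings. The normalisation of the Gaussian kernel makes its Fourier transform decrease
  pointwise in the width, so the ball of a given radius grows as the width shrinks
  (\<open>gauss_kernel_order\<close>, \<open>rkhs_ball_mono_kernel\<close>). The interpolation
  hypothesis gives, for every s > 0, an f in \<open>H \<alpha>\<close> within
  \<open>2 * B * s powr \<beta>\<close> of g in sup norm and of norm at most r0 =
  \<open>2 * B * s powr (\<beta> - 1)\<close>; this f also lies in the ball of radius r0 at width
  \<open>u\<close>. A suitable power s of n gives the squared bias and r0 / sqrt n the same order n
  powr (- \<beta> / (1 + \<beta>)) (\<open>rate_exponents\<close>).

  On the first event the estimators at width \<open>u\<close> whose radius is large enough are close
  to f in empirical norm. No width of \<Gamma> lies below \<open>u\<close>, so the selection
  criterion at \<open>u\<close> is of the order of squared bias plus penalty, and minimality carries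
  this bound to the selected pair. It controls both the selected radius, through the surplus \<nu>
  in the penalty, and the empirical distance from the selected estimator to one at width
  \<open>u\<close> with a larger radius, hence to f (\<open>goldenshluger_lepski_bound\<close>). On
  the second event the empirical norm of the clipped difference can be replaced by the norm of
  L2(P), because both functions lie in one ball at width \<open>u\<close>; the sup distance from f
  to g completes the bound (\<open>risk_bound\<close>).

  The second event has to be shown measurable and likely. Divided by r w(\<gamma>), where
  w(\<gamma>) is \<gamma> to the power - d / 2, the squared clipped differences take values in an
  interval of length 4 C and are Lipschitz in the scaled functions and the scale. Symmetrisation and
  contraction reduce the mean supremum to sign averages of linear classes; the square of such a sign
  sum is dominated by a quadratic sign chaos indexed by the kernels, and chaining with exponential
  tails produces the entropy integral in J (\<open>chaos_entropy_bound\<close>,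
  \<open>sign_mean_adm_class\<close>). The bounded difference inequality supplies the deviation, and
  continuity lets a countable subclass stand for the whole one (\<open>countable_reduction\<close>,
  \<open>event4_prob\<close>).\<close>

section \<open>Inner-product calculus in Hilbert spaces of functions\<close>

locale function_hilbert =
  fixes S :: "'a set" and H :: "('a \<Rightarrow> real) set" and ip :: "('a \<Rightarrow> real) \<Rightarrow> ('a \<Rightarrow> real) \<Rightarrow> real"
  assumes fhs: "function_hilbert_space S H ip"
begin

lemma vanish: "f \<in> H \<Longrightarrow> x \<notin> S \<Longrightarrow> f x = 0"
  by (rule fhs[unfolded function_hilbert_space_def, THEN conjunct1, THEN bspec, THEN spec, THEN mp])

lemma zero_mem: "(\<lambda>x. 0) \<in> H"
  by (rule fhs[unfolded function_hilbert_space_def, THEN conjunct2, THEN conjunct1])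

lemma add_mem: "f \<in> H \<Longrightarrow> h \<in> H \<Longrightarrow> (\<lambda>x. f x + h x) \<in> H"
  by (rule fhs[unfolded function_hilbert_space_def, THEN conjunct2, THEN conjunct2, THEN conjunct1, THEN bspec, THEN bspec])

lemma scale_mem: "f \<in> H \<Longrightarrow> (\<lambda>x. c * f x) \<in> H"
  by (rule fhs[unfolded function_hilbert_space_def, THEN conjunct2, THEN conjunct2, THEN conjunct2, THEN conjunct1, THEN spec, THEN bspec])

lemma ip_commute: "f \<in> H \<Longrightarrow> h \<in> H \<Longrightarrow> ip f h = ip h f"
  by (rule fhs[unfolded function_hilbert_space_def, THEN conjunct2, THEN conjunct2, THEN conjunct2, THEN conjunct2, THEN conjunct1, THEN bspec, THEN bspec])

lemma ip_add_left: "f \<in> H \<Longrightarrow> f' \<in> H \<Longrightarrow> h \<in> H \<Longrightarrow> ip (\<lambda>x. f x + f' x) h = ip f h + ip f' h"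
  by (rule fhs[unfolded function_hilbert_space_def, THEN conjunct2, THEN conjunct2, THEN conjunct2, THEN conjunct2, THEN conjunct2, THEN conjunct1, THEN bspec, THEN bspec, THEN bspec])

lemma ip_scale_left: "f \<in> H \<Longrightarrow> h \<in> H \<Longrightarrow> ip (\<lambda>x. c * f x) h = c * ip f h"
  by (rule fhs[unfolded function_hilbert_space_def, THEN conjunct2, THEN conjunct2, THEN conjunct2, THEN conjunct2, THEN conjunct2, THEN conjunct2, THEN conjunct1, THEN spec, THEN bspec, THEN bspec])

lemma ip_nonneg_and_eq_0: "f \<in> H \<Longrightarrow> 0 \<le> ip f f \<and> (ip f f = 0 \<longrightarrow> f = (\<lambda>x. 0))"
  by (rule fhs[unfolded function_hilbert_space_def, THEN conjunct2, THEN conjunct2, THEN conjunct2, THEN conjunct2, THEN conjunct2, THEN conjunct2, THEN conjunct2, THEN conjunct1, THEN bspec])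

lemma ip_nonneg: "f \<in> H \<Longrightarrow> 0 \<le> ip f f"
  and ip_eq_0: "f \<in> H \<Longrightarrow> ip f f = 0 \<Longrightarrow> f = (\<lambda>x. 0)"
  using ip_nonneg_and_eq_0 by blast+

lemma complete:
  assumes F: "\<And>m. F m \<in> H" "\<And>\<epsilon>. \<epsilon> > 0 \<Longrightarrow> \<exists>N. \<forall>m\<ge>N. \<forall>l\<ge>N. ip_norm ip (F m - F l) < \<epsilon>"
  shows "\<exists>f\<in>H. (\<lambda>m. ip_norm ip (F m - f)) \<longlonglongrightarrow> 0"
  by (rule fhs[unfolded function_hilbert_space_def, THEN conjunct2, THEN conjunct2, THEN conjunct2, THEN conjunct2, THEN conjunct2, THEN conjunct2, THEN conjunct2, THEN conjunct2, 
        THEN spec, THEN mp]) (intro conjI allI impI F)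

lemma ip_add_right: "f \<in> H \<Longrightarrow> h \<in> H \<Longrightarrow> h' \<in> H \<Longrightarrow> ip f (\<lambda>x. h x + h' x) = ip f h + ip f h'"
  using ip_commute[of f "\<lambda>x. h x + h' x"] ip_add_left[of h h' f] ip_commute[of f h] ip_commute[of f h'] add_mem[of h h']
  by simp

lemma ip_scale_right: "f \<in> H \<Longrightarrow> h \<in> H \<Longrightarrow> ip f (\<lambda>x. c * h x) = c * ip f h"
  using ip_commute[of f "\<lambda>x. c * h x"] ip_scale_left[of h f c] ip_commute[of f h] scale_mem[of h c]
  by simp

lemma diff_eq: "f - h = (\<lambda>x. f x + (-1) * h x)" for f h :: "'a \<Rightarrow> real"
  by (simp add: fun_eq_iff)

lemma diff_mem: "f \<in> H \<Longrightarrow> h \<in> H \<Longrightarrow> f - h \<in> H"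
  unfolding diff_eq by (intro add_mem scale_mem)

lemma ip_diff_left: "f \<in> H \<Longrightarrow> f' \<in> H \<Longrightarrow> h \<in> H \<Longrightarrow> ip (f - f') h = ip f h - ip f' h"
  unfolding diff_eq using ip_add_left[of f "\<lambda>x. (-1) * f' x" h] ip_scale_left[of f' h "-1"] scale_mem[of f' "-1"]
  by simp

lemma ip_diff_right: "f \<in> H \<Longrightarrow> h \<in> H \<Longrightarrow> h' \<in> H \<Longrightarrow> ip f (h - h') = ip f h - ip f h'"
  using ip_commute[of f "h - h'"] ip_diff_left[of h h' f] ip_commute[of f h] ip_commute[of f h'] diff_mem[of h h']
  by simp

lemma ip_zero_left: "h \<in> H \<Longrightarrow> ip (\<lambda>x. 0) h = 0"
  using ip_scale_left[of "\<lambda>x. 0" h 0] zero_mem by simp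

lemma ip_norm_power2: "f \<in> H \<Longrightarrow> (ip_norm ip f)\<^sup>2 = ip f f"
  by (simp add: ip_norm_def ip_nonneg)

lemma ip_norm_nonneg: "f \<in> H \<Longrightarrow> 0 \<le> ip_norm ip f"
  by (simp add: ip_norm_def ip_nonneg)

lemma ip_norm_scale: "f \<in> H \<Longrightarrow> ip_norm ip (\<lambda>x. c * f x) = \<bar>c\<bar> * ip_norm ip f"
proof -
  assume f: "f \<in> H"
  have "ip (\<lambda>x. c * f x) (\<lambda>x. c * f x) = c\<^sup>2 * ip f f"
    using f by (simp add: ip_scale_left ip_scale_right scale_mem power2_eq_square)
  thus ?thesis
    by (simp add: ip_norm_def real_sqrt_mult)
qed

lemma Cauchy_Schwarz:
  assumes f: "f \<in> H" and h: "h \<in> H"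
  shows "\<bar>ip f h\<bar> \<le> ip_norm ip f * ip_norm ip h"
proof -
  have "(ip f h)\<^sup>2 \<le> ip f f * ip h h"
  proof (cases "ip h h = 0")
    case True
    hence "h = (\<lambda>x. 0)"
      using ip_eq_0 h by blast
    thus ?thesis
      using ip_zero_left[OF f] ip_commute[OF f h] ip_zero_left[OF h] by simp
  next
    case False
    \<comment> \<open>The minimiser over t of the squared norm of f + t h.\<close>
    define t where "t = - ip f h / ip h h"
    have th: "(\<lambda>x. t * h x) \<in> H"
      using h by (rule scale_mem)
    have "0 \<le> ip (\<lambda>x. f x + t * h x) (\<lambda>x. f x + t * h x)"
      using f th by (intro ip_nonneg add_mem)
    also have "\<dots> = ip f f + 2 * t * ip f h + t\<^sup>2 * ip h h"
      using f h th by (simp add: ip_add_left ip_add_right ip_scale_left ip_scale_right add_mem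
          ip_commute[of h f] power2_eq_square algebra_simps)
    also have "\<dots> = ip f f - (ip f h)\<^sup>2 / ip h h"
      using False by (simp add: t_def power2_eq_square field_simps)
    finally have "(ip f h)\<^sup>2 / ip h h \<le> ip f f"
      by simp
    moreover have "ip h h > 0"
      using False ip_nonneg[OF h] by simp
    ultimately show ?thesis
      by (simp add: field_simps)
  qed
  hence "sqrt ((ip f h)\<^sup>2) \<le> sqrt (ip f f * ip h h)"
    by (rule real_sqrt_le_mono)
  thus ?thesis
    by (simp add: ip_norm_def real_sqrt_mult)
qed

end

section \<open>Kernel combinations and inclusion of balls between kernels\<close>

locale rkhs =
  fixes S :: "'a set" and k :: "'a \<Rightarrow> 'a \<Rightarrow> real" and H :: "('a \<Rightarrow> real) set"
    and ip :: "('a \<Rightarrow> real) \<Rightarrow> ('a \<Rightarrow> real) \<Rightarrow> real"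
  assumes is_rkhs: "is_rkhs S k H ip"
begin

sublocale function_hilbert S H ip
  using is_rkhs by unfold_locales (simp add: is_rkhs_def)

lemma section_mem: "x \<in> S \<Longrightarrow> kernel_section S k x \<in> H"
  and reproducing: "x \<in> S \<Longrightarrow> f \<in> H \<Longrightarrow> ip f (kernel_section S k x) = f x"
  using is_rkhs by (auto simp: is_rkhs_def)

lemma ip_sections: "x \<in> S \<Longrightarrow> y \<in> S \<Longrightarrow> ip (kernel_section S k x) (kernel_section S k y) = k x y"
  using section_mem reproducing by (simp add: kernel_section_def)

text \<open>Weighted lists of points stand for the span of the sections. Points may repeat, so
  addition is concatenation and a perturbation by one section is a \<open>Cons\<close>; coefficients
  never have to be merged.\<close>

definition comb :: "(real \<times> 'a) list \<Rightarrow> 'a \<Rightarrow> real" where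
  "comb l = (\<lambda>z. \<Sum>p\<leftarrow>l. fst p * kernel_section S k (snd p) z)"

lemma comb_Nil: "comb [] = (\<lambda>z. 0)"
  and comb_Cons: "comb (p # l) = (\<lambda>z. fst p * kernel_section S k (snd p) z + comb l z)"
  and comb_append: "comb (l @ l') = (\<lambda>z. comb l z + comb l' z)"
  by (auto simp: comb_def)

lemma comb_scale: "comb (map (\<lambda>p. (c * fst p, snd p)) l) = (\<lambda>z. c * comb l z)"
  by (induction l) (auto simp: comb_Nil comb_Cons algebra_simps)

lemma comb_mem: "snd ` set l \<subseteq> S \<Longrightarrow> comb l \<in> H"
  by (induction l) (auto simp: comb_Nil comb_Cons intro!: zero_mem add_mem scale_mem section_mem)

lemma ip_comb: "snd ` set l \<subseteq> S \<Longrightarrow> f \<in> H \<Longrightarrow> ip f (comb l) = (\<Sum>p\<leftarrow>l. fst p * f (snd p))"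
proof (induction l)
  case Nil
  thus ?case
    using ip_zero_left ip_commute zero_mem by (simp add: comb_Nil)
next
  case (Cons p l)
  have "(\<lambda>z. fst p * kernel_section S k (snd p) z) \<in> H"
    using Cons by (intro scale_mem section_mem) auto
  thus ?case
    using Cons by (simp add: comb_Cons ip_add_right comb_mem ip_scale_right section_mem reproducing)
qed

lemma comb_eval: "snd ` set l \<subseteq> S \<Longrightarrow> y \<in> S \<Longrightarrow> comb l y = (\<Sum>p\<leftarrow>l. fst p * k (snd p) y)"
  by (induction l) (auto simp: comb_Nil comb_Cons kernel_section_def)

text \<open>The norm of a combination depends on kernel values alone, which is what turns an
  inequality between two kernels into one between the two norms.\<close>

lemma ip_comb_comb:
  assumes "snd ` set l \<subseteq> S"
  shows "ip (comb l) (comb l) = (\<Sum>p\<leftarrow>l. \<Sum>q\<leftarrow>l. fst p * fst q * k (snd p) (snd q))"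
proof -
  have "ip (comb l) (comb l) = (\<Sum>p\<leftarrow>l. fst p * comb l (snd p))"
    using assms by (intro ip_comb comb_mem)
  also have "\<dots> = (\<Sum>p\<leftarrow>l. \<Sum>q\<leftarrow>l. fst p * fst q * k (snd p) (snd q))"
  proof (intro arg_cong[where f=sum_list] map_cong refl)
    fix p assume p: "p \<in> set l"
    have "fst p * comb l (snd p) = (\<Sum>q\<leftarrow>l. fst p * (fst q * k (snd q) (snd p)))"
      using assms p by (subst comb_eval) (auto simp: sum_list_const_mult)
    also have "\<dots> = (\<Sum>q\<leftarrow>l. fst p * fst q * k (snd p) (snd q))"
    proof (intro arg_cong[where f=sum_list] map_cong refl)
      fix q assume q: "q \<in> set l"
      have "snd p \<in> S" "snd q \<in> S"
        using p q assms by auto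
      hence "k (snd q) (snd p) = k (snd p) (snd q)"
        using ip_sections ip_commute section_mem by metis
      thus "fst p * (fst q * k (snd q) (snd p)) = fst p * fst q * k (snd p) (snd q)"
        by simp
    qed
    finally show "fst p * comb l (snd p) = (\<Sum>q\<leftarrow>l. fst p * fst q * k (snd p) (snd q))" .
  qed
  finally show ?thesis .
qed

lemma abs_le: "f \<in> H \<Longrightarrow> x \<in> S \<Longrightarrow> \<bar>f x\<bar> \<le> ip_norm ip f * sqrt (k x x)"
  using Cauchy_Schwarz[of f "kernel_section S k x"] section_mem reproducing ip_sections
  by (simp add: ip_norm_def)

text \<open>The square root is the norm of the difference of the two sections, so a norm ball is
  equi-Lipschitz in the pseudometric that the kernel induces on S.\<close>

lemma abs_diff_le:
  assumes "f \<in> H" "x \<in> S" "y \<in> S"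
  shows "\<bar>f x - f y\<bar> \<le> ip_norm ip f * sqrt (k x x + k y y - 2 * k x y)"
proof -
  let ?d = "kernel_section S k x - kernel_section S k y"
  have kx: "kernel_section S k x \<in> H" "kernel_section S k y \<in> H"
    using assms section_mem by auto
  have "ip ?d ?d = k x x + k y y - 2 * k x y"
    using kx assms ip_commute[of "kernel_section S k y" "kernel_section S k x"] ip_sections[of x y]
    by (simp add: ip_diff_left ip_diff_right diff_mem ip_sections)
  moreover have "ip f ?d = f x - f y"
    using kx assms by (simp add: ip_diff_right reproducing)
  ultimately show ?thesis
    using Cauchy_Schwarz[of f ?d] assms kx by (simp add: ip_norm_def diff_mem)
qed

text \<open>Riesz representation by hand: the quadratic functional
  \<open>l \<mapsto> 2 (\<Sum>p\<leftarrow>l. fst p * f (snd p)) - ip (comb l) (comb l)\<close> is bounded, the parallelogram law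
  makes a maximising sequence Cauchy, and its limit is \<open>f\<close>.\<close>

lemma mem_ball_if_dominated:
  assumes f0: "\<And>x. x \<notin> S \<Longrightarrow> f x = 0" and r: "r \<ge> 0"
    and dom: "\<And>l. snd ` set l \<subseteq> S \<Longrightarrow> (\<Sum>p\<leftarrow>l. fst p * f (snd p)) \<le> r * ip_norm ip (comb l)"
  shows "f \<in> rkhs_ball H ip r"
proof -
  define L where "L l = (\<Sum>p\<leftarrow>l. fst p * f (snd p))" for l :: "(real \<times> 'a) list"
  define J where "J l = 2 * L l - ip (comb l) (comb l)" for l
  define W where "W = {l :: (real \<times> 'a) list. snd ` set l \<subseteq> S}"
  have W_H: "comb l \<in> H" if "l \<in> W" for l
    using that comb_mem[of l] by (simp add: W_def)
  have J_le: "J l \<le> r\<^sup>2" if "l \<in> W" for l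
  proof -
    have "L l \<le> r * ip_norm ip (comb l)"
      using dom[of l] that by (simp add: L_def W_def)
    moreover have "0 \<le> (r - ip_norm ip (comb l))\<^sup>2" by simp
    ultimately show ?thesis
      using ip_norm_power2[OF W_H[OF that]] by (simp add: J_def power2_diff)
  qed
  define M where "M = (SUP l\<in>W. J l)"
  have bdd: "bdd_above (J ` W)"
    by (rule bdd_aboveI2[OF J_le])
  have "[] \<in> W" by (simp add: W_def)
  have J_M: "J l \<le> M" if "l \<in> W" for l
    unfolding M_def by (rule cSUP_upper[OF that bdd])
  have "\<exists>l\<in>W. M - 1 / real (Suc m) < J l" for m
  proof -
    have "M - 1 / real (Suc m) < (SUP l\<in>W. J l)"
      by (simp add: M_def)
    thus ?thesis
      using less_cSUP_iff[of W J] bdd \<open>[] \<in> W\<close> by blast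
  qed
  then obtain lm where lm: "\<And>m. lm m \<in> W" "\<And>m. M - 1 / real (Suc m) < J (lm m)"
    by metis
  have L_append: "L (l @ l') = L l + L l'" for l l'
    by (simp add: L_def)
  have L_scale: "L (map (\<lambda>p. (c * fst p, snd p)) l) = c * L l" for c l
    by (induction l) (auto simp: L_def algebra_simps)
  \<comment> \<open>\<open>?m\<close> is the midpoint of the two combinations. Its value is at most
    M, so by the parallelogram law near-maximisers are close to one another.\<close>
  have par: "ip (comb l - comb l') (comb l - comb l') \<le> 2 * ((M - J l) + (M - J l'))"
    if "l \<in> W" "l' \<in> W" for l l'
  proof -
    let ?m = "map (\<lambda>p. (1/2 * fst p, snd p)) (l @ l')"
    have mW: "?m \<in> W"
      using that by (auto simp: W_def)
    have c: "comb ?m = (\<lambda>z. 1/2 * (comb l z + comb l' z))"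
      by (simp only: comb_scale comb_append)
    have "ip (comb ?m) (comb ?m) = 1/4 * (ip (comb l) (comb l) + 2 * ip (comb l) (comb l') + ip (comb l') (comb l'))"
    proof -
      have "ip (comb ?m) (comb ?m) = 1/2 * (1/2 * (ip (comb l) (comb l) + ip (comb l) (comb l')
          + (ip (comb l) (comb l') + ip (comb l') (comb l'))))"
        unfolding c using W_H[OF that(1)] W_H[OF that(2)]
        by (simp add: ip_scale_left ip_scale_right scale_mem add_mem ip_add_left ip_add_right
            ip_commute[of "comb l'" "comb l"] del: times_divide_eq_left)
      moreover have "a = 1/2 * (1/2 * (x + y + (y + z))) \<Longrightarrow> a = 1/4 * (x + 2 * y + z)" for a x y z :: real
        by simp
      ultimately show ?thesis by blast
    qed
    moreover have "ip (comb l - comb l') (comb l - comb l')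
        = ip (comb l) (comb l) - 2 * ip (comb l) (comb l') + ip (comb l') (comb l')"
      using W_H[OF that(1)] W_H[OF that(2)]
      by (simp add: ip_diff_left ip_diff_right diff_mem ip_commute[of "comb l'" "comb l"])
    moreover have "L ?m = 1/2 * (L l + L l')"
      by (simp only: L_scale L_append)
    ultimately show ?thesis
      using J_M[OF mW] by (simp add: J_def)
  qed
  have small: "2 * ((M - J (lm m)) + (M - J (lm l))) < 4 / real (Suc N)" if "m \<ge> N" "l \<ge> N" for m l N
  proof -
    have "1 / real (Suc m) \<le> 1 / real (Suc N)" "1 / real (Suc l) \<le> 1 / real (Suc N)"
      using that by (auto intro!: divide_left_mono)
    thus ?thesis using lm(2)[of m] lm(2)[of l] by simp
  qed
  have "\<exists>p\<in>H. (\<lambda>m. ip_norm ip (comb (lm m) - p)) \<longlonglongrightarrow> 0"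
  proof (rule complete)
    show "comb (lm m) \<in> H" for m
      using lm W_H by blast
    fix e :: real assume "e > 0"
    obtain N0 where "4 / e\<^sup>2 < real N0"
      using reals_Archimedean2 by blast
    then obtain N where N: "4 / e\<^sup>2 < real (Suc N)"
      using that[of N0] by simp
    hence N': "4 / real (Suc N) < e\<^sup>2"
      using \<open>e > 0\<close> by (simp add: field_simps)
    have "ip_norm ip (comb (lm m) - comb (lm l)) < e" if "m \<ge> N" "l \<ge> N" for m l
    proof -
      have "ip (comb (lm m) - comb (lm l)) (comb (lm m) - comb (lm l)) < e\<^sup>2"
        using par[OF lm(1) lm(1), of m l] small[OF that] N' by linarith
      thus ?thesis
        using \<open>e > 0\<close> by (simp add: ip_norm_def real_less_lsqrt)
    qed
    thus "\<exists>N. \<forall>m\<ge>N. \<forall>l\<ge>N. ip_norm ip (comb (lm m) - comb (lm l)) < e"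
      by blast
  qed
  then obtain p where p: "p \<in> H" and lim: "(\<lambda>m. ip_norm ip (comb (lm m) - p)) \<longlonglongrightarrow> 0"
    by blast
  have ip_lim: "(\<lambda>m. ip (comb (lm m)) h) \<longlonglongrightarrow> ip p h" if h: "h \<in> H" for h
  proof (rule Lim_null_comparison[THEN LIM_zero_cancel])
    show "\<forall>\<^sub>F m in sequentially. norm (ip (comb (lm m)) h - ip p h) \<le> ip_norm ip (comb (lm m) - p) * ip_norm ip h"
      using Cauchy_Schwarz[OF diff_mem[OF W_H[OF lm(1)] p] h] ip_diff_left[OF W_H[OF lm(1)] p h]
      by (intro always_eventually) auto
    show "(\<lambda>m. ip_norm ip (comb (lm m) - p) * ip_norm ip h) \<longlonglongrightarrow> 0"
      using lim by (rule tendsto_mult_left_zero)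
  qed
  have J_lim: "(\<lambda>m. J (lm m)) \<longlonglongrightarrow> M"
  proof (rule tendsto_sandwich[where f="\<lambda>m. M - 1 / real (Suc m)" and h="\<lambda>m. M"])
    show "(\<lambda>m. M - 1 / real (Suc m)) \<longlonglongrightarrow> M"
      using tendsto_diff[OF tendsto_const[of M] LIMSEQ_inverse_real_of_nat] by (simp add: inverse_eq_divide)
  qed (use lm J_M in \<open>auto intro!: always_eventually less_imp_le\<close>)
  have p_eq: "p x = f x" if x: "x \<in> S" for x
  proof -
    \<comment> \<open>Adding t times the section at x to the maximising sequence cannot raise the
      value above M; in the limit this is the optimality inequality for p in the direction of that
      section.\<close>
    have *: "2 * t * (f x - p x) \<le> t\<^sup>2 * k x x" for t
    proof -
      have "J (lm m) + 2 * t * (f x - ip (comb (lm m)) (kernel_section S k x)) - t\<^sup>2 * k x x \<le> M" for m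
      proof -
        have mW: "(t, x) # lm m \<in> W"
          using lm x by (auto simp: W_def)
        have s: "(\<lambda>z. t * kernel_section S k x z) \<in> H"
          using section_mem[OF x] by (rule scale_mem)
        have "ip (comb ((t, x) # lm m)) (comb ((t, x) # lm m))
          = t\<^sup>2 * k x x + 2 * t * ip (comb (lm m)) (kernel_section S k x) + ip (comb (lm m)) (comb (lm m))"
          using W_H[OF lm(1)[of m]] s section_mem[OF x] x
          by (simp add: comb_Cons ip_add_left ip_add_right add_mem ip_scale_left ip_scale_right ip_sections
              ip_commute[of "kernel_section S k x" "comb (lm m)"] power2_eq_square)
        thus ?thesis
          using J_M[OF mW] by (simp add: J_def L_def algebra_simps)
      qed
      moreover have "(\<lambda>m. J (lm m) + 2 * t * (f x - ip (comb (lm m)) (kernel_section S k x)) - t\<^sup>2 * k x x)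
          \<longlonglongrightarrow> M + 2 * t * (f x - ip p (kernel_section S k x)) - t\<^sup>2 * k x x"
        by (intro tendsto_intros J_lim ip_lim section_mem x)
      ultimately have "M + 2 * t * (f x - ip p (kernel_section S k x)) - t\<^sup>2 * k x x \<le> M"
        by (intro LIMSEQ_le_const2[where X="\<lambda>m. J (lm m) + 2 * t * (f x - ip (comb (lm m)) (kernel_section S k x)) - t\<^sup>2 * k x x"]) auto
      thus ?thesis
        using reproducing[OF x p] by simp
    qed
    have k0: "k x x \<ge> 0"
      using ip_nonneg[OF section_mem[OF x]] ip_sections[OF x x] by simp
    have "(f x - p x)\<^sup>2 * (k x x + 2) \<le> 0" 
    proof -
      \<comment> \<open>The \<open>+ 1\<close> keeps the denominator positive when
        \<open>k x x = 0\<close>. Inserting this t in the optimality inequality forces t =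
        0.\<close>
      define t where "t = (f x - p x) / (k x x + 1)"
      have tk: "t * (k x x + 1) = f x - p x"
        using k0 by (simp add: t_def)
      have "2 * t * (t * (k x x + 1)) \<le> t\<^sup>2 * k x x"
        unfolding tk by (rule *)
      hence "t\<^sup>2 * (k x x + 2) \<le> 0"
        by (simp add: algebra_simps power2_eq_square)
      hence "t = 0"
        using k0 by (smt (verit) mult_pos_pos zero_less_power2)
      thus ?thesis using tk by simp
    qed
    thus ?thesis
      using k0 by (smt (verit) mult_pos_pos zero_less_power2)
  qed
  have fp: "f = p"
  proof
    show "f x = p x" for x
      using p_eq[of x] f0[of x] vanish[OF p, of x] by (cases "x \<in> S") auto
  qed
  \<comment> \<open>Since f = p, pairing p with \<open>comb (lm m)\<close> evaluates the dominated
    functional; the domination bound passes to the limit.\<close>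
  have "ip p p \<le> r * ip_norm ip p"
  proof (rule LIMSEQ_le)
    show "(\<lambda>m. ip (comb (lm m)) p) \<longlonglongrightarrow> ip p p"
      using p by (rule ip_lim)
    have "(\<lambda>m. ip (comb (lm m) - p) (comb (lm m) - p) + 2 * ip (comb (lm m)) p - ip p p) \<longlonglongrightarrow> 0 + 2 * ip p p - ip p p"
    proof (intro tendsto_intros ip_lim p)
      have "(\<lambda>m. (ip_norm ip (comb (lm m) - p))\<^sup>2) \<longlonglongrightarrow> 0\<^sup>2"
        by (intro tendsto_intros lim)
      thus "(\<lambda>m. ip (comb (lm m) - p) (comb (lm m) - p)) \<longlonglongrightarrow> 0"
        using ip_norm_power2[OF diff_mem[OF W_H[OF lm(1)] p]] by simp
    qed
    moreover have "ip (comb (lm m) - p) (comb (lm m) - p) + 2 * ip (comb (lm m)) p - ip p p = ip (comb (lm m)) (comb (lm m))" for m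
      using W_H[OF lm(1)[of m]] p by (simp add: ip_diff_left ip_diff_right diff_mem ip_commute[of p "comb (lm m)"])
    ultimately have "(\<lambda>m. ip (comb (lm m)) (comb (lm m))) \<longlonglongrightarrow> ip p p"
      by simp
    thus "(\<lambda>m. r * ip_norm ip (comb (lm m))) \<longlonglongrightarrow> r * ip_norm ip p"
      unfolding ip_norm_def by (intro tendsto_intros)
    have "ip (comb (lm m)) p \<le> r * ip_norm ip (comb (lm m))" for m
      using ip_commute[OF W_H[OF lm(1)[of m]] p] ip_comb[of "lm m" p] p lm(1)[of m] dom[of "lm m"] fp
      by (simp add: W_def)
    thus "\<exists>N. \<forall>m\<ge>N. ip (comb (lm m)) p \<le> r * ip_norm ip (comb (lm m))"
      by blast
  qed
  hence "ip_norm ip p * ip_norm ip p \<le> r * ip_norm ip p"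
    using ip_norm_power2[OF p] by (simp add: power2_eq_square)
  hence "ip_norm ip p \<le> r"
    using r ip_norm_nonneg[OF p] by (smt (verit) mult_le_cancel_right)
  thus ?thesis
    using p fp by (simp add: rkhs_ball_def)
qed

end

text \<open>By reproduction and Cauchy--Schwarz in H, a weighted sum of values of f is at most r
  times the k-norm of the combination, hence at most r times its k'-norm;
  \<open>mem_ball_if_dominated\<close> turns that bound into membership in the ball for k'.\<close>

lemma rkhs_ball_mono_kernel:
  assumes k: "rkhs S k H ip" and k': "rkhs S k' H' ip'" and r: "r \<ge> 0"
    and le: "\<And>l. snd ` set l \<subseteq> S \<Longrightarrow>
      (\<Sum>p\<leftarrow>l. \<Sum>q\<leftarrow>l. fst p * fst q * k (snd p) (snd q)) \<le> (\<Sum>p\<leftarrow>l. \<Sum>q\<leftarrow>l. fst p * fst q * k' (snd p) (snd q))"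
  shows "rkhs_ball H ip r \<subseteq> rkhs_ball H' ip' r"
proof
  interpret a: rkhs S k H ip by fact
  interpret b: rkhs S k' H' ip' by fact
  fix f assume f: "f \<in> rkhs_ball H ip r"
  show "f \<in> rkhs_ball H' ip' r"
  proof (rule b.mem_ball_if_dominated)
    show "x \<notin> S \<Longrightarrow> f x = 0" for x
      using f a.vanish by (simp add: rkhs_ball_def)
    fix l :: "(real \<times> 'a) list" assume l: "snd ` set l \<subseteq> S"
    have "(\<Sum>p\<leftarrow>l. fst p * f (snd p)) = ip f (a.comb l)"
      using f l by (simp add: a.ip_comb rkhs_ball_def)
    also have "\<dots> \<le> ip_norm ip f * ip_norm ip (a.comb l)"
      using a.Cauchy_Schwarz[of f "a.comb l"] f a.comb_mem[OF l] by (simp add: rkhs_ball_def)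
    also have "\<dots> \<le> r * ip_norm ip' (b.comb l)"
      using f le[OF l] r a.ip_comb_comb[OF l] b.ip_comb_comb[OF l] a.ip_nonneg[OF a.comb_mem[OF l]]
      by (intro mult_mono) (auto simp: rkhs_ball_def ip_norm_def)
    finally show "(\<Sum>p\<leftarrow>l. fst p * f (snd p)) \<le> r * ip_norm ip' (b.comb l)" .
  qed fact
qed

section \<open>Fourier representation and ordering of the Gaussian kernels\<close>

text \<open>The spectral weight of the one-dimensional kernel exp(- s^2 / \<gamma>^2) / \<gamma>,
  namely exp(- \<gamma>^2 \<xi>^2 / 4) / (2 sqrt \<pi>). The factor 1 / \<gamma> of the kernel
  leaves a prefactor free of \<gamma>, whence the monotonicity in the width.\<close>

definition gauss_weight :: "real \<Rightarrow> real \<Rightarrow> real" where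
  "gauss_weight \<gamma> \<xi> = std_normal_density (\<gamma> * \<xi> / sqrt 2) / sqrt 2"

lemma gauss_weight_mono: "0 < \<eta> \<Longrightarrow> \<eta> \<le> \<gamma> \<Longrightarrow> gauss_weight \<gamma> \<xi> \<le> gauss_weight \<eta> \<xi>"
  by (auto simp: gauss_weight_def std_normal_density_def divide_right_mono power_mult_distrib power_divide
      intro!: divide_right_mono mult_right_mono power_mono)

lemma gauss_weight_nonneg: "0 \<le> gauss_weight \<gamma> \<xi>"
  by (simp add: gauss_weight_def std_normal_density_def)

lemma integrable_gauss_weight: 
  assumes "\<gamma> > 0"
  shows "integrable lborel (gauss_weight \<gamma>)"
proof -
  have "integrable lborel (\<lambda>x. std_normal_density (0 + (\<gamma> / sqrt 2) * x))"
    using assms integrable_normal_density[of 1 0] by (subst lborel_integrable_real_affine_iff) auto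
  thus ?thesis
    by (simp add: gauss_weight_def[abs_def])
qed

text \<open>The real part of the characteristic function of the standard normal law.\<close>

lemma integral_cos_std_normal:
  "(\<integral>x. cos (t * x) * std_normal_density x \<partial>lborel) = exp (- (t\<^sup>2) / 2)"
proof -
  have i: "integrable lborel (\<lambda>x. std_normal_density x *\<^sub>R iexp (t * x))"
  proof (rule Bochner_Integration.integrable_bound)
    show "integrable lborel std_normal_density"
      using integrable_normal_density[of 1 0] by simp
  qed (auto simp: norm_mult)
  have "complex_of_real (exp (- (t\<^sup>2) / 2)) = (CLINT x|std_normal_distribution. iexp (t * x))"
    using fun_cong[OF char_std_normal_distribution, of t] by (simp add: char_def)
  also have "\<dots> = (CLINT x|lborel. std_normal_density x *\<^sub>R iexp (t * x))"
    by (subst integral_density) auto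
  finally have "Re (CLINT x|lborel. std_normal_density x *\<^sub>R iexp (t * x)) = exp (- (t\<^sup>2) / 2)"
    by (metis Re_complex_of_real)
  also have "Re (CLINT x|lborel. std_normal_density x *\<^sub>R iexp (t * x)) = (\<integral>x. Re (std_normal_density x *\<^sub>R iexp (t * x)) \<partial>lborel)"
    using i by (rule integral_Re[symmetric])
  finally show ?thesis
    by (simp add: Re_exp mult.commute)
qed

lemma integral_cos_gauss_weight:
  assumes "\<gamma> > 0"
  shows "(\<integral>\<xi>. cos (s * \<xi>) * gauss_weight \<gamma> \<xi> \<partial>lborel) = exp (- s\<^sup>2 / \<gamma>\<^sup>2) / \<gamma>"
proof -
  define c where "c = \<gamma> / sqrt 2"
  have c: "c > 0" using assms by (simp add: c_def)
  have "exp (- s\<^sup>2 / \<gamma>\<^sup>2) = exp (- ((s / c)\<^sup>2) / 2)"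
    using assms by (simp add: c_def power_divide power_mult_distrib)
  also have "\<dots> = (\<integral>x. cos (s / c * x) * std_normal_density x \<partial>lborel)"
    by (rule integral_cos_std_normal[symmetric])
  also have "\<dots> = \<bar>c\<bar> *\<^sub>R (\<integral>x. cos (s / c * (0 + c * x)) * std_normal_density (0 + c * x) \<partial>lborel)"
    using c by (intro lborel_integral_real_affine) auto
  also have "(\<lambda>x. cos (s / c * (0 + c * x)) * std_normal_density (0 + c * x)) = (\<lambda>x. sqrt 2 * (cos (s * x) * gauss_weight \<gamma> x))"
    using c assms by (auto simp: gauss_weight_def c_def fun_eq_iff)
  also have "\<bar>c\<bar> *\<^sub>R (\<integral>x. sqrt 2 * (cos (s * x) * gauss_weight \<gamma> x) \<partial>lborel)
      = \<gamma> * (\<integral>x. cos (s * x) * gauss_weight \<gamma> x \<partial>lborel)"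
    using assms by (simp add: c_def)
  finally show ?thesis
    using assms by (simp add: field_simps)
qed

lemma integrable_trig_gauss_weight:
  assumes "\<gamma> > 0"
  shows "integrable lborel (\<lambda>\<xi>. cos (s * \<xi>) * gauss_weight \<gamma> \<xi>)"
  using integrable_gauss_weight[OF assms]
  by (rule Bochner_Integration.integrable_bound)
     (auto simp: gauss_weight_def abs_mult intro!: always_eventually divide_right_mono mult_left_le_one_le)

text \<open>The Gaussian kernel restricted to the coordinates in \<open>I\<close>. As the Fourier transform of
  each one-dimensional factor is a positive weight decreasing in the width, adding one
  coordinate at a time preserves the ordering by width.\<close>

definition coord_kernel :: "'d set \<Rightarrow> real \<Rightarrow> real^'d \<Rightarrow> real^'d \<Rightarrow> real" where
  "coord_kernel I \<gamma> x y = (\<Prod>k\<in>I. exp (- (x $ k - y $ k)\<^sup>2 / \<gamma>\<^sup>2) / \<gamma>)"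

lemma coord_kernel_UNIV: 
  assumes "\<gamma> > 0"
  shows "coord_kernel UNIV \<gamma> x y = gauss_kernel \<gamma> x (y :: real^'d)"
proof -
  have "(norm (x - y))\<^sup>2 = (\<Sum>k\<in>UNIV. (x $ k - y $ k)\<^sup>2)"
    by (simp add: norm_vec_def L2_set_def sum_nonneg)
  thus ?thesis
    using assms
    by (simp add: coord_kernel_def gauss_kernel_def prod_dividef exp_sum[symmetric] sum_negf
        sum_divide_distrib[symmetric] powr_minus powr_realpow divide_inverse[of _ "\<gamma> ^ _"] mult.commute
        sum_distrib_left flip: minus_divide_left)
qed

text \<open>Nonnegativity is carried along because a product of a form and a weight is compared
  factor by factor. The coefficients stay arbitrary in the induction because the added coordinate
  multiplies them by cosines and sines.\<close>

lemma coord_kernel_order: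
  fixes x :: "nat \<Rightarrow> real^'d" and c :: "nat \<Rightarrow> real"
  assumes "finite I" and \<eta>: "0 < \<eta>" "\<eta> \<le> \<gamma>"
  shows "0 \<le> (\<Sum>i<m. \<Sum>j<m. c i * c j * coord_kernel I \<gamma> (x i) (x j))
    \<and> (\<Sum>i<m. \<Sum>j<m. c i * c j * coord_kernel I \<gamma> (x i) (x j)) \<le> (\<Sum>i<m. \<Sum>j<m. c i * c j * coord_kernel I \<eta> (x i) (x j))"
  using assms(1)
proof (induction I arbitrary: c rule: finite_induct)
  case empty
  have "(\<Sum>i<m. \<Sum>j<m. c i * c j) = (\<Sum>i<m. c i)\<^sup>2"
    by (simp add: power2_eq_square sum_product)
  thus ?case by (simp add: coord_kernel_def)
next
  case (insert k I)
  define Q where "Q \<gamma> c = (\<Sum>i<m. \<Sum>j<m. c i * c j * coord_kernel I \<gamma> (x i) (x j))" for \<gamma> and c :: "nat \<Rightarrow> real"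
  \<comment> \<open>By the addition formula for cos(a - b), weighting the form with the cosine of
    the new coordinate difference gives two forms in the old coordinates with modulated
    coefficients, to which the induction hypothesis applies.\<close>
  define T where "T \<gamma> \<xi> = Q \<gamma> (\<lambda>i. c i * cos (\<xi> * x i $ k)) + Q \<gamma> (\<lambda>i. c i * sin (\<xi> * x i $ k))" for \<gamma> \<xi>
  have T: "T \<gamma> \<xi> = (\<Sum>i<m. \<Sum>j<m. c i * c j * coord_kernel I \<gamma> (x i) (x j) * cos ((x i $ k - x j $ k) * \<xi>))" for \<gamma> \<xi>
    unfolding T_def Q_def sum.distrib[symmetric]
    by (intro sum.cong refl) (simp add: cos_diff algebra_simps)
  have ker: "coord_kernel (insert k I) \<gamma>' y z
      = coord_kernel I \<gamma>' y z * (\<integral>\<xi>. cos ((y $ k - z $ k) * \<xi>) * gauss_weight \<gamma>' \<xi> \<partial>lborel)" if "\<gamma>' > 0" for \<gamma>' y z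
    using insert.hyps integral_cos_gauss_weight[OF that] by (simp add: coord_kernel_def)
  have int: "integrable lborel (\<lambda>\<xi>. T \<gamma>' \<xi> * gauss_weight \<gamma>' \<xi>)" if "\<gamma>' > 0" for \<gamma>'
  proof -
    have "integrable lborel (\<lambda>\<xi>. \<Sum>i<m. \<Sum>j<m. c i * c j * coord_kernel I \<gamma>' (x i) (x j) * (cos ((x i $ k - x j $ k) * \<xi>) * gauss_weight \<gamma>' \<xi>))"
      by (intro Bochner_Integration.integrable_sum integrable_mult_right integrable_trig_gauss_weight that)
    thus ?thesis
      by (simp add: T sum_distrib_right mult.assoc)
  qed
  have rep: "(\<Sum>i<m. \<Sum>j<m. c i * c j * coord_kernel (insert k I) \<gamma>' (x i) (x j))
      = (\<integral>\<xi>. T \<gamma>' \<xi> * gauss_weight \<gamma>' \<xi> \<partial>lborel)" if "\<gamma>' > 0" for \<gamma>'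
  proof -
    have "(\<integral>\<xi>. T \<gamma>' \<xi> * gauss_weight \<gamma>' \<xi> \<partial>lborel)
      = (\<integral>\<xi>. (\<Sum>i<m. \<Sum>j<m. c i * c j * coord_kernel I \<gamma>' (x i) (x j) * (cos ((x i $ k - x j $ k) * \<xi>) * gauss_weight \<gamma>' \<xi>)) \<partial>lborel)"
      by (simp add: T sum_distrib_right mult.assoc)
    also have "\<dots> = (\<Sum>i<m. \<Sum>j<m. c i * c j * coord_kernel I \<gamma>' (x i) (x j) * (\<integral>\<xi>. cos ((x i $ k - x j $ k) * \<xi>) * gauss_weight \<gamma>' \<xi> \<partial>lborel))"
      by (subst Bochner_Integration.integral_sum, intro Bochner_Integration.integrable_sum integrable_mult_right integrable_trig_gauss_weight that)
         (intro sum.cong refl, subst Bochner_Integration.integral_sum, auto intro!: integrable_mult_right integrable_trig_gauss_weight that)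
    finally show ?thesis
      by (simp add: ker[OF that] mult.assoc)
  qed
  have IH: "0 \<le> T \<gamma> \<xi>" "T \<gamma> \<xi> \<le> T \<eta> \<xi>" for \<xi>
    using insert.IH[of "\<lambda>i. c i * cos (\<xi> * x i $ k)"] insert.IH[of "\<lambda>i. c i * sin (\<xi> * x i $ k)"]
    unfolding T_def Q_def by linarith+
  have \<gamma>: "0 < \<gamma>" using \<eta> by simp
  show ?case
    unfolding rep[OF \<gamma>] rep[OF \<eta>(1)]
  proof
    show "0 \<le> (\<integral>\<xi>. T \<gamma> \<xi> * gauss_weight \<gamma> \<xi> \<partial>lborel)"
      using IH gauss_weight_nonneg by (intro Bochner_Integration.integral_nonneg mult_nonneg_nonneg)
    show "(\<integral>\<xi>. T \<gamma> \<xi> * gauss_weight \<gamma> \<xi> \<partial>lborel) \<le> (\<integral>\<xi>. T \<eta> \<xi> * gauss_weight \<eta> \<xi> \<partial>lborel)"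
    proof (intro integral_mono int \<gamma> \<eta>(1))
      show "T \<gamma> \<xi> * gauss_weight \<gamma> \<xi> \<le> T \<eta> \<xi> * gauss_weight \<eta> \<xi>" for \<xi>
        using IH[of \<xi>] gauss_weight_mono[OF \<eta>, of \<xi>] gauss_weight_nonneg[of \<gamma> \<xi>]
        by (intro mult_mono) auto
    qed
  qed
qed

lemma gauss_kernel_order:
  fixes l :: "(real \<times> (real^'d)) list"
  assumes "0 < \<eta>" "\<eta> \<le> \<gamma>"
  shows "(\<Sum>p\<leftarrow>l. \<Sum>q\<leftarrow>l. fst p * fst q * gauss_kernel \<gamma> (snd p) (snd q))
    \<le> (\<Sum>p\<leftarrow>l. \<Sum>q\<leftarrow>l. fst p * fst q * gauss_kernel \<eta> (snd p) (snd q))"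
proof -
  have "(\<Sum>i<length l. \<Sum>j<length l. fst (l ! i) * fst (l ! j) * coord_kernel UNIV \<gamma> (snd (l ! i)) (snd (l ! j)))
    \<le> (\<Sum>i<length l. \<Sum>j<length l. fst (l ! i) * fst (l ! j) * coord_kernel UNIV \<eta> (snd (l ! i)) (snd (l ! j)))"
    using coord_kernel_order[where I=UNIV and m="length l" and c="\<lambda>i. fst (l ! i)" and x="\<lambda>i. snd (l ! i)"] assms
    by simp
  thus ?thesis
    using assms by (simp add: coord_kernel_UNIV sum_list_sum_nth atLeast0LessThan)
qed

section \<open>Averages over random signs\<close>

text \<open>The expectation over independent fair signs at 1, ..., n, as an iterated average instead
  of a measure: conditioning on all but the last sign is unfolding, and integrability never
  arises.\<close>

primrec sign_mean :: "nat \<Rightarrow> ((nat \<Rightarrow> real) \<Rightarrow> real) \<Rightarrow> real" where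
  "sign_mean 0 h = h (\<lambda>_. 0)"
| "sign_mean (Suc n) h = (sign_mean n (\<lambda>\<epsilon>. h (\<epsilon>(Suc n := 1))) + sign_mean n (\<lambda>\<epsilon>. h (\<epsilon>(Suc n := -1)))) / 2"

text \<open>The sign vectors that \<open>sign_mean n\<close> averages over; coordinates outside \<open>1, \<dots>, n\<close> vanish.\<close>

definition sign_vectors :: "nat \<Rightarrow> (nat \<Rightarrow> real) set" where
  "sign_vectors n = {\<epsilon>. \<forall>i\<in>{1..n}. \<epsilon> i = 1 \<or> \<epsilon> i = -1}"

lemma sign_mean_mono_on:
  "(\<And>\<epsilon>. \<epsilon> \<in> sign_vectors n \<Longrightarrow> h \<epsilon> \<le> h' \<epsilon>) \<Longrightarrow> sign_mean n h \<le> sign_mean n h'"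
proof (induction n arbitrary: h h')
  case 0
  thus ?case by (simp add: sign_vectors_def)
next
  case (Suc n)
  have "\<epsilon>(Suc n := s) \<in> sign_vectors (Suc n)" if "\<epsilon> \<in> sign_vectors n" "s = 1 \<or> s = -1" for \<epsilon> s
    using that by (auto simp: sign_vectors_def)
  hence "sign_mean n (\<lambda>\<epsilon>. h (\<epsilon>(Suc n := s))) \<le> sign_mean n (\<lambda>\<epsilon>. h' (\<epsilon>(Suc n := s)))" if "s = 1 \<or> s = -1" for s
    using that Suc.prems by (intro Suc.IH) blast
  from this[of 1] this[of "-1"] show ?case by simp
qed

lemma sign_mean_mono: "(\<And>\<epsilon>. h \<epsilon> \<le> h' \<epsilon>) \<Longrightarrow> sign_mean n h \<le> sign_mean n h'"
  by (rule sign_mean_mono_on)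

lemma sign_mean_const: "sign_mean n (\<lambda>_. c) = c"
  by (induction n) auto

lemma sign_mean_add: "sign_mean n (\<lambda>\<epsilon>. h \<epsilon> + h' \<epsilon>) = sign_mean n h + sign_mean n h'"
  by (induction n arbitrary: h h') (auto simp: field_simps)

lemma sign_mean_cmult: "sign_mean n (\<lambda>\<epsilon>. c * h \<epsilon>) = c * sign_mean n h"
  by (induction n arbitrary: h) (auto simp: field_simps)

lemma sign_mean_half: "sign_mean n h / 2 = sign_mean n (\<lambda>\<epsilon>. h \<epsilon> / 2)"
  using sign_mean_cmult[of n "1 / 2" h] by simp

lemma sign_mean_sum: "sign_mean n (\<lambda>\<epsilon>. \<Sum>i\<in>I. h i \<epsilon>) = (\<Sum>i\<in>I. sign_mean n (h i))"
  by (induction I rule: infinite_finite_induct) (auto simp: sign_mean_const sign_mean_add)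

lemma sign_mean_nonneg: "(\<And>\<epsilon>. 0 \<le> h \<epsilon>) \<Longrightarrow> 0 \<le> sign_mean n h"
  using sign_mean_mono[of "\<lambda>_. 0" h n] by (simp add: sign_mean_const)

lemma sum_upd_Suc: "(\<Sum>i=1..n. f i ((\<epsilon>(Suc n := s)) i)) = (\<Sum>i=1..n. f i (\<epsilon> i))"
  by (intro sum.cong) auto

lemma sign_mean_measurable:
  assumes "\<And>\<epsilon>. h \<epsilon> \<in> borel_measurable M"
  shows "(\<lambda>x. sign_mean n (\<lambda>\<epsilon>. h \<epsilon> x)) \<in> borel_measurable M"
  using assms
proof (induction n arbitrary: h)
  case (Suc n)
  have "(\<lambda>x. sign_mean n (\<lambda>\<epsilon>. h (\<epsilon>(Suc n := s)) x)) \<in> borel_measurable M" for s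
    by (rule Suc.IH) (rule Suc.prems)
  thus ?case by simp
qed simp

lemma sign_mean_product_le:
  assumes "\<And>\<epsilon>. 0 \<le> p \<epsilon>"
  shows "(sign_mean n (\<lambda>\<epsilon>. p \<epsilon> * q \<epsilon>))\<^sup>2 \<le> sign_mean n (\<lambda>\<epsilon>. (p \<epsilon>)\<^sup>2) * sign_mean n (\<lambda>\<epsilon>. (q \<epsilon>)\<^sup>2)"
proof -
  define A where "A = sign_mean n (\<lambda>\<epsilon>. (p \<epsilon>)\<^sup>2)"
  define B where "B = sign_mean n (\<lambda>\<epsilon>. p \<epsilon> * q \<epsilon>)"
  define D where "D = sign_mean n (\<lambda>\<epsilon>. (q \<epsilon>)\<^sup>2)"
  have quad: "0 \<le> s\<^sup>2 * A + 2 * s * t * B + t\<^sup>2 * D" for s t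
  proof -
    have "0 \<le> sign_mean n (\<lambda>\<epsilon>. (s * p \<epsilon> + t * q \<epsilon>)\<^sup>2)"
      by (intro sign_mean_nonneg) simp
    also have "(\<lambda>\<epsilon>. (s * p \<epsilon> + t * q \<epsilon>)\<^sup>2) = (\<lambda>\<epsilon>. s\<^sup>2 * (p \<epsilon>)\<^sup>2 + (2 * s * t) * (p \<epsilon> * q \<epsilon>) + t\<^sup>2 * (q \<epsilon>)\<^sup>2)"
      by (auto simp: power2_eq_square algebra_simps)
    finally show ?thesis
      by (simp only: sign_mean_add sign_mean_cmult A_def B_def D_def)
  qed
  have "0 \<le> A" "0 \<le> D"
    unfolding A_def D_def by (intro sign_mean_nonneg; simp)+
  have "B\<^sup>2 \<le> A * D"
  proof (cases "D = 0")
    case True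
    have "B = 0"
    proof (rule ccontr)
      assume "B \<noteq> 0"
      \<comment> \<open>With D = 0 this choice of t gives the quadratic form the value - A - 2,
        which is negative.\<close>
      have "0 \<le> 1\<^sup>2 * A + 2 * 1 * (- (A + 1) / B) * B + (- (A + 1) / B)\<^sup>2 * D"
        by (rule quad)
      moreover have "2 * 1 * (- (A + 1) / B) * B = - 2 * (A + 1)"
        using \<open>B \<noteq> 0\<close> by simp
      ultimately show False using True \<open>0 \<le> A\<close> by simp
    qed
    thus ?thesis using \<open>0 \<le> A\<close> \<open>0 \<le> D\<close> by simp
  next
    case False
    hence "D > 0" using \<open>0 \<le> D\<close> by simp
    have "0 \<le> D\<^sup>2 * A + 2 * D * (-B) * B + (-B)\<^sup>2 * D" by (rule quad)
    also have "\<dots> = D * (A * D - B\<^sup>2)" by (simp add: power2_eq_square algebra_simps)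
    finally show ?thesis using \<open>D > 0\<close> by (simp add: zero_le_mult_iff)
  qed
  thus ?thesis by (simp add: A_def B_def D_def)
qed

text \<open>Hoeffding's bound for the log-moment of a fair two-point variable whose values are
  \<open>2 * \<bar>x\<bar>\<close> apart.\<close>

lemma cosh_le_exp_half_square: "(exp x + exp (- x)) / 2 \<le> exp (x\<^sup>2 / 2)" for x :: real
proof -
  have "- (2 * \<bar>x\<bar>) * (1 / 2) + ln (1 + 1 / 2 * (exp (2 * \<bar>x\<bar>) - 1)) \<le> (2 * \<bar>x\<bar>)\<^sup>2 / 8"
    by (rule Hoeffdings_lemma_aux) auto
  hence "ln ((1 + exp (2 * \<bar>x\<bar>)) / 2) \<le> \<bar>x\<bar> + x\<^sup>2 / 2"
    by (simp add: field_simps)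
  hence "exp (ln ((1 + exp (2 * \<bar>x\<bar>)) / 2)) \<le> exp (\<bar>x\<bar> + x\<^sup>2 / 2)"
    by simp
  hence "exp (- \<bar>x\<bar>) * ((1 + exp (2 * \<bar>x\<bar>)) / 2) \<le> exp (- \<bar>x\<bar>) * exp (\<bar>x\<bar> + x\<^sup>2 / 2)"
    by (intro mult_left_mono) (auto simp: add_pos_pos)
  hence "(exp (- \<bar>x\<bar>) + exp \<bar>x\<bar>) / 2 \<le> exp (x\<^sup>2 / 2)"
    by (simp add: exp_add[symmetric] algebra_simps)
  thus ?thesis
    by (cases "x \<ge> 0") (auto simp: add.commute)
qed

subsection \<open>Exponential moments of sign chaos\<close>

text \<open>The right-hand side is the exact moment when the sign sum is replaced by a centred
  Gaussian of the same variance. The free shift x absorbs one sign at a time, and the Gaussian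
  formula reproduces itself up to the inequality cosh z \<le> exp(z^2 / 2).\<close>

lemma sign_mean_exp_square:
  assumes "\<kappa> \<ge> 0" "2 * \<kappa> * (\<Sum>i=1..n. (b i)\<^sup>2) < 1"
  shows "sign_mean n (\<lambda>\<epsilon>. exp (\<kappa> * (x + (\<Sum>i=1..n. b i * \<epsilon> i))\<^sup>2))
    \<le> exp (\<kappa> * x\<^sup>2 / (1 - 2 * \<kappa> * (\<Sum>i=1..n. (b i)\<^sup>2))) / sqrt (1 - 2 * \<kappa> * (\<Sum>i=1..n. (b i)\<^sup>2))"
  using assms(2)
proof (induction n arbitrary: x)
  case 0
  thus ?case by simp
next
  case (Suc n)
  define V where "V = (\<Sum>i=1..n. (b i)\<^sup>2)"
  define v where "v = b (Suc n)"
  define d where "d = 1 - 2 * \<kappa> * V"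
  define \<mu> where "\<mu> = \<kappa> / d"
  have V': "(\<Sum>i=1..Suc n. (b i)\<^sup>2) = V + v\<^sup>2"
    by (simp add: V_def v_def)
  have pos: "2 * \<kappa> * (V + v\<^sup>2) < 1"
    using Suc.prems V' by simp
  have "0 \<le> 2 * \<kappa> * v\<^sup>2" using assms(1) by simp
  hence d: "d > 0" and dV: "2 * \<kappa> * V < 1"
    using pos by (auto simp: d_def algebra_simps)
  have \<mu>: "\<mu> \<ge> 0" using d assms(1) by (simp add: \<mu>_def)
  \<comment> \<open>Chosen so that \<open>d * (1 - y)\<close> is the denominator with the new
    coefficient included.\<close>
  define y where "y = 2 * \<mu> * v\<^sup>2"
  have y: "0 \<le> y" using \<mu> by (simp add: y_def)
  have dy: "d * (1 - y) = 1 - 2 * \<kappa> * (V + v\<^sup>2)"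
    using d by (simp add: y_def \<mu>_def d_def field_simps)
  hence y1: "y < 1" using pos d by (smt (verit) zero_less_mult_pos)
  have IH: "sign_mean n (\<lambda>\<epsilon>. exp (\<kappa> * (z + (\<Sum>i=1..n. b i * \<epsilon> i))\<^sup>2)) \<le> exp (\<mu> * z\<^sup>2) / sqrt d" for z
    using Suc.IH[of z] dV by (simp add: V_def d_def \<mu>_def)
  have "sign_mean (Suc n) (\<lambda>\<epsilon>. exp (\<kappa> * (x + (\<Sum>i=1..Suc n. b i * \<epsilon> i))\<^sup>2))
      = (sign_mean n (\<lambda>\<epsilon>. exp (\<kappa> * ((x + v) + (\<Sum>i=1..n. b i * \<epsilon> i))\<^sup>2))
       + sign_mean n (\<lambda>\<epsilon>. exp (\<kappa> * ((x - v) + (\<Sum>i=1..n. b i * \<epsilon> i))\<^sup>2))) / 2"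
    using sum_upd_Suc[where f="\<lambda>i e. b i * e" and n=n] by (simp add: v_def algebra_simps)
  also have "\<dots> \<le> (exp (\<mu> * (x + v)\<^sup>2) / sqrt d + exp (\<mu> * (x - v)\<^sup>2) / sqrt d) / 2"
    using IH[of "x + v"] IH[of "x - v"] by (intro divide_right_mono add_mono) auto
  also have "\<dots> = exp (\<mu> * x\<^sup>2 + \<mu> * v\<^sup>2) * ((exp (2 * \<mu> * x * v) + exp (- (2 * \<mu> * x * v))) / 2) / sqrt d"
    by (simp add: power2_eq_square algebra_simps exp_add[symmetric] add_divide_distrib)
  also have "\<dots> \<le> exp (\<mu> * x\<^sup>2 + \<mu> * v\<^sup>2) * exp ((2 * \<mu> * x * v)\<^sup>2 / 2) / sqrt d"
    using d by (intro divide_right_mono mult_left_mono cosh_le_exp_half_square) auto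
  also have "\<dots> = exp (\<mu> * x\<^sup>2 * (1 + y)) * (exp (y / 2) / sqrt d)"
    by (simp add: y_def exp_add[symmetric] power2_eq_square algebra_simps)
  \<comment> \<open>Two elementary bounds close the recursion: 1 + y \<le> 1 / (1 - y) in the
    exponent and exp(y / 2) \<le> 1 / sqrt(1 - y) in the prefactor.\<close>
  also have "\<dots> \<le> exp (\<mu> * x\<^sup>2 / (1 - y)) * (1 / sqrt (d * (1 - y)))"
  proof (intro mult_mono)
    have "(1 + y) * (1 - y) \<le> 1" by (simp add: algebra_simps)
    hence "1 + y \<le> 1 / (1 - y)"
      using y1 by (simp add: pos_le_divide_eq)
    hence "(\<mu> * x\<^sup>2) * (1 + y) \<le> (\<mu> * x\<^sup>2) * (1 / (1 - y))"
      using \<mu> by (intro mult_left_mono) auto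
    thus "exp (\<mu> * x\<^sup>2 * (1 + y)) \<le> exp (\<mu> * x\<^sup>2 / (1 - y))" by simp
    have "1 - y \<le> exp (- y)" using exp_ge_add_one_self[of "-y"] by simp
    hence "sqrt (1 - y) \<le> sqrt ((exp (- y / 2))\<^sup>2)"
      by (intro real_sqrt_le_mono) (simp add: power2_eq_square exp_add[symmetric])
    hence "exp (y / 2) * sqrt (1 - y) \<le> exp (y / 2) * exp (- y / 2)"
      by (intro mult_left_mono) auto
    hence "exp (y / 2) * sqrt (1 - y) \<le> 1"
      by (simp add: exp_add[symmetric])
    hence "exp (y / 2) \<le> 1 / sqrt (1 - y)"
      using y1 by (simp add: pos_le_divide_eq)
    hence "exp (y / 2) / sqrt d \<le> 1 / sqrt (1 - y) / sqrt d"
      using d by (intro divide_right_mono) auto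
    thus "exp (y / 2) / sqrt d \<le> 1 / sqrt (d * (1 - y))"
      by (simp add: real_sqrt_mult mult.commute)
  qed (use d in auto)
  also have "\<mu> * x\<^sup>2 / (1 - y) = \<kappa> * x\<^sup>2 / (d * (1 - y))"
    by (simp add: \<mu>_def)
  finally show ?case
    unfolding V' dy by simp
qed

text \<open>\<open>T j\<close> involves only signs with index below j. Given those, averaging over
  the j-th sign produces cosh(\<mu> T j), which the compensator exp(- \<mu>^2 (T j)^2 / 2) brings
  down to at most 1.\<close>

lemma sign_mean_chaos_supermartingale:
  fixes b :: "nat \<Rightarrow> nat \<Rightarrow> real"
  defines "T \<equiv> \<lambda>j \<epsilon>. \<Sum>i=1..<j. b i j * \<epsilon> i"
  shows "sign_mean n (\<lambda>\<epsilon>. exp (\<Sum>j=1..n. \<mu> * \<epsilon> j * T j \<epsilon> - \<mu>\<^sup>2 * (T j \<epsilon>)\<^sup>2 / 2)) \<le> 1"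
proof (induction n)
  case (Suc n)
  define E where "E \<epsilon> = (\<Sum>j=1..n. \<mu> * \<epsilon> j * T j \<epsilon> - \<mu>\<^sup>2 * (T j \<epsilon>)\<^sup>2 / 2)" for \<epsilon>
  have T_upd: "T j (\<epsilon>(Suc n := s)) = T j \<epsilon>" if "j \<le> Suc n" for j \<epsilon> s
    unfolding T_def using that by (intro sum.cong) auto
  have E_upd: "E (\<epsilon>(Suc n := s)) = E \<epsilon>" for \<epsilon> s
    unfolding E_def by (intro sum.cong) (auto simp: T_upd)
  have "sign_mean (Suc n) (\<lambda>\<epsilon>. exp (\<Sum>j=1..Suc n. \<mu> * \<epsilon> j * T j \<epsilon> - \<mu>\<^sup>2 * (T j \<epsilon>)\<^sup>2 / 2))
     = sign_mean n (\<lambda>\<epsilon>. exp (E \<epsilon>) * exp (- (\<mu>\<^sup>2 * (T (Suc n) \<epsilon>)\<^sup>2 / 2)) * ((exp (\<mu> * T (Suc n) \<epsilon>) + exp (- (\<mu> * T (Suc n) \<epsilon>))) / 2))"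
  proof -
    have "exp (\<Sum>j=1..Suc n. \<mu> * (\<epsilon>(Suc n := s)) j * T j (\<epsilon>(Suc n := s)) - \<mu>\<^sup>2 * (T j (\<epsilon>(Suc n := s)))\<^sup>2 / 2)
      = exp (E \<epsilon>) * exp (- (\<mu>\<^sup>2 * (T (Suc n) \<epsilon>)\<^sup>2 / 2)) * exp (s * (\<mu> * T (Suc n) \<epsilon>))" for \<epsilon> s
    proof -
      have "(\<Sum>j=1..Suc n. \<mu> * (\<epsilon>(Suc n := s)) j * T j (\<epsilon>(Suc n := s)) - \<mu>\<^sup>2 * (T j (\<epsilon>(Suc n := s)))\<^sup>2 / 2)
        = E (\<epsilon>(Suc n := s)) + (\<mu> * s * T (Suc n) \<epsilon> - \<mu>\<^sup>2 * (T (Suc n) \<epsilon>)\<^sup>2 / 2)"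
        by (simp add: E_def T_upd)
      thus ?thesis
        by (simp add: E_upd exp_add[symmetric] algebra_simps)
    qed
    note * = this
    show ?thesis
      unfolding sign_mean.simps * sign_mean_add[symmetric]
      by (subst sign_mean_half) (simp add: algebra_simps)
  qed
  also have "\<dots> \<le> sign_mean n (\<lambda>\<epsilon>. exp (E \<epsilon>))"
  proof (rule sign_mean_mono)
    fix \<epsilon>
    let ?t = "\<mu> * T (Suc n) \<epsilon>"
    have "exp (- (?t\<^sup>2 / 2)) * ((exp ?t + exp (- ?t)) / 2) \<le> exp (- (?t\<^sup>2 / 2)) * exp (?t\<^sup>2 / 2)"
      by (intro mult_left_mono cosh_le_exp_half_square) auto
    hence "exp (- (?t\<^sup>2 / 2)) * ((exp ?t + exp (- ?t)) / 2) \<le> 1"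
      by (simp add: exp_add[symmetric])
    hence "exp (E \<epsilon>) * (exp (- (?t\<^sup>2 / 2)) * ((exp ?t + exp (- ?t)) / 2)) \<le> exp (E \<epsilon>) * 1"
      by (intro mult_left_mono) auto
    thus "exp (E \<epsilon>) * exp (- (\<mu>\<^sup>2 * (T (Suc n) \<epsilon>)\<^sup>2 / 2)) * ((exp ?t + exp (- ?t)) / 2) \<le> exp (E \<epsilon>)"
      by (simp add: power_mult_distrib mult.assoc)
  qed
  also have "\<dots> \<le> 1"
    using Suc by (simp add: E_def)
  finally show ?case .
qed simp

text \<open>Convexity of exp: the mean of the numbers \<open>card I * x j\<close> is the sum m, and
  the tangent of exp at m lies below the graph.\<close>

lemma exp_sum_le_mean:
  fixes x :: "'i \<Rightarrow> real"
  assumes "finite I" "I \<noteq> {}"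
  shows "exp (\<Sum>j\<in>I. x j) \<le> (\<Sum>j\<in>I. exp (real (card I) * x j)) / real (card I)"
proof -
  define m where "m = (\<Sum>j\<in>I. x j)"
  define N where "N = real (card I)"
  have N: "N > 0"
    using assms by (simp add: N_def card_gt_0_iff)
  have "N * exp m = (\<Sum>j\<in>I. exp m * (1 + (N * x j - m)))"
    by (simp add: sum_distrib_left[symmetric] sum.distrib sum_subtractf m_def[symmetric] N_def[symmetric])
  also have "\<dots> \<le> (\<Sum>j\<in>I. exp m * exp (N * x j - m))"
    by (intro sum_mono mult_left_mono exp_ge_add_one_self) auto
  also have "\<dots> = (\<Sum>j\<in>I. exp (N * x j))"
    by (simp add: exp_add[symmetric])
  finally show ?thesis
    using N by (simp add: N_def m_def field_simps)
qed

text \<open>With \<open>U = (\<Sum>j. \<epsilon> j * T j)\<close>, Cauchy--Schwarz splits \<open>exp (\<lambda> U)\<close> into the square roots of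
  the supermartingale \<open>exp (2 \<lambda> U - 2 \<lambda>\<^sup>2 (\<Sum>j. (T j)\<^sup>2))\<close> and of \<open>exp (2 \<lambda>\<^sup>2 (\<Sum>j. (T j)\<^sup>2))\<close>.\<close>

lemma sign_mean_exp_chaos:
  assumes b: "\<And>i j. i \<in> {1..n} \<Longrightarrow> j \<in> {1..n} \<Longrightarrow> \<bar>b i j\<bar> \<le> \<delta>" and l: "\<bar>l\<bar> * real n * \<delta> \<le> 1 / 4"
  shows "sign_mean n (\<lambda>\<epsilon>. exp (l * (\<Sum>j=1..n. \<epsilon> j * (\<Sum>i=1..<j. b i j * \<epsilon> i)))) \<le> 2"
proof (cases "n = 0")
  case True
  thus ?thesis by simp
next
  case False
  define T where "T j \<epsilon> = (\<Sum>i=1..<j. b i j * \<epsilon> i)" for j and \<epsilon> :: "nat \<Rightarrow> real"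
  define E where "E \<epsilon> = (\<Sum>j=1..n. 2 * l * \<epsilon> j * T j \<epsilon> - (2 * l)\<^sup>2 * (T j \<epsilon>)\<^sup>2 / 2)" for \<epsilon>
  define W where "W \<epsilon> = (\<Sum>j=1..n. 2 * l\<^sup>2 * (T j \<epsilon>)\<^sup>2)" for \<epsilon>
  have "0 \<le> \<bar>b 1 1\<bar>" by simp
  also have "\<dots> \<le> \<delta>" using False by (intro b) auto
  finally have \<delta>: "0 \<le> \<delta>" .
  have single: "sign_mean n (\<lambda>\<epsilon>. exp (real n * (2 * l\<^sup>2 * (T j \<epsilon>)\<^sup>2))) \<le> 2" if j: "j \<in> {1..n}" for j
  proof -
    define b' where "b' i = (if i < j then b i j else 0)" for i
    have T: "T j \<epsilon> = 0 + (\<Sum>i=1..n. b' i * \<epsilon> i)" for \<epsilon>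
    proof -
      have "(\<Sum>i=1..n. b' i * \<epsilon> i) = (\<Sum>i\<in>{1..<j}. b i j * \<epsilon> i)"
        using j by (intro sum.mono_neutral_cong_right) (auto simp: b'_def)
      thus ?thesis by (simp add: T_def)
    qed
    define V where "V = (\<Sum>i=1..n. (b' i)\<^sup>2)"
    have "V \<le> (\<Sum>i=1..n. \<delta>\<^sup>2)"
      unfolding V_def
    proof (rule sum_mono)
      fix i assume "i \<in> {1..n}"
      hence "\<bar>b' i\<bar> \<le> \<delta>"
        using b[of i j] j \<delta> by (simp add: b'_def)
      thus "(b' i)\<^sup>2 \<le> \<delta>\<^sup>2"
        by (metis abs_ge_zero power2_abs power_mono)
    qed
    hence V: "V \<le> real n * \<delta>\<^sup>2" by simp
    \<comment> \<open>The factor n comes from \<open>exp_sum_le_mean\<close>, which splits the sum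
      over j into n equal shares; the smallness of l still keeps \<open>2 * \<kappa> * V\<close> at
      most 1/4.\<close>
    define \<kappa> where "\<kappa> = real n * (2 * l\<^sup>2)"
    have "2 * \<kappa> * V \<le> 2 * \<kappa> * (real n * \<delta>\<^sup>2)"
      using V by (intro mult_left_mono) (auto simp: \<kappa>_def)
    also have "\<dots> = 4 * (\<bar>l\<bar> * real n * \<delta>)\<^sup>2"
      by (simp add: \<kappa>_def power_mult_distrib power2_eq_square)
    also have "\<dots> \<le> 4 * (1 / 4)\<^sup>2"
      using l \<delta> by (intro mult_left_mono power_mono) auto
    finally have kV: "2 * \<kappa> * V \<le> 1 / 4" by (simp add: power2_eq_square)
    have "sign_mean n (\<lambda>\<epsilon>. exp (\<kappa> * (0 + (\<Sum>i=1..n. b' i * \<epsilon> i))\<^sup>2))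
        \<le> exp (\<kappa> * 0\<^sup>2 / (1 - 2 * \<kappa> * (\<Sum>i=1..n. (b' i)\<^sup>2))) / sqrt (1 - 2 * \<kappa> * (\<Sum>i=1..n. (b' i)\<^sup>2))"
      using kV by (intro sign_mean_exp_square) (auto simp: \<kappa>_def V_def)
    also have "\<dots> = 1 / sqrt (1 - 2 * \<kappa> * V)"
      by (simp add: V_def)
    also have "\<dots> \<le> 1 / sqrt (1 / 4)"
      using kV by (intro divide_left_mono real_sqrt_le_mono) auto
    also have "\<dots> = 2" by (simp add: real_sqrt_divide)
    finally show ?thesis
      unfolding T \<kappa>_def by (simp add: mult.assoc)
  qed
  have W: "sign_mean n (\<lambda>\<epsilon>. exp (W \<epsilon>)) \<le> 2"
  proof -
    have "sign_mean n (\<lambda>\<epsilon>. exp (W \<epsilon>)) \<le> sign_mean n (\<lambda>\<epsilon>. (1 / real n) * (\<Sum>j=1..n. exp (real n * (2 * l\<^sup>2 * (T j \<epsilon>)\<^sup>2))))"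
      using exp_sum_le_mean[of "{1..n}"] False by (intro sign_mean_mono) (auto simp: W_def)
    also have "\<dots> = (1 / real n) * (\<Sum>j=1..n. sign_mean n (\<lambda>\<epsilon>. exp (real n * (2 * l\<^sup>2 * (T j \<epsilon>)\<^sup>2))))"
      by (simp only: sign_mean_cmult sign_mean_sum)
    also have "\<dots> \<le> (1 / real n) * (\<Sum>j=1..n. 2)"
      by (intro mult_left_mono sum_mono single) auto
    also have "\<dots> = 2" using False by simp
    finally show ?thesis .
  qed
  have E: "sign_mean n (\<lambda>\<epsilon>. exp (E \<epsilon>)) \<le> 1"
    unfolding E_def T_def by (rule sign_mean_chaos_supermartingale)
  have split: "exp (l * (\<Sum>j=1..n. \<epsilon> j * (\<Sum>i=1..<j. b i j * \<epsilon> i))) = exp (E \<epsilon> / 2) * exp (W \<epsilon> / 2)" for \<epsilon>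
  proof -
    have "E \<epsilon> + W \<epsilon> = (\<Sum>j=1..n. 2 * l * \<epsilon> j * T j \<epsilon>)"
      unfolding E_def W_def sum.distrib[symmetric] by (intro sum.cong) (auto simp: power_mult_distrib)
    also have "\<dots> = 2 * (l * (\<Sum>j=1..n. \<epsilon> j * T j \<epsilon>))"
      by (simp add: sum_distrib_left mult.assoc)
    finally have "E \<epsilon> / 2 + W \<epsilon> / 2 = l * (\<Sum>j=1..n. \<epsilon> j * T j \<epsilon>)"
      by simp
    thus ?thesis
      by (simp add: exp_add[symmetric] T_def)
  qed
  have sq: "(exp (z / 2))\<^sup>2 = exp z" for z :: real
    by (simp add: power2_eq_square exp_add[symmetric])
  have "(sign_mean n (\<lambda>\<epsilon>. exp (E \<epsilon> / 2) * exp (W \<epsilon> / 2)))\<^sup>2 \<le> sign_mean n (\<lambda>\<epsilon>. exp (E \<epsilon>)) * sign_mean n (\<lambda>\<epsilon>. exp (W \<epsilon>))"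
    using sign_mean_product_le[of "\<lambda>\<epsilon>. exp (E \<epsilon> / 2)" n "\<lambda>\<epsilon>. exp (W \<epsilon> / 2)"] by (simp add: sq)
  also have "\<dots> \<le> 1 * 2"
    using E W by (intro mult_mono sign_mean_nonneg) auto
  also have "\<dots> \<le> (2 :: real)\<^sup>2" by simp
  finally show ?thesis
    unfolding split by (rule power2_le_imp_le) simp
qed

section \<open>Maximal inequality and chaining\<close>

abbreviation maximum :: "'a set \<Rightarrow> ('a \<Rightarrow> real) \<Rightarrow> real" where
  "maximum A f \<equiv> Max (f ` A)"

lemma maximum_ge: "finite A \<Longrightarrow> a \<in> A \<Longrightarrow> f a \<le> maximum A f"
  by (intro Max_ge) auto

lemma maximum_le_iff: "finite A \<Longrightarrow> A \<noteq> {} \<Longrightarrow> maximum A f \<le> c \<longleftrightarrow> (\<forall>a\<in>A. f a \<le> c)"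
  by simp

lemma maximum_attained: 
  assumes "finite A" "A \<noteq> {}"
  obtains a where "a \<in> A" "maximum A f = f a"
proof -
  have "maximum A f \<in> f ` A"
    using assms by (intro Max_in) auto
  thus thesis
    using that by blast
qed

text \<open>The tangent of exp at L = ln(2 card A) bounds the maximum by an affine function of the
  sum of exponentials, whose mean is at most exp L. No concavity argument for the logarithm is
  required.\<close>

lemma sign_mean_maximum_le:
  assumes A: "finite A" "A \<noteq> {}" and l: "l > 0"
    and mgf: "\<And>q. q \<in> A \<Longrightarrow> sign_mean n (\<lambda>\<epsilon>. exp (l * U q \<epsilon>)) \<le> 2"
  shows "sign_mean n (\<lambda>\<epsilon>. maximum A (\<lambda>q. U q \<epsilon>)) \<le> ln (2 * real (card A)) / l"
proof -
  define L where "L = ln (2 * real (card A))"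
  have card: "real (card A) > 0"
    using A by (simp add: card_gt_0_iff)
  have "maximum A (\<lambda>q. U q \<epsilon>) \<le> (L - 1) / l + exp (- L) / l * (\<Sum>q\<in>A. exp (l * U q \<epsilon>))" for \<epsilon>
  proof -
    obtain q where q: "q \<in> A" "maximum A (\<lambda>q. U q \<epsilon>) = U q \<epsilon>"
      using A by (rule maximum_attained)
    have "1 + (l * U q \<epsilon> - L) \<le> exp (l * U q \<epsilon> - L)"
      by (rule exp_ge_add_one_self)
    also have "\<dots> = exp (- L) * exp (l * U q \<epsilon>)"
      by (simp add: exp_add[symmetric])
    also have "\<dots> \<le> exp (- L) * (\<Sum>q\<in>A. exp (l * U q \<epsilon>))"
      using A q by (intro mult_left_mono member_le_sum) auto
    finally have "l * U q \<epsilon> \<le> (L - 1) + exp (- L) * (\<Sum>q\<in>A. exp (l * U q \<epsilon>))" by simp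
    hence "U q \<epsilon> \<le> ((L - 1) + exp (- L) * (\<Sum>q\<in>A. exp (l * U q \<epsilon>))) / l"
      using l by (simp add: pos_le_divide_eq mult.commute)
    thus ?thesis
      unfolding q(2) by (simp add: add_divide_distrib)
  qed
  hence "sign_mean n (\<lambda>\<epsilon>. maximum A (\<lambda>q. U q \<epsilon>))
      \<le> sign_mean n (\<lambda>\<epsilon>. (L - 1) / l + exp (- L) / l * (\<Sum>q\<in>A. exp (l * U q \<epsilon>)))"
    by (rule sign_mean_mono)
  also have "\<dots> = (L - 1) / l + exp (- L) / l * (\<Sum>q\<in>A. sign_mean n (\<lambda>\<epsilon>. exp (l * U q \<epsilon>)))"
    by (simp only: sign_mean_add sign_mean_cmult sign_mean_sum sign_mean_const)
  also have "\<dots> \<le> (L - 1) / l + exp (- L) / l * (\<Sum>q\<in>A. 2)"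
    using l by (intro add_left_mono mult_left_mono sum_mono mgf) auto
  also have "\<dots> = L / l"
    using card l by (simp add: L_def exp_minus exp_ln field_simps)
  finally show ?thesis by (simp add: L_def)
qed

text \<open>Each element of level k + 1 is linked by \<open>p k\<close> to level k with an increment
  of scale K / 2^k. The cost of a link is the logarithm of the cardinality, not its square root,
  because the increments have only exponential tails.\<close>

lemma sign_mean_chaining:
  fixes A :: "nat \<Rightarrow> 'f set" and U :: "'f \<Rightarrow> (nat \<Rightarrow> real) \<Rightarrow> real"
  assumes A: "\<And>k. finite (A k)" "\<And>k. A k \<noteq> {}" "A 0 = {z}" and z: "\<And>\<epsilon>. U z \<epsilon> = 0"
    and p: "\<And>k q. q \<in> A (Suc k) \<Longrightarrow> p k q \<in> A k" and K: "K > 0"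
    and mgf: "\<And>k q. q \<in> A (Suc k) \<Longrightarrow> sign_mean n (\<lambda>\<epsilon>. exp (2 ^ k / K * (U q \<epsilon> - U (p k q) \<epsilon>))) \<le> 2"
  shows "sign_mean n (\<lambda>\<epsilon>. maximum (A m) (\<lambda>q. U q \<epsilon>)) \<le> (\<Sum>k<m. K / 2 ^ k * ln (2 * real (card (A (Suc k)))))"
proof (induction m)
  case 0
  thus ?case by (simp add: A z sign_mean_const)
next
  case (Suc m)
  have "maximum (A (Suc m)) (\<lambda>q. U q \<epsilon>) \<le> maximum (A m) (\<lambda>q. U q \<epsilon>) + maximum (A (Suc m)) (\<lambda>q. U q \<epsilon> - U (p m q) \<epsilon>)" for \<epsilon>
  proof -
    obtain q where q: "q \<in> A (Suc m)" "maximum (A (Suc m)) (\<lambda>q. U q \<epsilon>) = U q \<epsilon>"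
      using A(1,2) by (rule maximum_attained)
    show ?thesis
      unfolding q(2)
      using maximum_ge[OF A(1) p[OF q(1)], of "\<lambda>q. U q \<epsilon>"] maximum_ge[OF A(1) q(1), of "\<lambda>q. U q \<epsilon> - U (p m q) \<epsilon>"]
      by linarith
  qed
  hence "sign_mean n (\<lambda>\<epsilon>. maximum (A (Suc m)) (\<lambda>q. U q \<epsilon>))
      \<le> sign_mean n (\<lambda>\<epsilon>. maximum (A m) (\<lambda>q. U q \<epsilon>) + maximum (A (Suc m)) (\<lambda>q. U q \<epsilon> - U (p m q) \<epsilon>))"
    by (rule sign_mean_mono)
  also have "\<dots> = sign_mean n (\<lambda>\<epsilon>. maximum (A m) (\<lambda>q. U q \<epsilon>)) + sign_mean n (\<lambda>\<epsilon>. maximum (A (Suc m)) (\<lambda>q. U q \<epsilon> - U (p m q) \<epsilon>))"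
    by (rule sign_mean_add)
  also have "\<dots> \<le> (\<Sum>k<m. K / 2 ^ k * ln (2 * real (card (A (Suc k))))) + ln (2 * real (card (A (Suc m)))) / (2 ^ m / K)"
    using K by (intro add_mono Suc sign_mean_maximum_le A mgf) auto
  finally show ?case by (simp add: mult.commute)
qed

subsection \<open>Contraction\<close>

text \<open>Let s and t be the two maximisers. Each distance |g k s - g k t| is attained by giving s
  and t the two signs in the right order. The base value a s + a t is needed once for every k, so
  the inequality is multiplied by card K and averaged, which puts the factor card K on g.\<close>

lemma maximum_contraction_step:
  assumes T: "finite T" "T \<noteq> {}" and K: "finite K" "K \<noteq> {}"
    and lip: "\<And>s t. s \<in> T \<Longrightarrow> t \<in> T \<Longrightarrow> \<bar>f s - f t\<bar> \<le> (\<Sum>k\<in>K. \<bar>g k s - g k t\<bar>)"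
  shows "maximum T (\<lambda>t. a t + f t) + maximum T (\<lambda>t. a t - f t)
    \<le> (\<Sum>k\<in>K. maximum T (\<lambda>t. a t + real (card K) * g k t) + maximum T (\<lambda>t. a t - real (card K) * g k t)) / real (card K)"
proof -
  obtain s where s: "s \<in> T" "maximum T (\<lambda>t. a t + f t) = a s + f s"
    using T by (rule maximum_attained)
  obtain t where t: "t \<in> T" "maximum T (\<lambda>t. a t - f t) = a t - f t"
    using T by (rule maximum_attained)
  define c where "c = real (card K)"
  have c: "c > 0"
    using K by (simp add: c_def card_gt_0_iff)
  have le: "a s + a t + c * \<bar>g k s - g k t\<bar> \<le> maximum T (\<lambda>t. a t + c * g k t) + maximum T (\<lambda>t. a t - c * g k t)" for k
  proof -
    have "a s + a t + c * (g k s - g k t) \<le> maximum T (\<lambda>t. a t + c * g k t) + maximum T (\<lambda>t. a t - c * g k t)"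
      using maximum_ge[OF T(1) s(1), of "\<lambda>t. a t + c * g k t"] maximum_ge[OF T(1) t(1), of "\<lambda>t. a t - c * g k t"]
      by (simp add: algebra_simps)
    moreover have "a s + a t - c * (g k s - g k t) \<le> maximum T (\<lambda>t. a t + c * g k t) + maximum T (\<lambda>t. a t - c * g k t)"
      using maximum_ge[OF T(1) t(1), of "\<lambda>t. a t + c * g k t"] maximum_ge[OF T(1) s(1), of "\<lambda>t. a t - c * g k t"]
      by (simp add: algebra_simps)
    ultimately show ?thesis
      by (simp add: abs_if algebra_simps)
  qed
  have "c * (a s + f s + (a t - f t)) \<le> c * (a s + a t + (\<Sum>k\<in>K. \<bar>g k s - g k t\<bar>))"
    using lip[OF s(1) t(1)] c by (intro mult_left_mono) auto
  also have "\<dots> = (\<Sum>k\<in>K. a s + a t + c * \<bar>g k s - g k t\<bar>)"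
    unfolding sum.distrib sum_distrib_left[symmetric] by (simp add: c_def algebra_simps)
  also have "\<dots> \<le> (\<Sum>k\<in>K. maximum T (\<lambda>t. a t + c * g k t) + maximum T (\<lambda>t. a t - c * g k t))"
    by (intro sum_mono le)
  finally show ?thesis
    using c unfolding s(2) t(2) c_def[symmetric] by (simp add: field_simps)
qed

text \<open>A class that is Lipschitz in several coordinate classes jointly is bounded by the sum of
  their separate sign averages. The shift has one summand \<open>a k\<close> per coordinate class,
  so that the induction can hand the last sign to one class at a time.\<close>

lemma sign_mean_contraction:
  assumes T: "finite T" "T \<noteq> {}" and K: "finite K" "K \<noteq> {}"
    and lip: "\<And>i s t. i \<in> {1..n} \<Longrightarrow> s \<in> T \<Longrightarrow> t \<in> T \<Longrightarrow> \<bar>f i s - f i t\<bar> \<le> (\<Sum>k\<in>K. \<bar>g k i s - g k i t\<bar>)"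
  shows "sign_mean n (\<lambda>\<epsilon>. maximum T (\<lambda>t. (\<Sum>k\<in>K. a k t) + (\<Sum>i=1..n. \<epsilon> i * f i t)))
    \<le> (\<Sum>k\<in>K. sign_mean n (\<lambda>\<epsilon>. maximum T (\<lambda>t. a k t + (\<Sum>i=1..n. \<epsilon> i * (real (card K) * g k i t)))))"
  using lip
proof (induction n arbitrary: a)
  case 0
  show ?case
  proof simp
    obtain t where t: "t \<in> T" "maximum T (\<lambda>t. \<Sum>k\<in>K. a k t) = (\<Sum>k\<in>K. a k t)"
      using T by (rule maximum_attained)
    show "maximum T (\<lambda>t. \<Sum>k\<in>K. a k t) \<le> (\<Sum>k\<in>K. maximum T (a k))"
      unfolding t(2) using T t by (intro sum_mono) auto
  qed
next
  case (Suc n)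
  define c where "c = real (card K)"
  have c: "c > 0"
    using K by (simp add: c_def card_gt_0_iff)
  define R where "R k b = sign_mean n (\<lambda>\<epsilon>. maximum T (\<lambda>t. b t + (\<Sum>i=1..n. \<epsilon> i * (c * g k i t))))" for k b
  define R' where "R' k = sign_mean (Suc n) (\<lambda>\<epsilon>. maximum T (\<lambda>t. a k t + (\<Sum>i=1..Suc n. \<epsilon> i * (c * g k i t))))" for k
  define Q where "Q b = sign_mean n (\<lambda>\<epsilon>. maximum T (\<lambda>t. b t + (\<Sum>i=1..n. \<epsilon> i * f i t)))" for b
  define G where "G k t = c * g k (Suc n) t" for k t
  have sum_Suc: "(\<Sum>i=1..Suc n. (\<epsilon>(Suc n := s)) i * h i t) = s * h (Suc n) t + (\<Sum>i=1..n. \<epsilon> i * h i t)" for \<epsilon> s t and h :: "nat \<Rightarrow> 'a \<Rightarrow> real"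
    using sum_upd_Suc[where f="\<lambda>i e. e * h i t"] by simp
  have IH: "Q (\<lambda>t. \<Sum>k\<in>K. b k t) \<le> (\<Sum>k\<in>K. R k (b k))" for b
    using Suc.IH[of b] Suc.prems by (simp add: Q_def R_def c_def)
  have R'_eq: "R' k = (R k (\<lambda>t. a k t + G k t) + R k (\<lambda>t. a k t - G k t)) / 2" for k
    unfolding R'_def R_def sign_mean.simps sum_Suc by (simp add: G_def algebra_simps)
  have R'_twice: "2 * R' k = R k (\<lambda>t. a k t + G k t) + R k (\<lambda>t. a k t - G k t)" for k
    by (simp add: R'_eq)
  have R_le_R': "R k (a k) \<le> R' k" for k
  proof -
    have "maximum T (\<lambda>t. a k t + (\<Sum>i=1..n. \<epsilon> i * (c * g k i t)))
      \<le> (maximum T (\<lambda>t. a k t + G k t + (\<Sum>i=1..n. \<epsilon> i * (c * g k i t)))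
        + maximum T (\<lambda>t. a k t - G k t + (\<Sum>i=1..n. \<epsilon> i * (c * g k i t)))) / 2" for \<epsilon>
    proof -
      obtain t where t: "t \<in> T" "maximum T (\<lambda>t. a k t + (\<Sum>i=1..n. \<epsilon> i * (c * g k i t))) = a k t + (\<Sum>i=1..n. \<epsilon> i * (c * g k i t))"
        using T by (rule maximum_attained)
      have mid: "y + z \<le> (p + q) / 2" if "y + x + z \<le> p" "y - x + z \<le> q" for x y z p q :: real
        using that by simp
      show ?thesis
        unfolding t(2)
        by (rule mid[where x="G k t"]; rule maximum_ge[OF T(1) t(1), of "\<lambda>t. a k t + G k t + (\<Sum>i=1..n. \<epsilon> i * (c * g k i t))"]
          maximum_ge[OF T(1) t(1), of "\<lambda>t. a k t - G k t + (\<Sum>i=1..n. \<epsilon> i * (c * g k i t))"])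
    qed
    thus ?thesis
      unfolding R'_eq R_def sign_mean_add[symmetric] sign_mean_half by (rule sign_mean_mono)
  qed
  \<comment> \<open>Only the summand of class k receives the last coordinate; the induction
    hypothesis then changes that one term of the sum.\<close>
  have perturb: "Q (\<lambda>t. (\<Sum>k\<in>K. a k t) + s * G k t) \<le> (\<Sum>l\<in>K - {k}. R l (a l)) + R k (\<lambda>t. a k t + s * G k t)" if k: "k \<in> K" for k s
  proof -
    define b where "b l t = (if l = k then a l t + s * G k t else a l t)" for l t
    have "(\<Sum>l\<in>K. b l t) = (\<Sum>l\<in>K. a l t) + s * G k t" for t
      using K k by (simp add: b_def sum.remove[of K k])
    hence "Q (\<lambda>t. (\<Sum>k\<in>K. a k t) + s * G k t) \<le> (\<Sum>l\<in>K. R l (b l))"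
      using IH[of b] by simp
    also have "\<dots> = (\<Sum>l\<in>K - {k}. R l (a l)) + R k (\<lambda>t. a k t + s * G k t)"
      using K k by (simp add: sum.remove[of K k] b_def[abs_def])
    finally show ?thesis .
  qed
  have step: "Q (\<lambda>t. (\<Sum>k\<in>K. a k t) + f (Suc n) t) + Q (\<lambda>t. (\<Sum>k\<in>K. a k t) - f (Suc n) t)
      \<le> (\<Sum>k\<in>K. Q (\<lambda>t. (\<Sum>k\<in>K. a k t) + G k t) + Q (\<lambda>t. (\<Sum>k\<in>K. a k t) - G k t)) / c"
  proof -
    have "sign_mean n (\<lambda>\<epsilon>. maximum T (\<lambda>t. ((\<Sum>k\<in>K. a k t) + (\<Sum>i=1..n. \<epsilon> i * f i t)) + f (Suc n) t)
          + maximum T (\<lambda>t. ((\<Sum>k\<in>K. a k t) + (\<Sum>i=1..n. \<epsilon> i * f i t)) - f (Suc n) t))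
      \<le> sign_mean n (\<lambda>\<epsilon>. 1 / c * (\<Sum>k\<in>K. maximum T (\<lambda>t. ((\<Sum>k\<in>K. a k t) + (\<Sum>i=1..n. \<epsilon> i * f i t)) + G k t)
          + maximum T (\<lambda>t. ((\<Sum>k\<in>K. a k t) + (\<Sum>i=1..n. \<epsilon> i * f i t)) - G k t)))"
      using maximum_contraction_step[OF T K, of "f (Suc n)" "\<lambda>k. g k (Suc n)"] Suc.prems
      by (intro sign_mean_mono) (simp add: c_def G_def)
    thus ?thesis
      unfolding Q_def sign_mean_cmult sign_mean_sum sign_mean_add
      by (simp add: algebra_simps)
  qed
  have "sign_mean (Suc n) (\<lambda>\<epsilon>. maximum T (\<lambda>t. (\<Sum>k\<in>K. a k t) + (\<Sum>i=1..Suc n. \<epsilon> i * f i t)))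
      = (Q (\<lambda>t. (\<Sum>k\<in>K. a k t) + f (Suc n) t) + Q (\<lambda>t. (\<Sum>k\<in>K. a k t) - f (Suc n) t)) / 2"
    unfolding Q_def sign_mean.simps sum_Suc by (simp add: algebra_simps)
  also have "\<dots> \<le> (\<Sum>k\<in>K. Q (\<lambda>t. (\<Sum>k\<in>K. a k t) + G k t) + Q (\<lambda>t. (\<Sum>k\<in>K. a k t) - G k t)) / c / 2"
    using step by (intro divide_right_mono) auto
  also have "\<dots> \<le> (\<Sum>k\<in>K. 2 * ((\<Sum>l\<in>K - {k}. R l (a l)) + R' k)) / c / 2"
  proof (intro divide_right_mono sum_mono)
    fix k assume k: "k \<in> K"
    show "Q (\<lambda>t. (\<Sum>k\<in>K. a k t) + G k t) + Q (\<lambda>t. (\<Sum>k\<in>K. a k t) - G k t) \<le> 2 * ((\<Sum>l\<in>K - {k}. R l (a l)) + R' k)"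
      using perturb[OF k, of 1] perturb[OF k, of "-1"] R'_twice[of k] by (simp add: distrib_left)
  qed (use c in auto)
  \<comment> \<open>The classes not chosen still lack the last sign; adding it can only increase
    their averages, by \<open>R_le_R'\<close>.\<close>
  also have "\<dots> \<le> (\<Sum>k\<in>K. 2 * (\<Sum>l\<in>K. R' l)) / c / 2"
  proof (intro divide_right_mono sum_mono mult_left_mono)
    fix k assume k: "k \<in> K"
    have "(\<Sum>l\<in>K - {k}. R l (a l)) \<le> (\<Sum>l\<in>K - {k}. R' l)"
      by (intro sum_mono R_le_R')
    thus "(\<Sum>l\<in>K - {k}. R l (a l)) + R' k \<le> (\<Sum>l\<in>K. R' l)"
      using K k by (simp add: sum.remove[of K k])
  qed (use c in auto)
  also have "\<dots> = (\<Sum>l\<in>K. R' l)"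
    using c by (simp add: c_def)
  finally show ?case
    by (simp only: R'_def c_def)
qed

section \<open>Product samples: Fubini, symmetrisation and bounded differences\<close>

lemma bounded_integrable:
  fixes f :: "'a \<Rightarrow> real"
  assumes "finite_measure M" "f \<in> borel_measurable M" "\<And>x. x \<in> space M \<Longrightarrow> \<bar>f x\<bar> \<le> B"
  shows "integrable M f"
  using assms by (intro finite_measure.integrable_const_bound[where B=B]) auto

context prob_space
begin

lemma abs_expectation_le:
  assumes h: "h \<in> borel_measurable M" "\<And>x. x \<in> space M \<Longrightarrow> \<bar>h x\<bar> \<le> (c :: real)"
  shows "\<bar>\<integral>x. h x \<partial>M\<bar> \<le> c"
proof -
  have i: "integrable M h"
    using h by (rule bounded_integrable[OF finite_measure_axioms])
  have "\<bar>\<integral>x. h x \<partial>M\<bar> \<le> (\<integral>x. \<bar>h x\<bar> \<partial>M)"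
    by (rule integral_abs_bound)
  also have "\<dots> \<le> (\<integral>x. c \<partial>M)"
    using i h(2) by (intro integral_mono) auto
  finally show ?thesis by (simp add: prob_space)
qed

abbreviation sample_space :: "nat \<Rightarrow> (nat \<Rightarrow> 'a) measure" where
  "sample_space n \<equiv> Pi\<^sub>M {1..n} (\<lambda>_. M)"

lemma prob_space_sample_space: "prob_space (sample_space n)"
  by (intro prob_space_PiM) (rule prob_space_axioms)

lemma product_sigma_finite_const: "product_sigma_finite (\<lambda>_. M)"
  by (simp add: product_sigma_finite_def sigma_finite_measure_axioms)

lemma atLeastAtMost_Suc_insert: "{1..Suc n} = insert (Suc n) {1..n}"
  by auto

lemma space_sample_space_upd:
  "x \<in> space (sample_space n) \<Longrightarrow> y \<in> space M \<Longrightarrow> x(Suc n := y) \<in> space (sample_space (Suc n))"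
  by (auto simp: space_PiM PiE_def extensional_def)

lemma upd_measurable:
  "(\<lambda>(x, y). x(Suc n := y)) \<in> measurable (sample_space n \<Otimes>\<^sub>M M) (sample_space (Suc n))"
  unfolding atLeastAtMost_Suc_insert by (rule measurable_add_dim)

text \<open>Both orders of integration are provided: symmetrisation treats the last observation with
  the others fixed, and then the others with the last one fixed.\<close>

lemma integral_sample_space_Suc:
  fixes f :: "(nat \<Rightarrow> 'a) \<Rightarrow> real"
  assumes f: "f \<in> borel_measurable (sample_space (Suc n))" and B: "\<And>x. x \<in> space (sample_space (Suc n)) \<Longrightarrow> \<bar>f x\<bar> \<le> B"
  shows "(\<integral>x. f x \<partial>sample_space (Suc n)) = (\<integral>x. (\<integral>y. f (x(Suc n := y)) \<partial>M) \<partial>sample_space n)"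
    and "(\<integral>x. f x \<partial>sample_space (Suc n)) = (\<integral>y. (\<integral>x. f (x(Suc n := y)) \<partial>sample_space n) \<partial>M)"
    and "(\<lambda>x. \<integral>y. f (x(Suc n := y)) \<partial>M) \<in> borel_measurable (sample_space n)"
    and "(\<lambda>y. \<integral>x. f (x(Suc n := y)) \<partial>sample_space n) \<in> borel_measurable M"
proof -
  interpret product_sigma_finite "\<lambda>_. M" by (rule product_sigma_finite_const)
  interpret s: prob_space "sample_space n" by (rule prob_space_sample_space)
  interpret p: pair_prob_space "sample_space n" M ..
  have m: "(\<lambda>(x, y). f (x(Suc n := y))) \<in> borel_measurable (sample_space n \<Otimes>\<^sub>M M)"
    using measurable_compose[OF upd_measurable f] by (simp add: split_beta')
  have "integrable (sample_space n \<Otimes>\<^sub>M M) (\<lambda>(x, y). f (x(Suc n := y)))"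
    using m B space_sample_space_upd
    by (intro bounded_integrable[where B=B] p.finite_measure_axioms) (auto simp: space_pair_measure)
  hence swap: "(\<integral>y. (\<integral>x. f (x(Suc n := y)) \<partial>sample_space n) \<partial>M) = (\<integral>x. (\<integral>y. f (x(Suc n := y)) \<partial>M) \<partial>sample_space n)"
    by (rule p.Fubini_integral)
  show 1: "(\<integral>x. f x \<partial>sample_space (Suc n)) = (\<integral>x. (\<integral>y. f (x(Suc n := y)) \<partial>M) \<partial>sample_space n)"
    unfolding atLeastAtMost_Suc_insert
  proof (rule product_integral_insert)
    show "integrable (Pi\<^sub>M (insert (Suc n) {1..n}) (\<lambda>_. M)) f"
      unfolding atLeastAtMost_Suc_insert[symmetric]
      using f B by (intro bounded_integrable[where B=B] prob_space.finite_measure prob_space_sample_space)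
  qed auto
  show "(\<integral>x. f x \<partial>sample_space (Suc n)) = (\<integral>y. (\<integral>x. f (x(Suc n := y)) \<partial>sample_space n) \<partial>M)"
    using 1 swap by simp
  show "(\<lambda>x. \<integral>y. f (x(Suc n := y)) \<partial>M) \<in> borel_measurable (sample_space n)"
    using m by (rule borel_measurable_lebesgue_integral)
  have "(\<lambda>(y, x). f (x(Suc n := y))) \<in> borel_measurable (M \<Otimes>\<^sub>M sample_space n)"
    using measurable_compose[OF measurable_pair_swap' m] by (simp add: split_beta')
  thus "(\<lambda>y. \<integral>x. f (x(Suc n := y)) \<partial>sample_space n) \<in> borel_measurable M"
    by (rule s.borel_measurable_lebesgue_integral)
qed

lemma integrable_sample_space_Suc:
  fixes f :: "(nat \<Rightarrow> 'a) \<Rightarrow> real"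
  assumes f: "f \<in> borel_measurable (sample_space (Suc n))" and B: "\<And>x. x \<in> space (sample_space (Suc n)) \<Longrightarrow> \<bar>f x\<bar> \<le> B"
  shows "x \<in> space (sample_space n) \<Longrightarrow> integrable M (\<lambda>y. f (x(Suc n := y)))"
    and "y \<in> space M \<Longrightarrow> integrable (sample_space n) (\<lambda>x. f (x(Suc n := y)))"
    and "integrable (sample_space n) (\<lambda>x. \<integral>y. f (x(Suc n := y)) \<partial>M)"
    and "integrable M (\<lambda>y. \<integral>x. f (x(Suc n := y)) \<partial>sample_space n)"
proof -
  interpret s: prob_space "sample_space n" by (rule prob_space_sample_space)
  have m: "(\<lambda>(x, y). f (x(Suc n := y))) \<in> borel_measurable (sample_space n \<Otimes>\<^sub>M M)"
    using measurable_compose[OF upd_measurable f] by (simp add: split_beta')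
  have b: "\<bar>f (x(Suc n := y))\<bar> \<le> B" if "x \<in> space (sample_space n)" "y \<in> space M" for x y
    using B space_sample_space_upd[OF that] by blast
  have m1: "(\<lambda>y. f (x(Suc n := y))) \<in> borel_measurable M" if "x \<in> space (sample_space n)" for x
    using measurable_compose[OF measurable_Pair1'[OF that] m] by simp
  have m2: "(\<lambda>x. f (x(Suc n := y))) \<in> borel_measurable (sample_space n)" if "y \<in> space M" for y
    using measurable_compose[OF measurable_Pair2'[OF that] m] by simp
  show "integrable M (\<lambda>y. f (x(Suc n := y)))" if "x \<in> space (sample_space n)" for x
    using m1[OF that] b[OF that] by (rule bounded_integrable[OF finite_measure_axioms])
  show "integrable (sample_space n) (\<lambda>x. f (x(Suc n := y)))" if "y \<in> space M" for y
    using m2[OF that] b[OF _ that] by (rule bounded_integrable[OF s.finite_measure_axioms])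
  show "integrable (sample_space n) (\<lambda>x. \<integral>y. f (x(Suc n := y)) \<partial>M)"
    using integral_sample_space_Suc(3)[OF f B] abs_expectation_le[OF m1 b]
    by (rule bounded_integrable[OF s.finite_measure_axioms])
  show "integrable M (\<lambda>y. \<integral>x. f (x(Suc n := y)) \<partial>sample_space n)"
    using integral_sample_space_Suc(4)[OF f B] s.abs_expectation_le[OF m2 b]
    by (rule bounded_integrable[OF finite_measure_axioms])
qed

lemma maximum_measurable:
  "finite T \<Longrightarrow> (\<And>t. t \<in> T \<Longrightarrow> f t \<in> borel_measurable N) \<Longrightarrow> (\<lambda>x. maximum T (\<lambda>t. f t x)) \<in> borel_measurable N"
  by (rule borel_measurable_Max)

lemma abs_maximum_le:
  assumes "finite T" "T \<noteq> {}" "\<And>t. t \<in> T \<Longrightarrow> \<bar>f t\<bar> \<le> B"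
  shows "\<bar>maximum T f\<bar> \<le> B"
  using assms by (metis maximum_attained)

text \<open>Symmetrisation of one coordinate at a time: the remaining coordinates are absorbed into
  the deterministic shift \<open>a\<close>.\<close>

lemma symmetrisation_step:
  fixes f :: "'t \<Rightarrow> 'a \<Rightarrow> real"
  assumes T: "finite T" "T \<noteq> {}" and f: "\<And>t. t \<in> T \<Longrightarrow> f t \<in> borel_measurable M"
    and B: "\<And>t x. t \<in> T \<Longrightarrow> x \<in> space M \<Longrightarrow> \<bar>f t x\<bar> \<le> B"
  shows "(\<integral>x. maximum T (\<lambda>t. a t + (f t x - (\<integral>y. f t y \<partial>M))) \<partial>M)
    \<le> (\<integral>x. (maximum T (\<lambda>t. a t + 2 * f t x) + maximum T (\<lambda>t. a t - 2 * f t x)) / 2 \<partial>M)"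
proof -
  define Ba where "Ba = (\<Sum>t\<in>T. \<bar>a t\<bar>)"
  have Ba: "\<bar>a t\<bar> \<le> Ba" if "t \<in> T" for t
    unfolding Ba_def using T that by (intro member_le_sum) auto
  interpret p: pair_prob_space M M ..
  have int_f: "integrable M (f t)" if "t \<in> T" for t
    using f B that by (intro bounded_integrable[where B=B] finite_measure_axioms) auto
  have meas: "(\<lambda>x. maximum T (\<lambda>t. a t + c * f t x)) \<in> borel_measurable M" for c
    using f by (intro maximum_measurable T) auto
  have int: "integrable M (\<lambda>x. maximum T (\<lambda>t. a t + c * f t x))" for c
  proof (rule bounded_integrable[OF finite_measure_axioms meas])
    fix x assume x: "x \<in> space M"
    show "\<bar>maximum T (\<lambda>t. a t + c * f t x)\<bar> \<le> Ba + \<bar>c\<bar> * B"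
    proof (rule abs_maximum_le[OF T])
      fix t assume t: "t \<in> T"
      have "\<bar>c * f t x\<bar> \<le> \<bar>c\<bar> * B"
        unfolding abs_mult using B[OF t x] by (intro mult_left_mono) auto
      thus "\<bar>a t + c * f t x\<bar> \<le> Ba + \<bar>c\<bar> * B"
        using Ba[OF t] by linarith
    qed
  qed
  have fst_m: "(\<lambda>z. f t (fst z)) \<in> borel_measurable (M \<Otimes>\<^sub>M M)" and snd_m: "(\<lambda>z. f t (snd z)) \<in> borel_measurable (M \<Otimes>\<^sub>M M)" if "t \<in> T" for t
    using f[OF that] by (auto intro: measurable_compose[OF measurable_fst] measurable_compose[OF measurable_snd])
  have meas2: "(\<lambda>z. maximum T (\<lambda>t. a t + (f t (fst z) - f t (snd z)))) \<in> borel_measurable (M \<Otimes>\<^sub>M M)"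
    using fst_m snd_m by (intro maximum_measurable T) auto
  have bd2: "\<bar>maximum T (\<lambda>t. a t + (f t x - f t y))\<bar> \<le> Ba + 2 * B" if "x \<in> space M" "y \<in> space M" for x y
  proof (rule abs_maximum_le[OF T])
    fix t assume t: "t \<in> T"
    show "\<bar>a t + (f t x - f t y)\<bar> \<le> Ba + 2 * B"
      using Ba[OF t] B[OF t that(1)] B[OF t that(2)] by linarith
  qed
  have int2: "integrable (M \<Otimes>\<^sub>M M) (\<lambda>z. maximum T (\<lambda>t. a t + (f t (fst z) - f t (snd z))))"
    using bd2 by (intro bounded_integrable[where B="Ba + 2 * B"] p.finite_measure_axioms meas2) (auto simp: space_pair_measure)
  have int1: "integrable M (\<lambda>y. maximum T (\<lambda>t. a t + (f t x - f t y)))" if "x \<in> space M" for x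
    using f bd2[OF that] by (intro bounded_integrable[where B="Ba + 2 * B"] finite_measure_axioms maximum_measurable T) auto
  \<comment> \<open>Jensen: the expectation is replaced by an independent copy y, and a maximum of
    means is at most the mean of the maximum.\<close>
  have "(\<integral>x. maximum T (\<lambda>t. a t + (f t x - (\<integral>y. f t y \<partial>M))) \<partial>M)
      \<le> (\<integral>x. (\<integral>y. maximum T (\<lambda>t. a t + (f t x - f t y)) \<partial>M) \<partial>M)"
  proof (rule integral_mono)
    have "\<bar>\<integral>y. f t y \<partial>M\<bar> \<le> B" if "t \<in> T" for t
      by (rule abs_expectation_le[OF f[OF that] B[OF that]])
    hence "\<bar>a t + (f t x - (\<integral>y. f t y \<partial>M))\<bar> \<le> Ba + 2 * B" if "t \<in> T" "x \<in> space M" for t x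
      using that Ba[OF that(1)] B[OF that] by (smt (verit))
    thus "integrable M (\<lambda>x. maximum T (\<lambda>t. a t + (f t x - (\<integral>y. f t y \<partial>M))))"
      using f by (intro bounded_integrable[where B="Ba + 2 * B"] finite_measure_axioms maximum_measurable abs_maximum_le T) auto
    show "integrable M (\<lambda>x. \<integral>y. maximum T (\<lambda>t. a t + (f t x - f t y)) \<partial>M)"
      using p.integrable_fst'[OF int2] by simp
    fix x assume x: "x \<in> space M"
    have "a t + (f t x - (\<integral>y. f t y \<partial>M)) \<le> (\<integral>y. maximum T (\<lambda>t. a t + (f t x - f t y)) \<partial>M)" if t: "t \<in> T" for t
    proof -
      have "a t + (f t x - (\<integral>y. f t y \<partial>M)) = (\<integral>y. a t + (f t x - f t y) \<partial>M)"
        using int_f[OF t] by (simp add: prob_space)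
      also have "\<dots> \<le> (\<integral>y. maximum T (\<lambda>t. a t + (f t x - f t y)) \<partial>M)"
        using int_f[OF t] int1[OF x] t T(1)
        by (intro integral_mono maximum_ge[where f="\<lambda>t. a t + (f t x - f t _)"]) auto
      finally show ?thesis .
    qed
    thus "maximum T (\<lambda>t. a t + (f t x - (\<integral>y. f t y \<partial>M))) \<le> (\<integral>y. maximum T (\<lambda>t. a t + (f t x - f t y)) \<partial>M)"
      using T by simp
  qed
  \<comment> \<open>Writing a + f x - f y as the average of a + 2 f x and a - 2 f y decouples the
    two copies; this is the origin of the factor 2.\<close>
  also have "\<dots> \<le> (\<integral>x. (\<integral>y. (maximum T (\<lambda>t. a t + 2 * f t x) + maximum T (\<lambda>t. a t + (-2) * f t y)) / 2 \<partial>M) \<partial>M)"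
  proof (intro integral_mono int1)
    show "integrable M (\<lambda>x. \<integral>y. maximum T (\<lambda>t. a t + (f t x - f t y)) \<partial>M)"
      using p.integrable_fst'[OF int2] by simp
    show "integrable M (\<lambda>x. \<integral>y. (maximum T (\<lambda>t. a t + 2 * f t x) + maximum T (\<lambda>t. a t + (-2) * f t y)) / 2 \<partial>M)"
      using int[of 2] int[of "-2"] by (simp add: prob_space)
    fix x y 
    show "integrable M (\<lambda>y. (maximum T (\<lambda>t. a t + 2 * f t x) + maximum T (\<lambda>t. a t + (-2) * f t y)) / 2)"
      using int[of "-2"] by simp
    obtain t where t: "t \<in> T" "maximum T (\<lambda>t. a t + (f t x - f t y)) = a t + (f t x - f t y)"
      using T by (rule maximum_attained)
    show "maximum T (\<lambda>t. a t + (f t x - f t y)) \<le> (maximum T (\<lambda>t. a t + 2 * f t x) + maximum T (\<lambda>t. a t + (-2) * f t y)) / 2"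
      unfolding t(2) using maximum_ge[OF T(1) t(1), of "\<lambda>t. a t + 2 * f t x"] maximum_ge[OF T(1) t(1), of "\<lambda>t. a t + (-2) * f t y"]
      by (simp add: field_simps)
  qed
  also have "\<dots> = (\<integral>x. (maximum T (\<lambda>t. a t + 2 * f t x) + maximum T (\<lambda>t. a t + (-2) * f t x)) / 2 \<partial>M)"
    using int[of 2] int[of "-2"] by (simp add: prob_space)
  finally show ?thesis by simp
qed

text \<open>The last observation is symmetrised with the centred sum of the others as shift. Then
  that observation and its sign are frozen into the shift and the induction hypothesis treats the
  rest.\<close>

lemma symmetrisation:
  fixes f :: "'t \<Rightarrow> 'a \<Rightarrow> real"
  assumes T: "finite T" "T \<noteq> {}" and f: "\<And>t. t \<in> T \<Longrightarrow> f t \<in> borel_measurable M"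
    and B: "\<And>t x. t \<in> T \<Longrightarrow> x \<in> space M \<Longrightarrow> \<bar>f t x\<bar> \<le> B"
  shows "(\<integral>x. maximum T (\<lambda>t. a t + (\<Sum>i=1..n. f t (x i) - (\<integral>y. f t y \<partial>M))) \<partial>sample_space n)
    \<le> (\<integral>x. sign_mean n (\<lambda>\<epsilon>. maximum T (\<lambda>t. a t + (\<Sum>i=1..n. \<epsilon> i * (2 * f t (x i))))) \<partial>sample_space n)"
proof (induction n arbitrary: a)
  case 0
  show ?case by simp
next
  case (Suc n)
  define Ba where "Ba = (\<Sum>t\<in>T. \<bar>a t\<bar>)"
  have Ba: "\<bar>a t\<bar> \<le> Ba" if "t \<in> T" for t
    unfolding Ba_def using T that by (intro member_le_sum) auto
  have comp: "(\<lambda>x. f t (x i)) \<in> borel_measurable (sample_space m)" if "t \<in> T" "i \<in> {1..m}" for t i m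
    using that f by (intro measurable_compose[OF measurable_component_singleton]) auto
  have pt: "x i \<in> space M" if "x \<in> space (sample_space m)" "i \<in> {1..m}" for x i m
    using that by (auto simp: space_PiM)
  define m where "m t = (\<integral>y. f t y \<partial>M)" for t
  have int_f: "integrable M (f t)" if "t \<in> T" for t
    using f B that by (intro bounded_integrable[where B=B] finite_measure_axioms) auto
  have m: "\<bar>m t\<bar> \<le> B" if "t \<in> T" for t
    unfolding m_def by (rule abs_expectation_le[OF f[OF that] B[OF that]])
  have abs_sum: "\<bar>\<Sum>i=1..k. h i\<bar> \<le> real k * c" if "\<And>i. i \<in> {1..k} \<Longrightarrow> \<bar>h i\<bar> \<le> c" for h :: "nat \<Rightarrow> real" and c k
    using order_trans[OF sum_abs sum_mono[of "{1..k}" "\<lambda>i. \<bar>h i\<bar>" "\<lambda>_. c"]] that by simp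
  define D where "D k x t = (\<Sum>i=1..k. f t (x i) - m t)" for k :: nat and x t
  have D_m: "(\<lambda>x. D k x t) \<in> borel_measurable (sample_space k)" if "t \<in> T" for k t
    unfolding D_def using comp that by (intro borel_measurable_sum borel_measurable_diff) auto
  have D_b: "\<bar>D k x t\<bar> \<le> real k * (2 * B)" if "t \<in> T" "x \<in> space (sample_space k)" for k x t
    unfolding D_def
  proof (rule abs_sum)
    fix i assume "i \<in> {1..k}"
    thus "\<bar>f t (x i) - m t\<bar> \<le> 2 * B"
      using B[OF that(1) pt[OF that(2)]] m[OF that(1)] by (smt (verit))
  qed
  define Z where "Z n b x = sign_mean n (\<lambda>\<epsilon>. maximum T (\<lambda>t. b t + (\<Sum>i=1..n. \<epsilon> i * (2 * f t (x i)))))" for n b x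
  have Z_m: "(\<lambda>x. Z n b x) \<in> borel_measurable (sample_space n)" for n b
    unfolding Z_def using comp
    by (intro sign_mean_measurable maximum_measurable T borel_measurable_add borel_measurable_sum borel_measurable_times borel_measurable_const)
  have Z_b: "\<bar>Z n b x\<bar> \<le> c + real n * (2 * B)" if c: "\<And>t. t \<in> T \<Longrightarrow> \<bar>b t\<bar> \<le> c" and x: "x \<in> space (sample_space n)" for n b c x
  proof -
    have *: "\<bar>maximum T (\<lambda>t. b t + (\<Sum>i=1..n. \<epsilon> i * (2 * f t (x i))))\<bar> \<le> c + real n * (2 * B)" if e: "\<epsilon> \<in> sign_vectors n" for \<epsilon>
    proof (rule abs_maximum_le[OF T])
      fix t assume t: "t \<in> T"
      have "\<bar>\<Sum>i=1..n. \<epsilon> i * (2 * f t (x i))\<bar> \<le> real n * (2 * B)"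
      proof (rule abs_sum)
        fix i assume i: "i \<in> {1..n}"
        have "\<epsilon> i = 1 \<or> \<epsilon> i = -1"
          using e i by (auto simp: sign_vectors_def)
        thus "\<bar>\<epsilon> i * (2 * f t (x i))\<bar> \<le> 2 * B"
          using B[OF t pt[OF x i]] by (auto simp: abs_mult)
      qed
      thus "\<bar>b t + (\<Sum>i=1..n. \<epsilon> i * (2 * f t (x i)))\<bar> \<le> c + real n * (2 * B)"
        using c[OF t] by linarith
    qed
    have "Z n b x \<le> sign_mean n (\<lambda>_. c + real n * (2 * B))"
      unfolding Z_def
    proof (rule sign_mean_mono_on)
      fix \<epsilon> assume "\<epsilon> \<in> sign_vectors n"
      from *[OF this] show "maximum T (\<lambda>t. b t + (\<Sum>i=1..n. \<epsilon> i * (2 * f t (x i)))) \<le> c + real n * (2 * B)"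
        by (rule abs_le_D1)
    qed
    moreover have "sign_mean n (\<lambda>_. - (c + real n * (2 * B))) \<le> Z n b x"
      unfolding Z_def
    proof (rule sign_mean_mono_on)
      fix \<epsilon> assume "\<epsilon> \<in> sign_vectors n"
      from abs_le_D2[OF *[OF this]] show "- (c + real n * (2 * B)) \<le> maximum T (\<lambda>t. b t + (\<Sum>i=1..n. \<epsilon> i * (2 * f t (x i))))"
        by (rule minus_le_iff[THEN iffD1])
    qed
    ultimately show ?thesis
      by (simp add: sign_mean_const abs_le_iff)
  qed
  define V where "V x = maximum T (\<lambda>t. a t + D (Suc n) x t)" for x
  have V_m: "V \<in> borel_measurable (sample_space (Suc n))"
    unfolding V_def[abs_def] using D_m by (intro maximum_measurable T borel_measurable_add) auto
  have V_b: "\<bar>V x\<bar> \<le> Ba + real (Suc n) * (2 * B)" if x: "x \<in> space (sample_space (Suc n))" for x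
    unfolding V_def
  proof (rule abs_maximum_le[OF T])
    fix t assume t: "t \<in> T"
    show "\<bar>a t + D (Suc n) x t\<bar> \<le> Ba + real (Suc n) * (2 * B)"
      using Ba[OF t] D_b[OF t x] by linarith
  qed
  \<comment> \<open>The intermediate stage: the last coordinate carries its sign, the first n are
    still centred.\<close>
  define W where "W x = (maximum T (\<lambda>t. (a t + D n x t) + 2 * f t (x (Suc n))) + maximum T (\<lambda>t. (a t + D n x t) - 2 * f t (x (Suc n)))) / 2" for x
  have D_m': "(\<lambda>x. D n x t) \<in> borel_measurable (sample_space (Suc n))" if "t \<in> T" for t
    unfolding D_def using comp[of t _ "Suc n"] that by (intro borel_measurable_sum borel_measurable_diff) auto
  have D_b': "\<bar>D n x t\<bar> \<le> real n * (2 * B)" if "t \<in> T" "x \<in> space (sample_space (Suc n))" for x t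
    unfolding D_def
  proof (rule abs_sum)
    fix i assume "i \<in> {1..n}"
    thus "\<bar>f t (x i) - m t\<bar> \<le> 2 * B"
      using B[OF that(1) pt[OF that(2), of i]] m[OF that(1)] by (simp add: abs_le_iff)
  qed
  have W_m: "W \<in> borel_measurable (sample_space (Suc n))"
    unfolding W_def[abs_def] using D_m' comp[of _ "Suc n" "Suc n"]
    by (intro borel_measurable_divide borel_measurable_add maximum_measurable T borel_measurable_diff borel_measurable_times) auto
  have W_b: "\<bar>W x\<bar> \<le> Ba + real (Suc n) * (2 * B)" if x: "x \<in> space (sample_space (Suc n))" for x
  proof -
    have *: "\<bar>a t + D n x t\<bar> \<le> Ba + real n * (2 * B)" "\<bar>2 * f t (x (Suc n))\<bar> \<le> 2 * B" if t: "t \<in> T" for t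
      using Ba[OF t] D_b'[OF t x] B[OF t pt[OF x, of "Suc n"]] by auto
    have "\<bar>maximum T (\<lambda>t. (a t + D n x t) + 2 * f t (x (Suc n)))\<bar> \<le> Ba + real (Suc n) * (2 * B)"
    proof (rule abs_maximum_le[OF T])
      fix t assume t: "t \<in> T"
      have "real (Suc n) * (2 * B) = real n * (2 * B) + 2 * B" by (simp add: algebra_simps)
      thus "\<bar>(a t + D n x t) + 2 * f t (x (Suc n))\<bar> \<le> Ba + real (Suc n) * (2 * B)"
        using *[OF t] by linarith
    qed
    moreover have "\<bar>maximum T (\<lambda>t. (a t + D n x t) - 2 * f t (x (Suc n)))\<bar> \<le> Ba + real (Suc n) * (2 * B)"
    proof (rule abs_maximum_le[OF T])
      fix t assume t: "t \<in> T"
      have "real (Suc n) * (2 * B) = real n * (2 * B) + 2 * B" by (simp add: algebra_simps)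
      thus "\<bar>(a t + D n x t) - 2 * f t (x (Suc n))\<bar> \<le> Ba + real (Suc n) * (2 * B)"
        using *[OF t] by linarith
    qed
    moreover have "\<bar>(p + q) / 2\<bar> \<le> r" if "\<bar>p\<bar> \<le> r" "\<bar>q\<bar> \<le> r" for p q r :: real
      using that by (simp add: abs_le_iff field_simps)
    ultimately show ?thesis
      unfolding W_def by blast
  qed
  have D_upd: "D n (x(Suc n := y)) t = D n x t" for x y t
    unfolding D_def by (intro sum.cong) auto
  have D_Suc: "D (Suc n) (x(Suc n := y)) t = D n x t + (f t y - m t)" for x y t
    using D_upd[of x y t] by (simp add: D_def)
  have "(\<integral>x. V x \<partial>sample_space (Suc n)) = (\<integral>x. (\<integral>y. V (x(Suc n := y)) \<partial>M) \<partial>sample_space n)"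
    by (rule integral_sample_space_Suc(1)[OF V_m V_b])
  also have "\<dots> \<le> (\<integral>x. (\<integral>y. W (x(Suc n := y)) \<partial>M) \<partial>sample_space n)"
  proof (rule integral_mono)
    show "integrable (sample_space n) (\<lambda>x. \<integral>y. V (x(Suc n := y)) \<partial>M)"
      by (rule integrable_sample_space_Suc(3)[OF V_m V_b])
    show "integrable (sample_space n) (\<lambda>x. \<integral>y. W (x(Suc n := y)) \<partial>M)"
      by (rule integrable_sample_space_Suc(3)[OF W_m W_b])
    fix x assume x: "x \<in> space (sample_space n)"
    have "(\<integral>y. maximum T (\<lambda>t. (a t + D n x t) + (f t y - (\<integral>y. f t y \<partial>M))) \<partial>M)
      \<le> (\<integral>y. (maximum T (\<lambda>t. (a t + D n x t) + 2 * f t y) + maximum T (\<lambda>t. (a t + D n x t) - 2 * f t y)) / 2 \<partial>M)"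
      by (rule symmetrisation_step[OF T f B])
    thus "(\<integral>y. V (x(Suc n := y)) \<partial>M) \<le> (\<integral>y. W (x(Suc n := y)) \<partial>M)"
      by (simp only: V_def W_def D_Suc D_upd m_def fun_upd_same add.assoc)
  qed
  \<comment> \<open>Integrating over the first n observations inside lets the induction hypothesis
    be used for each fixed y.\<close>
  also have "\<dots> = (\<integral>y. (\<integral>x. W (x(Suc n := y)) \<partial>sample_space n) \<partial>M)"
    using integral_sample_space_Suc(1)[OF W_m W_b] integral_sample_space_Suc(2)[OF W_m W_b] by simp
  also have "\<dots> \<le> (\<integral>y. (\<integral>x. Z (Suc n) a (x(Suc n := y)) \<partial>sample_space n) \<partial>M)"
  proof (rule integral_mono)
    show "integrable M (\<lambda>y. \<integral>x. W (x(Suc n := y)) \<partial>sample_space n)"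
      by (rule integrable_sample_space_Suc(4)[OF W_m W_b])
    show "integrable M (\<lambda>y. \<integral>x. Z (Suc n) a (x(Suc n := y)) \<partial>sample_space n)"
      by (rule integrable_sample_space_Suc(4)[OF Z_m Z_b[OF Ba]])
    fix y assume y: "y \<in> space M"
    interpret s: prob_space "sample_space n" by (rule prob_space_sample_space)
    have b: "\<bar>a t + c * (2 * f t y)\<bar> \<le> Ba + 2 * B" if "t \<in> T" "c = 1 \<or> c = -1" for t c
      using Ba[OF that(1)] B[OF that(1) y] that(2) by auto
    define X where "X c x = maximum T (\<lambda>t. (a t + c * (2 * f t y)) + D n x t)" for c x
    have X_m: "X c \<in> borel_measurable (sample_space n)" for c
      unfolding X_def[abs_def] using D_m by (intro maximum_measurable T borel_measurable_add) auto
    have X_b: "\<bar>X c x\<bar> \<le> Ba + 2 * B + real n * (2 * B)" if "c = 1 \<or> c = -1" "x \<in> space (sample_space n)" for c x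
      unfolding X_def
    proof (rule abs_maximum_le[OF T])
      fix t assume t: "t \<in> T"
      show "\<bar>(a t + c * (2 * f t y)) + D n x t\<bar> \<le> Ba + 2 * B + real n * (2 * B)"
        using b[OF t that(1)] D_b[OF t that(2)] by linarith
    qed
    have X_i: "integrable (sample_space n) (X c)" if "c = 1 \<or> c = -1" for c
      by (rule bounded_integrable[OF s.finite_measure_axioms X_m X_b[OF that]])
    have Z_i: "integrable (sample_space n) (Z n (\<lambda>t. a t + c * (2 * f t y)))" if "c = 1 \<or> c = -1" for c
      by (rule bounded_integrable[OF s.finite_measure_axioms Z_m Z_b[OF b[OF _ that]]])
    have XZ: "(\<integral>x. X c x \<partial>sample_space n) \<le> (\<integral>x. Z n (\<lambda>t. a t + c * (2 * f t y)) x \<partial>sample_space n)" for c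
      unfolding X_def Z_def D_def m_def by (rule Suc)
    have "(\<integral>x. W (x(Suc n := y)) \<partial>sample_space n) = (\<integral>x. (X 1 x + X (-1) x) / 2 \<partial>sample_space n)"
      by (simp add: W_def X_def D_upd algebra_simps)
    also have "\<dots> = ((\<integral>x. X 1 x \<partial>sample_space n) + (\<integral>x. X (-1) x \<partial>sample_space n)) / 2"
      using X_i by simp
    also have "\<dots> \<le> ((\<integral>x. Z n (\<lambda>t. a t + 1 * (2 * f t y)) x \<partial>sample_space n) + (\<integral>x. Z n (\<lambda>t. a t + (-1) * (2 * f t y)) x \<partial>sample_space n)) / 2"
      by (intro divide_right_mono add_mono XZ) auto
    also have "\<dots> = (\<integral>x. (Z n (\<lambda>t. a t + 1 * (2 * f t y)) x + Z n (\<lambda>t. a t + (-1) * (2 * f t y)) x) / 2 \<partial>sample_space n)"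
      using Z_i[of 1] Z_i[of "-1"] by simp
    also have "\<dots> = (\<integral>x. Z (Suc n) a (x(Suc n := y)) \<partial>sample_space n)"
    proof (rule Bochner_Integration.integral_cong[OF refl])
      fix x assume "x \<in> space (sample_space n)"
      have *: "a t + (\<Sum>i=1..Suc n. (\<epsilon>(Suc n := s)) i * (2 * f t ((x(Suc n := y)) i)))
          = a t + s * (2 * f t y) + (\<Sum>i=1..n. \<epsilon> i * (2 * f t (x i)))" for t \<epsilon> s
      proof -
        have "(\<Sum>i=1..n. (\<epsilon>(Suc n := s)) i * (2 * f t ((x(Suc n := y)) i))) = (\<Sum>i=1..n. \<epsilon> i * (2 * f t (x i)))"
          by (intro sum.cong) auto
        thus ?thesis by simp
      qed
      show "(Z n (\<lambda>t. a t + 1 * (2 * f t y)) x + Z n (\<lambda>t. a t + (-1) * (2 * f t y)) x) / 2 = Z (Suc n) a (x(Suc n := y))"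
        unfolding Z_def sign_mean.simps * ..
    qed
    finally show "(\<integral>x. W (x(Suc n := y)) \<partial>sample_space n) \<le> (\<integral>x. Z (Suc n) a (x(Suc n := y)) \<partial>sample_space n)" .
  qed
  also have "\<dots> = (\<integral>x. Z (Suc n) a x \<partial>sample_space (Suc n))"
    by (rule integral_sample_space_Suc(2)[OF Z_m Z_b[OF Ba], symmetric])
  finally show ?case
    by (simp only: V_def D_def m_def Z_def)
qed

text \<open>McDiarmid's bounded difference inequality, by Hoeffding's lemma in the last coordinate.\<close>

lemma bounded_difference_exp_moment:
  fixes f :: "(nat \<Rightarrow> 'a) \<Rightarrow> real"
  assumes f: "f \<in> borel_measurable (sample_space n)" and B: "\<And>x. x \<in> space (sample_space n) \<Longrightarrow> \<bar>f x\<bar> \<le> B"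
    and diff: "\<And>x i y. x \<in> space (sample_space n) \<Longrightarrow> i \<in> {1..n} \<Longrightarrow> y \<in> space M \<Longrightarrow> f (x(i := y)) \<le> f x + c"
    and l: "l > 0" and c: "c \<ge> 0"
  shows "(\<integral>\<^sup>+x. ennreal (exp (l * (f x - (\<integral>x. f x \<partial>sample_space n)))) \<partial>sample_space n) \<le> ennreal (exp (real n * (l\<^sup>2 * c\<^sup>2 / 8)))"
  using f B diff
proof (induction n arbitrary: f)
  case 0
  interpret s: prob_space "sample_space 0" by (rule prob_space_sample_space)
  have "f x = f (\<lambda>_. undefined)" if "x \<in> space (sample_space 0)" for x
    using that by (simp add: space_PiM_empty)
  hence "(\<integral>x. f x \<partial>sample_space 0) = (\<integral>x. f (\<lambda>_. undefined) \<partial>sample_space 0)"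
    by (rule Bochner_Integration.integral_cong[OF refl])
  hence E: "(\<integral>x. f x \<partial>sample_space 0) = f (\<lambda>_. undefined)"
    using s.prob_space by simp
  have "(\<integral>\<^sup>+x. ennreal (exp (l * (f x - (\<integral>x. f x \<partial>sample_space 0)))) \<partial>sample_space 0) = (\<integral>\<^sup>+x. 1 \<partial>sample_space 0)"
    unfolding E by (intro nn_integral_cong) (simp add: space_PiM_empty)
  thus ?case
    using s.emeasure_space_1 by simp
next
  case (Suc n)
  interpret product_sigma_finite "\<lambda>_. M" by (rule product_sigma_finite_const)
  interpret s: prob_space "sample_space n" by (rule prob_space_sample_space)
  note f = Suc.prems(1) and B = Suc.prems(2) and diff = Suc.prems(3)
  \<comment> \<open>Averaging out the last observation preserves bounded differences with the same
    c, so the induction hypothesis applies to g.\<close>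
  define g where "g x = (\<integral>y. f (x(Suc n := y)) \<partial>M)" for x
  have g_m: "g \<in> borel_measurable (sample_space n)"
    unfolding g_def[abs_def] by (rule integral_sample_space_Suc(3)[OF f B])
  have int: "integrable M (\<lambda>y. f (x(Suc n := y)))" if "x \<in> space (sample_space n)" for x
    by (rule integrable_sample_space_Suc(1)[OF f B that])
  have fb: "\<bar>f (x(Suc n := y))\<bar> \<le> B" if "x \<in> space (sample_space n)" "y \<in> space M" for x y
    using B space_sample_space_upd[OF that] by blast
  have g_B: "\<bar>g x\<bar> \<le> B" if "x \<in> space (sample_space n)" for x
    unfolding g_def using int[OF that] fb[OF that] by (intro abs_expectation_le) auto
  have g_diff: "g (x(i := y)) \<le> g x + c" if x: "x \<in> space (sample_space n)" and i: "i \<in> {1..n}" and y: "y \<in> space M" for x i y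
  proof -
    have x': "x(i := y) \<in> space (sample_space n)"
      using x i y by (auto simp: space_PiM PiE_def extensional_def)
    have "g (x(i := y)) \<le> (\<integral>z. f (x(Suc n := z)) + c \<partial>M)"
      unfolding g_def
    proof (rule integral_mono)
      show "integrable M (\<lambda>z. f ((x(i := y))(Suc n := z)))" "integrable M (\<lambda>z. f (x(Suc n := z)) + c)"
        using int[OF x'] int[OF x] by auto
      fix z assume z: "z \<in> space M"
      have "(x(i := y))(Suc n := z) = (x(Suc n := z))(i := y)"
        using i by (auto simp: fun_eq_iff)
      moreover have "f ((x(Suc n := z))(i := y)) \<le> f (x(Suc n := z)) + c"
        by (rule diff[OF space_sample_space_upd[OF x z] _ y]) (use i in auto)
      ultimately show "f ((x(i := y))(Suc n := z)) \<le> f (x(Suc n := z)) + c"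
        by (simp only:)
    qed
    also have "\<dots> = g x + c"
      using int[OF x] by (simp add: g_def prob_space)
    finally show ?thesis .
  qed
  have Eg: "(\<integral>x. f x \<partial>sample_space (Suc n)) = (\<integral>x. g x \<partial>sample_space n)"
    unfolding g_def by (rule integral_sample_space_Suc(1)[OF f B])
  define E where "E = (\<integral>x. g x \<partial>sample_space n)"
  have inner: "(\<integral>\<^sup>+y. ennreal (exp (l * (f (x(Suc n := y)) - g x))) \<partial>M) \<le> ennreal (exp (l\<^sup>2 * c\<^sup>2 / 8))"
    if x: "x \<in> space (sample_space n)" for x
  proof -
    \<comment> \<open>With the other coordinates fixed, the values lie in the interval from a to a +
      c, so Hoeffding's lemma applies to the last one.\<close>
    define a where "a = (INF y\<in>space M. f (x(Suc n := y)))"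
    have bdd: "bdd_below ((\<lambda>y. f (x(Suc n := y))) ` space M)"
      using fb[OF x] by (intro bdd_belowI2[where m="-B"]) (auto simp: abs_le_iff minus_le_iff)
    have lower: "a \<le> f (x(Suc n := y))" if "y \<in> space M" for y
      unfolding a_def using bdd that by (rule cINF_lower)
    have upper: "f (x(Suc n := y)) \<le> a + c" if y: "y \<in> space M" for y
    proof -
      have "f (x(Suc n := y)) - c \<le> f (x(Suc n := z))" if z: "z \<in> space M" for z
      proof -
        have "f ((x(Suc n := z))(Suc n := y)) \<le> f (x(Suc n := z)) + c"
          by (rule diff[OF space_sample_space_upd[OF x z] _ y]) simp
        thus ?thesis
          by (simp only: fun_upd_upd diff_le_eq)
      qed
      hence "f (x(Suc n := y)) - c \<le> a"
        unfolding a_def by (intro cINF_greatest not_empty)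
      thus ?thesis by simp
    qed
    interpret h: interval_bounded_random_variable M "\<lambda>y. f (x(Suc n := y))" a "a + c"
      using int[OF x] lower upper by unfold_locales auto
    show ?thesis
      using h.Hoeffdings_lemma_nn_integral[OF l] by (simp add: g_def)
  qed
  have meas: "(\<lambda>x. ennreal (exp (l * (f x - E)))) \<in> borel_measurable (sample_space (Suc n))"
    using f by measurable
  have "(\<integral>\<^sup>+x. ennreal (exp (l * (f x - E))) \<partial>sample_space (Suc n))
      = (\<integral>\<^sup>+x. (\<integral>\<^sup>+y. ennreal (exp (l * (f (x(Suc n := y)) - E))) \<partial>M) \<partial>sample_space n)"
    unfolding atLeastAtMost_Suc_insert
  proof (rule product_nn_integral_insert)
    show "(\<lambda>x. ennreal (exp (l * (f x - E)))) \<in> borel_measurable (Pi\<^sub>M (insert (Suc n) {1..n}) (\<lambda>_. M))"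
      unfolding atLeastAtMost_Suc_insert[symmetric] by (rule meas)
  qed auto
  also have "\<dots> \<le> (\<integral>\<^sup>+x. ennreal (exp (l * (g x - E))) * ennreal (exp (l\<^sup>2 * c\<^sup>2 / 8)) \<partial>sample_space n)"
  proof (rule nn_integral_mono)
    fix x assume x: "x \<in> space (sample_space n)"
    have "(\<integral>\<^sup>+y. ennreal (exp (l * (f (x(Suc n := y)) - E))) \<partial>M)
      = (\<integral>\<^sup>+y. ennreal (exp (l * (g x - E))) * ennreal (exp (l * (f (x(Suc n := y)) - g x))) \<partial>M)"
      by (intro nn_integral_cong) (simp add: ennreal_mult'[symmetric] exp_add[symmetric] algebra_simps)
    also have "\<dots> = ennreal (exp (l * (g x - E))) * (\<integral>\<^sup>+y. ennreal (exp (l * (f (x(Suc n := y)) - g x))) \<partial>M)"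
      using int[OF x] by (intro nn_integral_cmult) auto
    also have "\<dots> \<le> ennreal (exp (l * (g x - E))) * ennreal (exp (l\<^sup>2 * c\<^sup>2 / 8))"
      by (intro mult_left_mono inner x) auto
    finally show "(\<integral>\<^sup>+y. ennreal (exp (l * (f (x(Suc n := y)) - E))) \<partial>M) \<le> ennreal (exp (l * (g x - E))) * ennreal (exp (l\<^sup>2 * c\<^sup>2 / 8))" .
  qed
  also have "\<dots> = (\<integral>\<^sup>+x. ennreal (exp (l * (g x - E))) \<partial>sample_space n) * ennreal (exp (l\<^sup>2 * c\<^sup>2 / 8))"
    using g_m by (intro nn_integral_multc) auto
  also have "\<dots> \<le> ennreal (exp (real n * (l\<^sup>2 * c\<^sup>2 / 8))) * ennreal (exp (l\<^sup>2 * c\<^sup>2 / 8))"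
    unfolding E_def by (intro mult_right_mono Suc.IH g_m g_B g_diff) auto
  also have "\<dots> = ennreal (exp (real (Suc n) * (l\<^sup>2 * c\<^sup>2 / 8)))"
    by (simp add: ennreal_mult'[symmetric] exp_add[symmetric] algebra_simps)
  finally show ?case
    unfolding Eg E_def .
qed

lemma bounded_difference_tail:
  fixes f :: "(nat \<Rightarrow> 'a) \<Rightarrow> real"
  assumes f: "f \<in> borel_measurable (sample_space n)" and B: "\<And>x. x \<in> space (sample_space n) \<Longrightarrow> \<bar>f x\<bar> \<le> B"
    and diff: "\<And>x i y. x \<in> space (sample_space n) \<Longrightarrow> i \<in> {1..n} \<Longrightarrow> y \<in> space M \<Longrightarrow> f (x(i := y)) \<le> f x + c"
    and n: "n \<ge> 1" and c: "c > 0" and s: "s > 0"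
  shows "measure (sample_space n) {x \<in> space (sample_space n). f x \<ge> (\<integral>x. f x \<partial>sample_space n) + s} \<le> exp (- (2 * s\<^sup>2 / (real n * c\<^sup>2)))"
proof -
  interpret s: prob_space "sample_space n" by (rule prob_space_sample_space)
  define E where "E = (\<integral>x. f x \<partial>sample_space n)"
  \<comment> \<open>The minimiser of the Chernoff exponent
    \<open>- l * s + real n * (l^2 * c^2 / 8)\<close>.\<close>
  define l where "l = 4 * s / (real n * c\<^sup>2)"
  have l: "l > 0" using n c s by (simp add: l_def)
  have "emeasure (sample_space n) {x \<in> space (sample_space n). f x \<ge> E + s}
     \<le> (\<integral>\<^sup>+x. ennreal (exp (- l * s)) * ennreal (exp (l * (f x - E))) \<partial>sample_space n)"
  proof -
    have "emeasure (sample_space n) {x \<in> space (sample_space n). f x \<ge> E + s} = (\<integral>\<^sup>+x. indicator {x \<in> space (sample_space n). f x \<ge> E + s} x \<partial>sample_space n)"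
      using f by simp
    also have "\<dots> \<le> (\<integral>\<^sup>+x. ennreal (exp (- l * s)) * ennreal (exp (l * (f x - E))) \<partial>sample_space n)"
    proof (rule nn_integral_mono)
      fix x
      have "1 \<le> exp (- l * s) * exp (l * (f x - E))" if "f x \<ge> E + s"
      proof -
        have "l * s \<le> l * (f x - E)" using that l by (intro mult_left_mono) auto
        thus ?thesis by (simp add: exp_add[symmetric])
      qed
      thus "indicator {x \<in> space (sample_space n). f x \<ge> E + s} x \<le> ennreal (exp (- l * s)) * ennreal (exp (l * (f x - E)))"
        by (auto simp: indicator_def ennreal_mult'[symmetric] simp flip: ennreal_1 intro!: ennreal_leI)
    qed
    finally show ?thesis .
  qed
  also have "\<dots> = ennreal (exp (- l * s)) * (\<integral>\<^sup>+x. ennreal (exp (l * (f x - E))) \<partial>sample_space n)"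
    using f by (intro nn_integral_cmult) auto
  also have "\<dots> \<le> ennreal (exp (- l * s)) * ennreal (exp (real n * (l\<^sup>2 * c\<^sup>2 / 8)))"
    unfolding E_def using c by (intro mult_left_mono bounded_difference_exp_moment[OF f B diff l]) auto
  also have "\<dots> = ennreal (exp (- l * s + real n * (l\<^sup>2 * c\<^sup>2 / 8)))"
    by (simp add: ennreal_mult'[symmetric] exp_add[symmetric])
  also have "- l * s + real n * (l\<^sup>2 * c\<^sup>2 / 8) = - (2 * s\<^sup>2 / (real n * c\<^sup>2))"
    using n c by (simp add: l_def power2_eq_square field_simps)
  finally show ?thesis
    unfolding E_def s.emeasure_eq_measure by simp
qed

end

subsection \<open>Covering numbers\<close>

definition rbf :: "real \<Rightarrow> (real^'d) \<times> (real^'d) \<Rightarrow> real" where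
  "rbf \<gamma> = (\<lambda>(x1, x2). exp (- (norm (x1 - x2))\<^sup>2 / \<gamma>\<^sup>2))"

lemma kernel_class_eq: "kernel_class \<Gamma> = rbf ` \<Gamma> \<union> {\<lambda>_. 0}"
  by (simp add: kernel_class_def rbf_def[abs_def])

lemma kernel_class_range: "f \<in> kernel_class \<Gamma> \<Longrightarrow> 0 \<le> f p \<and> f p \<le> 1"
  by (auto simp: kernel_class_eq rbf_def split: prod.splits)

lemma sup_norm_le: "A \<noteq> {} \<Longrightarrow> (\<And>x. x \<in> A \<Longrightarrow> \<bar>f x\<bar> \<le> c) \<Longrightarrow> sup_norm A f \<le> c"
  unfolding sup_norm_def by (rule cSUP_least)

lemma abs_le_sup_norm: "(\<And>x. x \<in> A \<Longrightarrow> \<bar>f x\<bar> \<le> c) \<Longrightarrow> x \<in> A \<Longrightarrow> \<bar>f x\<bar> \<le> sup_norm A f"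
  unfolding sup_norm_def by (rule cSUP_upper) (auto intro!: bdd_aboveI2[where M=c])

text \<open>With z = q / \<gamma>^2, passing to the smaller width \<eta> increases the exponent by z
  (\<gamma>^2 / \<eta>^2 - 1), and z exp(- z) \<le> 1 removes the dependence on the distance of the
  points. The constant is therefore uniform even for unbounded S.\<close>

lemma rbf_Lipschitz:
  assumes u: "0 < u" and \<gamma>: "\<gamma> \<in> {u..v}" and \<eta>: "\<eta> \<in> {u..v}"
  shows "\<bar>rbf \<gamma> p - rbf \<eta> p\<bar> \<le> 2 * v / u\<^sup>2 * \<bar>\<gamma> - \<eta>\<bar>"
proof -
  have main: "\<bar>rbf \<gamma> p - rbf \<eta> p\<bar> \<le> 2 * v / u\<^sup>2 * \<bar>\<gamma> - \<eta>\<bar>"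
    if \<gamma>: "\<gamma> \<in> {u..v}" and \<eta>: "\<eta> \<in> {u..v}" and le: "\<eta> \<le> \<gamma>" for \<gamma> \<eta>
  proof -
    obtain x y where p: "p = (x, y)" by (cases p)
    define q where "q = (norm (x - y))\<^sup>2"
    have q: "q \<ge> 0" by (simp add: q_def)
    have pos: "\<eta> > 0" "\<gamma> > 0" using \<gamma> \<eta> u by auto
    define z where "z = q / \<gamma>\<^sup>2"
    have z: "z \<ge> 0" using q by (simp add: z_def)
    have zq: "q / \<eta>\<^sup>2 = z * (\<gamma>\<^sup>2 / \<eta>\<^sup>2)" using pos by (simp add: z_def)
    have "\<eta>\<^sup>2 \<le> \<gamma>\<^sup>2" using le pos by (intro power_mono) auto
    hence ratio: "1 \<le> \<gamma>\<^sup>2 / \<eta>\<^sup>2" using pos by simp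
    have "z \<le> exp z"
      using exp_ge_add_one_self[of z] by linarith
    hence "z * exp (- z) \<le> exp z * exp (- z)"
      by (rule mult_right_mono) simp
    hence ze: "z * exp (- z) \<le> 1" by (simp add: exp_add[symmetric])
    have "exp (- z) - exp (- (q / \<eta>\<^sup>2)) = exp (- z) * (1 - exp (- (z * (\<gamma>\<^sup>2 / \<eta>\<^sup>2 - 1))))"
      by (simp add: zq algebra_simps exp_add[symmetric])
    also have "\<dots> \<le> exp (- z) * (z * (\<gamma>\<^sup>2 / \<eta>\<^sup>2 - 1))"
      using exp_ge_add_one_self[of "- (z * (\<gamma>\<^sup>2 / \<eta>\<^sup>2 - 1))"] by (intro mult_left_mono) auto
    also have "\<dots> = (z * exp (- z)) * (\<gamma>\<^sup>2 / \<eta>\<^sup>2 - 1)" by (simp add: mult_ac)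
    also have "\<dots> \<le> 1 * (\<gamma>\<^sup>2 / \<eta>\<^sup>2 - 1)"
      using ze ratio by (intro mult_right_mono) auto
    also have "\<dots> = (\<gamma> + \<eta>) * (\<gamma> - \<eta>) / \<eta>\<^sup>2"
      using pos by (simp add: field_simps power2_eq_square)
    also have "\<dots> \<le> (2 * v) * (\<gamma> - \<eta>) / u\<^sup>2"
      using \<gamma> \<eta> le u by (intro frac_le mult_right_mono mult_nonneg_nonneg power_mono) auto
    finally have "exp (- z) - exp (- (q / \<eta>\<^sup>2)) \<le> 2 * v / u\<^sup>2 * (\<gamma> - \<eta>)" by simp
    moreover have "exp (- (q / \<eta>\<^sup>2)) \<le> exp (- z)"
      using ratio z mult_left_mono[of 1 "\<gamma>\<^sup>2 / \<eta>\<^sup>2" z] by (simp add: zq)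
    ultimately show ?thesis
      using le by (simp add: p rbf_def q_def[symmetric] z_def)
  qed
  show ?thesis
  proof (cases "\<eta> \<le> \<gamma>")
    case True
    thus ?thesis using main \<gamma> \<eta> by blast
  next
    case False
    hence "\<bar>rbf \<eta> p - rbf \<gamma> p\<bar> \<le> 2 * v / u\<^sup>2 * \<bar>\<eta> - \<gamma>\<bar>"
      using \<gamma> \<eta> by (intro main) auto
    thus ?thesis by (simp add: abs_minus_commute)
  qed
qed

locale kernel_covering =
  fixes S :: "(real^'d) set" and \<Gamma> :: "real set" and u v :: real
  assumes S: "S \<noteq> {}" and \<Gamma>: "\<Gamma> \<noteq> {}" "\<Gamma> \<subseteq> {u..v}" and u: "0 < u"
begin

abbreviation L where "L \<equiv> (kernel_class \<Gamma> :: ((real^'d) \<times> (real^'d) \<Rightarrow> real) set)"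

definition dist_L :: "((real^'d) \<times> (real^'d) \<Rightarrow> real) \<Rightarrow> _ \<Rightarrow> real" where
  "dist_L f1 f2 = sup_norm (S \<times> S) (f1 - f2)"

definition N :: "real \<Rightarrow> nat" where "N a = covering_number a L dist_L"

definition entropy :: "real \<Rightarrow> real" where "entropy a = ln (2 * real (N a))"

lemma abs_diff_le_1: "f \<in> L \<Longrightarrow> f' \<in> L \<Longrightarrow> \<bar>(f - f') p\<bar> \<le> 1"
  using kernel_class_range[of f \<Gamma> p] kernel_class_range[of f' \<Gamma> p] by auto

lemma dist_L_le_1: "f \<in> L \<Longrightarrow> f' \<in> L \<Longrightarrow> dist_L f f' \<le> 1"
  unfolding dist_L_def using S abs_diff_le_1 by (intro sup_norm_le) auto

lemma abs_diff_le_dist_L: "f \<in> L \<Longrightarrow> f' \<in> L \<Longrightarrow> p \<in> S \<times> S \<Longrightarrow> \<bar>f p - f' p\<bar> \<le> dist_L f f'"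
  unfolding dist_L_def using abs_le_sup_norm[of "S \<times> S" "f - f'" 1 p] abs_diff_le_1 by simp

text \<open>Values lie between 0 and 1, and any \<open>rbf \<gamma>\<close> differs from the zero
  function by 1 on the diagonal. The entropy integral therefore ends at 1/2.\<close>

lemma diameter_L: "(SUP (f1, f2)\<in>L \<times> L. dist_L f1 f2) = 1"
proof (rule antisym)
  have z: "(\<lambda>_. 0) \<in> L" by (simp add: kernel_class_eq)
  show "(SUP (f1, f2)\<in>L \<times> L. dist_L f1 f2) \<le> 1"
    using dist_L_le_1 z by (intro cSUP_least) auto
  obtain \<gamma> x where g: "\<gamma> \<in> \<Gamma>" "x \<in> S" using \<Gamma> S by blast
  have rg: "rbf \<gamma> \<in> L" using g by (simp add: kernel_class_eq)
  have "1 = \<bar>rbf \<gamma> (x, x) - 0\<bar>" by (simp add: rbf_def)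
  also have "\<dots> \<le> dist_L (rbf \<gamma>) (\<lambda>_. 0)"
    using abs_diff_le_dist_L[OF rg z, of "(x, x)"] g by simp
  also have "\<dots> = (\<lambda>(f1, f2). dist_L f1 f2) (rbf \<gamma>, \<lambda>_. 0)" by simp
  also have "\<dots> \<le> (SUP (f1, f2)\<in>L \<times> L. dist_L f1 f2)"
    using rg z dist_L_le_1 by (intro cSUP_upper bdd_aboveI2[where M=1]) auto
  finally show "1 \<le> (SUP (f1, f2)\<in>L \<times> L. dist_L f1 f2)" .
qed

lemma complexity_J_eq: "complexity_J S \<Gamma> = sqrt (162 * (LBINT a:{0..1/2}. entropy a) + 1)"
  unfolding complexity_J_def Let_def dist_L_def[symmetric] entropy_def N_def
  by (subst diameter_L) (simp add: dist_L_def[abs_def])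

text \<open>The widths are divided into cells of length 1 / c, within which kernels differ by at
  most a. The centre of a cell is taken from \<Gamma> itself, since a cover must lie in the class;
  the 2 counts the incomplete cell and the zero function.\<close>

lemma finite_cover:
  assumes a: "a > 0"
  obtains A where "A \<subseteq> L" "finite A" "real (card A) \<le> 2 + (v - u) * (2 * v / u\<^sup>2 / a)" "\<forall>x\<in>L. \<exists>y\<in>A. dist_L x y \<le> a"
proof -
  define c where "c = 2 * v / u\<^sup>2 / a"
  have uv: "u \<le> v" using \<Gamma> by auto
  have c: "c > 0" using a u uv by (simp add: c_def)
  define \<phi> where "\<phi> \<gamma> = nat \<lfloor>(\<gamma> - u) * c\<rfloor>" for \<gamma>
  define rep where "rep k = (SOME \<gamma>. \<gamma> \<in> \<Gamma> \<and> \<phi> \<gamma> = k)" for k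
  have rep: "rep (\<phi> \<gamma>) \<in> \<Gamma> \<and> \<phi> (rep (\<phi> \<gamma>)) = \<phi> \<gamma>" if "\<gamma> \<in> \<Gamma>" for \<gamma>
    unfolding rep_def by (rule someI[of _ \<gamma>]) (use that in simp)
  have le: "\<phi> \<gamma> \<le> nat \<lfloor>(v - u) * c\<rfloor>" if "\<gamma> \<in> \<Gamma>" for \<gamma>
    unfolding \<phi>_def using that \<Gamma> c by (intro nat_mono floor_mono mult_right_mono) auto
  define A :: "((real^'d) \<times> (real^'d) \<Rightarrow> real) set" where "A = (\<lambda>k. rbf (rep k)) ` (\<phi> ` \<Gamma>) \<union> {\<lambda>_. 0 :: real}"
  have sub: "\<phi> ` \<Gamma> \<subseteq> {.. nat \<lfloor>(v - u) * c\<rfloor>}" using le by auto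
  hence fin: "finite (\<phi> ` \<Gamma>)" by (rule finite_subset) simp
  have "card A \<le> card (\<phi> ` \<Gamma>) + 1"
    unfolding A_def using fin by (intro order_trans[OF card_Un_le] add_mono card_image_le) auto
  also have "card (\<phi> ` \<Gamma>) \<le> card {.. nat \<lfloor>(v - u) * c\<rfloor>}"
    using sub by (intro card_mono) auto
  finally have "card A \<le> nat \<lfloor>(v - u) * c\<rfloor> + 2" by simp
  moreover have "real (nat \<lfloor>(v - u) * c\<rfloor>) \<le> (v - u) * c"
    using uv c by simp
  ultimately have card: "real (card A) \<le> 2 + (v - u) * c" by linarith
  have "dist_L (rbf \<gamma>) (rbf (rep (\<phi> \<gamma>))) \<le> a" if g: "\<gamma> \<in> \<Gamma>" for \<gamma>
    unfolding dist_L_def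
  proof (rule sup_norm_le)
    fix p :: "(real^'d) \<times> (real^'d)"
    define \<eta> where "\<eta> = rep (\<phi> \<gamma>)"
    have \<eta>: "\<eta> \<in> \<Gamma>" "\<phi> \<eta> = \<phi> \<gamma>" using rep[OF g] by (auto simp: \<eta>_def)
    have nn: "0 \<le> (\<gamma> - u) * c" "0 \<le> (\<eta> - u) * c" using g \<eta> \<Gamma> c by auto
    have "\<lfloor>(\<gamma> - u) * c\<rfloor> = \<lfloor>(\<eta> - u) * c\<rfloor>"
      using \<eta>(2) nn by (simp add: \<phi>_def eq_nat_nat_iff)
    hence "\<bar>(\<gamma> - u) * c - (\<eta> - u) * c\<bar> \<le> 1" by linarith
    hence "\<bar>(\<gamma> - \<eta>) * c\<bar> \<le> 1" by (simp add: algebra_simps)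
    hence ge: "c * \<bar>\<gamma> - \<eta>\<bar> \<le> 1" using c by (simp add: abs_mult mult.commute)
    have "\<bar>rbf \<gamma> p - rbf \<eta> p\<bar> \<le> 2 * v / u\<^sup>2 * \<bar>\<gamma> - \<eta>\<bar>"
      using g \<eta> \<Gamma> u by (intro rbf_Lipschitz) auto
    also have "\<dots> = a * (c * \<bar>\<gamma> - \<eta>\<bar>)" using a by (simp add: c_def)
    also have "\<dots> \<le> a * 1" using a ge by (intro mult_left_mono) auto
    finally show "\<bar>(rbf \<gamma> - rbf (rep (\<phi> \<gamma>))) p\<bar> \<le> a" by (simp add: \<eta>_def)
  qed (use S in auto)
  moreover have "dist_L (\<lambda>_. 0) (\<lambda>_. 0) \<le> a"
    unfolding dist_L_def using S a by (intro sup_norm_le) auto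
  moreover have "rbf (rep (\<phi> \<gamma>)) \<in> A" if "\<gamma> \<in> \<Gamma>" for \<gamma>
    using that by (simp add: A_def)
  moreover have "(\<lambda>_. 0) \<in> A" by (simp add: A_def)
  ultimately have cov: "\<forall>x\<in>L. \<exists>y\<in>A. dist_L x y \<le> a"
    unfolding kernel_class_eq by blast
  have "A \<subseteq> L" unfolding A_def kernel_class_eq using rep by auto
  moreover have "finite A" using fin by (simp add: A_def)
  ultimately show thesis using that card cov unfolding c_def by blast
qed

text \<open>The \<open>LEAST\<close> in the covering number is attained, because a finite cover
  exists.\<close>

lemma minimal_cover:
  assumes "a > 0"
  obtains A where "A \<subseteq> L" "finite A" "card A = N a" "\<forall>x\<in>L. \<exists>y\<in>A. dist_L x y \<le> a"
proof -
  obtain A where A: "A \<subseteq> L" "finite A" "real (card A) \<le> 2 + (v - u) * (2 * v / u\<^sup>2 / a)" "\<forall>x\<in>L. \<exists>y\<in>A. dist_L x y \<le> a"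
    by (rule finite_cover[OF assms])
  define P where "P m \<longleftrightarrow> (\<exists>A\<subseteq>L. finite A \<and> card A = m \<and> (\<forall>x\<in>L. \<exists>y\<in>A. dist_L x y \<le> a))" for m
  have "P (card A)"
    unfolding P_def by (intro exI[of _ A] conjI A refl)
  hence "P (N a)"
    unfolding N_def covering_number_def P_def[symmetric] by (rule LeastI)
  then obtain A' where "A' \<subseteq> L" "finite A'" "card A' = N a" "\<forall>x\<in>L. \<exists>y\<in>A'. dist_L x y \<le> a"
    unfolding P_def by (elim exE conjE)
  thus thesis by (rule that)
qed

lemma N_le:
  assumes A: "A \<subseteq> L" "finite A" "\<forall>x\<in>L. \<exists>y\<in>A. dist_L x y \<le> a"
  shows "N a \<le> card A"
proof -
  define P where "P m \<longleftrightarrow> (\<exists>A\<subseteq>L. finite A \<and> card A = m \<and> (\<forall>x\<in>L. \<exists>y\<in>A. dist_L x y \<le> a))" for m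
  have "P (card A)"
    unfolding P_def by (intro exI[of _ A] conjI A refl)
  thus ?thesis
    unfolding N_def covering_number_def P_def[symmetric] by (rule Least_le)
qed

lemma N_antimono: 
  assumes "0 < a" "a \<le> b"
  shows "N b \<le> N a"
proof -
  obtain A where A: "A \<subseteq> L" "finite A" "card A = N a" "\<forall>x\<in>L. \<exists>y\<in>A. dist_L x y \<le> a"
    by (rule minimal_cover[OF assms(1)])
  have "\<forall>x\<in>L. \<exists>y\<in>A. dist_L x y \<le> b"
    using A(4) assms(2) order_trans by blast
  thus ?thesis
    using N_le[OF A(1,2)] A(3) by simp
qed

lemma N_pos: 
  assumes "0 < a"
  shows "N a \<ge> 1"
proof -
  obtain A where A: "A \<subseteq> L" "finite A" "card A = N a" "\<forall>x\<in>L. \<exists>y\<in>A. dist_L x y \<le> a"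
    by (rule minimal_cover[OF assms])
  have "(\<lambda>_. 0) \<in> L" by (simp add: kernel_class_eq)
  then obtain y where "y \<in> A" using A(4) by blast
  hence "card A > 0" using A(2) by (auto simp: card_gt_0_iff)
  thus ?thesis using A(3) by simp
qed

lemma N_bound: 
  assumes "0 < a"
  shows "real (N a) \<le> 2 + (v - u) * (2 * v / u\<^sup>2 / a)"
proof -
  obtain A where A: "A \<subseteq> L" "finite A" "real (card A) \<le> 2 + (v - u) * (2 * v / u\<^sup>2 / a)" "\<forall>x\<in>L. \<exists>y\<in>A. dist_L x y \<le> a"
    by (rule finite_cover[OF assms])
  have "real (N a) \<le> real (card A)"
    using N_le[OF A(1,2,4)] by simp
  thus ?thesis using A(3) by linarith
qed

lemma entropy_nonneg: "entropy a \<ge> 0"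
  by (cases "N a = 0") (auto simp: entropy_def)

lemma entropy_antimono: "0 < a \<Longrightarrow> a \<le> b \<Longrightarrow> entropy b \<le> entropy a"
  using N_antimono[of a b] N_pos[of b] by (simp add: entropy_def)

text \<open>Covering numbers grow at most like 1 / a, and ln y \<le> 2 sqrt y then bounds the
  entropy by a multiple of a^(- 1/2), which is integrable at 0. Measurability comes from
  monotonicity.\<close>

lemma entropy_integrable: "set_integrable lborel {0..1/2} entropy"
proof -
  define c where "c = (v - u) * (2 * v / u\<^sup>2)"
  have c: "c \<ge> 0" using \<Gamma> u by (auto simp: c_def)
  define k where "k = 2 * sqrt (4 + 2 * c)"
  have bd: "entropy a \<le> k * a powr (- 1 / 2)" if a: "0 < a" "a \<le> 1/2" for a
  proof -
    have "real (N a) \<le> 2 + c / a"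
      using N_bound[OF a(1)] by (simp add: c_def)
    also have "\<dots> \<le> 2 / a + c / a"
      using a by (simp add: pos_le_divide_eq)
    finally have "real (N a) \<le> (2 + c) / a"
      by (simp only: add_divide_distrib)
    hence "2 * real (N a) \<le> 2 * ((2 + c) / a)" by (rule mult_left_mono) simp
    hence Na: "2 * real (N a) \<le> (4 + 2 * c) / a" by simp
    have pos: "2 * real (N a) > 0" using N_pos[OF a(1)] by simp
    have "entropy a = 2 * ln (sqrt (2 * real (N a)))"
      using pos by (simp add: entropy_def ln_sqrt del: of_nat_mult)
    also have "\<dots> \<le> 2 * sqrt (2 * real (N a))"
      using pos ln_le_minus_one[of "sqrt (2 * real (N a))"] by simp
    also have "\<dots> \<le> 2 * sqrt ((4 + 2 * c) / a)"
      using Na by (intro mult_left_mono real_sqrt_le_mono) auto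
    also have "\<dots> = k * (1 / sqrt a)"
      by (simp add: k_def real_sqrt_divide)
    also have "1 / sqrt a = a powr (- 1 / 2)"
      using a powr_minus_divide[of a "1 / 2"] powr_half_sqrt[of a] by simp
    finally show ?thesis .
  qed
  have "(\<lambda>x. x powr (- 1 / 2)) integrable_on {0..1/2 :: real}"
    by (rule integrable_on_powr_from_0) auto
  hence "(\<lambda>x. x powr (- 1 / 2)) absolutely_integrable_on {0..1/2 :: real}"
    by (rule nonnegative_absolutely_integrable_1) auto
  moreover have "(\<lambda>x :: real. indicator {0..1/2} x *\<^sub>R x powr (- 1 / 2)) \<in> borel_measurable lborel"
    by measurable
  ultimately have i: "set_integrable lborel {0..1/2} (\<lambda>x :: real. x powr (- 1 / 2))"
    unfolding set_integrable_def by (simp only: integrable_completion)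
  have "set_integrable lborel {0<..1/2} entropy"
    unfolding set_integrable_def
  proof (rule Bochner_Integration.integrable_bound)
    show "integrable lborel (\<lambda>x. k * (indicator {0..1/2} x *\<^sub>R x powr (- 1 / 2)))"
      using i unfolding set_integrable_def by (rule integrable_mult_right)
    have "(\<lambda>x. - entropy x) \<in> borel_measurable (restrict_space borel {0<..1/2})"
    proof (rule borel_measurable_mono_on_fnc)
      show "mono_on {0<..1/2} (\<lambda>x. - entropy x)"
        by (rule mono_onI) (simp add: entropy_antimono)
    qed
    hence "(\<lambda>x. indicator {0<..1/2} x *\<^sub>R - entropy x) \<in> borel_measurable borel"
      using borel_measurable_restrict_space_iff[of "{0<..1/2}" borel "\<lambda>x. - entropy x"] by simp
    hence "(\<lambda>x. - (indicator {0<..1/2} x *\<^sub>R - entropy x)) \<in> borel_measurable borel"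
      by (rule borel_measurable_uminus)
    thus "(\<lambda>x. indicator {0<..1/2} x *\<^sub>R entropy x) \<in> borel_measurable lborel"
      by simp
    show "AE x in lborel. norm (indicator {0<..1/2} x *\<^sub>R entropy x) \<le> norm (k * (indicator {0..1/2} x *\<^sub>R x powr (- 1 / 2)))"
    proof (rule AE_I2)
      fix x :: real
      have "k \<ge> 0" using c by (simp add: k_def)
      thus "norm (indicator {0<..1/2} x *\<^sub>R entropy x) \<le> norm (k * (indicator {0..1/2} x *\<^sub>R x powr (- 1 / 2)))"
        using bd[of x] entropy_nonneg[of x] by (auto simp: indicator_def abs_mult)
    qed
  qed
  moreover have "integrable lborel (\<lambda>x :: real. indicator {0} x *\<^sub>R entropy 0)"
    by (intro integrable_scaleR_left integrable_real_indicator) auto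
  ultimately have "integrable lborel (\<lambda>x. indicator {0<..1/2} x *\<^sub>R entropy x + indicator {0} x *\<^sub>R entropy 0)"
    unfolding set_integrable_def by (rule Bochner_Integration.integrable_add)
  also have "(\<lambda>x. indicator {0<..1/2} x *\<^sub>R entropy x + indicator {0} x *\<^sub>R entropy 0) = (\<lambda>x. indicator {0..1/2} x *\<^sub>R entropy x)"
    by (auto simp: fun_eq_iff indicator_def)
  finally show ?thesis
    unfolding set_integrable_def .
qed

text \<open>On the dyadic interval from 2^-(k+2) to 2^-(k+1) the decreasing entropy is at least its
  value at the right end, and 2^-k is four times the length of that interval.\<close>

lemma dyadic_entropy_sum: "(\<Sum>k<m. 1 / 2 ^ k * entropy (1 / 2 ^ Suc k)) \<le> 4 * (LBINT a:{0..1/2}. entropy a)"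
proof -
  have sub: "set_integrable lborel A entropy" if "A \<subseteq> {0..1/2}" "A \<in> sets borel" for A
    using entropy_integrable by (rule set_integrable_subset) (use that in auto)
  have "(\<Sum>k<m. 1 / 2 ^ (k + 2) * entropy (1 / 2 ^ Suc k)) \<le> (LBINT a:{1 / 2 ^ Suc m<..1/2}. entropy a)"
  proof (induction m)
    case 0
    show ?case by (simp add: set_lebesgue_integral_def)
  next
    case (Suc m)
    let ?A = "{1 / 2 ^ Suc (Suc m)<..1 / 2 ^ Suc m} :: real set" and ?B = "{1 / 2 ^ Suc m<..1/2} :: real set"
    have le: "1 / 2 ^ Suc (Suc m) \<le> (1 / 2 ^ Suc m :: real)" "1 / 2 ^ Suc m \<le> (1 / 2 :: real)"
      by (auto simp: field_simps)
    have "{p<..r} = {p<..q} \<union> {q<..r}" if "p \<le> q" "q \<le> r" for p q r :: real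
      using that by auto
    from this[OF le] have U: "{1 / 2 ^ Suc (Suc m)<..1/2} = ?A \<union> ?B" .
    have pos: "0 < (1 / 2 ^ Suc (Suc m) :: real)" by simp
    have iA: "set_integrable lborel ?A entropy" 
    proof (rule sub)
      show "?A \<subseteq> {0..1/2}"
      proof
        fix x assume "x \<in> ?A"
        hence x: "1 / 2 ^ Suc (Suc m) < x" "x \<le> 1 / 2 ^ Suc m" by auto
        from order_trans[OF x(2) le(2)] less_trans[OF pos x(1)] show "x \<in> {0..1/2}" by simp
      qed
    qed auto
    have iB: "set_integrable lborel ?B entropy"
    proof (rule sub)
      show "?B \<subseteq> {0..1/2}"
      proof
        fix x assume x: "x \<in> ?B"
        have "0 < (1 / 2 ^ Suc m :: real)" by simp
        also have "\<dots> < x" using x by simp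
        finally show "x \<in> {0..1/2}" using x by simp
      qed
    qed auto
    have "1 / 2 ^ (m + 2) * entropy (1 / 2 ^ Suc m) = (LBINT a:?A. entropy (1 / 2 ^ Suc m))"
      using le(1) by (simp add: set_integral_const field_simps)
    also have "\<dots> \<le> (LBINT a:?A. entropy a)"
    proof (rule set_integral_mono)
      show "set_integrable lborel ?A (\<lambda>_. entropy (1 / 2 ^ Suc m))"
        using le(1) by (auto simp: set_integrable_def)
      fix x assume "x \<in> ?A"
      thus "entropy (1 / 2 ^ Suc m) \<le> entropy x"
        using pos by (intro entropy_antimono) (auto intro: less_trans)
    qed fact
    finally have "(\<Sum>k<Suc m. 1 / 2 ^ (k + 2) * entropy (1 / 2 ^ Suc k)) \<le> (LBINT a:?B. entropy a) + (LBINT a:?A. entropy a)"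
      using Suc by simp
    also have "\<dots> = (LBINT a:?A \<union> ?B. entropy a)"
      using iA iB by (subst set_integral_Un) auto
    finally show ?case unfolding U .
  qed
  also have "\<dots> \<le> (LBINT a:{0..1/2}. entropy a)"
    unfolding set_lebesgue_integral_def
  proof (rule integral_mono)
    have s: "{1 / 2 ^ Suc m<..1/2} \<subseteq> {0..1/2 :: real}"
    proof
      fix x :: real assume x: "x \<in> {1 / 2 ^ Suc m<..1/2}"
      have "0 < (1 / 2 ^ Suc m :: real)" by simp
      also have "\<dots> < x" using x by simp
      finally show "x \<in> {0..1/2}" using x by simp
    qed
    show "integrable lborel (\<lambda>x. indicator {1 / 2 ^ Suc m<..1/2} x *\<^sub>R entropy x)"
      using sub[OF s] by (simp add: set_integrable_def)
    show "integrable lborel (\<lambda>x. indicator {0..1/2} x *\<^sub>R entropy x)"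
      using entropy_integrable by (simp add: set_integrable_def)
    show "indicator {1 / 2 ^ Suc m<..1/2} x *\<^sub>R entropy x \<le> indicator {0..1/2} x *\<^sub>R entropy x" for x
    proof (rule scaleR_right_mono[OF _ entropy_nonneg])
      show "indicator {1 / 2 ^ Suc m<..1/2} x \<le> (indicator {0..1/2} x :: real)"
        using s by (meson indicator_leI subsetD)
    qed
  qed
  finally have *: "(\<Sum>k<m. 1 / 2 ^ (k + 2) * entropy (1 / 2 ^ Suc k)) \<le> (LBINT a:{0..1/2}. entropy a)" .
  have "(\<Sum>k<m. 1 / 2 ^ k * entropy (1 / 2 ^ Suc k)) = 4 * (\<Sum>k<m. 1 / 2 ^ (k + 2) * entropy (1 / 2 ^ Suc k))"
    unfolding sum_distrib_left by (intro sum.cong) (auto simp: power_add)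
  thus ?thesis using * by simp
qed

end

section \<open>Sign chaos of the kernel class and its entropy bound\<close>

text \<open>The off-diagonal part of the quadratic form of f at the sample. It is summed over i < j
  with a factor 2, the triangular shape for which \<open>sign_mean_exp_chaos\<close> is
  stated.\<close>

definition chaos :: "nat \<Rightarrow> (nat \<Rightarrow> 'a) \<Rightarrow> ('a \<times> 'a \<Rightarrow> real) \<Rightarrow> (nat \<Rightarrow> real) \<Rightarrow> real" where
  "chaos n x f \<epsilon> = (\<Sum>j=1..n. \<epsilon> j * (\<Sum>i=1..<j. 2 * f (x i, x j) * \<epsilon> i))"

lemma chaos_diff: "chaos n x f \<epsilon> - chaos n x f' \<epsilon> = chaos n x (f - f') \<epsilon>"
  by (simp add: chaos_def sum_subtractf algebra_simps)

lemma quadratic_form_eq_chaos: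
  assumes sym: "\<And>i j. f (x i, x j) = f (x j, x i)"
  shows "(\<Sum>i=1..n. \<Sum>j=1..n. \<epsilon> i * \<epsilon> j * f (x i, x j)) = (\<Sum>i=1..n. (\<epsilon> i)\<^sup>2 * f (x i, x i)) + chaos n x f \<epsilon>"
proof (induction n)
  case (Suc n)
  have "(\<Sum>i=1..Suc n. \<Sum>j=1..Suc n. \<epsilon> i * \<epsilon> j * f (x i, x j))
      = (\<Sum>i=1..n. \<Sum>j=1..n. \<epsilon> i * \<epsilon> j * f (x i, x j)) + (\<Sum>i=1..n. \<epsilon> i * \<epsilon> (Suc n) * f (x i, x (Suc n)))
        + ((\<Sum>j=1..n. \<epsilon> (Suc n) * \<epsilon> j * f (x (Suc n), x j)) + (\<epsilon> (Suc n))\<^sup>2 * f (x (Suc n), x (Suc n)))"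
    by (simp add: sum.distrib power2_eq_square)
  also have "(\<Sum>j=1..n. \<epsilon> (Suc n) * \<epsilon> j * f (x (Suc n), x j)) = (\<Sum>i=1..n. \<epsilon> i * \<epsilon> (Suc n) * f (x i, x (Suc n)))"
    by (intro sum.cong refl) (simp add: sym[of "Suc n"] mult.commute)
  also have "(\<Sum>i=1..n. \<epsilon> i * \<epsilon> (Suc n) * f (x i, x (Suc n))) = \<epsilon> (Suc n) * (\<Sum>i=1..n. f (x i, x (Suc n)) * \<epsilon> i)"
    by (simp add: sum_distrib_left mult_ac)
  finally have "(\<Sum>i=1..Suc n. \<Sum>j=1..Suc n. \<epsilon> i * \<epsilon> j * f (x i, x j))
      = (\<Sum>i=1..n. \<Sum>j=1..n. \<epsilon> i * \<epsilon> j * f (x i, x j)) + 2 * (\<epsilon> (Suc n) * (\<Sum>i=1..n. f (x i, x (Suc n)) * \<epsilon> i))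
        + (\<epsilon> (Suc n))\<^sup>2 * f (x (Suc n), x (Suc n))"
    by linarith
  moreover have "chaos (Suc n) x f \<epsilon> = chaos n x f \<epsilon> + 2 * (\<epsilon> (Suc n) * (\<Sum>i=1..n. f (x i, x (Suc n)) * \<epsilon> i))"
    by (simp add: chaos_def atLeastLessThanSuc_atLeastAtMost sum_distrib_left mult_ac)
  ultimately show ?case
    unfolding Suc by simp
qed (simp add: chaos_def)

context kernel_covering
begin

lemma zero_mem_L: "(\<lambda>_. 0) \<in> L"
  by (simp add: kernel_class_eq)

lemma chaos_increment:
  assumes x: "\<And>i. i \<in> {1..n} \<Longrightarrow> x i \<in> S" and f: "f \<in> L" "f' \<in> L" and d: "dist_L f f' \<le> \<delta>"
    and l: "\<bar>l\<bar> * real n * (2 * \<delta>) \<le> 1 / 4"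
  shows "sign_mean n (\<lambda>\<epsilon>. exp (l * (chaos n x f \<epsilon> - chaos n x f' \<epsilon>))) \<le> 2"
  unfolding chaos_diff unfolding chaos_def
proof (rule sign_mean_exp_chaos[OF _ l])
  fix i j assume "i \<in> {1..n}" "j \<in> {1..n}"
  hence "\<bar>f (x i, x j) - f' (x i, x j)\<bar> \<le> dist_L f f'"
    using x by (intro abs_diff_le_dist_L f) auto
  thus "\<bar>2 * (f - f') (x i, x j)\<bar> \<le> 2 * \<delta>"
    using d by (simp add: abs_mult)
qed

text \<open>A crude bound of order n^2; it is used only where \<delta> tends to 0 with n fixed, to
  pass from the nets to arbitrary members of the class.\<close>

lemma abs_chaos_diff_le:
  assumes x: "\<And>i. i \<in> {1..n} \<Longrightarrow> x i \<in> S" and f: "f \<in> L" "f' \<in> L" and d: "dist_L f f' \<le> \<delta>"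
    and e: "\<epsilon> \<in> sign_vectors n"
  shows "chaos n x f \<epsilon> - chaos n x f' \<epsilon> \<le> real n * (real n * (2 * \<delta>))"
  unfolding chaos_diff unfolding chaos_def
proof -
  have ab: "\<bar>\<epsilon> i\<bar> = 1" if "i \<in> {1..n}" for i
  proof -
    have "\<epsilon> i = 1 \<or> \<epsilon> i = -1"
      using e that unfolding sign_vectors_def by blast
    thus ?thesis by auto
  qed
  have dd: "\<bar>2 * (f - f') (x i, x j) * \<epsilon> i\<bar> \<le> 2 * \<delta>" if "i \<in> {1..n}" "j \<in> {1..n}" for i j
  proof -
    have "\<bar>f (x i, x j) - f' (x i, x j)\<bar> \<le> dist_L f f'"
      using x that by (intro abs_diff_le_dist_L f) auto
    thus ?thesis using d ab[OF that(1)] by (simp add: abs_mult)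
  qed
  have "(\<Sum>j=1..n. \<epsilon> j * (\<Sum>i=1..<j. 2 * (f - f') (x i, x j) * \<epsilon> i)) \<le> (\<Sum>j=1..n. real n * (2 * \<delta>))"
  proof (rule sum_mono)
    fix j assume j: "j \<in> {1..n}"
    have "0 \<le> \<bar>2 * (f - f') (x j, x j) * \<epsilon> j\<bar>" by simp
    also have "\<dots> \<le> 2 * \<delta>" by (rule dd[OF j j])
    finally have d0: "0 \<le> 2 * \<delta>" .
    have "\<epsilon> j * (\<Sum>i=1..<j. 2 * (f - f') (x i, x j) * \<epsilon> i) \<le> \<bar>\<epsilon> j\<bar> * \<bar>\<Sum>i=1..<j. 2 * (f - f') (x i, x j) * \<epsilon> i\<bar>"
      unfolding abs_mult[symmetric] by (rule abs_ge_self)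
    also have "\<dots> = \<bar>\<Sum>i=1..<j. 2 * (f - f') (x i, x j) * \<epsilon> i\<bar>"
      using ab[OF j] by simp
    also have "\<dots> \<le> (\<Sum>i=1..<j. 2 * \<delta>)"
    proof (rule order_trans[OF sum_abs], rule sum_mono)
      fix i assume "i \<in> {1..<j}"
      thus "\<bar>2 * (f - f') (x i, x j) * \<epsilon> i\<bar> \<le> 2 * \<delta>"
        using j by (intro dd) auto
    qed
    also have "\<dots> = real (j - 1) * (2 * \<delta>)" by simp
    also have "\<dots> \<le> real n * (2 * \<delta>)"
      using j d0 by (intro mult_right_mono) auto
    finally show "\<epsilon> j * (\<Sum>i=1..<j. 2 * (f - f') (x i, x j) * \<epsilon> i) \<le> real n * (2 * \<delta>)" .
  qed
  thus "(\<Sum>j=1..n. \<epsilon> j * (\<Sum>i=1..<j. 2 * (f - f') (x i, x j) * \<epsilon> i)) \<le> real n * (real n * (2 * \<delta>))"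
    by simp
qed

text \<open>Chaining along minimal covers at dyadic radii. The link scale 8 n and the factor 4 from
  comparing the dyadic sum with the integral multiply to 32 n.\<close>

lemma chaos_entropy_bound:
  assumes x: "\<And>i. i \<in> {1..n} \<Longrightarrow> x i \<in> S" and n: "n \<ge> 1" and G: "finite G" "G \<noteq> {}" "G \<subseteq> L"
  shows "sign_mean n (\<lambda>\<epsilon>. maximum G (\<lambda>f. chaos n x f \<epsilon>)) \<le> 32 * real n * (LBINT a:{0..1/2}. entropy a)"
proof -
  define I where "I = (LBINT a:{0..1/2}. entropy a)"
  have "\<exists>A. A \<subseteq> L \<and> finite A \<and> card A = N (1 / 2 ^ Suc k) \<and> (\<forall>f\<in>L. \<exists>h\<in>A. dist_L f h \<le> 1 / 2 ^ Suc k)" for k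
  proof -
    have "0 < (1 / 2 ^ Suc k :: real)" by simp
    then obtain A where "A \<subseteq> L" "finite A" "card A = N (1 / 2 ^ Suc k)" "\<forall>f\<in>L. \<exists>h\<in>A. dist_L f h \<le> 1 / 2 ^ Suc k"
      by (rule minimal_cover)
    thus ?thesis by (intro exI[of _ A] conjI)
  qed
  then obtain B where B: "\<And>k. B k \<subseteq> L" "\<And>k. finite (B k)" "\<And>k. card (B k) = N (1 / 2 ^ Suc k)"
    "\<And>k. \<forall>f\<in>L. \<exists>h\<in>B k. dist_L f h \<le> 1 / 2 ^ Suc k"
    by metis
  \<comment> \<open>Level 0 is the zero function alone: the class has diameter 1, so it covers at
    radius 2^0, and its chaos vanishes.\<close>
  define A where "A k = (case k of 0 \<Rightarrow> {\<lambda>_. 0} | Suc k \<Rightarrow> B k)" for k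
  have A_simps: "A 0 = {\<lambda>_. 0}" "A (Suc k) = B k" for k by (auto simp: A_def)
  have A_L: "A k \<subseteq> L" for k using B(1) zero_mem_L by (cases k) (auto simp: A_simps)
  have A_fin: "finite (A k)" for k using B(2) by (cases k) (auto simp: A_simps)
  have A_cov: "\<exists>h\<in>A k. dist_L f h \<le> 1 / 2 ^ k" if "f \<in> L" for f k
    using bspec[OF B(4) that] dist_L_le_1[OF that zero_mem_L] by (cases k) (auto simp: A_simps)
  have A_ne: "A k \<noteq> {}" for k using A_cov[OF zero_mem_L, of k] by auto
  define p where "p k f = (SOME h. h \<in> A k \<and> dist_L f h \<le> 1 / 2 ^ k)" for k f
  have p: "p k f \<in> A k \<and> dist_L f (p k f) \<le> 1 / 2 ^ k" if "f \<in> L" for k f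
  proof -
    have "\<exists>h. h \<in> A k \<and> dist_L f h \<le> 1 / 2 ^ k"
      using A_cov[OF that] by blast
    thus ?thesis
      unfolding p_def by (rule someI_ex)
  qed
  have finite_level: "sign_mean n (\<lambda>\<epsilon>. maximum (A m) (\<lambda>f. chaos n x f \<epsilon>)) \<le> 32 * real n * I" for m
  proof -
    have "sign_mean n (\<lambda>\<epsilon>. maximum (A m) (\<lambda>f. chaos n x f \<epsilon>))
        \<le> (\<Sum>k<m. 8 * real n / 2 ^ k * ln (2 * real (card (A (Suc k)))))"
    proof (rule sign_mean_chaining[where z="\<lambda>_. 0" and p=p])
      fix k q assume q: "q \<in> A (Suc k)"
      hence qL: "q \<in> L" using A_L by blast
      show "p k q \<in> A k" using p[OF qL] by blast
      show "sign_mean n (\<lambda>\<epsilon>. exp (2 ^ k / (8 * real n) * (chaos n x q \<epsilon> - chaos n x (p k q) \<epsilon>))) \<le> 2"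
      proof (rule chaos_increment[OF x qL])
        show "p k q \<in> L" using p[OF qL] A_L by blast
        show "dist_L q (p k q) \<le> 1 / 2 ^ k" using p[OF qL] by blast
        \<comment> \<open>The scale 8 n makes the left side exactly 1/4, the limit allowed by
          \<open>chaos_increment\<close>.\<close>
        show "\<bar>2 ^ k / (8 * real n)\<bar> * real n * (2 * (1 / 2 ^ k)) \<le> 1 / 4"
          using n by simp
      qed
    qed (use A_fin A_ne n in \<open>auto simp: A_simps chaos_def\<close>)
    also have "\<dots> = 8 * real n * (\<Sum>k<m. 1 / 2 ^ k * entropy (1 / 2 ^ Suc k))"
      by (simp add: A_simps B(3) entropy_def sum_distrib_left)
    also have "\<dots> \<le> 8 * real n * (4 * I)"
      unfolding I_def by (intro mult_left_mono dyadic_entropy_sum) auto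
    finally show ?thesis by simp
  qed
  \<comment> \<open>Members of G are replaced by their level-m neighbours; the error vanishes as m
    grows.\<close>
  have "sign_mean n (\<lambda>\<epsilon>. maximum G (\<lambda>f. chaos n x f \<epsilon>)) \<le> 32 * real n * I + real n * (real n * 2) * (1 / 2) ^ m" for m
  proof -
    have "sign_mean n (\<lambda>\<epsilon>. maximum G (\<lambda>f. chaos n x f \<epsilon>))
        \<le> sign_mean n (\<lambda>\<epsilon>. maximum (A m) (\<lambda>f. chaos n x f \<epsilon>) + real n * (real n * (2 * (1 / 2 ^ m))))"
    proof (rule sign_mean_mono_on)
      fix \<epsilon> assume e: "\<epsilon> \<in> sign_vectors n"
      obtain f where f: "f \<in> G" "maximum G (\<lambda>f. chaos n x f \<epsilon>) = chaos n x f \<epsilon>"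
        using G(1,2) by (rule maximum_attained)
      have fL: "f \<in> L" using f G by blast
      have pL: "p m f \<in> L" using p[OF fL] A_L by blast
      have "chaos n x f \<epsilon> - chaos n x (p m f) \<epsilon> \<le> real n * (real n * (2 * (1 / 2 ^ m)))"
        using p[OF fL] by (intro abs_chaos_diff_le x fL pL e) auto
      moreover have "chaos n x (p m f) \<epsilon> \<le> maximum (A m) (\<lambda>f. chaos n x f \<epsilon>)"
        using p[OF fL] by (intro maximum_ge A_fin) auto
      ultimately show "maximum G (\<lambda>f. chaos n x f \<epsilon>) \<le> maximum (A m) (\<lambda>f. chaos n x f \<epsilon>) + real n * (real n * (2 * (1 / 2 ^ m)))"
        unfolding f(2) by linarith
    qed
    also have "\<dots> = sign_mean n (\<lambda>\<epsilon>. maximum (A m) (\<lambda>f. chaos n x f \<epsilon>)) + real n * (real n * (2 * (1 / 2 ^ m)))"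
      by (simp only: sign_mean_add sign_mean_const)
    finally show ?thesis
      using finite_level[of m] by (simp add: power_one_over)
  qed
  moreover have "(\<lambda>m. 32 * real n * I + real n * (real n * 2) * (1 / 2) ^ m) \<longlonglongrightarrow> 32 * real n * I + real n * (real n * 2) * 0"
    by (intro tendsto_intros LIMSEQ_realpow_zero) auto
  ultimately have "sign_mean n (\<lambda>\<epsilon>. maximum G (\<lambda>f. chaos n x f \<epsilon>)) \<le> 32 * real n * I + real n * (real n * 2) * 0"
    by (intro LIMSEQ_le_const) auto
  thus ?thesis by (simp add: I_def)
qed

lemma entropy_integral_nonneg: "0 \<le> (LBINT a:{0..1/2}. entropy a)"
  unfolding set_lebesgue_integral_def by (intro Bochner_Integration.integral_nonneg) (simp add: entropy_nonneg)

text \<open>The square of the linear sum is at most n plus a chaos, since \<open>rbf\<close> is 1 on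
  the diagonal. The bound y \<le> (y^2 + s^2) / (2 s) then transfers the entropy bound for the chaos
  to the linear sums.\<close>

lemma sign_mean_linear_class:
  assumes x: "\<And>i. i \<in> {1..n} \<Longrightarrow> x i \<in> S" and n: "n \<ge> 1" and T: "finite T" "T \<noteq> {}"
    and \<gamma>: "\<And>t. t \<in> T \<Longrightarrow> \<gamma> t \<in> \<Gamma>"
    and dom: "\<And>t \<epsilon>. t \<in> T \<Longrightarrow> (\<Sum>i=1..n. \<epsilon> i * g t i)\<^sup>2 \<le> (\<Sum>i=1..n. \<Sum>j=1..n. \<epsilon> i * \<epsilon> j * rbf (\<gamma> t) (x i, x j))"
  shows "sign_mean n (\<lambda>\<epsilon>. maximum T (\<lambda>t. \<Sum>i=1..n. \<epsilon> i * g t i)) \<le> complexity_J S \<Gamma> * sqrt (real n)"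
proof -
  define I where "I = (LBINT a:{0..1/2}. entropy a)"
  have I: "I \<ge> 0" unfolding I_def by (rule entropy_integral_nonneg)
  define J where "J = complexity_J S \<Gamma>"
  have J2: "J\<^sup>2 = 162 * I + 1"
    using I unfolding J_def complexity_J_eq I_def[symmetric] by simp
  have J: "J > 0" 
    using I unfolding J_def complexity_J_eq I_def[symmetric] by simp
  \<comment> \<open>With I the entropy integral, the final bound (n (1 + 32 I) + s^2) / (2 s) is at
    most s, because J^2 = 1 + 162 I.\<close>
  define s where "s = J * sqrt (real n)"
  have s: "s > 0" using J n by (simp add: s_def)
  define G where "G = (\<lambda>t. rbf (\<gamma> t) :: (real^'d) \<times> (real^'d) \<Rightarrow> real) ` T"
  have G: "finite G" "G \<noteq> {}" "G \<subseteq> L"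
    using T \<gamma> by (auto simp: G_def kernel_class_eq)
  have sym: "rbf c (y, z) = rbf c (z, y)" for c and y z :: "real^'d"
    by (simp add: rbf_def norm_minus_commute)
  have "sign_mean n (\<lambda>\<epsilon>. maximum T (\<lambda>t. \<Sum>i=1..n. \<epsilon> i * g t i))
      \<le> sign_mean n (\<lambda>\<epsilon>. (real n / s + s) / 2 + 1 / (2 * s) * maximum G (\<lambda>f. chaos n x f \<epsilon>))"
  proof (rule sign_mean_mono_on)
    fix \<epsilon> assume e: "\<epsilon> \<in> sign_vectors n"
    obtain t where t: "t \<in> T" "maximum T (\<lambda>t. \<Sum>i=1..n. \<epsilon> i * g t i) = (\<Sum>i=1..n. \<epsilon> i * g t i)"
      using T by (rule maximum_attained)
    define y where "y = (\<Sum>i=1..n. \<epsilon> i * g t i)"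
    have "y\<^sup>2 \<le> (\<Sum>i=1..n. (\<epsilon> i)\<^sup>2 * rbf (\<gamma> t) (x i, x i)) + chaos n x (rbf (\<gamma> t)) \<epsilon>"
      using dom[OF t(1), of \<epsilon>] quadratic_form_eq_chaos[where f="rbf (\<gamma> t)" and x=x and n=n and \<epsilon>=\<epsilon>] sym by (simp add: y_def)
    also have "(\<Sum>i=1..n. (\<epsilon> i)\<^sup>2 * rbf (\<gamma> t) (x i, x i)) = (\<Sum>i=1..n. 1)"
      using e by (intro sum.cong) (auto simp: rbf_def sign_vectors_def power2_eq_1_iff)
    finally have y2: "y\<^sup>2 \<le> real n + maximum G (\<lambda>f. chaos n x f \<epsilon>)"
      using maximum_ge[OF G(1), of "rbf (\<gamma> t)" "\<lambda>f. chaos n x f \<epsilon>"] t(1) by (simp add: G_def)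
    have "0 \<le> (y - s)\<^sup>2" by simp
    hence "2 * s * y \<le> y\<^sup>2 + s\<^sup>2" by (simp add: power2_diff algebra_simps)
    hence "y \<le> (y\<^sup>2 + s\<^sup>2) / (2 * s)"
      using s by (simp add: pos_le_divide_eq mult_ac)
    also have "\<dots> \<le> (real n + maximum G (\<lambda>f. chaos n x f \<epsilon>) + s\<^sup>2) / (2 * s)"
      using y2 s by (intro divide_right_mono) auto
    also have "\<dots> = (real n / s + s) / 2 + 1 / (2 * s) * maximum G (\<lambda>f. chaos n x f \<epsilon>)"
      using s by (simp add: field_simps power2_eq_square)
    finally show "maximum T (\<lambda>t. \<Sum>i=1..n. \<epsilon> i * g t i) \<le> (real n / s + s) / 2 + 1 / (2 * s) * maximum G (\<lambda>f. chaos n x f \<epsilon>)"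
      unfolding t(2) y_def .
  qed
  also have "\<dots> = (real n / s + s) / 2 + 1 / (2 * s) * sign_mean n (\<lambda>\<epsilon>. maximum G (\<lambda>f. chaos n x f \<epsilon>))"
    by (simp only: sign_mean_add sign_mean_cmult sign_mean_const)
  also have "\<dots> \<le> (real n / s + s) / 2 + 1 / (2 * s) * (32 * real n * I)"
    unfolding I_def using s by (intro add_left_mono mult_left_mono chaos_entropy_bound x n G) auto
  also have "\<dots> = (real n * (1 + 32 * I) + s\<^sup>2) / (2 * s)"
    using s by (simp add: field_simps power2_eq_square)
  also have "\<dots> \<le> (s\<^sup>2 + s\<^sup>2) / (2 * s)"
  proof -
    have "real n * (1 + 32 * I) \<le> real n * J\<^sup>2"
      using I by (intro mult_left_mono) (auto simp: J2)
    also have "\<dots> = s\<^sup>2" by (simp add: s_def power_mult_distrib)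
    finally show ?thesis using s by (intro divide_right_mono) auto
  qed
  also have "\<dots> = s" using s by (simp add: power2_eq_square)
  finally show ?thesis by (simp add: s_def J_def)
qed

end

section \<open>Countable dense subclasses\<close>

text \<open>One point of A is picked from every basic open set that meets A. It serves both for the
  sample set and for sets of sequences of function values.\<close>

lemma countable_sequentially_dense:
  fixes A :: "'a :: {second_countable_topology, metric_space} set"
  obtains E where "countable E" "E \<subseteq> A" "\<forall>a\<in>A. \<exists>s. (\<forall>m. s m \<in> E) \<and> s \<longlonglongrightarrow> a"
proof -
  obtain B :: "'a set set" where B: "countable B" "topological_basis B"
    using ex_countable_basis by blast
  define pick where "pick b = (SOME a. a \<in> b \<inter> A)" for b
  have pick: "pick b \<in> b \<and> pick b \<in> A" if "b \<inter> A \<noteq> {}" for b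
  proof -
    have "\<exists>a. a \<in> b \<inter> A" using that by blast
    hence "pick b \<in> b \<inter> A" unfolding pick_def by (rule someI_ex)
    thus ?thesis by blast
  qed
  define E where "E = pick ` {b \<in> B. b \<inter> A \<noteq> {}}"
  have 1: "E \<subseteq> A"
    unfolding E_def using pick by blast
  have 2: "countable E"
    unfolding E_def by (intro countable_image countable_subset[OF _ B(1)]) blast
  have 3: "\<forall>a\<in>A. \<exists>s. (\<forall>m. s m \<in> E) \<and> s \<longlonglongrightarrow> a"
  proof
    fix a assume a: "a \<in> A"
    have "a \<in> closure E"
      unfolding closure_iff_nhds_not_empty
    proof (intro allI impI)
      fix X U assume U: "U \<subseteq> X" "open U" "a \<in> U"
      obtain b where b: "b \<in> B" "a \<in> b" "b \<subseteq> U"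
        by (rule topological_basisE[OF B(2) U(2,3)])
      have ne: "b \<inter> A \<noteq> {}" using a b(2) by blast
      have "pick b \<in> E" unfolding E_def using b(1) ne by blast
      moreover have "pick b \<in> X" using pick[OF ne] b(3) U(1) by blast
      ultimately show "E \<inter> X \<noteq> {}" by blast
    qed
    thus "\<exists>s. (\<forall>m. s m \<in> E) \<and> s \<longlonglongrightarrow> a"
      unfolding closure_sequential .
  qed
  show thesis by (rule that[OF 2 1 3])
qed

lemma (in rkhs) kernel_metric_nonneg:
  assumes x: "x \<in> S" and y: "y \<in> S"
  shows "0 \<le> k x x + k y y - 2 * k x y"
proof -
  have kx: "kernel_section S k x \<in> H" "kernel_section S k y \<in> H"
    using x y by (auto intro: section_mem)
  have "0 \<le> ip (kernel_section S k x - kernel_section S k y) (kernel_section S k x - kernel_section S k y)"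
    by (intro ip_nonneg diff_mem kx)
  also have "\<dots> = k x x + k y y - 2 * k x y"
    using kx x y ip_commute[OF kx(2) kx(1)]
    by (simp add: ip_diff_left ip_diff_right diff_mem ip_sections)
  finally show ?thesis .
qed

text \<open>A function is recorded by its values along a countable dense subset of S; these
  sequences form a subset of a second countable space. Equicontinuity of the ball in the kernel
  pseudometric extends pointwise convergence from that subset to S.\<close>

lemma (in rkhs) countable_pointwise_dense_ball:
  assumes dense: "countable S0" "S0 \<subseteq> S" "\<And>x. x \<in> S \<Longrightarrow> \<exists>s. (\<forall>m. s m \<in> S0) \<and> (\<lambda>m. k x x + k (s m) (s m) - 2 * k x (s m)) \<longlonglongrightarrow> 0"
    and S: "S \<noteq> {}"
  obtains D where "countable D" "D \<subseteq> rkhs_ball H ip 1"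
    "\<And>f. f \<in> rkhs_ball H ip 1 \<Longrightarrow> \<exists>h. (\<forall>m. h m \<in> D) \<and> (\<forall>x\<in>S. (\<lambda>m. h m x) \<longlonglongrightarrow> f x)"
proof -
  have S0: "S0 \<noteq> {}"
    using dense(3) S by blast
  define e where "e = from_nat_into S0"
  have e: "range e = S0"
    unfolding e_def using dense(1) S0 by (rule range_from_nat_into[rotated])
  define \<phi> where "\<phi> f i = f (e i)" for f :: "'a \<Rightarrow> real" and i :: nat
  let ?B = "rkhs_ball H ip 1"
  obtain E where E: "countable E" "E \<subseteq> \<phi> ` ?B" "\<forall>a\<in>\<phi> ` ?B. \<exists>s. (\<forall>m. s m \<in> E) \<and> s \<longlonglongrightarrow> a"
    by (rule countable_sequentially_dense[of "\<phi> ` ?B"])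
  define D where "D = inv_into ?B \<phi> ` E"
  have D_B: "D \<subseteq> ?B"
    unfolding D_def
  proof
    fix h assume "h \<in> inv_into ?B \<phi> ` E"
    then obtain z where z: "z \<in> E" "h = inv_into ?B \<phi> z" by blast
    hence "z \<in> \<phi> ` ?B" using E(2) by blast
    thus "h \<in> ?B" unfolding z(2) by (rule inv_into_into)
  qed
  have "\<exists>h. (\<forall>m. h m \<in> D) \<and> (\<forall>x\<in>S. (\<lambda>m. h m x) \<longlonglongrightarrow> f x)" if f: "f \<in> ?B" for f
  proof -
    obtain s where s: "\<And>m. s m \<in> E" "s \<longlonglongrightarrow> \<phi> f"
      using bspec[OF E(3) imageI[OF f]] by blast
    define h where "h m = inv_into ?B \<phi> (s m)" for m
    have hD: "h m \<in> D" for m using s by (simp add: h_def D_def)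
    have \<phi>h: "\<phi> (h m) = s m" for m
    proof -
      have "s m \<in> \<phi> ` ?B"
        using s(1)[of m] E(2) by blast
      thus ?thesis
        unfolding h_def by (rule f_inv_into_f)
    qed
    have conv0: "(\<lambda>m. h m y) \<longlonglongrightarrow> f y" if "y \<in> S0" for y
    proof -
      have "y \<in> range e" using that by (simp only: e)
      then obtain i where i: "y = e i" by (rule rangeE)
      have "continuous_on UNIV (\<lambda>z :: nat \<Rightarrow> real. z i)"
        by (rule continuous_on_product_coordinates)
      from continuous_on_tendsto_compose[OF this s(2)] have "(\<lambda>m. s m i) \<longlonglongrightarrow> \<phi> f i"
        by simp
      thus ?thesis
        unfolding i \<phi>h[symmetric] unfolding \<phi>_def .
    qed
    have H: "h m \<in> H" "ip_norm ip (h m) \<le> 1" "f \<in> H" "ip_norm ip f \<le> 1" for m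
      using subsetD[OF D_B hD[of m]] f by (simp_all add: rkhs_ball_def)
    have "(\<lambda>m. h m x) \<longlonglongrightarrow> f x" if x: "x \<in> S" for x
    proof (rule LIMSEQ_I)
      fix \<epsilon> :: real assume \<epsilon>: "\<epsilon> > 0"
      obtain w where w: "\<And>m. w m \<in> S0" "(\<lambda>m. k x x + k (w m) (w m) - 2 * k x (w m)) \<longlonglongrightarrow> 0"
        using dense(3)[OF x] by blast
      have "(\<lambda>m. sqrt (k x x + k (w m) (w m) - 2 * k x (w m))) \<longlonglongrightarrow> sqrt 0"
        by (intro tendsto_real_sqrt w(2))
      hence "eventually (\<lambda>m. sqrt (k x x + k (w m) (w m) - 2 * k x (w m)) < \<epsilon> / 3) sequentially"
        using \<epsilon> by (intro order_tendstoD) auto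
      then obtain j where j: "sqrt (k x x + k (w j) (w j) - 2 * k x (w j)) < \<epsilon> / 3"
        by (auto simp: eventually_sequentially)
      define y where "y = w j"
      have y: "y \<in> S0" "y \<in> S" using w(1) dense(2) by (auto simp: y_def)
      \<comment> \<open>The equicontinuity used twice below, for f and for the approximating
        functions.\<close>
      have near: "\<bar>g x - g y\<bar> < \<epsilon> / 3" if "g \<in> H" "ip_norm ip g \<le> 1" for g
      proof -
        have "\<bar>g x - g y\<bar> \<le> ip_norm ip g * sqrt (k x x + k y y - 2 * k x y)"
          by (rule abs_diff_le[OF that(1) x y(2)])
        also have "\<dots> \<le> 1 * sqrt (k x x + k y y - 2 * k x y)"
          by (intro mult_right_mono[OF that(2)] real_sqrt_ge_zero kernel_metric_nonneg x y(2))
        also have "\<dots> < \<epsilon> / 3" using j by (simp add: y_def)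
        finally show ?thesis .
      qed
      have "\<epsilon> / 3 > 0" using \<epsilon> by simp
      from LIMSEQ_D[OF conv0[OF y(1)] this] obtain m0
        where m0: "\<forall>m\<ge>m0. norm (h m y - f y) < \<epsilon> / 3" by blast
      have "\<bar>h m x - f x\<bar> < \<epsilon>" if "m \<ge> m0" for m
        using near[OF H(1,2)[of m]] near[OF H(3,4)] m0[rule_format, OF that, unfolded real_norm_def] by linarith
      thus "\<exists>no. \<forall>m\<ge>no. norm (h m x - f x) < \<epsilon>" by auto
    qed
    thus ?thesis using hD by blast
  qed
  moreover have "countable D" using E(1) by (simp add: D_def)
  ultimately show thesis using that D_B by blast
qed

section \<open>Deviations of finite classes\<close>

lemma sign_mean_linear: "sign_mean n (\<lambda>\<epsilon>. \<Sum>i=1..n. \<epsilon> i * c i) = 0"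
proof (induction n)
  case (Suc n)
  have "(\<Sum>i=1..Suc n. (\<epsilon>(Suc n := s)) i * c i) = s * c (Suc n) + (\<Sum>i=1..n. \<epsilon> i * c i)" for \<epsilon> s
    using sum_upd_Suc[where f="\<lambda>i e. e * c i"] by simp
  note sum = this
  show ?case
    unfolding sign_mean.simps sum sign_mean_add sign_mean_const Suc by simp
qed simp

lemma sign_mean_square: "sign_mean n (\<lambda>\<epsilon>. (\<Sum>i=1..n. \<epsilon> i)\<^sup>2) = real n"
proof (induction n)
  case (Suc n)
  have sum: "(\<Sum>i=1..Suc n. (\<epsilon>(Suc n := s)) i) = s + (\<Sum>i=1..n. \<epsilon> i)" for \<epsilon> :: "nat \<Rightarrow> real" and s
    using sum_upd_Suc[where f="\<lambda>i e. e"] by simp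
  have "(s + (\<Sum>i=1..n. \<epsilon> i))\<^sup>2 = (s\<^sup>2 + (\<Sum>i=1..n. \<epsilon> i)\<^sup>2) + 2 * s * (\<Sum>i=1..n. \<epsilon> i * 1)" for \<epsilon> :: "nat \<Rightarrow> real" and s
    by (simp add: power2_sum)
  hence sq: "sign_mean n (\<lambda>\<epsilon>. (s + (\<Sum>i=1..n. \<epsilon> i))\<^sup>2) = s\<^sup>2 + real n" for s
    by (simp only: sign_mean_add sign_mean_cmult sign_mean_const sign_mean_linear Suc mult_zero_right add_0_right)
  show ?case
    unfolding sign_mean.simps sum sq by simp
qed simp

text \<open>The supremum Z of the centred sums has mean at most R by symmetrisation and bounded
  differences c, so the tail inequality at c sqrt(n \<tau>) gives exp(- 2 \<tau>).\<close>

lemma (in prob_space) one_sided_deviation: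
  fixes f :: "'t \<Rightarrow> 'a \<Rightarrow> real"
  assumes T: "finite T" "T \<noteq> {}" and f: "\<And>t. t \<in> T \<Longrightarrow> f t \<in> borel_measurable M"
    and range: "\<And>t x. t \<in> T \<Longrightarrow> x \<in> space M \<Longrightarrow> f t x \<in> {lo..lo + c}" and c: "c > 0"
    and R: "\<And>x. x \<in> space (sample_space n) \<Longrightarrow> sign_mean n (\<lambda>\<epsilon>. maximum T (\<lambda>t. \<Sum>i=1..n. \<epsilon> i * (2 * f t (x i)))) \<le> R"
    and n: "n \<ge> 1" and \<tau>: "\<tau> > 0"
  shows "measure (sample_space n) {x \<in> space (sample_space n). \<exists>t\<in>T. (\<Sum>i=1..n. f t (x i) - (\<integral>y. f t y \<partial>M)) \<ge> R + c * sqrt (real n * \<tau>)} \<le> exp (- (2 * \<tau>))"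
proof -
  interpret s: prob_space "sample_space n" by (rule prob_space_sample_space)
  define B where "B = \<bar>lo\<bar> + c"
  have B: "\<bar>f t x\<bar> \<le> B" if "t \<in> T" "x \<in> space M" for t x
    using range[OF that] by (auto simp: B_def)
  define m where "m t = (\<integral>y. f t y \<partial>M)" for t
  have mB: "\<bar>m t\<bar> \<le> B" if "t \<in> T" for t
    unfolding m_def by (rule abs_expectation_le[OF f[OF that] B[OF that]])
  have pt: "x i \<in> space M" if "x \<in> space (sample_space n)" "i \<in> {1..n}" for x i
    using that by (auto simp: space_PiM)
  have comp: "(\<lambda>x. f t (x i)) \<in> borel_measurable (sample_space n)" if "t \<in> T" "i \<in> {1..n}" for t i
    using that f by (intro measurable_compose[OF measurable_component_singleton]) auto
  define Z where "Z x = maximum T (\<lambda>t. \<Sum>i=1..n. f t (x i) - m t)" for x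
  have Z_m: "Z \<in> borel_measurable (sample_space n)"
    unfolding Z_def[abs_def] using comp by (intro maximum_measurable T borel_measurable_sum borel_measurable_diff) auto
  have Z_b: "\<bar>Z x\<bar> \<le> real n * (2 * B)" if x: "x \<in> space (sample_space n)" for x
    unfolding Z_def
  proof (rule abs_maximum_le[OF T])
    fix t assume t: "t \<in> T"
    have "\<bar>\<Sum>i=1..n. f t (x i) - m t\<bar> \<le> (\<Sum>i=1..n. 2 * B)"
    proof (rule order_trans[OF sum_abs], rule sum_mono)
      fix i assume i: "i \<in> {1..n}"
      show "\<bar>f t (x i) - m t\<bar> \<le> 2 * B"
        using B[OF t pt[OF x i]] mB[OF t] by linarith
    qed
    thus "\<bar>\<Sum>i=1..n. f t (x i) - m t\<bar> \<le> real n * (2 * B)" by simp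
  qed
  \<comment> \<open>The maximiser for the altered sample competes at the original sample, and its
    sums differ in one term, by at most the length c of the range.\<close>
  have Z_diff: "Z (x(i := y)) \<le> Z x + c" if x: "x \<in> space (sample_space n)" and i: "i \<in> {1..n}" and y: "y \<in> space M" for x i y
  proof -
    obtain t where t: "t \<in> T" "Z (x(i := y)) = (\<Sum>j=1..n. f t ((x(i := y)) j) - m t)"
      unfolding Z_def using T by (rule maximum_attained)
    have "(\<Sum>j=1..n. f t ((x(i := y)) j) - m t) = (f t y - m t) + (\<Sum>j\<in>{1..n} - {i}. f t ((x(i := y)) j) - m t)"
      using i by (subst sum.remove[of _ i]) auto
    also have "(\<Sum>j\<in>{1..n} - {i}. f t ((x(i := y)) j) - m t) = (\<Sum>j\<in>{1..n} - {i}. f t (x j) - m t)"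
      by (intro sum.cong) auto
    also have "f t y \<le> f t (x i) + c"
      using range[OF t(1) y] range[OF t(1) pt[OF x i]] by auto
    also have "(f t (x i) + c - m t) + (\<Sum>j\<in>{1..n} - {i}. f t (x j) - m t) = (\<Sum>j=1..n. f t (x j) - m t) + c"
      using i by (subst sum.remove[of "{1..n}" i]) auto
    also have "(\<Sum>j=1..n. f t (x j) - m t) \<le> Z x"
      unfolding Z_def by (rule maximum_ge[OF T(1) t(1)])
    finally show ?thesis
      unfolding t(2) by simp
  qed
  have "(\<integral>x. Z x \<partial>sample_space n) = (\<integral>x. maximum T (\<lambda>t. 0 + (\<Sum>i=1..n. f t (x i) - (\<integral>y. f t y \<partial>M))) \<partial>sample_space n)"
    by (simp add: Z_def m_def)
  also have "\<dots> \<le> (\<integral>x. sign_mean n (\<lambda>\<epsilon>. maximum T (\<lambda>t. 0 + (\<Sum>i=1..n. \<epsilon> i * (2 * f t (x i))))) \<partial>sample_space n)"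
    by (rule symmetrisation[OF T f B])
  also have "\<dots> \<le> R"
  proof -
    define W where "W x = sign_mean n (\<lambda>\<epsilon>. maximum T (\<lambda>t. \<Sum>i=1..n. \<epsilon> i * (2 * f t (x i))))" for x
    have W_m: "W \<in> borel_measurable (sample_space n)"
      unfolding W_def[abs_def] using comp
      by (intro sign_mean_measurable maximum_measurable T borel_measurable_sum borel_measurable_times borel_measurable_const)
    have W_nonneg: "0 \<le> W x" for x
    proof -
      obtain t where t: "t \<in> T" using T(2) by blast
      have "0 = sign_mean n (\<lambda>\<epsilon>. \<Sum>i=1..n. \<epsilon> i * (2 * f t (x i)))"
        by (simp only: sign_mean_linear)
      also have "\<dots> \<le> W x"
        unfolding W_def
        by (rule sign_mean_mono) (rule maximum_ge[OF T(1) t, of "\<lambda>t. \<Sum>i=1..n. _ i * (2 * f t (x i))"])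
      finally show ?thesis .
    qed
    have "\<bar>W x\<bar> \<le> R" if "x \<in> space (sample_space n)" for x
      using W_nonneg[of x] R[OF that] by (simp add: W_def)
    hence "(\<integral>x. W x \<partial>sample_space n) \<le> R"
      using s.abs_expectation_le[OF W_m] by (simp add: abs_le_iff)
    thus ?thesis by (simp add: W_def)
  qed
  finally have E: "(\<integral>x. Z x \<partial>sample_space n) \<le> R" .
  have s0: "c * sqrt (real n * \<tau>) > 0"
    using c n \<tau> by simp
  have "measure (sample_space n) {x \<in> space (sample_space n). \<exists>t\<in>T. (\<Sum>i=1..n. f t (x i) - (\<integral>y. f t y \<partial>M)) \<ge> R + c * sqrt (real n * \<tau>)}
    \<le> measure (sample_space n) {x \<in> space (sample_space n). Z x \<ge> (\<integral>x. Z x \<partial>sample_space n) + c * sqrt (real n * \<tau>)}"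
  proof (rule s.finite_measure_mono)
    show "{x \<in> space (sample_space n). Z x \<ge> (\<integral>x. Z x \<partial>sample_space n) + c * sqrt (real n * \<tau>)} \<in> sets (sample_space n)"
      using Z_m by measurable
    show "{x \<in> space (sample_space n). \<exists>t\<in>T. (\<Sum>i=1..n. f t (x i) - (\<integral>y. f t y \<partial>M)) \<ge> R + c * sqrt (real n * \<tau>)}
      \<subseteq> {x \<in> space (sample_space n). Z x \<ge> (\<integral>x. Z x \<partial>sample_space n) + c * sqrt (real n * \<tau>)}"
    proof safe
      fix x t assume x: "x \<in> space (sample_space n)" and t: "t \<in> T"
        and ge: "R + c * sqrt (real n * \<tau>) \<le> (\<Sum>i=1..n. f t (x i) - (\<integral>y. f t y \<partial>M))"
      have "(\<Sum>i=1..n. f t (x i) - m t) \<le> Z x"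
        unfolding Z_def by (rule maximum_ge[OF T(1) t])
      thus "(\<integral>x. Z x \<partial>sample_space n) + c * sqrt (real n * \<tau>) \<le> Z x"
        using ge E unfolding m_def by linarith
    qed
  qed
  also have "\<dots> \<le> exp (- (2 * (c * sqrt (real n * \<tau>))\<^sup>2 / (real n * c\<^sup>2)))"
    by (rule bounded_difference_tail[OF Z_m Z_b Z_diff n c s0])
  also have "2 * (c * sqrt (real n * \<tau>))\<^sup>2 / (real n * c\<^sup>2) = 2 * \<tau>"
    using c n \<tau> by (simp add: power_mult_distrib)
  finally show ?thesis .
qed

text \<open>The sum of values is the inner product of f with a combination of sections, so
  Cauchy--Schwarz yields the quadratic form of the kernel.\<close>

lemma (in rkhs) sum_evaluations_le:
  fixes n :: nat
  assumes f: "f \<in> rkhs_ball H ip r" and x: "\<And>i. i \<in> {1..n} \<Longrightarrow> x i \<in> S"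
  shows "(\<Sum>i=1..n. c i * f (x i))\<^sup>2 \<le> r\<^sup>2 * (\<Sum>i=1..n. \<Sum>j=1..n. c i * c j * k (x i) (x j))"
proof -
  define l where "l = map (\<lambda>i. (c i, x i)) [1..<Suc n]"
  have list_sum: "(\<Sum>p\<leftarrow>l. g (fst p) (snd p)) = (\<Sum>i=1..n. g (c i) (x i))" for g :: "real \<Rightarrow> 'a \<Rightarrow> real"
  proof -
    have "(\<Sum>p\<leftarrow>l. g (fst p) (snd p)) = (\<Sum>i\<leftarrow>[1..<Suc n]. g (c i) (x i))"
      unfolding l_def by (simp add: comp_def del: upt_Suc)
    thus ?thesis
      by (simp add: interv_sum_list_conv_sum_set_nat atLeastLessThanSuc_atLeastAtMost del: upt_Suc)
  qed
  have l: "snd ` set l \<subseteq> S"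
    unfolding l_def using x by (auto simp del: upt_Suc)
  have fH: "f \<in> H" "ip_norm ip f \<le> r"
    using f by (auto simp: rkhs_ball_def)
  have "\<bar>\<Sum>i=1..n. c i * f (x i)\<bar> = \<bar>ip f (comb l)\<bar>"
    using ip_comb[OF l fH(1)] list_sum[of "\<lambda>a b. a * f b"] by simp
  also have "\<dots> \<le> ip_norm ip f * ip_norm ip (comb l)"
    by (rule Cauchy_Schwarz[OF fH(1) comb_mem[OF l]])
  also have "\<dots> \<le> r * ip_norm ip (comb l)"
    by (rule mult_right_mono[OF fH(2) ip_norm_nonneg[OF comb_mem[OF l]]])
  finally have "(\<Sum>i=1..n. c i * f (x i))\<^sup>2 \<le> (r * ip_norm ip (comb l))\<^sup>2"
    by (metis abs_ge_zero power2_abs power_mono)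
  also have "\<dots> = r\<^sup>2 * ip (comb l) (comb l)"
    by (simp add: power_mult_distrib ip_norm_power2 comb_mem[OF l])
  also have "ip (comb l) (comb l) = (\<Sum>i=1..n. \<Sum>j=1..n. c i * c j * k (x i) (x j))"
    using ip_comb_comb[OF l] list_sum[of "\<lambda>a b. \<Sum>q\<leftarrow>l. a * fst q * k b (snd q)"]
      list_sum[of "\<lambda>a' b'. _ * a' * k _ b'"] by simp
  finally show ?thesis .
qed

section \<open>Clipped squared differences over all widths and radii\<close>

lemma abs_clip_le: "C \<ge> 0 \<Longrightarrow> \<bar>clip C s\<bar> \<le> C"
  by (auto simp: clip_def)

lemma abs_clip_diff_le: "\<bar>clip C s - clip C s'\<bar> \<le> \<bar>s - s'\<bar>"
  by (auto simp: clip_def min_def max_def)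

lemma clip_eq: "\<bar>s\<bar> \<le> C \<Longrightarrow> clip C s = s"
  by (auto simp: clip_def)

text \<open>Scaling commutes with clipping if the level is scaled too, and clipping is 1-Lipschitz
  in the argument and in the level.\<close>

lemma clip_scaled_diff_le:
  assumes "\<rho> > 0" "\<rho>' > 0" "C > 0"
  shows "\<bar>\<rho> * clip C s - \<rho>' * clip C s'\<bar> \<le> \<bar>\<rho> * s - \<rho>' * s'\<bar> + C * \<bar>\<rho> - \<rho>'\<bar>"
proof -
  have scale: "r * clip C z = clip (r * C) (r * z)" if "r > 0" for r z
    using that by (simp add: clip_def max_mult_distrib_left min_mult_distrib_left mult.commute)
  have "\<bar>clip a z - clip a' z'\<bar> \<le> \<bar>z - z'\<bar> + \<bar>a - a'\<bar>" if "a > 0" "a' > 0" for a a' z z'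
    using that by (auto simp: clip_def max_def min_def)
  from this[of "\<rho> * C" "\<rho>' * C" "\<rho> * s" "\<rho>' * s'"]
  have "\<bar>\<rho> * clip C s - \<rho>' * clip C s'\<bar> \<le> \<bar>\<rho> * s - \<rho>' * s'\<bar> + \<bar>\<rho> * C - \<rho>' * C\<bar>"
    using assms by (simp add: scale)
  also have "\<bar>\<rho> * C - \<rho>' * C\<bar> = C * \<bar>\<rho> - \<rho>'\<bar>"
    using assms by (simp add: left_diff_distrib[symmetric] abs_mult)
  finally show ?thesis .
qed

text \<open>With \<open>z = \<rho> y\<close> and \<open>z' = \<rho>' y'\<close>,
  \<open>\<rho> y\<^sup>2 - \<rho>' y'\<^sup>2 = (z - z') (y + y') + (\<rho>' - \<rho>) y y'\<close>.\<close>

lemma scaled_square_clip_diff_le: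
  assumes "\<rho> > 0" "\<rho>' > 0" "C > 0"
  shows "\<bar>\<rho> * (clip C s1 - clip C s2)\<^sup>2 - \<rho>' * (clip C s1' - clip C s2')\<^sup>2\<bar>
    \<le> 4 * C * \<bar>\<rho> * s1 - \<rho>' * s1'\<bar> + 4 * C * \<bar>\<rho> * s2 - \<rho>' * s2'\<bar> + 12 * C\<^sup>2 * \<bar>\<rho> - \<rho>'\<bar>"
proof -
  define y y' where "y = clip C s1 - clip C s2" and "y' = clip C s1' - clip C s2'"
  have y: "\<bar>y\<bar> \<le> 2 * C" "\<bar>y'\<bar> \<le> 2 * C"
    using abs_clip_le[of C s1] abs_clip_le[of C s2] abs_clip_le[of C s1'] abs_clip_le[of C s2'] assms
    by (auto simp: y_def y'_def)
  define z where "z = \<rho> * y - \<rho>' * y'"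
  have "\<bar>z\<bar> \<le> \<bar>\<rho> * clip C s1 - \<rho>' * clip C s1'\<bar> + \<bar>\<rho> * clip C s2 - \<rho>' * clip C s2'\<bar>"
    by (simp add: z_def y_def y'_def algebra_simps)
  hence z: "\<bar>z\<bar> \<le> \<bar>\<rho> * s1 - \<rho>' * s1'\<bar> + \<bar>\<rho> * s2 - \<rho>' * s2'\<bar> + 2 * (C * \<bar>\<rho> - \<rho>'\<bar>)"
    using clip_scaled_diff_le[OF assms, of s1 s1'] clip_scaled_diff_le[OF assms, of s2 s2'] by linarith
  have "\<rho> * y\<^sup>2 - \<rho>' * y'\<^sup>2 = z * (y + y') + (\<rho>' - \<rho>) * (y * y')"
    by (simp add: z_def power2_eq_square algebra_simps)
  hence "\<bar>\<rho> * y\<^sup>2 - \<rho>' * y'\<^sup>2\<bar> \<le> \<bar>z\<bar> * \<bar>y + y'\<bar> + \<bar>\<rho> - \<rho>'\<bar> * (\<bar>y\<bar> * \<bar>y'\<bar>)"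
    by (metis abs_minus_commute abs_mult abs_triangle_ineq)
  also have "\<dots> \<le> (\<bar>\<rho> * s1 - \<rho>' * s1'\<bar> + \<bar>\<rho> * s2 - \<rho>' * s2'\<bar> + 2 * (C * \<bar>\<rho> - \<rho>'\<bar>)) * (4 * C) + \<bar>\<rho> - \<rho>'\<bar> * (2 * C * (2 * C))"
    using y z assms by (intro add_mono mult_mono) auto
  also have "\<dots> = 4 * C * \<bar>\<rho> * s1 - \<rho>' * s1'\<bar> + 4 * C * \<bar>\<rho> * s2 - \<rho>' * s2'\<bar> + 12 * C\<^sup>2 * \<bar>\<rho> - \<rho>'\<bar>"
    by (simp add: power2_eq_square algebra_simps)
  finally show ?thesis by (simp add: y_def y'_def)
qed

lemma maximum_cmult_le:
  assumes "finite T" "T \<noteq> {}" "c \<ge> 0"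
  shows "maximum T (\<lambda>t. c * f t) \<le> c * maximum T f"
proof -
  have "c * f t \<le> c * maximum T f" if "t \<in> T" for t
    by (rule mult_left_mono[OF maximum_ge[OF assms(1) that] assms(3)])
  thus ?thesis
    using maximum_le_iff[OF assms(1,2), of "\<lambda>t. c * f t"] by blast
qed

text \<open>\<open>\<Gamma>0\<close> approximates widths from below, because the balls at the
  approximating widths then contain the ball at the limit.\<close>

locale gaussian_class = kernel_covering S \<Gamma> u v
  for S :: "(real^'d) set" and \<Gamma> :: "real set" and u v :: real +
  fixes P :: "(real^'d) measure" and H :: "real \<Rightarrow> (real^'d \<Rightarrow> real) set"
    and ip :: "real \<Rightarrow> (real^'d \<Rightarrow> real) \<Rightarrow> (real^'d \<Rightarrow> real) \<Rightarrow> real" and C :: real and \<Gamma>0 :: "real set"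
  assumes prob_P: "prob_space P" and sets_P: "sets P = sets (borel_on S)"
    and rkhs: "\<And>\<gamma>. \<gamma> \<in> \<Gamma> \<Longrightarrow> is_rkhs S (gauss_kernel \<gamma>) (H \<gamma>) (ip \<gamma>)"
    and C: "C > 0"
    and \<Gamma>0: "countable \<Gamma>0" "\<Gamma>0 \<subseteq> \<Gamma>" "\<And>\<gamma>. \<gamma> \<in> \<Gamma> \<Longrightarrow> \<exists>s. (\<forall>m::nat. s m \<in> \<Gamma>0 \<and> s m \<le> \<gamma>) \<and> s \<longlonglongrightarrow> \<gamma>"
begin

sublocale P: prob_space P by (rule prob_P)

text \<open>The square root of the kernel on the diagonal, hence a sup bound for the unit ball
  (\<open>ball_abs_le\<close>).\<close>

definition w :: "real \<Rightarrow> real" where "w \<gamma> = \<gamma> powr (- real CARD('d) / 2)"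

abbreviation ball where "ball \<gamma> r \<equiv> rkhs_ball (H \<gamma>) (ip \<gamma>) r"

abbreviation J where "J \<equiv> complexity_J S \<Gamma>"

lemma space_P: "space P = S"
  using sets_eq_imp_space_eq[OF sets_P] by (simp add: space_restrict_space)

lemma rkhs': "\<gamma> \<in> \<Gamma> \<Longrightarrow> rkhs S (gauss_kernel \<gamma>) (H \<gamma>) (ip \<gamma>)"
  unfolding rkhs_def by (rule rkhs)

lemma \<gamma>_pos: "\<gamma> \<in> \<Gamma> \<Longrightarrow> \<gamma> > 0"
  using \<Gamma> u by auto

lemma w_pos: "\<gamma> \<in> \<Gamma> \<Longrightarrow> w \<gamma> > 0"
  using \<gamma>_pos[of \<gamma>] by (simp add: w_def)

lemma w_power2: "\<gamma> \<in> \<Gamma> \<Longrightarrow> (w \<gamma>)\<^sup>2 = \<gamma> powr (- real CARD('d))"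
  using \<gamma>_pos[of \<gamma>] by (simp add: w_def powr_powr[symmetric] power2_eq_square powr_add[symmetric])

lemma gauss_kernel_eq: "\<gamma> \<in> \<Gamma> \<Longrightarrow> gauss_kernel \<gamma> x y = (w \<gamma>)\<^sup>2 * rbf \<gamma> (x, y)" for x y :: "real^'d"
  by (simp add: gauss_kernel_def rbf_def w_power2)

lemma ball_abs_le: 
  assumes "\<gamma> \<in> \<Gamma>" "f \<in> ball \<gamma> r" "x \<in> S"
  shows "\<bar>f x\<bar> \<le> r * w \<gamma>"
proof -
  interpret rkhs S "gauss_kernel \<gamma>" "H \<gamma>" "ip \<gamma>" by (rule rkhs'[OF assms(1)])
  have f: "f \<in> H \<gamma>" "ip_norm (ip \<gamma>) f \<le> r"
    using assms(2) by (auto simp: rkhs_ball_def)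
  have "\<bar>f x\<bar> \<le> ip_norm (ip \<gamma>) f * sqrt (gauss_kernel \<gamma> x x)"
    by (rule abs_le[OF f(1) assms(3)])
  also have "sqrt (gauss_kernel \<gamma> x x) = w \<gamma>"
    using w_pos[OF assms(1)] by (simp add: gauss_kernel_eq[OF assms(1)] rbf_def)
  also have "ip_norm (ip \<gamma>) f * w \<gamma> \<le> r * w \<gamma>"
    using w_pos[OF assms(1)] by (intro mult_right_mono f(2)) simp
  finally show ?thesis .
qed

lemma kernel_metric_tendsto:
  assumes "\<gamma> \<in> \<Gamma>" "s \<longlonglongrightarrow> x"
  shows "(\<lambda>m. gauss_kernel \<gamma> x x + gauss_kernel \<gamma> (s m) (s m) - 2 * gauss_kernel \<gamma> x (s m)) \<longlonglongrightarrow> 0"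
proof -
  have "(\<lambda>m. gauss_kernel \<gamma> x x + gauss_kernel \<gamma> x x - 2 * gauss_kernel \<gamma> x (s m)) \<longlonglongrightarrow>
      gauss_kernel \<gamma> x x + gauss_kernel \<gamma> x x - 2 * gauss_kernel \<gamma> x x"
    unfolding gauss_kernel_def using \<gamma>_pos[OF assms(1)] by (intro tendsto_intros assms(2)) auto
  thus ?thesis
    by (simp add: gauss_kernel_def)
qed

text \<open>Convergence of points implies convergence in the kernel pseudometric. The continuity
  obtained is the source of measurability for members of \<open>H \<gamma>\<close>.\<close>

lemma ball_continuous_on:
  assumes \<gamma>: "\<gamma> \<in> \<Gamma>" and f: "f \<in> H \<gamma>"
  shows "continuous_on S f"
  unfolding continuous_on_sequentially
proof (intro ballI allI impI, elim conjE)
  fix x s assume x: "x \<in> S" and s: "\<forall>m. s m \<in> S" "s \<longlonglongrightarrow> x"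
  interpret rkhs S "gauss_kernel \<gamma>" "H \<gamma>" "ip \<gamma>" by (rule rkhs'[OF \<gamma>])
  define B where "B m = ip_norm (ip \<gamma>) f * sqrt (gauss_kernel \<gamma> x x + gauss_kernel \<gamma> (s m) (s m) - 2 * gauss_kernel \<gamma> x (s m))" for m
  have "B \<longlonglongrightarrow> ip_norm (ip \<gamma>) f * sqrt 0"
    unfolding B_def[abs_def] by (intro tendsto_mult tendsto_const tendsto_real_sqrt kernel_metric_tendsto \<gamma> s(2))
  hence B0: "B \<longlonglongrightarrow> 0" by simp
  have "norm (f (s m) - f x) \<le> B m" for m
    using abs_diff_le[OF f x s(1)[rule_format, of m]] by (simp only: real_norm_def abs_minus_commute B_def)
  hence "\<forall>\<^sub>F m in sequentially. norm (f (s m) - f x) \<le> B m"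
    by (intro always_eventually allI)
  hence "(\<lambda>m. f (s m) - f x) \<longlonglongrightarrow> 0"
    using B0 by (rule Lim_null_comparison)
  thus "(f \<circ> s) \<longlonglongrightarrow> f x"
    unfolding comp_def by (rule LIM_zero_cancel)
qed

lemma H_measurable:
  assumes "\<gamma> \<in> \<Gamma>" "f \<in> H \<gamma>"
  shows "f \<in> borel_measurable P"
proof -
  have "f \<in> borel_measurable (restrict_space borel S)"
    by (rule borel_measurable_continuous_on_restrict[OF ball_continuous_on[OF assms]])
  thus ?thesis
    by (simp only: measurable_cong_sets[OF sets_P refl])
qed

lemma clip_measurable: "f \<in> borel_measurable K \<Longrightarrow> (\<lambda>x. clip C (f x)) \<in> borel_measurable K"
  unfolding clip_def by (intro borel_measurable_max borel_measurable_min borel_measurable_const)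

lemma ball_mono_radius: "r \<le> q \<Longrightarrow> ball \<gamma> r \<subseteq> ball \<gamma> q"
  by (auto simp: rkhs_ball_def)

lemma ball_mono_width:
  assumes "\<eta> \<in> \<Gamma>" "\<gamma> \<in> \<Gamma>" "\<eta> \<le> \<gamma>" "r \<ge> 0"
  shows "ball \<gamma> r \<subseteq> ball \<eta> r"
  by (rule rkhs_ball_mono_kernel[OF rkhs'[OF assms(2)] rkhs'[OF assms(1)] assms(4)])
     (rule gauss_kernel_order[OF \<gamma>_pos[OF assms(1)] assms(3)])

lemma ball_scale:
  assumes "\<gamma> \<in> \<Gamma>" "f \<in> ball \<gamma> r" "c \<ge> 0"
  shows "(\<lambda>x. c * f x) \<in> ball \<gamma> (c * r)"
proof -
  interpret rkhs S "gauss_kernel \<gamma>" "H \<gamma>" "ip \<gamma>" by (rule rkhs'[OF assms(1)])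
  have f: "f \<in> H \<gamma>" "ip_norm (ip \<gamma>) f \<le> r"
    using assms(2) by (auto simp: rkhs_ball_def)
  show ?thesis
    using scale_mem[OF f(1), of c] ip_norm_scale[OF f(1), of c] mult_left_mono[OF f(2) assms(3)] assms(3)
    by (simp add: rkhs_ball_def)
qed

definition sqd :: "(real^'d \<Rightarrow> real) \<Rightarrow> (real^'d \<Rightarrow> real) \<Rightarrow> real^'d \<Rightarrow> real" where
  "sqd f1 f2 x = (clip C (f1 x) - clip C (f2 x))\<^sup>2"

lemma emp_norm2_sqd: "emp_norm2 n x ((clip C \<circ> f1) - (clip C \<circ> f2)) = (1 / real n) * (\<Sum>i=1..n. sqd f1 f2 (x i))"
  by (simp add: emp_norm2_def sqd_def)

lemma L2_norm2_sqd: "L2_norm2 P ((clip C \<circ> f1) - (clip C \<circ> f2)) = (\<integral>x. sqd f1 f2 x \<partial>P)"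
  by (simp add: L2_norm2_def sqd_def)

lemma sqd_nonneg: "0 \<le> sqd f1 f2 x"
  by (simp add: sqd_def)

lemma sqd_le: "sqd f1 f2 x \<le> 4 * C\<^sup>2"
proof -
  have "\<bar>clip C (f1 x) - clip C (f2 x)\<bar> \<le> 2 * C"
    using abs_clip_le[of C "f1 x"] abs_clip_le[of C "f2 x"] C by linarith
  hence "\<bar>clip C (f1 x) - clip C (f2 x)\<bar>\<^sup>2 \<le> (2 * C)\<^sup>2"
    by (intro power_mono) auto
  thus ?thesis by (simp add: sqd_def power_mult_distrib)
qed

lemma sqd_measurable: "f1 \<in> borel_measurable K \<Longrightarrow> f2 \<in> borel_measurable K \<Longrightarrow> sqd f1 f2 \<in> borel_measurable K"
  unfolding sqd_def[abs_def] by (intro borel_measurable_power borel_measurable_diff clip_measurable)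

text \<open>One factor of the square is bounded by the clipping level and the other by the radius.
  The bound is thus linear in \<open>r * w \<gamma>\<close>, and division by that quantity gives a
  class with range in an interval of length 4 C.\<close>

lemma sqd_ball_le:
  assumes \<gamma>: "\<gamma> \<in> \<Gamma>" and f: "f1 \<in> ball \<gamma> r" "f2 \<in> ball \<gamma> r" and x: "x \<in> S"
  shows "sqd f1 f2 x \<le> 4 * C * (r * w \<gamma>)"
proof -
  have "\<bar>clip C (f1 x) - clip C (f2 x)\<bar> \<le> 2 * C"
    using abs_clip_le[of C "f1 x"] abs_clip_le[of C "f2 x"] C by linarith
  moreover have "\<bar>clip C (f1 x) - clip C (f2 x)\<bar> \<le> 2 * (r * w \<gamma>)"
    using abs_clip_diff_le[of C "f1 x" "f2 x"] ball_abs_le[OF \<gamma> f(1) x] ball_abs_le[OF \<gamma> f(2) x] by linarith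
  ultimately have "\<bar>clip C (f1 x) - clip C (f2 x)\<bar> * \<bar>clip C (f1 x) - clip C (f2 x)\<bar> \<le> (2 * C) * (2 * (r * w \<gamma>))"
    using C by (intro mult_mono) auto
  thus ?thesis by (simp add: sqd_def power2_eq_square)
qed

definition dev :: "nat \<Rightarrow> (nat \<Rightarrow> real^'d) \<Rightarrow> (real^'d \<Rightarrow> real) \<Rightarrow> (real^'d \<Rightarrow> real) \<Rightarrow> real" where
  "dev n x f1 f2 = (1 / real n) * (\<Sum>i=1..n. sqd f1 f2 (x i)) - (\<integral>x. sqd f1 f2 x \<partial>P)"

text \<open>Restricting to \<open>C \<le> r * w \<gamma>\<close> keeps the scale 1 / (r w(\<gamma>))
  bounded by 1 / C. Smaller radii are recovered in \<open>countable_reduction\<close> by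
  homogeneity.\<close>

definition adm :: "real \<times> real \<times> (real^'d \<Rightarrow> real) \<times> (real^'d \<Rightarrow> real) \<Rightarrow> bool" where
  "adm = (\<lambda>(\<gamma>, r, f1, f2). \<gamma> \<in> \<Gamma> \<and> C \<le> r * w \<gamma> \<and> f1 \<in> ball \<gamma> r \<and> f2 \<in> ball \<gamma> r)"

lemma J_ge_1: "J \<ge> 1"
  using entropy_integral_nonneg unfolding complexity_J_eq by simp

text \<open>The class is normalised by \<open>\<rho> = 1 / (r * w \<gamma>) \<le> 1 / C\<close>; as a function of
  \<open>(\<rho>, \<rho> f1, \<rho> f2)\<close> it is Lipschitz, uniformly over all widths and radii.\<close>

lemma sign_mean_adm_class:
  assumes T: "finite T" "T \<noteq> {}" "\<And>\<theta>. \<theta> \<in> T \<Longrightarrow> adm \<theta>" and n: "n \<ge> 1"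
    and x: "\<And>i. i \<in> {1..n} \<Longrightarrow> x i \<in> S" and sg: "\<sigma> = 1 \<or> \<sigma> = -1"
  shows "sign_mean n (\<lambda>\<epsilon>. maximum T (\<lambda>(\<gamma>, r, f1, f2). \<Sum>i=1..n. \<epsilon> i * (2 * (\<sigma> * (1 / (r * w \<gamma>) * sqd f1 f2 (x i))))))
    \<le> 120 * C * J * sqrt (real n)"
proof -
  define \<rho> where "\<rho> = (\<lambda>(\<gamma>, r, f1 :: real^'d \<Rightarrow> real, f2 :: real^'d \<Rightarrow> real). 1 / (r * w \<gamma>))"
  define a where "a j = (\<lambda>(\<gamma>, r, f1, f2). \<lambda>i. 1 / (r * w \<gamma>) * (if j = (0::nat) then f1 else f2) (x i))" for j
  define F where "F i = (\<lambda>(\<gamma>, r, f1, f2). 2 * (\<sigma> * (1 / (r * w \<gamma>) * sqd f1 f2 (x i))))" for i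
  \<comment> \<open>The three coordinate classes of the contraction: the two scaled functions and
    the scale itself. The constants are twice those of \<open>scaled_square_clip_diff_le\<close>,
    the 2 coming from symmetrisation.\<close>
  define g where "g k i \<theta> = (if k < 2 then 8 * C * a k \<theta> i else 24 * C\<^sup>2 * \<rho> \<theta>)" for k :: nat and i \<theta>
  have \<rho>: "0 < \<rho> \<theta>" "\<rho> \<theta> \<le> 1 / C" if "\<theta> \<in> T" for \<theta>
  proof -
    obtain \<gamma> r f1 f2 where \<theta>: "\<theta> = (\<gamma>, r, f1, f2)" by (cases \<theta>)
    have "C \<le> r * w \<gamma>" using T(3)[OF that] by (simp add: \<theta> adm_def)
    thus "0 < \<rho> \<theta>" "\<rho> \<theta> \<le> 1 / C"
      using C by (auto simp: \<rho>_def \<theta> intro!: divide_left_mono)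
  qed
  have lip: "\<bar>F i \<theta> - F i \<theta>'\<bar> \<le> (\<Sum>k\<in>{..<3}. \<bar>g k i \<theta> - g k i \<theta>'\<bar>)" if "\<theta> \<in> T" "\<theta>' \<in> T" for i \<theta> \<theta>'
  proof -
    obtain \<gamma> r f1 f2 where \<theta>: "\<theta> = (\<gamma>, r, f1, f2)" by (cases \<theta>)
    obtain \<gamma>' r' f1' f2' where \<theta>': "\<theta>' = (\<gamma>', r', f1', f2')" by (cases \<theta>')
    have "F i \<theta> - F i \<theta>' = 2 * \<sigma> * (\<rho> \<theta> * (clip C (f1 (x i)) - clip C (f2 (x i)))\<^sup>2 - \<rho> \<theta>' * (clip C (f1' (x i)) - clip C (f2' (x i)))\<^sup>2)"
      by (simp add: F_def \<theta> \<theta>' \<rho>_def sqd_def right_diff_distrib)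
    hence "\<bar>F i \<theta> - F i \<theta>'\<bar> = 2 * \<bar>\<rho> \<theta> * (clip C (f1 (x i)) - clip C (f2 (x i)))\<^sup>2 - \<rho> \<theta>' * (clip C (f1' (x i)) - clip C (f2' (x i)))\<^sup>2\<bar>"
      using sg by (auto simp only: abs_mult)
    also have "\<dots> \<le> 2 * (4 * C * \<bar>\<rho> \<theta> * f1 (x i) - \<rho> \<theta>' * f1' (x i)\<bar> + 4 * C * \<bar>\<rho> \<theta> * f2 (x i) - \<rho> \<theta>' * f2' (x i)\<bar> + 12 * C\<^sup>2 * \<bar>\<rho> \<theta> - \<rho> \<theta>'\<bar>)"
      by (intro mult_left_mono scaled_square_clip_diff_le \<rho> that C) simp
    also have "\<dots> = \<bar>8 * C * (a 0 \<theta> i - a 0 \<theta>' i)\<bar> + \<bar>8 * C * (a 1 \<theta> i - a 1 \<theta>' i)\<bar> + \<bar>24 * C\<^sup>2 * (\<rho> \<theta> - \<rho> \<theta>')\<bar>"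
      unfolding abs_mult using C by (simp add: a_def \<theta> \<theta>' \<rho>_def)
    also have "\<dots> = (\<Sum>k\<in>{..<3}. \<bar>g k i \<theta> - g k i \<theta>'\<bar>)"
      by (simp add: g_def numeral_3_eq_3 right_diff_distrib)
    finally show ?thesis .
  qed
  have "0 \<in> {..<3::nat}" by simp
  hence K: "finite {..<3::nat}" "{..<3::nat} \<noteq> {}" by blast+
  \<comment> \<open>The kernel is \<open>(w \<gamma>)^2\<close> times \<open>rbf \<gamma>\<close>,
    so the scaled function is dominated by the unnormalised kernel, uniformly in width and
    radius.\<close>
  have lin: "sign_mean n (\<lambda>\<epsilon>. maximum T (\<lambda>\<theta>. \<Sum>i=1..n. \<epsilon> i * a j \<theta> i)) \<le> J * sqrt (real n)" for j
  proof (rule sign_mean_linear_class[OF x n T(1,2), where \<gamma>=fst])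
    fix \<theta> \<epsilon> assume t: "\<theta> \<in> T"
    obtain \<gamma> r f1 f2 where \<theta>: "\<theta> = (\<gamma>, r, f1, f2)" by (cases \<theta>)
    have ad: "\<gamma> \<in> \<Gamma>" "C \<le> r * w \<gamma>" "f1 \<in> ball \<gamma> r" "f2 \<in> ball \<gamma> r"
      using T(3)[OF t] by (auto simp: \<theta> adm_def)
    show "fst \<theta> \<in> \<Gamma>" using ad by (simp add: \<theta>)
    interpret rkhs S "gauss_kernel \<gamma>" "H \<gamma>" "ip \<gamma>" by (rule rkhs'[OF ad(1)])
    define f where "f = (if j = 0 then f1 else f2)"
    have f: "f \<in> ball \<gamma> r" using ad by (simp add: f_def)
    have rw: "r * w \<gamma> > 0" using ad(2) C by linarith
    have "(\<Sum>i=1..n. \<epsilon> i * f (x i))\<^sup>2 \<le> r\<^sup>2 * (\<Sum>i=1..n. \<Sum>j=1..n. \<epsilon> i * \<epsilon> j * gauss_kernel \<gamma> (x i) (x j))"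
      by (rule sum_evaluations_le[OF f x])
    also have "\<dots> = (r * w \<gamma>)\<^sup>2 * (\<Sum>i=1..n. \<Sum>j=1..n. \<epsilon> i * \<epsilon> j * rbf \<gamma> (x i, x j))"
      by (simp add: gauss_kernel_eq[OF ad(1)] power_mult_distrib sum_distrib_left mult_ac)
    finally have *: "(\<Sum>i=1..n. \<epsilon> i * f (x i))\<^sup>2 \<le> (r * w \<gamma>)\<^sup>2 * (\<Sum>i=1..n. \<Sum>j=1..n. \<epsilon> i * \<epsilon> j * rbf \<gamma> (x i, x j))" .
    have div: "p / q \<le> z" if "p \<le> q * z" "q > 0" for p q z :: real
      using that by (simp add: pos_divide_le_eq mult.commute)
    have "(\<Sum>i=1..n. \<epsilon> i * f (x i))\<^sup>2 / (r * w \<gamma>)\<^sup>2 \<le> (\<Sum>i=1..n. \<Sum>j=1..n. \<epsilon> i * \<epsilon> j * rbf \<gamma> (x i, x j))"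
      by (rule div[OF *]) (rule zero_less_power[OF rw])
    moreover have "(\<Sum>i=1..n. \<epsilon> i * a j \<theta> i) = (\<Sum>i=1..n. \<epsilon> i * f (x i)) / (r * w \<gamma>)"
      by (simp add: a_def \<theta> f_def sum_divide_distrib)
    ultimately show "(\<Sum>i=1..n. \<epsilon> i * a j \<theta> i)\<^sup>2 \<le> (\<Sum>i=1..n. \<Sum>j=1..n. \<epsilon> i * \<epsilon> j * rbf (fst \<theta>) (x i, x j))"
      by (simp add: power_divide \<theta>)
  qed
  have g12: "sign_mean n (\<lambda>\<epsilon>. maximum T (\<lambda>\<theta>. 0 + (\<Sum>i=1..n. \<epsilon> i * (real (card {..<3::nat}) * g k i \<theta>)))) \<le> 24 * C * (J * sqrt (real n))" if k: "k < 2" for k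
  proof -
    have "sign_mean n (\<lambda>\<epsilon>. maximum T (\<lambda>\<theta>. 0 + (\<Sum>i=1..n. \<epsilon> i * (real (card {..<3::nat}) * g k i \<theta>))))
      \<le> sign_mean n (\<lambda>\<epsilon>. 24 * C * maximum T (\<lambda>\<theta>. \<Sum>i=1..n. \<epsilon> i * a k \<theta> i))"
    proof (rule sign_mean_mono)
      fix \<epsilon>
      have "0 + (\<Sum>i=1..n. \<epsilon> i * (real (card {..<3::nat}) * g k i \<theta>)) = 24 * C * (\<Sum>i=1..n. \<epsilon> i * a k \<theta> i)" for \<theta>
        using k by (simp add: g_def sum_distrib_left mult_ac)
      thus "maximum T (\<lambda>\<theta>. 0 + (\<Sum>i=1..n. \<epsilon> i * (real (card {..<3::nat}) * g k i \<theta>))) \<le> 24 * C * maximum T (\<lambda>\<theta>. \<Sum>i=1..n. \<epsilon> i * a k \<theta> i)"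
        using maximum_cmult_le[OF T(1,2), of "24 * C" "\<lambda>\<theta>. \<Sum>i=1..n. \<epsilon> i * a k \<theta> i"] C by (simp only:)
    qed
    also have "\<dots> = 24 * C * sign_mean n (\<lambda>\<epsilon>. maximum T (\<lambda>\<theta>. \<Sum>i=1..n. \<epsilon> i * a k \<theta> i))"
      by (rule sign_mean_cmult)
    also have "\<dots> \<le> 24 * C * (J * sqrt (real n))"
      using C by (intro mult_left_mono lin) auto
    finally show ?thesis .
  qed
  \<comment> \<open>This class is the sum of the signs times a scale of at most 1 / C. Its absolute
    value is linearised by 2 |y| \<le> y^2 / s + s with s = sqrt n, and the mean of y^2 is
    n.\<close>
  have g3: "sign_mean n (\<lambda>\<epsilon>. maximum T (\<lambda>\<theta>. 0 + (\<Sum>i=1..n. \<epsilon> i * (real (card {..<3::nat}) * g 2 i \<theta>)))) \<le> 72 * C * sqrt (real n)"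
  proof -
    define s where "s = sqrt (real n)"
    have s: "s > 0" "s\<^sup>2 = real n" using n by (auto simp: s_def)
    have "sign_mean n (\<lambda>\<epsilon>. maximum T (\<lambda>\<theta>. 0 + (\<Sum>i=1..n. \<epsilon> i * (real (card {..<3::nat}) * g 2 i \<theta>))))
      \<le> sign_mean n (\<lambda>\<epsilon>. 36 * C / s * (\<Sum>i=1..n. \<epsilon> i)\<^sup>2 + 36 * C * s)"
    proof (rule sign_mean_mono)
      fix \<epsilon> :: "nat \<Rightarrow> real"
      define y where "y = (\<Sum>i=1..n. \<epsilon> i)"
      have "0 + (\<Sum>i=1..n. \<epsilon> i * (real (card {..<3::nat}) * g 2 i \<theta>)) \<le> 36 * C / s * y\<^sup>2 + 36 * C * s" if t: "\<theta> \<in> T" for \<theta>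
      proof -
        have "0 + (\<Sum>i=1..n. \<epsilon> i * (real (card {..<3::nat}) * g 2 i \<theta>)) = y * (72 * C\<^sup>2 * \<rho> \<theta>)"
          by (simp add: g_def y_def sum_distrib_right mult.assoc)
        also have "\<dots> = 72 * C\<^sup>2 * \<rho> \<theta> * y"
          by (rule mult.commute)
        also have "\<dots> \<le> 72 * C\<^sup>2 * \<rho> \<theta> * \<bar>y\<bar>"
          using \<rho>(1)[OF t] by (intro mult_left_mono) auto
        also have "\<dots> \<le> 72 * C\<^sup>2 * (1 / C) * \<bar>y\<bar>"
          using \<rho>(2)[OF t] by (intro mult_right_mono mult_left_mono) auto
        also have "\<dots> = 36 * C * (2 * \<bar>y\<bar>)"
          using C by (simp add: power2_eq_square)
        also have "2 * \<bar>y\<bar> \<le> y\<^sup>2 / s + s"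
        proof -
          have "0 \<le> (\<bar>y\<bar> - s)\<^sup>2" by simp
          hence "2 * \<bar>y\<bar> * s \<le> y\<^sup>2 + s\<^sup>2" by (simp add: power2_diff algebra_simps)
          hence "2 * \<bar>y\<bar> \<le> (y\<^sup>2 + s\<^sup>2) / s" using s by (simp add: pos_le_divide_eq)
          thus ?thesis using s by (simp add: add_divide_distrib power2_eq_square)
        qed
        finally show ?thesis
          using C by (simp add: distrib_left)
      qed
      thus "maximum T (\<lambda>\<theta>. 0 + (\<Sum>i=1..n. \<epsilon> i * (real (card {..<3::nat}) * g 2 i \<theta>))) \<le> 36 * C / s * (\<Sum>i=1..n. \<epsilon> i)\<^sup>2 + 36 * C * s"
        unfolding maximum_le_iff[OF T(1,2)] y_def by blast
    qed
    also have "\<dots> = 36 * C / s * real n + 36 * C * s"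
      by (simp only: sign_mean_add sign_mean_cmult sign_mean_const sign_mean_square)
    also have "\<dots> = 72 * C * s"
      using s by (simp add: s(2)[symmetric] power2_eq_square)
    finally show ?thesis by (simp add: s_def)
  qed
  have "sign_mean n (\<lambda>\<epsilon>. maximum T (\<lambda>\<theta>. (\<Sum>k\<in>{..<3::nat}. 0) + (\<Sum>i=1..n. \<epsilon> i * F i \<theta>)))
    \<le> (\<Sum>k\<in>{..<3}. sign_mean n (\<lambda>\<epsilon>. maximum T (\<lambda>\<theta>. 0 + (\<Sum>i=1..n. \<epsilon> i * (real (card {..<3::nat}) * g k i \<theta>)))))"
    by (rule sign_mean_contraction[OF T(1,2) K lip])
  \<comment> \<open>The contraction factor is 3, so 24 = 3 * 8 and 72 = 3 * 24; with J \<ge> 1 the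
    total is 24 + 24 + 72 = 120.\<close>
  also have "\<dots> \<le> 24 * C * (J * sqrt (real n)) + 24 * C * (J * sqrt (real n)) + 72 * C * sqrt (real n)"
  proof -
    have "(\<Sum>k\<in>{..<3}. h k) = h 0 + h 1 + h 2" for h :: "nat \<Rightarrow> real"
      by (simp add: numeral_3_eq_3 numeral_2_eq_2)
    thus ?thesis
      using g12[of 0] g12[of 1] g3 by (simp only:) linarith
  qed
  also have "\<dots> \<le> 48 * C * (J * sqrt (real n)) + 72 * C * (J * sqrt (real n))"
    using C J_ge_1 mult_right_mono[of 1 J "sqrt (real n)"] by (simp add: mult_left_mono)
  also have "\<dots> = 120 * C * J * sqrt (real n)" by (simp add: algebra_simps)
  finally have "sign_mean n (\<lambda>\<epsilon>. maximum T (\<lambda>\<theta>. \<Sum>i=1..n. \<epsilon> i * F i \<theta>)) \<le> 120 * C * J * sqrt (real n)"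
    by simp
  moreover have "(\<lambda>\<theta>. \<Sum>i=1..n. \<epsilon> i * F i \<theta>) = (\<lambda>(\<gamma>, r, f1, f2). \<Sum>i=1..n. \<epsilon> i * (2 * (\<sigma> * (1 / (r * w \<gamma>) * sqd f1 f2 (x i)))))" for \<epsilon>
    by (auto simp: F_def fun_eq_iff)
  ultimately show ?thesis by (simp only:)
qed

text \<open>The bound of the deviation event divided by \<open>r * w \<gamma>\<close>, and thus the
  same for all widths and radii.\<close>

definition rate :: "nat \<Rightarrow> real \<Rightarrow> real" where
  "rate n t = 151 * J * C * sqrt t / sqrt (real n) + 8 * C * t / (3 * real n)"

lemma rate_nonneg: "t \<ge> 0 \<Longrightarrow> 0 \<le> rate n t"
  using C J_ge_1 by (simp add: rate_def)

text \<open>\<open>one_sided_deviation\<close> for the normalised class, with \<sigma> selecting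
  upper or lower deviations. The exponent 2 t leaves room for a union of the two sides.\<close>

lemma one_sided_adm:
  assumes T: "finite T" "T \<noteq> {}" "\<And>\<theta>. \<theta> \<in> T \<Longrightarrow> adm \<theta>" and n: "n \<ge> 1" and t: "t \<ge> 1" and sg: "\<sigma> = 1 \<or> \<sigma> = -1"
  shows "measure (P.sample_space n) {x \<in> space (P.sample_space n). \<exists>(\<gamma>, r, f1, f2)\<in>T. \<sigma> * dev n x f1 f2 > rate n t * (r * w \<gamma>)} \<le> exp (- (2 * t))"
    and "{x \<in> space (P.sample_space n). \<exists>(\<gamma>, r, f1, f2)\<in>T. \<sigma> * dev n x f1 f2 > rate n t * (r * w \<gamma>)} \<in> sets (P.sample_space n)"
proof -
  interpret s: prob_space "P.sample_space n" by (rule P.prob_space_sample_space)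
  have adm: "\<gamma> \<in> \<Gamma>" "C \<le> r * w \<gamma>" "f1 \<in> ball \<gamma> r" "f2 \<in> ball \<gamma> r" if "(\<gamma>, r, f1, f2) \<in> T" for \<gamma> r f1 f2
    using T(3)[OF that] by (auto simp: adm_def)
  have meas: "f1 \<in> borel_measurable P" "f2 \<in> borel_measurable P" if "(\<gamma>, r, f1, f2) \<in> T" for \<gamma> r f1 f2
    using adm[OF that] by (auto intro!: H_measurable simp: rkhs_ball_def)
  have rw: "r * w \<gamma> > 0" if "(\<gamma>, r, f1, f2) \<in> T" for \<gamma> r f1 f2
    using adm(2)[OF that] C by linarith
  have pt: "x i \<in> S" if "x \<in> space (P.sample_space n)" "i \<in> {1..n}" for x i
    using that by (auto simp: space_PiM space_P)
  define f where "f = (\<lambda>(\<gamma>, r, f1, f2) x. \<sigma> * (1 / (r * w \<gamma>) * sqd f1 f2 x))"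
  \<comment> \<open>The normalised values lie between 0 and 4 C, or between - 4 C and 0 after the
    change of sign.\<close>
  define lo where "lo = (if \<sigma> = 1 then 0 else - (4 * C))"
  define R where "R = 120 * C * J * sqrt (real n)"
  define c where "c = R + 4 * C * sqrt (real n * t)"
  have f_m: "f \<theta> \<in> borel_measurable P" if "\<theta> \<in> T" for \<theta>
  proof -
    obtain \<gamma> r f1 f2 where \<theta>: "\<theta> = (\<gamma>, r, f1, f2)" by (cases \<theta>)
    have "sqd f1 f2 \<in> borel_measurable P"
      using meas that unfolding \<theta> by (intro sqd_measurable) blast+
    thus ?thesis
      unfolding f_def \<theta> prod.case by (intro borel_measurable_times borel_measurable_const)
  qed
  have f_range: "f \<theta> x \<in> {lo..lo + 4 * C}" if \<theta>T: "\<theta> \<in> T" and x: "x \<in> space P" for \<theta> x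
  proof -
    obtain \<gamma> r f1 f2 where \<theta>: "\<theta> = (\<gamma>, r, f1, f2)" by (cases \<theta>)
    note ad = adm[OF \<theta>T[unfolded \<theta>]] and rw' = rw[OF \<theta>T[unfolded \<theta>]]
    define q where "q = 1 / (r * w \<gamma>) * sqd f1 f2 x"
    have "sqd f1 f2 x \<le> 4 * C * (r * w \<gamma>)"
      using x space_P by (intro sqd_ball_le ad) auto
    hence "q \<le> 4 * C"
      using rw' unfolding q_def by (simp add: pos_divide_le_eq)
    moreover have "q \<ge> 0"
      unfolding q_def using rw' sqd_nonneg by (intro mult_nonneg_nonneg) auto
    ultimately have "\<sigma> * q \<in> {lo..lo + 4 * C}"
      using sg C by (auto simp: lo_def)
    thus ?thesis by (simp add: f_def \<theta> q_def)
  qed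
  have R: "sign_mean n (\<lambda>\<epsilon>. maximum T (\<lambda>\<theta>. \<Sum>i=1..n. \<epsilon> i * (2 * f \<theta> (x i)))) \<le> R" if x: "x \<in> space (P.sample_space n)" for x
  proof -
    have "(\<lambda>\<theta>. \<Sum>i=1..n. \<epsilon> i * (2 * f \<theta> (x i))) = (\<lambda>(\<gamma>, r, f1, f2). \<Sum>i=1..n. \<epsilon> i * (2 * (\<sigma> * (1 / (r * w \<gamma>) * sqd f1 f2 (x i)))))" for \<epsilon>
      by (rule ext) (simp add: f_def split: prod.split)
    thus ?thesis
      unfolding R_def by (simp only:) (rule sign_mean_adm_class[OF T n pt[OF x] sg])
  qed
  let ?A = "{x \<in> space (P.sample_space n). \<exists>\<theta>\<in>T. (\<Sum>i=1..n. f \<theta> (x i) - (\<integral>y. f \<theta> y \<partial>P)) \<ge> R + 4 * C * sqrt (real n * t)}"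
  let ?B = "{x \<in> space (P.sample_space n). \<exists>(\<gamma>, r, f1, f2)\<in>T. \<sigma> * dev n x f1 f2 > rate n t * (r * w \<gamma>)}"
  have A: "measure (P.sample_space n) ?A \<le> exp (- (2 * t))"
    using C t by (intro P.one_sided_deviation[OF T(1,2) f_m f_range _ R n]) auto
  have comp: "(\<lambda>x. f \<theta> (x i)) \<in> borel_measurable (P.sample_space n)" if "\<theta> \<in> T" "i \<in> {1..n}" for \<theta> i
    by (rule measurable_compose[OF measurable_component_singleton[OF that(2)] f_m[OF that(1)]])
  have A_sets: "?A \<in> sets (P.sample_space n)"
    using T(1) comp
    by (intro sets.sets_Collect_finite_Ex borel_measurable_le borel_measurable_const borel_measurable_sum borel_measurable_diff) auto
  have dev_f: "\<sigma> * dev n x f1 f2 = (r * w \<gamma>) / real n * (\<Sum>i=1..n. f (\<gamma>, r, f1, f2) (x i) - (\<integral>y. f (\<gamma>, r, f1, f2) y \<partial>P))"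
    if \<theta>: "(\<gamma>, r, f1, f2) \<in> T" for \<gamma> r f1 f2 x
  proof -
    have "(\<integral>y. f (\<gamma>, r, f1, f2) y \<partial>P) = \<sigma> * (1 / (r * w \<gamma>) * (\<integral>y. sqd f1 f2 y \<partial>P))"
      by (simp add: f_def)
    hence "(\<Sum>i=1..n. f (\<gamma>, r, f1, f2) (x i) - (\<integral>y. f (\<gamma>, r, f1, f2) y \<partial>P))
        = \<sigma> / (r * w \<gamma>) * ((\<Sum>i=1..n. sqd f1 f2 (x i)) - real n * (\<integral>y. sqd f1 f2 y \<partial>P))"
      by (simp add: f_def sum_subtractf sum_distrib_left right_diff_distrib)
    also have "\<dots> = \<sigma> / (r * w \<gamma>) * (real n * dev n x f1 f2)"
      using n by (simp add: dev_def right_diff_distrib)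
    finally have "(\<Sum>i=1..n. f (\<gamma>, r, f1, f2) (x i) - (\<integral>y. f (\<gamma>, r, f1, f2) y \<partial>P)) = \<sigma> / (r * w \<gamma>) * (real n * dev n x f1 f2)" .
    moreover have "w \<gamma> \<noteq> 0" "r \<noteq> 0"
      using rw[OF \<theta>] by auto
    ultimately show ?thesis
      using n by simp
  qed
  have dev_m: "(\<lambda>x. \<sigma> * dev n x f1 f2) \<in> borel_measurable (P.sample_space n)" if \<theta>: "(\<gamma>, r, f1, f2) \<in> T" for \<gamma> r f1 f2
    unfolding dev_f[OF \<theta>] using comp[OF \<theta>]
    by (intro borel_measurable_times borel_measurable_const borel_measurable_sum borel_measurable_diff)
  have "?B = {x \<in> space (P.sample_space n). \<exists>\<theta>\<in>T. rate n t * (fst (snd \<theta>) * w (fst \<theta>)) < \<sigma> * dev n x (fst (snd (snd \<theta>))) (snd (snd (snd \<theta>)))}"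
    by (auto simp: split_beta')
  also have "\<dots> \<in> sets (P.sample_space n)"
  proof (intro sets.sets_Collect_finite_Ex T(1) borel_measurable_less borel_measurable_const)
    fix \<theta> assume "\<theta> \<in> T"
    thus "(\<lambda>x. \<sigma> * dev n x (fst (snd (snd \<theta>))) (snd (snd (snd \<theta>)))) \<in> borel_measurable (P.sample_space n)"
      using dev_m[of "fst \<theta>" "fst (snd \<theta>)" "fst (snd (snd \<theta>))" "snd (snd (snd \<theta>))"] by simp
  qed
  finally show "?B \<in> sets (P.sample_space n)" .
  have "?B \<subseteq> ?A"
  proof safe
    fix x \<gamma> r f1 f2 assume x: "x \<in> space (P.sample_space n)" and \<theta>: "(\<gamma>, r, f1, f2) \<in> T"
      and gt: "rate n t * (r * w \<gamma>) < \<sigma> * dev n x f1 f2"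
    define z where "z = (\<Sum>i=1..n. f (\<gamma>, r, f1, f2) (x i) - (\<integral>y. f (\<gamma>, r, f1, f2) y \<partial>P))"
    have "rate n t * (r * w \<gamma>) < (z / real n) * (r * w \<gamma>)"
      using gt unfolding dev_f[OF \<theta>] z_def[symmetric] by (simp add: mult.commute)
    hence "rate n t < z / real n"
      by (rule mult_right_less_imp_less) (rule less_imp_le[OF rw[OF \<theta>]])
    hence zr: "rate n t * real n < z"
      using n by (simp add: pos_less_divide_eq)
    \<comment> \<open>120 from the mean and 4 from the deviation, both with t \<ge> 1 and J \<ge> 1
      inserted, give 124, which is below 151.\<close>
    have "R + 4 * C * sqrt (real n * t) \<le> 151 * J * C * sqrt t * sqrt (real n)"
    proof -
      have "1 \<le> sqrt t" using t by simp
      hence "R \<le> R * sqrt t"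
        using C J_ge_1 n by (simp add: R_def)
      moreover have "4 * C * sqrt (real n * t) \<le> J * (4 * C * sqrt (real n * t))"
        using mult_right_mono[OF J_ge_1, of "4 * C * sqrt (real n * t)"] C t by simp
      moreover have "0 \<le> J * C * sqrt t * sqrt (real n)"
        using C J_ge_1 t by simp
      moreover have "R * sqrt t + J * (4 * C * sqrt (real n * t)) = 124 * (J * C * sqrt t * sqrt (real n))"
        by (simp add: R_def real_sqrt_mult algebra_simps)
      ultimately show ?thesis by linarith
    qed
    also have "\<dots> \<le> rate n t * real n"
    proof -
      have "rate n t * real n = 151 * J * C * sqrt t * (real n / sqrt (real n)) + 8 * C * t / 3"
        using n by (simp add: rate_def distrib_right)
      also have "real n / sqrt (real n) = sqrt (real n)"
        by (simp add: real_div_sqrt)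
      finally show ?thesis using C t by simp
    qed
    finally have "R + 4 * C * sqrt (real n * t) \<le> z" using zr by linarith
    thus "\<exists>\<theta>\<in>T. R + 4 * C * sqrt (real n * t) \<le> (\<Sum>i=1..n. f \<theta> (x i) - (\<integral>y. f \<theta> y \<partial>P))"
      unfolding z_def using \<theta> by blast
  qed
  hence "measure (P.sample_space n) ?B \<le> measure (P.sample_space n) ?A"
    using A_sets by (rule s.finite_measure_mono)
  thus "measure (P.sample_space n) ?B \<le> exp (- (2 * t))"
    using A by linarith
qed

end

section \<open>From finite classes to all widths, radii and functions\<close>

context gaussian_class
begin

text \<open>The bad events of the initial segments of an enumeration increase to the bad event of T,
  so their common bound passes to the union by continuity of measure.\<close>

lemma countable_adm:
  assumes T: "countable T" "\<And>\<theta>. \<theta> \<in> T \<Longrightarrow> adm \<theta>" and n: "n \<ge> 1" and t: "t \<ge> 1"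
  defines "G \<equiv> {x \<in> space (P.sample_space n). \<forall>(\<gamma>, r, f1, f2)\<in>T. \<bar>dev n x f1 f2\<bar> \<le> rate n t * (r * w \<gamma>)}"
  shows "G \<in> sets (P.sample_space n)" "measure (P.sample_space n) G \<ge> 1 - exp (- t)"
proof -
  interpret s: prob_space "P.sample_space n" by (rule P.prob_space_sample_space)
  have "G \<in> sets (P.sample_space n) \<and> measure (P.sample_space n) G \<ge> 1 - exp (- t)"
  proof (cases "T = {}")
    case True
    hence "G = space (P.sample_space n)" by (auto simp: G_def)
    thus ?thesis using s.prob_space by simp
  next
    case False
    define e where "e = from_nat_into T"
    have e: "range e = T"
      unfolding e_def by (rule range_from_nat_into[OF False T(1)])
    define V where "V \<sigma> \<theta> x = (case \<theta> of (\<gamma>, r, f1, f2) \<Rightarrow> \<sigma> * dev n x f1 f2 > rate n t * (r * w \<gamma>))"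
      for \<sigma> :: real and \<theta> and x :: "nat \<Rightarrow> real^'d"
    define bad where "bad \<sigma> m = {x \<in> space (P.sample_space n). \<exists>\<theta>\<in>e ` {..m}. V \<sigma> \<theta> x}" for \<sigma> :: real and m :: nat
    have G_V: "G = {x \<in> space (P.sample_space n). \<forall>\<theta>\<in>T. \<not> V 1 \<theta> x \<and> \<not> V (-1) \<theta> x}"
    proof -
      have "(case \<theta> of (\<gamma>, r, f1, f2) \<Rightarrow> \<bar>dev n x f1 f2\<bar> \<le> rate n t * (r * w \<gamma>)) \<longleftrightarrow> \<not> V 1 \<theta> x \<and> \<not> V (-1) \<theta> x" for \<theta> x
        by (cases \<theta>) (auto simp: V_def)
      thus ?thesis unfolding G_def by simp
    qed
    have fin: "finite (e ` {..m})" "e ` {..m} \<noteq> {}" for m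
      by auto
    have fin_adm: "adm \<theta>" if "\<theta> \<in> e ` {..m}" for \<theta> m
    proof (rule T(2))
      show "\<theta> \<in> T" using that unfolding e[symmetric] by blast
    qed
    have bad: "bad \<sigma> m \<in> sets (P.sample_space n)" "measure (P.sample_space n) (bad \<sigma> m) \<le> exp (- (2 * t))" if "\<sigma> = 1 \<or> \<sigma> = -1" for \<sigma> m
      unfolding bad_def V_def
      by (rule one_sided_adm(2)[OF fin _ n t that], erule fin_adm) (rule one_sided_adm(1)[OF fin _ n t that], erule fin_adm)
    define B where "B m = bad 1 m \<union> bad (-1) m" for m
    have B_sets: "B m \<in> sets (P.sample_space n)" for m
      unfolding B_def using bad(1) by (intro sets.Un) auto
    have B_le: "measure (P.sample_space n) (B m) \<le> exp (- t)" for m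
    proof -
      have "measure (P.sample_space n) (B m) \<le> measure (P.sample_space n) (bad 1 m) + measure (P.sample_space n) (bad (-1) m)"
        unfolding B_def using bad(1) by (intro measure_Un_le) auto
      also have "\<dots> \<le> 2 * exp (- (2 * t))"
        using bad(2)[of 1 m] bad(2)[of "-1" m] by simp
      also have "\<dots> = (2 * exp (- t)) * exp (- t)"
        by (simp add: exp_add[symmetric])
      \<comment> \<open>exp t \<ge> 1 + t \<ge> 2 absorbs the factor 2 from the two sides.\<close>
      also have "\<dots> \<le> 1 * exp (- t)"
      proof (rule mult_right_mono)
        have "2 \<le> exp t" using exp_ge_add_one_self[of t] t by linarith
        thus "2 * exp (- t) \<le> 1" by (simp add: exp_minus field_simps)
      qed simp
      finally show ?thesis by simp
    qed
    have mono: "incseq B"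
    proof (rule incseq_SucI)
      fix m
      have sub: "e ` {..m} \<subseteq> e ` {..Suc m}" by (intro image_mono) simp
      have "bad \<sigma> m \<subseteq> bad \<sigma> (Suc m)" for \<sigma>
        unfolding bad_def using sub by blast
      thus "B m \<subseteq> B (Suc m)" unfolding B_def by (intro Un_mono)
    qed
    have "(\<lambda>m. measure (P.sample_space n) (B m)) \<longlonglongrightarrow> measure (P.sample_space n) (\<Union>m. B m)"
      using B_sets mono by (intro s.finite_Lim_measure_incseq) auto
    hence U_le: "measure (P.sample_space n) (\<Union>m. B m) \<le> exp (- t)"
      by (rule LIMSEQ_le_const2) (use B_le in blast)
    have "x \<in> (\<Union>m. B m) \<longleftrightarrow> x \<in> space (P.sample_space n) \<and> (\<exists>\<theta>\<in>T. V 1 \<theta> x \<or> V (-1) \<theta> x)" for x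
    proof -
      have ex: "(\<exists>\<theta>\<in>T. Q \<theta>) \<longleftrightarrow> (\<exists>m. \<exists>\<theta>\<in>e ` {..m}. Q \<theta>)" for Q
      proof
        assume "\<exists>\<theta>\<in>T. Q \<theta>"
        then obtain k where "Q (e k)" unfolding e[symmetric] by blast
        moreover have "e k \<in> e ` {..k}" by simp
        ultimately show "\<exists>m. \<exists>\<theta>\<in>e ` {..m}. Q \<theta>" by blast
      next
        assume "\<exists>m. \<exists>\<theta>\<in>e ` {..m}. Q \<theta>"
        thus "\<exists>\<theta>\<in>T. Q \<theta>" unfolding e[symmetric] by blast
      qed
      have "x \<in> B m \<longleftrightarrow> x \<in> space (P.sample_space n) \<and> (\<exists>\<theta>\<in>e ` {..m}. V 1 \<theta> x \<or> V (-1) \<theta> x)" for m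
        unfolding B_def bad_def Un_iff mem_Collect_eq bex_disj_distrib by (simp only: conj_disj_distribL)
      thus ?thesis
        unfolding ex by simp
    qed
    hence G_eq: "G = space (P.sample_space n) - (\<Union>m. B m)"
      unfolding G_V set_eq_iff Diff_iff mem_Collect_eq by simp blast
    have U: "(\<Union>m. B m) \<in> sets (P.sample_space n)"
      using B_sets by (intro sets.countable_UN) auto
    have "measure (P.sample_space n) G = 1 - measure (P.sample_space n) (\<Union>m. B m)"
      unfolding G_eq by (rule s.prob_compl[OF U])
    moreover have "G \<in> sets (P.sample_space n)"
      unfolding G_eq by (intro sets.Diff sets.top U)
    ultimately show ?thesis
      using U_le by linarith
  qed
  thus "G \<in> sets (P.sample_space n)" "measure (P.sample_space n) G \<ge> 1 - exp (- t)" by auto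
qed

text \<open>Clipping makes the squared differences uniformly bounded, so pointwise convergence
  suffices by dominated convergence.\<close>

lemma dev_tendsto:
  assumes f: "\<And>m. f m \<in> borel_measurable P" "\<And>m. f' m \<in> borel_measurable P" "g \<in> borel_measurable P" "g' \<in> borel_measurable P"
    and lim: "\<And>z. z \<in> S \<Longrightarrow> (\<lambda>m. f m z) \<longlonglongrightarrow> g z" "\<And>z. z \<in> S \<Longrightarrow> (\<lambda>m. f' m z) \<longlonglongrightarrow> g' z"
    and x: "\<And>i. i \<in> {1..n} \<Longrightarrow> x i \<in> S"
  shows "(\<lambda>m. dev n x (f m) (f' m)) \<longlonglongrightarrow> dev n x g g'"
proof -
  have sq: "(\<lambda>m. sqd (f m) (f' m) z) \<longlonglongrightarrow> sqd g g' z" if "z \<in> S" for z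
    unfolding sqd_def clip_def using lim[OF that] by (intro tendsto_intros)
  have "(\<lambda>m. \<integral>z. sqd (f m) (f' m) z \<partial>P) \<longlonglongrightarrow> (\<integral>z. sqd g g' z \<partial>P)"
  proof (rule integral_dominated_convergence[where w="\<lambda>_. 4 * C\<^sup>2"])
    show "AE z in P. (\<lambda>m. sqd (f m) (f' m) z) \<longlonglongrightarrow> sqd g g' z"
      using sq by (intro AE_I2) (simp add: space_P)
    show "AE z in P. norm (sqd (f m) (f' m) z) \<le> 4 * C\<^sup>2" for m
      using sqd_nonneg sqd_le by (intro AE_I2) simp
    show "sqd g g' \<in> borel_measurable P" "\<And>m. sqd (f m) (f' m) \<in> borel_measurable P"
      by (intro sqd_measurable f)+
  qed simp
  moreover have "(\<lambda>m. (1 / real n) * (\<Sum>i=1..n. sqd (f m) (f' m) (x i))) \<longlonglongrightarrow> (1 / real n) * (\<Sum>i=1..n. sqd g g' (x i))"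
    by (intro tendsto_mult tendsto_const tendsto_sum sq x)
  ultimately show ?thesis
    unfolding dev_def by (rule tendsto_diff[rotated])
qed

lemma unit_ball_dense:
  assumes \<gamma>: "\<gamma> \<in> \<Gamma>"
  shows "\<exists>D. countable D \<and> D \<subseteq> ball \<gamma> 1 \<and> (\<forall>f\<in>ball \<gamma> 1. \<exists>h. (\<forall>m::nat. h m \<in> D) \<and> (\<forall>x\<in>S. (\<lambda>m. h m x) \<longlonglongrightarrow> f x))"
proof -
  interpret rkhs S "gauss_kernel \<gamma>" "H \<gamma>" "ip \<gamma>" by (rule rkhs'[OF \<gamma>])
  obtain S0 where S0: "countable S0" "S0 \<subseteq> S" "\<forall>a\<in>S. \<exists>s. (\<forall>m::nat. s m \<in> S0) \<and> s \<longlonglongrightarrow> a"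
    by (rule countable_sequentially_dense)
  have "\<exists>s. (\<forall>m::nat. s m \<in> S0) \<and> (\<lambda>m. gauss_kernel \<gamma> x x + gauss_kernel \<gamma> (s m) (s m) - 2 * gauss_kernel \<gamma> x (s m)) \<longlonglongrightarrow> 0" if x: "x \<in> S" for x
  proof -
    obtain s where s: "\<forall>m::nat. s m \<in> S0" "s \<longlonglongrightarrow> x"
      using bspec[OF S0(3) x] by blast
    show ?thesis
      by (intro exI[of _ s] conjI s(1) kernel_metric_tendsto \<gamma> s(2))
  qed
  note dense = this
  show ?thesis
  proof (rule countable_pointwise_dense_ball[OF S0(1,2) dense S])
    fix D assume "countable D" "D \<subseteq> ball \<gamma> 1"
      "\<And>f. f \<in> ball \<gamma> 1 \<Longrightarrow> \<exists>h. (\<forall>m::nat. h m \<in> D) \<and> (\<forall>x\<in>S. (\<lambda>m. h m x) \<longlonglongrightarrow> f x)"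
    thus ?thesis by blast
  qed
qed

lemma w_tendsto: "\<gamma> \<in> \<Gamma> \<Longrightarrow> s \<longlonglongrightarrow> \<gamma> \<Longrightarrow> (\<lambda>m. w (s m)) \<longlonglongrightarrow> w \<gamma>"
  unfolding w_def using \<gamma>_pos[of \<gamma>] by (intro tendsto_intros) auto

lemma ball_measurable: "\<gamma> \<in> \<Gamma> \<Longrightarrow> f \<in> ball \<gamma> r \<Longrightarrow> f \<in> borel_measurable P"
  by (rule H_measurable) (auto simp: rkhs_ball_def)

lemma ball_normalise:
  assumes "\<gamma> \<in> \<Gamma>" "f \<in> ball \<gamma> r" "r > 0"
  obtains h where "h \<in> ball \<gamma> 1" "f = (\<lambda>x. r * h x)"
proof -
  have "(\<lambda>x. 1 / r * f x) \<in> ball \<gamma> (1 / r * r)"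
    using assms(3) by (intro ball_scale[OF assms(1,2)]) auto
  moreover have "f = (\<lambda>x. r * (1 / r * f x))" using assms(3) by auto
  ultimately show thesis using that assms(3) by simp
qed

text \<open>The bound extends from T in stages: to all functions at countably many widths and
  rational radii by pointwise density, to all widths and all radii with C \<le> r w(\<gamma>) by
  monotonicity of the balls, and to small radii by scaling. The set T depends neither on the sample
  nor on K.\<close>

lemma countable_reduction:
  obtains T where "countable T" "\<And>\<theta>. \<theta> \<in> T \<Longrightarrow> adm \<theta>"
    "\<And>n x K. K \<ge> 0 \<Longrightarrow> (\<And>i. i \<in> {1..n} \<Longrightarrow> x i \<in> S) \<Longrightarrow>
      \<forall>(\<gamma>, r, f1, f2)\<in>T. \<bar>dev n x f1 f2\<bar> \<le> K * (r * w \<gamma>) \<Longrightarrow>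
      \<forall>\<gamma>\<in>\<Gamma>. \<forall>r\<ge>0. \<forall>f1\<in>ball \<gamma> r. \<forall>f2\<in>ball \<gamma> r. \<bar>dev n x f1 f2\<bar> \<le> K * (r * w \<gamma>)"
proof -
  define dense where "dense \<gamma> D \<longleftrightarrow> countable D \<and> D \<subseteq> ball \<gamma> 1 \<and>
    (\<forall>f\<in>ball \<gamma> 1. \<exists>h. (\<forall>m::nat. h m \<in> D) \<and> (\<forall>x\<in>S. (\<lambda>m. h m x) \<longlonglongrightarrow> f x))" for \<gamma> D
  define D where "D \<gamma> = (SOME D. dense \<gamma> D)" for \<gamma>
  have dense: "dense \<gamma> (D \<gamma>)" if "\<gamma> \<in> \<Gamma>" for \<gamma>
    using unit_ball_dense[OF that] unfolding dense_def[symmetric] D_def by (rule someI_ex)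
  have D: "countable (D \<gamma>)" if "\<gamma> \<in> \<Gamma>" for \<gamma>
    by (rule dense[OF that, unfolded dense_def, THEN conjunct1])
  have D_sub: "D \<gamma> \<subseteq> ball \<gamma> 1" if "\<gamma> \<in> \<Gamma>" for \<gamma>
    by (rule dense[OF that, unfolded dense_def, THEN conjunct2, THEN conjunct1])
  have D_lim: "\<forall>f\<in>ball \<gamma> 1. \<exists>h. (\<forall>m::nat. h m \<in> D \<gamma>) \<and> (\<forall>x\<in>S. (\<lambda>m. h m x) \<longlonglongrightarrow> f x)" if "\<gamma> \<in> \<Gamma>" for \<gamma>
    by (rule dense[OF that, unfolded dense_def, THEN conjunct2, THEN conjunct2])
  define T where "T = (\<Union>\<gamma>\<in>\<Gamma>0. \<Union>q\<in>{q\<in>\<rat>. C \<le> q * w \<gamma>}. \<Union>h1\<in>D \<gamma>. \<Union>h2\<in>D \<gamma>. {(\<gamma>, q, \<lambda>x. q * h1 x, \<lambda>x. q * h2 x)})"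
  have \<Gamma>0': "\<gamma> \<in> \<Gamma>" if "\<gamma> \<in> \<Gamma>0" for \<gamma> using \<Gamma>0(2) that by blast
  have cq: "countable {q \<in> \<rat>. C \<le> q * w \<gamma>}" for \<gamma>
    by (rule countable_subset[OF _ countable_rat]) blast
  have T_count: "countable T"
    unfolding T_def by (intro countable_UN \<Gamma>0(1) cq D \<Gamma>0') auto
  have q_pos: "q > 0" if "C \<le> q * w \<gamma>" "\<gamma> \<in> \<Gamma>" for q \<gamma>
  proof -
    have "0 < q * w \<gamma>" using that(1) C by linarith
    thus ?thesis using w_pos[OF that(2)] by (simp add: zero_less_mult_iff)
  qed
  have T_adm: "adm \<theta>" if "\<theta> \<in> T" for \<theta>
  proof -
    have "\<theta> \<in> (\<Union>\<gamma>\<in>\<Gamma>0. \<Union>q\<in>{q\<in>\<rat>. C \<le> q * w \<gamma>}. \<Union>h1\<in>D \<gamma>. \<Union>h2\<in>D \<gamma>. {(\<gamma>, q, \<lambda>x. q * h1 x, \<lambda>x. q * h2 x)})"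
      using that by (simp only: T_def)
    thus ?thesis
    proof (elim UN_E CollectE conjE singletonE)
      fix \<gamma> q h1 h2
      assume \<gamma>0: "\<gamma> \<in> \<Gamma>0" and h: "h1 \<in> D \<gamma>" "h2 \<in> D \<gamma>" and q: "C \<le> q * w \<gamma>"
        and \<theta>: "\<theta> = (\<gamma>, q, \<lambda>x. q * h1 x, \<lambda>x. q * h2 x)"
      have \<gamma>: "\<gamma> \<in> \<Gamma>" by (rule \<Gamma>0'[OF \<gamma>0])
      have "(\<lambda>x. q * h x) \<in> ball \<gamma> q" if "h \<in> D \<gamma>" for h
        using ball_scale[OF \<gamma> subsetD[OF D_sub[OF \<gamma>] that], of q] q_pos[OF q \<gamma>] by simp
      thus ?thesis using \<theta> \<gamma> q h by (simp add: adm_def)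
    qed
  qed
  have main: "\<forall>\<gamma>\<in>\<Gamma>. \<forall>r\<ge>0. \<forall>f1\<in>ball \<gamma> r. \<forall>f2\<in>ball \<gamma> r. \<bar>dev n x f1 f2\<bar> \<le> K * (r * w \<gamma>)"
    if K: "K \<ge> 0" and x: "\<And>i. i \<in> {1..n} \<Longrightarrow> x i \<in> S" and T: "\<forall>(\<gamma>, r, f1, f2)\<in>T. \<bar>dev n x f1 f2\<bar> \<le> K * (r * w \<gamma>)" for n x K
  proof -
    have step1: "\<bar>dev n x f1 f2\<bar> \<le> K * (q * w \<gamma>)"
      if \<gamma>0: "\<gamma> \<in> \<Gamma>0" and q: "q \<in> \<rat>" "C \<le> q * w \<gamma>" and f: "f1 \<in> ball \<gamma> q" "f2 \<in> ball \<gamma> q" for \<gamma> q f1 f2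
    proof -
      have \<gamma>: "\<gamma> \<in> \<Gamma>" by (rule \<Gamma>0'[OF \<gamma>0])
      have q0: "q > 0" by (rule q_pos[OF q(2) \<gamma>])
      obtain h1 where h1: "h1 \<in> ball \<gamma> 1" "f1 = (\<lambda>x. q * h1 x)" by (rule ball_normalise[OF \<gamma> f(1) q0])
      obtain h2 where h2: "h2 \<in> ball \<gamma> 1" "f2 = (\<lambda>x. q * h2 x)" by (rule ball_normalise[OF \<gamma> f(2) q0])
      obtain s1 where s1: "\<forall>m::nat. s1 m \<in> D \<gamma>" "\<forall>x\<in>S. (\<lambda>m. s1 m x) \<longlonglongrightarrow> h1 x"
        using bspec[OF D_lim[OF \<gamma>] h1(1)] by blast
      obtain s2 where s2: "\<forall>m::nat. s2 m \<in> D \<gamma>" "\<forall>x\<in>S. (\<lambda>m. s2 m x) \<longlonglongrightarrow> h2 x"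
        using bspec[OF D_lim[OF \<gamma>] h2(1)] by blast
      have in_T: "(\<gamma>, q, \<lambda>x. q * s1 m x, \<lambda>x. q * s2 m x) \<in> T" for m
        unfolding T_def using \<gamma>0 q s1(1) s2(1) by blast
      have sb: "s1 m \<in> ball \<gamma> 1" "s2 m \<in> ball \<gamma> 1" for m
        using s1(1) s2(1) D_sub[OF \<gamma>] by blast+
      have "(\<lambda>m. dev n x (\<lambda>x. q * s1 m x) (\<lambda>x. q * s2 m x)) \<longlonglongrightarrow> dev n x f1 f2"
      proof (rule dev_tendsto[OF _ _ _ _ _ _ x])
        show "(\<lambda>x. q * s1 m x) \<in> borel_measurable P" "(\<lambda>x. q * s2 m x) \<in> borel_measurable P" for m
          using ball_measurable[OF \<gamma> sb(1)] ball_measurable[OF \<gamma> sb(2)] by (intro borel_measurable_times borel_measurable_const; blast)+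
        show "f1 \<in> borel_measurable P" "f2 \<in> borel_measurable P"
          using ball_measurable[OF \<gamma>] f by blast+
        show "(\<lambda>m. q * s1 m z) \<longlonglongrightarrow> f1 z" if "z \<in> S" for z
          unfolding h1(2) using s1(2) that by (intro tendsto_mult tendsto_const) blast
        show "(\<lambda>m. q * s2 m z) \<longlonglongrightarrow> f2 z" if "z \<in> S" for z
          unfolding h2(2) using s2(2) that by (intro tendsto_mult tendsto_const) blast
      qed
      hence "(\<lambda>m. \<bar>dev n x (\<lambda>x. q * s1 m x) (\<lambda>x. q * s2 m x)\<bar>) \<longlonglongrightarrow> \<bar>dev n x f1 f2\<bar>"
        by (rule tendsto_rabs)
      moreover have "\<bar>dev n x (\<lambda>x. q * s1 m x) (\<lambda>x. q * s2 m x)\<bar> \<le> K * (q * w \<gamma>)" for m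
        using bspec[OF T in_T[of m]] by simp
      ultimately show ?thesis
        by (intro LIMSEQ_le_const2[where X="\<lambda>m. \<bar>dev n x (\<lambda>x. q * s1 m x) (\<lambda>x. q * s2 m x)\<bar>"]) blast+
    qed
    \<comment> \<open>Widths increase to \<gamma> and rational radii decrease to r. Every
      approximating ball contains the given one, and the bounds converge.\<close>
    have step2: "\<bar>dev n x f1 f2\<bar> \<le> K * (r * w \<gamma>)"
      if \<gamma>: "\<gamma> \<in> \<Gamma>" and r: "C \<le> r * w \<gamma>" and f: "f1 \<in> ball \<gamma> r" "f2 \<in> ball \<gamma> r" for \<gamma> r f1 f2
    proof -
      have r0: "r > 0" by (rule q_pos[OF r \<gamma>])
      obtain s where s: "\<forall>m::nat. s m \<in> \<Gamma>0 \<and> s m \<le> \<gamma>" "s \<longlonglongrightarrow> \<gamma>"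
        using \<Gamma>0(3)[OF \<gamma>] by blast
      have "\<exists>q\<in>\<rat>. r < q \<and> q < r + 1 / real (Suc m)" for m
        by (rule Rats_dense_in_real) simp
      then obtain q where q: "\<And>m. q m \<in> \<rat>" "\<And>m. r < q m" "\<And>m. q m < r + 1 / real (Suc m)"
        by metis
      have q_lim: "q \<longlonglongrightarrow> r"
      proof (rule tendsto_sandwich[where f="\<lambda>_. r" and h="\<lambda>m. r + 1 / real (Suc m)"])
        show "(\<lambda>m. r + 1 / real (Suc m)) \<longlonglongrightarrow> r"
          using tendsto_add[OF tendsto_const[of r] LIMSEQ_inverse_real_of_nat] by (simp add: inverse_eq_divide)
      qed (use q in \<open>auto intro!: always_eventually less_imp_le\<close>)
      have "\<bar>dev n x f1 f2\<bar> \<le> K * (q m * w (s m))" for m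
      proof -
        have sm: "s m \<in> \<Gamma>0" "s m \<le> \<gamma>" "s m \<in> \<Gamma>" using s(1) \<Gamma>0' by blast+
        have "w \<gamma> \<le> w (s m)"
          unfolding w_def using sm \<gamma>_pos[OF sm(3)] by (intro powr_mono2') auto
        hence "r * w \<gamma> \<le> q m * w (s m)"
          using q(2)[of m] r0 w_pos[OF \<gamma>] by (intro mult_mono) auto
        hence "C \<le> q m * w (s m)" using r by linarith
        moreover have "ball \<gamma> r \<subseteq> ball (s m) (q m)"
          using ball_mono_width[OF sm(3) \<gamma> sm(2), of r] ball_mono_radius[of r "q m" "s m"] q(2)[of m] r0 by auto
        ultimately show ?thesis
          using step1[OF sm(1) q(1)] f by blast
      qed
      moreover have "(\<lambda>m. K * (q m * w (s m))) \<longlonglongrightarrow> K * (r * w \<gamma>)"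
        by (intro tendsto_mult tendsto_const q_lim w_tendsto \<gamma> s(2))
      ultimately show ?thesis
        by (intro LIMSEQ_le_const[where X="\<lambda>m. K * (q m * w (s m))"]) blast+
    qed
    show ?thesis
    proof (intro ballI allI impI)
      fix \<gamma> r f1 f2 assume \<gamma>: "\<gamma> \<in> \<Gamma>" and r: "0 \<le> r" and f: "f1 \<in> ball \<gamma> r" "f2 \<in> ball \<gamma> r"
      have w0: "w \<gamma> > 0" by (rule w_pos[OF \<gamma>])
      have sq0: "sqd f1 f2 z \<le> 4 * C * (r * w \<gamma>)" if "z \<in> S" for z
        by (rule sqd_ball_le[OF \<gamma> f that])
      consider "r = 0" | "r > 0" "r * w \<gamma> < C" | "C \<le> r * w \<gamma>" using r by linarith
      thus "\<bar>dev n x f1 f2\<bar> \<le> K * (r * w \<gamma>)"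
      proof cases
        case 1
        have z: "sqd f1 f2 z = 0" if "z \<in> S" for z
          using sq0[OF that] sqd_nonneg[of f1 f2 z] 1 by simp
        have "(\<integral>z. sqd f1 f2 z \<partial>P) = (\<integral>z. 0 \<partial>P)"
          by (rule Bochner_Integration.integral_cong) (auto simp: space_P z)
        moreover have "(\<Sum>i=1..n. sqd f1 f2 (x i)) = 0"
          by (intro sum.neutral ballI z x)
        ultimately show ?thesis using 1 by (simp add: dev_def)
      next
        case 2
        \<comment> \<open>The factor that lifts the radius to the threshold. The functions are
          bounded by C before and after scaling, so clipping is inactive and the deviation scales by
          c^2, whereas its bound scales only by c.\<close>
        define c where "c = C / (r * w \<gamma>)"
        have c: "c \<ge> 1" "c * r * w \<gamma> = C" using 2 w0 C by (auto simp: c_def)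
        define f1' f2' where "f1' = (\<lambda>z. c * f1 z)" and "f2' = (\<lambda>z. c * f2 z)"
        have f': "f1' \<in> ball \<gamma> (c * r)" "f2' \<in> ball \<gamma> (c * r)"
          unfolding f1'_def f2'_def using c by (auto intro!: ball_scale \<gamma> f)
        have "\<bar>dev n x f1' f2'\<bar> \<le> K * (c * r * w \<gamma>)"
          using c by (intro step2 \<gamma> f') auto
        moreover have sc: "sqd f1' f2' z = c\<^sup>2 * sqd f1 f2 z" if z: "z \<in> S" for z
        proof -
          have "\<bar>f1 z\<bar> \<le> C" "\<bar>f2 z\<bar> \<le> C"
            using ball_abs_le[OF \<gamma> f(1) z] ball_abs_le[OF \<gamma> f(2) z] 2 by linarith+
          moreover have "\<bar>f1' z\<bar> \<le> C" "\<bar>f2' z\<bar> \<le> C"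
            using ball_abs_le[OF \<gamma> f'(1) z] ball_abs_le[OF \<gamma> f'(2) z] c(2) by linarith+
          ultimately have "sqd f1' f2' z = (f1' z - f2' z)\<^sup>2" "sqd f1 f2 z = (f1 z - f2 z)\<^sup>2"
            by (simp_all add: sqd_def clip_eq)
          thus ?thesis
            by (simp add: f1'_def f2'_def right_diff_distrib[symmetric] power_mult_distrib)
        qed
        have "dev n x f1' f2' = c\<^sup>2 * dev n x f1 f2"
        proof -
          have "(\<integral>z. sqd f1' f2' z \<partial>P) = (\<integral>z. c\<^sup>2 * sqd f1 f2 z \<partial>P)"
            by (rule Bochner_Integration.integral_cong) (auto simp: space_P sc)
          moreover have "(\<Sum>i=1..n. sqd f1' f2' (x i)) = (\<Sum>i=1..n. c\<^sup>2 * sqd f1 f2 (x i))"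
            by (intro sum.cong refl sc x)
          ultimately show ?thesis
            by (simp add: dev_def right_diff_distrib sum_distrib_left[symmetric] mult_ac)
        qed
        ultimately have "c\<^sup>2 * \<bar>dev n x f1 f2\<bar> \<le> K * (c * r * w \<gamma>)"
          by (simp add: abs_mult)
        hence "c * (c * \<bar>dev n x f1 f2\<bar>) \<le> c * (K * (r * w \<gamma>))"
          by (simp add: power2_eq_square mult_ac)
        hence "c * \<bar>dev n x f1 f2\<bar> \<le> K * (r * w \<gamma>)"
          using c(1) by (simp add: mult_le_cancel_left)
        moreover have "1 * \<bar>dev n x f1 f2\<bar> \<le> c * \<bar>dev n x f1 f2\<bar>"
          by (rule mult_right_mono[OF c(1)]) simp
        ultimately show ?thesis by linarith
      next
        case 3
        thus ?thesis by (rule step2[OF \<gamma> _ f])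
      qed
    qed
  qed
  show thesis
    by (rule that[OF T_count T_adm]) (assumption | rule main)+
qed

end

section \<open>Measurability and probability of the uniform deviation event\<close>

context gaussian_class
begin

lemma zero_mem_ball:
  assumes "\<gamma> \<in> \<Gamma>" "r \<ge> 0"
  shows "(\<lambda>_. 0) \<in> ball \<gamma> r"
proof -
  interpret rkhs S "gauss_kernel \<gamma>" "H \<gamma>" "ip \<gamma>" by (rule rkhs'[OF assms(1)])
  show ?thesis
    using zero_mem ip_zero_left[OF zero_mem] assms(2) by (simp add: rkhs_ball_def ip_norm_def)
qed

lemma abs_dev_le:
  assumes n: "n \<ge> 1" and f: "f1 \<in> borel_measurable P" "f2 \<in> borel_measurable P"
  shows "\<bar>dev n x f1 f2\<bar> \<le> 8 * C\<^sup>2"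
proof -
  have "0 \<le> (1 / real n) * (\<Sum>i=1..n. sqd f1 f2 (x i))"
    by (intro mult_nonneg_nonneg sum_nonneg sqd_nonneg) simp
  moreover have "(1 / real n) * (\<Sum>i=1..n. sqd f1 f2 (x i)) \<le> (1 / real n) * (\<Sum>i=1..n. 4 * C\<^sup>2)"
    by (intro mult_left_mono sum_mono sqd_le) simp
  moreover have "(1 / real n) * (\<Sum>i=1..n. 4 * C\<^sup>2) = 4 * C\<^sup>2"
    using n by simp
  moreover have "\<bar>\<integral>z. sqd f1 f2 z \<partial>P\<bar> \<le> 4 * C\<^sup>2"
    using sqd_nonneg sqd_le by (intro P.abs_expectation_le sqd_measurable f) simp
  ultimately show ?thesis
    unfolding dev_def by linarith
qed

text \<open>A real supremum carries information only over a nonempty set bounded above: the zero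
  function gives the first, clipping the second.\<close>

lemma SUP_deviation_le_iff:
  assumes n: "n \<ge> 1" and \<gamma>: "\<gamma> \<in> \<Gamma>" and r: "r \<ge> 0"
  shows "(SUP (f1, f2)\<in>ball \<gamma> r \<times> ball \<gamma> r.
      \<bar>emp_norm2 n x ((clip C \<circ> f1) - (clip C \<circ> f2)) - L2_norm2 P ((clip C \<circ> f1) - (clip C \<circ> f2))\<bar>) \<le> c
    \<longleftrightarrow> (\<forall>f1\<in>ball \<gamma> r. \<forall>f2\<in>ball \<gamma> r. \<bar>dev n x f1 f2\<bar> \<le> c)"
proof -
  have "(SUP p\<in>ball \<gamma> r \<times> ball \<gamma> r. \<bar>dev n x (fst p) (snd p)\<bar>) \<le> c \<longleftrightarrow> (\<forall>p\<in>ball \<gamma> r \<times> ball \<gamma> r. \<bar>dev n x (fst p) (snd p)\<bar> \<le> c)"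
  proof (rule cSUP_le_iff)
    show "ball \<gamma> r \<times> ball \<gamma> r \<noteq> {}"
      using zero_mem_ball[OF \<gamma> r] by blast
    show "bdd_above ((\<lambda>p. \<bar>dev n x (fst p) (snd p)\<bar>) ` (ball \<gamma> r \<times> ball \<gamma> r))"
    proof (rule bdd_aboveI2)
      fix p assume "p \<in> ball \<gamma> r \<times> ball \<gamma> r"
      hence "fst p \<in> borel_measurable P" "snd p \<in> borel_measurable P"
        using ball_measurable[OF \<gamma>] by (auto simp: mem_Times_iff)
      thus "\<bar>dev n x (fst p) (snd p)\<bar> \<le> 8 * C\<^sup>2"
        by (rule abs_dev_le[OF n])
    qed
  qed
  thus ?thesis
    unfolding emp_norm2_sqd L2_norm2_sqd dev_def[symmetric] by (simp add: split_beta')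
qed

lemma deviation_bound_eq:
  "151 * complexity_J S \<Gamma> * \<gamma> powr (- real CARD('d) / 2) * C * r * sqrt t / sqrt (real n)
     + 8 * \<gamma> powr (- real CARD('d) / 2) * C * r * t / (3 * real n) = rate n t * (r * w \<gamma>)"
  unfolding rate_def w_def by (simp add: distrib_left distrib_right mult_ac)

text \<open>The event depends on the covariates alone and, by \<open>countable_reduction\<close>, is
  the preimage of a countable intersection of sample events. The covariates have law P^n, so
  measurability and probability come from the product space.\<close>

lemma event4_prob:
  assumes sample: "regression_sample M S Q g n X Y" and P_def: "P = distr Q (borel_on S) fst"
    and n: "n \<ge> 1" and t: "t \<ge> 1"
  shows "event4 M S P \<Gamma> H ip C n t X \<in> sets M" and "measure M (event4 M S P \<Gamma> H ip C n t X) \<ge> 1 - exp (- t)"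
proof -
  interpret M: prob_space M using sample by (simp add: regression_sample_def)
  have ind: "M.indep_vars (\<lambda>_. borel_on S \<Otimes>\<^sub>M borel) (\<lambda>i \<omega>. (X i \<omega>, Y i \<omega>)) {1..n}"
    using sample by (simp add: regression_sample_def)
  have law: "distr M (borel_on S \<Otimes>\<^sub>M borel) (\<lambda>\<omega>. (X i \<omega>, Y i \<omega>)) = Q" if "i \<in> {1..n}" for i
    using sample that by (simp add: regression_sample_def)
  have pair_m: "(\<lambda>\<omega>. (X i \<omega>, Y i \<omega>)) \<in> measurable M (borel_on S \<Otimes>\<^sub>M borel)" if "i \<in> {1..n}" for i
    using ind that unfolding M.indep_vars_def by blast
  have X_m: "X i \<in> measurable M (borel_on S)" if "i \<in> {1..n}" for i
    using measurable_compose[OF pair_m[OF that] measurable_fst] by simp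
  have X_law: "distr M (borel_on S) (X i) = P" if i: "i \<in> {1..n}" for i
  proof -
    have "P = distr (distr M (borel_on S \<Otimes>\<^sub>M borel) (\<lambda>\<omega>. (X i \<omega>, Y i \<omega>))) (borel_on S) fst"
      by (simp only: P_def law[OF i])
    also have "\<dots> = distr M (borel_on S) (fst \<circ> (\<lambda>\<omega>. (X i \<omega>, Y i \<omega>)))"
      by (rule distr_distr[OF measurable_fst pair_m[OF i]])
    finally show ?thesis by (simp add: comp_def)
  qed
  have "M.indep_vars (\<lambda>_. borel_on S) (\<lambda>i \<omega>. fst (X i \<omega>, Y i \<omega>)) {1..n}"
    by (rule M.indep_vars_compose2[OF ind]) (rule measurable_fst)
  hence indX: "M.indep_vars (\<lambda>_. borel_on S) X {1..n}" by simp
  \<comment> \<open>Restricted to the indices 1, ..., n, so that it takes values in the product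
    space; empirical averages see no other index.\<close>
  define \<Phi> where "\<Phi> \<omega> = (\<lambda>i\<in>{1..n}. X i \<omega>)" for \<omega>
  have ne: "{1..n} \<noteq> {}" using n by simp
  have sets_eq: "sets (P.sample_space n) = sets (Pi\<^sub>M {1..n} (\<lambda>_. borel_on S))"
    by (rule sets_PiM_cong[OF refl sets_P])
  have "distr M (Pi\<^sub>M {1..n} (\<lambda>_. borel_on S)) \<Phi> = Pi\<^sub>M {1..n} (\<lambda>i. distr M (borel_on S) (X i))"
    unfolding \<Phi>_def by (rule iffD1[OF M.indep_vars_iff_distr_eq_PiM'[OF ne] indX]) (rule X_m)
  also have "\<dots> = P.sample_space n"
    by (rule PiM_cong[OF refl X_law])
  finally have law_\<Phi>: "distr M (Pi\<^sub>M {1..n} (\<lambda>_. borel_on S)) \<Phi> = P.sample_space n" .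
  have \<Phi>_m: "\<Phi> \<in> measurable M (Pi\<^sub>M {1..n} (\<lambda>_. borel_on S))"
    unfolding \<Phi>_def[abs_def] by (rule measurable_restrict) (rule X_m)
  have XS: "X i \<omega> \<in> S" if "i \<in> {1..n}" "\<omega> \<in> space M" for i \<omega>
    using measurable_space[OF X_m[OF that(1)] that(2)] by (simp add: space_restrict_space)
  obtain T where T: "countable T" "\<And>\<theta>. \<theta> \<in> T \<Longrightarrow> adm \<theta>"
    "\<And>n x K. K \<ge> 0 \<Longrightarrow> (\<And>i. i \<in> {1..n} \<Longrightarrow> x i \<in> S) \<Longrightarrow>
      \<forall>(\<gamma>, r, f1, f2)\<in>T. \<bar>dev n x f1 f2\<bar> \<le> K * (r * w \<gamma>) \<Longrightarrow>
      \<forall>\<gamma>\<in>\<Gamma>. \<forall>r\<ge>0. \<forall>f1\<in>ball \<gamma> r. \<forall>f2\<in>ball \<gamma> r. \<bar>dev n x f1 f2\<bar> \<le> K * (r * w \<gamma>)"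
    using countable_reduction by metis
  define G where "G = {x \<in> space (P.sample_space n). \<forall>(\<gamma>, r, f1, f2)\<in>T. \<bar>dev n x f1 f2\<bar> \<le> rate n t * (r * w \<gamma>)}"
  have G: "G \<in> sets (P.sample_space n)" "measure (P.sample_space n) G \<ge> 1 - exp (- t)"
    unfolding G_def by (rule countable_adm[OF T(1) _ n t], erule T(2))+
  have dev_\<Phi>: "dev n (\<Phi> \<omega>) f1 f2 = dev n (\<lambda>i. X i \<omega>) f1 f2" for \<omega> f1 f2
    unfolding dev_def \<Phi>_def by simp
  have \<Phi>_space: "\<Phi> \<omega> \<in> space (P.sample_space n)" if "\<omega> \<in> space M" for \<omega>
    using XS that by (auto simp: \<Phi>_def space_PiM space_P)
  have event_iff: "\<omega> \<in> event4 M S P \<Gamma> H ip C n t X \<longleftrightarrow> \<omega> \<in> space M \<and>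
      (\<forall>\<gamma>\<in>\<Gamma>. \<forall>r\<ge>0. \<forall>f1\<in>ball \<gamma> r. \<forall>f2\<in>ball \<gamma> r. \<bar>dev n (\<lambda>i. X i \<omega>) f1 f2\<bar> \<le> rate n t * (r * w \<gamma>))" for \<omega>
    unfolding event4_def deviation_bound_eq mem_Collect_eq
    by (intro conj_cong refl ball_cong all_cong SUP_deviation_le_iff[OF n])
  have "event4 M S P \<Gamma> H ip C n t X = \<Phi> -` G \<inter> space M"
  proof (rule set_eqI)
    fix \<omega>
    show "\<omega> \<in> event4 M S P \<Gamma> H ip C n t X \<longleftrightarrow> \<omega> \<in> \<Phi> -` G \<inter> space M"
    proof
      assume e: "\<omega> \<in> event4 M S P \<Gamma> H ip C n t X"
      hence \<omega>: "\<omega> \<in> space M" and b: "\<And>\<gamma> r f1 f2. \<gamma> \<in> \<Gamma> \<Longrightarrow> r \<ge> 0 \<Longrightarrow> f1 \<in> ball \<gamma> r \<Longrightarrow> f2 \<in> ball \<gamma> r \<Longrightarrow> \<bar>dev n (\<lambda>i. X i \<omega>) f1 f2\<bar> \<le> rate n t * (r * w \<gamma>)"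
        unfolding event_iff by blast+
      have "\<bar>dev n (\<Phi> \<omega>) f1 f2\<bar> \<le> rate n t * (r * w \<gamma>)" if \<theta>: "(\<gamma>, r, f1, f2) \<in> T" for \<gamma> r f1 f2
      proof -
        have ad: "\<gamma> \<in> \<Gamma>" "C \<le> r * w \<gamma>" "f1 \<in> ball \<gamma> r" "f2 \<in> ball \<gamma> r"
          using T(2)[OF \<theta>] by (auto simp: adm_def)
        have "0 < r * w \<gamma>" using ad(2) C by linarith
        hence "0 \<le> r" using w_pos[OF ad(1)] by (simp add: zero_less_mult_iff)
        thus ?thesis unfolding dev_\<Phi> by (intro b ad)
      qed
      hence "\<Phi> \<omega> \<in> G"
        unfolding G_def using \<Phi>_space[OF \<omega>] by auto
      thus "\<omega> \<in> \<Phi> -` G \<inter> space M" using \<omega> by simp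
    next
      assume e: "\<omega> \<in> \<Phi> -` G \<inter> space M"
      hence \<omega>: "\<omega> \<in> space M" and "\<Phi> \<omega> \<in> G" by auto
      hence "\<forall>(\<gamma>, r, f1, f2)\<in>T. \<bar>dev n (\<lambda>i. X i \<omega>) f1 f2\<bar> \<le> rate n t * (r * w \<gamma>)"
        unfolding G_def dev_\<Phi> mem_Collect_eq by (rule_tac conjunct2)
      from T(3)[OF rate_nonneg _ this] show "\<omega> \<in> event4 M S P \<Gamma> H ip C n t X"
        unfolding event_iff using \<omega> XS t by simp
    qed
  qed
  note eq = this
  show "event4 M S P \<Gamma> H ip C n t X \<in> sets M"
    unfolding eq using \<Phi>_m G(1) unfolding sets_eq by (rule measurable_sets)
  have "measure M (\<Phi> -` G \<inter> space M) = measure (P.sample_space n) G"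
    unfolding law_\<Phi>[symmetric] by (rule measure_distr[symmetric, OF \<Phi>_m]) (use G(1) sets_eq in blast)
  thus "measure M (event4 M S P \<Gamma> H ip C n t X) \<ge> 1 - exp (- t)"
    unfolding eq using G(2) by linarith
qed

end

subsection \<open>The Goldenshluger--Lepski comparison\<close>

lemma emp_norm2_nonneg: "0 \<le> emp_norm2 n x f"
  unfolding emp_norm2_def by (intro mult_nonneg_nonneg sum_nonneg) auto

lemma square_triangle: "(a - c)\<^sup>2 \<le> 2 * (a - b)\<^sup>2 + 2 * (b - c)\<^sup>2" for a b c :: real
proof -
  have "(a - c)\<^sup>2 + ((a - b) - (b - c))\<^sup>2 = 2 * (a - b)\<^sup>2 + 2 * (b - c)\<^sup>2"
    by (simp add: power2_eq_square algebra_simps)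
  moreover have "0 \<le> ((a - b) - (b - c))\<^sup>2" by (rule zero_le_power2)
  ultimately show ?thesis by linarith
qed

lemma emp_norm2_triangle: "emp_norm2 n x (f - h) \<le> 2 * emp_norm2 n x (f - g) + 2 * emp_norm2 n x (g - h)"
proof -
  define A where "A = (\<Sum>i=1..n. (f (x i) - g (x i))\<^sup>2)"
  define B where "B = (\<Sum>i=1..n. (g (x i) - h (x i))\<^sup>2)"
  have "(\<Sum>i=1..n. (f (x i) - h (x i))\<^sup>2) \<le> (\<Sum>i=1..n. 2 * (f (x i) - g (x i))\<^sup>2 + 2 * (g (x i) - h (x i))\<^sup>2)"
    by (rule sum_mono) (rule square_triangle)
  also have "\<dots> = 2 * A + 2 * B"
    unfolding A_def B_def sum.distrib sum_distrib_left ..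
  finally have "(1 / real n) * (\<Sum>i=1..n. (f (x i) - h (x i))\<^sup>2) \<le> (1 / real n) * (2 * A + 2 * B)"
    by (rule mult_left_mono) simp
  moreover have "(1 / real n) * (2 * A + 2 * B) = 2 * ((1 / real n) * A) + 2 * ((1 / real n) * B)"
    by (simp add: algebra_simps)
  ultimately show ?thesis
    unfolding emp_norm2_def fun_diff_def A_def B_def by linarith
qed

lemma emp_norm2_triangle_le:
  assumes "emp_norm2 n x (f - g) \<le> a" "emp_norm2 n x (g - h) \<le> b"
  shows "emp_norm2 n x (f - h) \<le> 2 * a + 2 * b"
  using emp_norm2_triangle[of n x f h g] assms by linarith

lemma emp_norm2_minus_commute: "emp_norm2 n x (f - h) = emp_norm2 n x (h - f)"
  by (simp add: emp_norm2_def power2_commute)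

lemma emp_norm2_clip_le: "emp_norm2 n x ((clip C \<circ> f) - (clip C \<circ> h)) \<le> emp_norm2 n x (f - h)"
  unfolding emp_norm2_def
proof (intro mult_left_mono sum_mono)
  fix i
  have "\<bar>clip C (f (x i)) - clip C (h (x i))\<bar> \<le> \<bar>f (x i) - h (x i)\<bar>"
    by (auto simp: clip_def min_def max_def)
  thus "(((clip C \<circ> f) - (clip C \<circ> h)) (x i))\<^sup>2 \<le> ((f - h) (x i))\<^sup>2"
    by (simp add: abs_le_square_iff)
qed auto

lemma nested_SUP_upper:
  fixes F :: "'a \<Rightarrow> 'b \<Rightarrow> real"
  assumes "\<And>a b. a \<in> A \<Longrightarrow> b \<in> B \<Longrightarrow> F a b \<le> K" "a \<in> A" "b \<in> B"
  shows "F a b \<le> (SUP a\<in>A. SUP b\<in>B. F a b)"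
proof -
  have "F a b \<le> (SUP b\<in>B. F a b)"
    using assms by (intro cSUP_upper bdd_aboveI2[where M=K]) auto
  also have "\<dots> \<le> (SUP a\<in>A. SUP b\<in>B. F a b)"
  proof (rule cSUP_upper[OF assms(2)], rule bdd_aboveI2)
    fix a assume "a \<in> A"
    thus "(SUP b\<in>B. F a b) \<le> K"
      using assms by (intro cSUP_least) auto
  qed
  finally show ?thesis .
qed

text \<open>Comparison with the zero function, which lies in every ball. The bound is uniform over
  widths and radii, so the suprema of the selection criterion are over bounded sets.\<close>

lemma constrained_lse_emp_norm2_le:
  assumes k: "rkhs S k H ip" and lse: "is_constrained_lse S k H ip n x y r h" and r: "r \<ge> 0"
  shows "(1 / real n) * (\<Sum>i=1..n. (h (x i) - y i)\<^sup>2) \<le> (1 / real n) * (\<Sum>i=1..n. (y i)\<^sup>2)"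
    and "h \<in> rkhs_ball H ip r"
proof -
  interpret rkhs S k H ip by fact
  have z: "(\<lambda>_. 0) \<in> rkhs_ball H ip r"
    using zero_mem ip_zero_left[OF zero_mem] r by (simp add: rkhs_ball_def ip_norm_def)
  show "h \<in> rkhs_ball H ip r"
    using lse z by (cases "r = 0") (simp_all add: is_constrained_lse_def)
  show "(1 / real n) * (\<Sum>i=1..n. (h (x i) - y i)\<^sup>2) \<le> (1 / real n) * (\<Sum>i=1..n. (y i)\<^sup>2)"
  proof (cases "r = 0")
    case True
    thus ?thesis using lse by (simp add: is_constrained_lse_def)
  next
    case False
    have "\<forall>f\<in>rkhs_ball H ip r. (1 / real n) * (\<Sum>i=1..n. (h (x i) - y i)\<^sup>2) \<le> (1 / real n) * (\<Sum>i=1..n. (f (x i) - y i)\<^sup>2)"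
      using lse unfolding is_constrained_lse_def if_not_P[OF False] by (elim conjE)
    from bspec[OF this z] show ?thesis by simp
  qed
qed

text \<open>A deterministic statement. At the reference pair (u, r) only the width u competes, so
  \<open>near\<close> bounds the criterion there; minimality carries the bound to the selected pair.
  Testing that pair against itself bounds \<open>rh\<close>, and testing it against width u at
  radius \<open>max r rh\<close> bounds its distance to f.\<close>

lemma goldenshluger_lepski_bound:
  fixes x :: "nat \<Rightarrow> real^'d" and h :: "real \<Rightarrow> real \<Rightarrow> real^'d \<Rightarrow> real"
  defines "w \<equiv> \<lambda>\<gamma>. \<gamma> powr (- real CARD('d) / 2)"
  assumes u: "0 < u" "\<Gamma> \<subseteq> {u..v}" "u \<in> \<Gamma>" and R: "R \<subseteq> {0..}" and n: "n \<ge> 1" and \<tau>: "\<tau> > 0" and \<nu>: "\<nu> > 0"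
    and bdd: "\<And>\<gamma> r. \<gamma> \<in> \<Gamma> \<Longrightarrow> r \<in> R \<Longrightarrow> emp_norm2 n x (h \<gamma> r - y) \<le> Y"
    and gl: "is_gl_minimiser \<Gamma> R \<tau> \<nu> n x h \<gamma>h rh"
    and near: "\<And>s. s \<in> R \<Longrightarrow> r \<le> s \<Longrightarrow> emp_norm2 n x (h u s - f) \<le> \<tau> * (w u * s) / sqrt (real n) / 4 + 4 * e2"
    and r: "r \<in> R" and e2: "e2 \<ge> 0"
  defines "p \<equiv> \<tau> * r / sqrt (real n)" and "q \<equiv> \<tau> * max r rh / sqrt (real n)"
    and "K0 \<equiv> 16 + 2 * (1 + \<nu>) * w u"
  defines "K1 \<equiv> 1 + K0 / (2 * \<nu> * w v)"
  shows "q \<le> K1 * (e2 + p)"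
    and "emp_norm2 n x (h \<gamma>h rh - f) \<le> (2 * K0 + 5 / 2 * w u * K1 + 8) * (e2 + p)"
proof -
  define c where "c = \<tau> / sqrt (real n)"
  have c: "c > 0" using \<tau> n by (simp add: c_def)
  define V where "V \<gamma> r \<eta> s = emp_norm2 n x (h \<gamma> r - h \<eta> s) - \<tau> * (w \<gamma> * r + w \<eta> * s) / sqrt (real n)" for \<gamma> r \<eta> s
  have V: "V \<gamma> r \<eta> s = emp_norm2 n x (h \<gamma> r - h \<eta> s) - c * (w \<gamma> * r + w \<eta> * s)" for \<gamma> r \<eta> s
    by (simp add: V_def c_def)
  define obj where "obj \<gamma> r = gl_objective \<Gamma> R \<tau> \<nu> n x h \<gamma> r" for \<gamma> r
  have obj: "obj \<gamma> r = (SUP \<eta>\<in>{\<eta>\<in>\<Gamma>. \<eta> \<le> \<gamma>}. SUP s\<in>{s\<in>R. r \<le> s}. V \<gamma> r \<eta> s) + 2 * (1 + \<nu>) * (c * (w \<gamma> * r))" for \<gamma> r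
    unfolding obj_def gl_objective_def V_def w_def c_def by simp
  have w_pos: "w \<gamma> > 0" if "\<gamma> \<in> \<Gamma>" for \<gamma>
    using that u by (auto simp: w_def)
  have R0: "s \<ge> 0" if "s \<in> R" for s using R that by auto
  have V_le: "V \<gamma> r \<eta> s \<le> 4 * Y" if "\<gamma> \<in> \<Gamma>" "r \<in> R" "\<eta> \<in> \<Gamma>" "s \<in> R" for \<gamma> r \<eta> s
  proof -
    have "emp_norm2 n x (h \<gamma> r - h \<eta> s) \<le> 2 * Y + 2 * Y"
      using emp_norm2_triangle[of n x "h \<gamma> r" "h \<eta> s" y] bdd[OF that(1,2)] bdd[OF that(3,4)]
        emp_norm2_minus_commute[of n x y "h \<eta> s"] by linarith
    moreover have "0 \<le> c * (w \<gamma> * r + w \<eta> * s)"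
      using c w_pos[OF that(1)] w_pos[OF that(3)] R0[OF that(2)] R0[OF that(4)]
      by (intro mult_nonneg_nonneg add_nonneg_nonneg) auto
    ultimately show ?thesis unfolding V by linarith
  qed
  note gl' = gl[unfolded is_gl_minimiser_def obj_def[symmetric]]
  have hat: "\<gamma>h \<in> \<Gamma>" "rh \<in> R"
    using gl' by simp_all
  have min: "obj \<gamma>h rh \<le> obj u r"
    by (rule bspec[OF bspec[OF gl'[THEN conjunct2, THEN conjunct2] u(3)] r])
  have wu: "w u > 0" by (rule w_pos[OF u(3)])
  have V_obj: "V \<gamma>h rh \<eta> s + 2 * (1 + \<nu>) * (c * (w \<gamma>h * rh)) \<le> obj \<gamma>h rh"
    if "\<eta> \<in> \<Gamma>" "\<eta> \<le> \<gamma>h" "s \<in> R" "rh \<le> s" for \<eta> s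
  proof -
    have "V \<gamma>h rh \<eta> s \<le> (SUP \<eta>\<in>{\<eta>\<in>\<Gamma>. \<eta> \<le> \<gamma>h}. SUP s\<in>{s\<in>R. rh \<le> s}. V \<gamma>h rh \<eta> s)"
    proof (rule nested_SUP_upper[where K="4 * Y"])
      fix \<eta> s assume "\<eta> \<in> {\<eta>\<in>\<Gamma>. \<eta> \<le> \<gamma>h}" "s \<in> {s\<in>R. rh \<le> s}"
      thus "V \<gamma>h rh \<eta> s \<le> 4 * Y" by (intro V_le hat) simp_all
    qed (simp_all add: that)
    thus ?thesis unfolding obj by linarith
  qed
  have near': "emp_norm2 n x (h u s - f) \<le> c * (w u * s) / 4 + 4 * e2" if "s \<in> R" "r \<le> s" for s
    using near[OF that] by (simp add: c_def)
  have obj_u: "obj u r \<le> 16 * e2 + 2 * (1 + \<nu>) * (c * (w u * r))"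
  proof -
    \<comment> \<open>Both estimators are within their \<open>near\<close> bound of f. Doubling the
      quarters of the penalties gives halves, which the subtracted penalties outweigh; what remains
      is 2 * 4 e2 + 2 * 4 e2.\<close>
    have "(SUP \<eta>\<in>{\<eta>\<in>\<Gamma>. \<eta> \<le> u}. SUP s\<in>{s\<in>R. r \<le> s}. V u r \<eta> s) \<le> 16 * e2"
    proof (rule cSUP_least, goal_cases)
      case 1
      show "{\<eta>\<in>\<Gamma>. \<eta> \<le> u} \<noteq> {}" using u(3) by blast
    next
      case (2 \<eta>)
      note \<eta> = this
      show ?case
      proof (rule cSUP_least)
      show "{s\<in>R. r \<le> s} \<noteq> {}" using r by blast
      fix s assume s: "s \<in> {s\<in>R. r \<le> s}"
      have \<eta>u: "\<eta> = u" using \<eta> u(2) by force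
      have sR: "s \<in> R" "r \<le> s" using s by auto
      have "emp_norm2 n x (h u r - h u s) \<le> 2 * (c * (w u * r) / 4 + 4 * e2) + 2 * (c * (w u * s) / 4 + 4 * e2)"
        by (rule emp_norm2_triangle_le[OF near'[OF r order_refl] near'[OF sR, folded emp_norm2_minus_commute[of n x f "h u s"]]])
      moreover have "0 \<le> c * (w u * r)" "0 \<le> c * (w u * s)"
        using c wu R0[OF r] R0[of s] s by auto
      ultimately show "V u r \<eta> s \<le> 16 * e2"
        unfolding V \<eta>u distrib_left by linarith
      qed
    qed
    thus ?thesis unfolding obj by linarith
  qed
  have p_eq: "p = c * r" by (simp add: p_def c_def)
  moreover have "c * r \<ge> 0" using c R0[OF r] by simp
  ultimately have p: "p = c * r" "p \<ge> 0" by simp_all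
  have K0: "K0 \<ge> 16" using wu \<nu> by (simp add: K0_def)
  define E where "E = e2 + p"
  have E: "E \<ge> 0" using e2 p by (simp add: E_def)
  have G: "obj \<gamma>h rh \<le> K0 * E"
  proof -
    have "16 * e2 + 2 * (1 + \<nu>) * (c * (w u * r)) = 16 * e2 + (2 * (1 + \<nu>) * w u) * p"
      by (simp add: p(1))
    also have "\<dots> \<le> K0 * e2 + K0 * p"
      using e2 p(2) wu \<nu> by (intro add_mono mult_right_mono) (auto simp: K0_def)
    finally show ?thesis using min obj_u by (simp add: E_def distrib_left)
  qed
  have wv: "w v \<le> w \<gamma>h" "w v > 0"
    using hat(1) u by (auto simp: w_def intro!: powr_mono2')
  \<comment> \<open>Compared with itself, the selected pair contributes minus twice its penalty
    term, so only the surplus 2 \<nu> of 2 (1 + \<nu>) is left to bound the radius.\<close>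
  have rh: "2 * \<nu> * w v * (c * rh) \<le> K0 * E"
  proof -
    have z: "emp_norm2 n x (h \<gamma>h rh - h \<gamma>h rh) = 0" by (simp add: emp_norm2_def)
    have "V \<gamma>h rh \<gamma>h rh + 2 * (1 + \<nu>) * (c * (w \<gamma>h * rh)) \<le> K0 * E"
      using V_obj[OF hat(1) order_refl hat(2) order_refl] G by linarith
    hence "2 * \<nu> * (c * (w \<gamma>h * rh)) \<le> K0 * E"
      unfolding V z by (simp add: algebra_simps)
    moreover have "w v * rh \<le> w \<gamma>h * rh"
      using wv R0[OF hat(2)] by (intro mult_right_mono)
    hence "2 * \<nu> * (c * (w v * rh)) \<le> 2 * \<nu> * (c * (w \<gamma>h * rh))"
      using c \<nu> by (intro mult_left_mono) auto
    ultimately show ?thesis by (simp add: mult_ac)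
  qed
  have "c * rh \<le> K0 / (2 * \<nu> * w v) * E"
  proof -
    have "2 * \<nu> * w v > 0" using \<nu> wv by simp
    thus ?thesis using rh by (simp add: pos_le_divide_eq mult_ac)
  qed
  moreover have "q \<le> c * r + c * rh"
  proof -
    have "max r rh \<le> r + rh" using R0[OF r] R0[OF hat(2)] by simp
    hence "c * max r rh \<le> c * (r + rh)" using c by (intro mult_left_mono) auto
    thus ?thesis by (simp add: q_def c_def distrib_left)
  qed
  moreover have "c * r \<le> E" using e2 by (simp add: E_def p(1))
  ultimately have q: "q \<le> K1 * E" by (simp add: K1_def distrib_right)
  thus "q \<le> K1 * (e2 + p)" by (simp add: E_def)
  define s where "s = max r rh"
  have s: "s \<in> R" "r \<le> s" "rh \<le> s" using r hat(2) by (auto simp: s_def max_def)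
  have qs: "q = c * s" by (simp add: q_def c_def s_def)
  have "u \<le> \<gamma>h" using hat(1) u(2) by auto
  \<comment> \<open>The radius s is at least \<open>rh\<close>, so (u, s) competes with the selected
    pair, and at least r, so \<open>near\<close> applies to it.\<close>
  have "emp_norm2 n x (h \<gamma>h rh - h u s) \<le> K0 * E + w u * q"
  proof -
    have "V \<gamma>h rh u s + 2 * (1 + \<nu>) * (c * (w \<gamma>h * rh)) \<le> K0 * E"
      using V_obj[OF u(3) \<open>u \<le> \<gamma>h\<close> s(1,3)] G by linarith
    hence "emp_norm2 n x (h \<gamma>h rh - h u s) + (1 + 2 * \<nu>) * (c * (w \<gamma>h * rh)) \<le> K0 * E + w u * q"
      unfolding V qs by (simp add: algebra_simps)
    moreover have "0 \<le> (1 + 2 * \<nu>) * (c * (w \<gamma>h * rh))"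
      using c \<nu> w_pos[OF hat(1)] R0[OF hat(2)] by simp
    ultimately show ?thesis by linarith
  qed
  moreover have "emp_norm2 n x (h u s - f) \<le> w u * q / 4 + 4 * e2"
    using near'[OF s(1,2)] by (simp add: qs mult_ac)
  ultimately have "emp_norm2 n x (h \<gamma>h rh - f) \<le> 2 * (K0 * E + w u * q) + 2 * (w u * q / 4 + 4 * e2)"
    by (rule emp_norm2_triangle_le)
  also have "\<dots> = 2 * K0 * E + 5 / 2 * (w u * q) + 8 * e2" by simp
  also have "\<dots> \<le> 2 * K0 * E + 5 / 2 * (w u * (K1 * E)) + 8 * E"
    using q wu p(2) by (intro add_mono mult_left_mono order_refl) (auto simp: E_def)
  also have "\<dots> = (2 * K0 + 5 / 2 * w u * K1 + 8) * E"
    by (simp only: distrib_right mult.assoc)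
  finally show "emp_norm2 n x (h \<gamma>h rh - f) \<le> (2 * K0 + 5 / 2 * w u * K1 + 8) * (e2 + p)"
    by (simp only: E_def)
qed

section \<open>Grids, interpolation and the choice of the rate\<close>

text \<open>r0 is rounded up to a multiple of b. If that multiple is beyond the grid, the endpoint a
  sqrt n lies between r0 and it.\<close>

lemma radius_grid_approx:
  assumes "a > 0" "b > 0" "0 \<le> r0" "r0 \<le> a * sqrt (real n)"
  obtains r where "r \<in> radius_grid a b n" "r0 \<le> r" "r \<le> r0 + b"
proof -
  define I where "I = nat \<lceil>a * sqrt (real n) / b\<rceil>"
  define i where "i = nat \<lceil>r0 / b\<rceil>"
  have ri: "real i = of_int \<lceil>r0 / b\<rceil>"
    using assms by (simp add: i_def)
  have "r0 / b \<le> real i" "real i \<le> r0 / b + 1"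
    unfolding ri by linarith+
  hence bi: "r0 \<le> b * real i" "b * real i \<le> r0 + b"
    using assms by (simp_all add: field_simps)
  show thesis
  proof (cases "i < I")
    case True
    hence "b * real i \<in> radius_grid a b n"
      unfolding radius_grid_def I_def by blast
    thus ?thesis using bi by (rule that)
  next
    case False
    have "real I = of_int \<lceil>a * sqrt (real n) / b\<rceil>"
      using assms by (simp add: I_def)
    hence "a * sqrt (real n) / b \<le> real I" by linarith
    also have "real I \<le> real i" using False by simp
    finally have "a * sqrt (real n) \<le> b * real i"
      using assms by (simp add: field_simps)
    thus ?thesis
      using that[of "a * sqrt (real n)"] assms bi by (simp add: radius_grid_def)
  qed
qed

lemma radius_grid_nonneg: "a > 0 \<Longrightarrow> b > 0 \<Longrightarrow> radius_grid a b n \<subseteq> {0..}"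
  by (auto simp: radius_grid_def)

lemma finite_width_grid: "finite (width_grid u v c)"
  by (simp add: width_grid_def)

text \<open>The index i = 0 gives u whenever u < v; for u = v there is no index at all, and the
  added endpoint v supplies it.\<close>

lemma left_mem_width_grid:
  assumes "0 < u" "u \<le> v" "c > 1"
  shows "u \<in> width_grid u v c"
proof (cases "u = v")
  case False
  hence "ln (v / u) / ln c > 0"
    using assms by simp
  hence "0 < nat \<lceil>ln (v / u) / ln c\<rceil>" by simp
  hence "u * c ^ 0 \<in> (\<lambda>i. u * c ^ i) ` {i. i < nat \<lceil>ln (v / u) / ln c\<rceil>}"
    by blast
  thus ?thesis by (simp add: width_grid_def)
qed (simp add: width_grid_def)

text \<open>Rationals approach every point from the left except u, which has no smaller point in the
  interval and is put in by hand.\<close>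

lemma countable_left_dense_interval:
  assumes "u \<le> (v :: real)"
  obtains E where "countable E" "E \<subseteq> {u..v}" "\<And>\<gamma>. \<gamma> \<in> {u..v} \<Longrightarrow> \<exists>s. (\<forall>m::nat. s m \<in> E \<and> s m \<le> \<gamma>) \<and> s \<longlonglongrightarrow> \<gamma>"
proof -
  define E where "E = insert u (\<rat> \<inter> {u..v})"
  have 1: "countable E"
    unfolding E_def by (intro countable_insert countable_Int1 countable_rat)
  have 2: "E \<subseteq> {u..v}" using assms by (auto simp: E_def)
  have 3: "\<exists>s. (\<forall>m::nat. s m \<in> E \<and> s m \<le> \<gamma>) \<and> s \<longlonglongrightarrow> \<gamma>" if \<gamma>: "\<gamma> \<in> {u..v}" for \<gamma>
  proof (cases "\<gamma> = u")
    case True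
    thus ?thesis by (intro exI[of _ "\<lambda>_. u"]) (simp add: E_def)
  next
    case False
    have "\<exists>q\<in>\<rat>. max u (\<gamma> - 1 / real (Suc m)) < q \<and> q < \<gamma>" for m
      using \<gamma> False by (intro Rats_dense_in_real) auto
    then obtain q where q: "\<And>m. q m \<in> \<rat>" "\<And>m. max u (\<gamma> - 1 / real (Suc m)) < q m" "\<And>m. q m < \<gamma>"
      by metis
    have "q m \<in> E \<and> q m \<le> \<gamma>" for m
      using q(1)[of m] q(2)[of m] q(3)[of m] \<gamma> by (auto simp: E_def)
    moreover have "q \<longlonglongrightarrow> \<gamma>"
    proof (rule tendsto_sandwich[where f="\<lambda>m. \<gamma> - 1 / real (Suc m)" and h="\<lambda>_. \<gamma>"])
      show "(\<lambda>m. \<gamma> - 1 / real (Suc m)) \<longlonglongrightarrow> \<gamma>"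
        using tendsto_diff[OF tendsto_const[of \<gamma>] LIMSEQ_inverse_real_of_nat] by (simp add: inverse_eq_divide)
      show "\<forall>\<^sub>F m in sequentially. \<gamma> - 1 / real (Suc m) \<le> q m"
        using q(2) by (intro always_eventually allI) (simp add: less_imp_le)
      show "\<forall>\<^sub>F m in sequentially. q m \<le> \<gamma>"
        using q(3) by (intro always_eventually allI) (simp add: less_imp_le)
    qed simp
    ultimately show ?thesis by blast
  qed
  show thesis by (rule that[OF 1 2 3])
qed

text \<open>The interpolation norm bounds the K-functional at s by B s^\<beta>. The infimum need not
  be attained, and the factor 2 makes the inequality strict so that some f realises it.\<close>

lemma interpolation_approx:
  assumes norm: "interp_norm nZ W nW \<beta> g \<le> ennreal B" and B: "B > 0" and s: "s > 0" and W: "W \<noteq> {}"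
    and nn: "\<And>f. f \<in> W \<Longrightarrow> 0 \<le> nZ (g - f)" "\<And>f. f \<in> W \<Longrightarrow> 0 \<le> nW f"
  obtains f where "f \<in> W" "nZ (g - f) \<le> 2 * B * s powr \<beta>" "nW f \<le> 2 * B * s powr (\<beta> - 1)"
proof -
  define K where "K = K_functional nZ W nW g s"
  have "ennreal (s powr (- \<beta>) * K) \<le> interp_norm nZ W nW \<beta> g"
    unfolding interp_norm_def K_def using s by (intro SUP_upper) simp
  also note norm
  finally have "s powr (- \<beta>) * K \<le> B"
    using B by (simp add: ennreal_le_iff)
  hence "s powr \<beta> * (s powr (- \<beta>) * K) \<le> s powr \<beta> * B"
    by (rule mult_left_mono) simp
  hence "K \<le> s powr \<beta> * B"
    using s by (simp add: mult.assoc[symmetric] powr_add[symmetric])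
  also have "\<dots> < 2 * B * s powr \<beta>"
    using B s by simp
  finally have "(INF f\<in>W. nZ (g - f) + s * nW f) < 2 * B * s powr \<beta>"
    by (simp only: K_def K_functional_def)
  then obtain f where f: "f \<in> W" "nZ (g - f) + s * nW f < 2 * B * s powr \<beta>"
    using cInf_lessD[of "(\<lambda>f. nZ (g - f) + s * nW f) ` W"] W by blast
  have "nZ (g - f) \<le> 2 * B * s powr \<beta>"
    using f(2) nn[OF f(1)] s by (smt (verit) mult_nonneg_nonneg)
  moreover have "s * nW f \<le> s * (2 * B * s powr (\<beta> - 1))"
  proof -
    have "s * (2 * B * s powr (\<beta> - 1)) = 2 * B * (s * s powr (\<beta> - 1))"
      by (rule mult.left_commute)
    also have "s * s powr (\<beta> - 1) = s powr \<beta>"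
      using s by (simp add: powr_diff)
    finally show ?thesis
      using f(2) nn(1)[OF f(1)] by linarith
  qed
  hence "nW f \<le> 2 * B * s powr (\<beta> - 1)"
    using s by (rule mult_left_le_imp_le)
  ultimately show thesis using that f(1) by blast
qed

text \<open>s solves (s^\<beta>)^2 = s^(\<beta> - 1) / sqrt n, the balance of squared bias and
  radius term, and N is the common value. The cost 1 / sqrt n of rounding the radius is of no larger
  order, as \<beta> / (1 + \<beta>) \<le> 1/2.\<close>

lemma rate_exponents:
  assumes n: "n \<ge> (1::nat)" and \<beta>: "\<beta> \<in> {0<..<1::real}"
  defines "s \<equiv> real n powr (- 1 / (2 * (1 + \<beta>)))" and "N \<equiv> real n powr (- \<beta> / (1 + \<beta>))"
  shows "(s powr \<beta>)\<^sup>2 = N" and "s powr (\<beta> - 1) = N * sqrt (real n)" and "1 / sqrt (real n) \<le> N"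
    and "N / sqrt (real n) = real n powr (- (1 + 3 * \<beta>) / (2 * (1 + \<beta>)))"
proof -
  have n0: "real n > 0" using n by simp
  have sq: "sqrt (real n) = real n powr (1 / 2)" using n0 by (simp add: powr_half_sqrt)
  have b: "1 + \<beta> \<noteq> 0" "1 + \<beta> > 0" using \<beta> by auto
  have "(s powr \<beta>)\<^sup>2 = real n powr ((- 1 / (2 * (1 + \<beta>)) * \<beta>) + (- 1 / (2 * (1 + \<beta>)) * \<beta>))"
    unfolding s_def powr_powr power2_eq_square powr_add ..
  also have "(- 1 / (2 * (1 + \<beta>)) * \<beta>) + (- 1 / (2 * (1 + \<beta>)) * \<beta>) = - \<beta> / (1 + \<beta>)"
  proof -
    have "- 1 / (2 * z) * \<beta> + - 1 / (2 * z) * \<beta> = - \<beta> / z" if "z \<noteq> 0" for z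
      using that by (simp add: field_simps)
    from this[OF b(1)] show ?thesis .
  qed
  finally show "(s powr \<beta>)\<^sup>2 = N" by (simp only: N_def)
  have "- 1 / (2 * (1 + \<beta>)) * (\<beta> - 1) = - \<beta> / (1 + \<beta>) + 1 / 2"
    using b by (simp add: field_simps)
  thus "s powr (\<beta> - 1) = N * sqrt (real n)"
    unfolding s_def powr_powr N_def sq powr_add[symmetric] by (simp only:)
  have "- (1 / 2) \<le> - \<beta> / (1 + \<beta>)"
    using \<beta> b by (simp add: field_simps)
  hence "real n powr (- (1 / 2)) \<le> N"
    unfolding N_def using n by (intro powr_mono) auto
  thus "1 / sqrt (real n) \<le> N"
    unfolding sq by (simp only: powr_minus_divide)
  have "- \<beta> / (1 + \<beta>) - 1 / 2 = - (1 + 3 * \<beta>) / (2 * (1 + \<beta>))"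
    using b by (simp add: field_simps)
  thus "N / sqrt (real n) = real n powr (- (1 + 3 * \<beta>) / (2 * (1 + \<beta>)))"
    unfolding sq N_def powr_diff[symmetric] by (simp only:)
qed

section \<open>Risk bound for a given approximant and radius\<close>

lemma (in gaussian_class) L2_norm2_triangle_le:
  assumes "f \<in> borel_measurable P" "f' \<in> borel_measurable P" "g \<in> borel_measurable P"
    and bd: "\<And>z. z \<in> S \<Longrightarrow> \<bar>f z\<bar> \<le> b" "\<And>z. z \<in> S \<Longrightarrow> \<bar>f' z\<bar> \<le> b" "\<And>z. z \<in> S \<Longrightarrow> \<bar>g z\<bar> \<le> b"
    and e: "\<And>z. z \<in> S \<Longrightarrow> \<bar>f' z - g z\<bar> \<le> e"
  shows "L2_norm2 P (f - g) \<le> 2 * L2_norm2 P (f - f') + 2 * e\<^sup>2"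
proof -
  have b: "(k z)\<^sup>2 \<le> (2 * b)\<^sup>2" if "z \<in> S" "k = f - g \<or> k = f - f'" for k z
  proof -
    have "\<bar>k z\<bar> \<le> 2 * b"
      using bd[OF that(1)] that(2) by auto
    thus ?thesis
      by (metis abs_ge_zero power2_abs power_mono)
  qed
  have int: "integrable P (\<lambda>z. (k z)\<^sup>2)" if "k = f - g \<or> k = f - f'" for k
  proof (rule bounded_integrable[where B="(2 * b)\<^sup>2"])
    show "(\<lambda>z. (k z)\<^sup>2) \<in> borel_measurable P"
      using that assms(1-3) by (auto simp: fun_diff_def)
    show "\<bar>(k z)\<^sup>2\<bar> \<le> (2 * b)\<^sup>2" if "z \<in> space P" for z
      using b[of z k] that \<open>k = f - g \<or> k = f - f'\<close> by (simp add: space_P)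
  qed (rule P.finite_measure_axioms)
  have "L2_norm2 P (f - g) \<le> (\<integral>z. 2 * ((f - f') z)\<^sup>2 + 2 * e\<^sup>2 \<partial>P)"
    unfolding L2_norm2_def
  proof (rule integral_mono)
    show "integrable P (\<lambda>z. ((f - g) z)\<^sup>2)" by (rule int[OF disjI1[OF refl]])
    show "integrable P (\<lambda>z. 2 * ((f - f') z)\<^sup>2 + 2 * e\<^sup>2)"
      using int[of "f - f'"] by simp
    fix z assume "z \<in> space P"
    hence "\<bar>f' z - g z\<bar>\<^sup>2 \<le> e\<^sup>2"
      using e[of z] by (intro power_mono) (auto simp: space_P)
    thus "((f - g) z)\<^sup>2 \<le> 2 * ((f - f') z)\<^sup>2 + 2 * e\<^sup>2"
      using square_triangle[of "f z" "g z" "f' z"] by simp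
  qed
  also have "\<dots> = 2 * L2_norm2 P (f - f') + 2 * e\<^sup>2"
    using int[of "f - f'"] by (simp add: L2_norm2_def P.prob_space)
  finally show ?thesis .
qed

text \<open>The first event feeds \<open>goldenshluger_lepski_bound\<close>, the second transfers
  the empirical bound to L2(P), and e2 accounts for replacing f by g. Clipping the functions only
  decreases the empirical distance.\<close>

lemma (in gaussian_class) risk_bound:
  fixes x :: "nat \<Rightarrow> real^'d" and h :: "real \<Rightarrow> real \<Rightarrow> real^'d \<Rightarrow> real"
  assumes u\<Gamma>: "u \<in> \<Gamma>" and R: "R \<subseteq> {0..}" and n: "n \<ge> 1" and \<sigma>: "\<sigma> > 0" and \<nu>: "\<nu> > 0"
    and \<tau>: "\<tau> \<ge> 84 * J * \<sigma>" and t: "t = (\<tau> / (84 * J * \<sigma>))\<^sup>2"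
    and lse: "\<And>\<gamma> r. \<gamma> \<in> \<Gamma> \<Longrightarrow> r \<ge> 0 \<Longrightarrow> is_constrained_lse S (gauss_kernel \<gamma>) (H \<gamma>) (ip \<gamma>) n x y r (h \<gamma> r)"
    and gl: "is_gl_minimiser \<Gamma> R \<tau> \<nu> n x h \<gamma>h rh"
    and ev3: "event3_bound S \<Gamma> H ip g \<sigma> n t x h"
    and ev4: "\<And>\<gamma> r f1 f2. \<gamma> \<in> \<Gamma> \<Longrightarrow> r \<ge> 0 \<Longrightarrow> f1 \<in> ball \<gamma> r \<Longrightarrow> f2 \<in> ball \<gamma> r \<Longrightarrow> \<bar>dev n x f1 f2\<bar> \<le> rate n t * (r * w \<gamma>)"
    and g: "g \<in> borel_measurable P" "\<And>z. z \<in> S \<Longrightarrow> \<bar>g z\<bar> \<le> C"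
    and f: "f \<in> ball u r" and r: "r \<in> R"
  defines "e2 \<equiv> (sup_norm S (f - g))\<^sup>2"
  defines "E \<equiv> e2 + \<tau> * r / sqrt (real n)" and "K0 \<equiv> 16 + 2 * (1 + \<nu>) * w u"
  defines "K1 \<equiv> 1 + K0 / (2 * \<nu> * w v)"
  defines "K2 \<equiv> 2 * K0 + 5 / 2 * w u * K1 + 8"
  shows "L2_norm2 P ((clip C \<circ> h \<gamma>h rh) - g)
    \<le> 2 * (K2 + 151 * C * w u / (84 * \<sigma>) * K1) * E + 2 * (8 * C * w u / (3 * (84 * \<sigma>)\<^sup>2) * K1) * (\<tau> * E / sqrt (real n)) + 2 * e2"
proof -
  have J: "J \<ge> 1" by (rule J_ge_1)
  define a where "a = 84 * \<sigma>"
  have a: "a > 0" using \<sigma> by (simp add: a_def)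
  have aJ: "84 * J * \<sigma> = a * J" by (simp add: a_def)
  have "a * 1 \<le> a * J" using J a by (intro mult_left_mono) auto
  hence aJ_ge: "a \<le> a * J" by simp
  have \<tau>0: "\<tau> > 0" using \<tau> a aJ_ge unfolding aJ by linarith
  have st: "sqrt t = \<tau> / (a * J)"
    using \<tau>0 a J by (simp add: t aJ)
  have R0: "s \<ge> 0" if "s \<in> R" for s using R that by auto
  have wu: "w u > 0" by (rule w_pos[OF u\<Gamma>])
  have hat: "\<gamma>h \<in> \<Gamma>" "rh \<in> R" using gl by (simp_all add: is_gl_minimiser_def)
  have h_ball: "h \<gamma> s \<in> ball \<gamma> s" if "\<gamma> \<in> \<Gamma>" "s \<in> R" for \<gamma> s
    by (rule constrained_lse_emp_norm2_le(2)[OF rkhs'[OF that(1)] lse[OF that(1) R0[OF that(2)]] R0[OF that(2)]])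
  have h_le: "(1 / real n) * (\<Sum>i=1..n. (h \<gamma> s (x i) - y i)\<^sup>2) \<le> (1 / real n) * (\<Sum>i=1..n. (y i)\<^sup>2)" if "\<gamma> \<in> \<Gamma>" "s \<in> R" for \<gamma> s
    by (rule constrained_lse_emp_norm2_le(1)[OF rkhs'[OF that(1)] lse[OF that(1) R0[OF that(2)]] R0[OF that(2)]])
  have e2: "e2 \<ge> 0" by (simp add: e2_def)
  \<comment> \<open>The observations are indexed by i and need not be a function of the covariate.
    The estimator \<open>h u r\<close> serves as reference instead, at the cost of a factor
    4.\<close>
  obtain yy where yy: "\<And>\<gamma> s. \<gamma> \<in> \<Gamma> \<Longrightarrow> s \<in> R \<Longrightarrow> emp_norm2 n x (h \<gamma> s - yy) \<le> 4 * ((1 / real n) * (\<Sum>i=1..n. (y i)\<^sup>2))"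
  proof
    fix \<gamma> s assume gs: "\<gamma> \<in> \<Gamma>" "s \<in> R"
    define Y where "Y = (1 / real n) * (\<Sum>i=1..n. (y i)\<^sup>2)"
    have "emp_norm2 n x (h \<gamma> s - h u r) \<le> (1 / real n) * (\<Sum>i=1..n. 2 * (h \<gamma> s (x i) - y i)\<^sup>2 + 2 * (y i - h u r (x i))\<^sup>2)"
      unfolding emp_norm2_def fun_diff_def by (intro mult_left_mono sum_mono square_triangle) simp
    also have "\<dots> = 2 * ((1 / real n) * (\<Sum>i=1..n. (h \<gamma> s (x i) - y i)\<^sup>2)) + 2 * ((1 / real n) * (\<Sum>i=1..n. (h u r (x i) - y i)\<^sup>2))"
      unfolding sum.distrib sum_distrib_left[symmetric] power2_commute[of "y _"] distrib_left by simp
    also have "\<dots> \<le> 2 * Y + 2 * Y"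
      using h_le[OF gs] h_le[OF u\<Gamma> r] unfolding Y_def by linarith
    finally show "emp_norm2 n x (h \<gamma> s - h u r) \<le> 4 * ((1 / real n) * (\<Sum>i=1..n. (y i)\<^sup>2))"
      by (simp add: Y_def)
  qed
  define p where "p = \<tau> * r / sqrt (real n)"
  define q where "q = \<tau> * max r rh / sqrt (real n)"
  define s where "s = max r rh"
  have near: "emp_norm2 n x (h u z - f) \<le> \<tau> * (w u * z) / sqrt (real n) / 4 + 4 * e2" if z: "z \<in> R" "r \<le> z" for z
  proof -
    have "f \<in> ball u z" using f ball_mono_radius[OF z(2)] by blast
    hence "emp_norm2 n x (h u z - f) \<le> 21 * J * u powr (- real CARD('d) / 2) * \<sigma> * z * sqrt t / sqrt (real n) + 4 * e2"
      using ev3 u\<Gamma> R0[OF z(1)] unfolding event3_bound_def e2_def by blast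
    \<comment> \<open>The choice of t is made for this: 84 = 4 * 21 turns the stochastic term into a
      quarter of the penalty.\<close>
    also have "21 * J * u powr (- real CARD('d) / 2) * \<sigma> * z * sqrt t / sqrt (real n) = \<tau> * (w u * z) / sqrt (real n) / 4"
      using J a by (simp add: st a_def w_def mult_ac)
    finally show ?thesis .
  qed
  note GL = goldenshluger_lepski_bound[OF u \<Gamma>(2) u\<Gamma> R n \<tau>0 \<nu> yy gl near[unfolded w_def] r e2]
  have q_le: "q \<le> K1 * E" and emp_le: "emp_norm2 n x (h \<gamma>h rh - f) \<le> K2 * E"
    using GL unfolding K2_def K1_def K0_def E_def q_def w_def by blast+
  have s: "s \<in> R" "r \<le> s" "rh \<le> s" using r hat(2) by (auto simp: s_def max_def)
  have s0: "s \<ge> 0" by (rule R0[OF s(1)])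
  have "u \<le> \<gamma>h" using hat(1) \<Gamma> by auto
  \<comment> \<open>Lowering the width to u and raising the radius to s both enlarge the ball, so
    selected estimator and approximant share one ball and the deviation bound applies to the
    pair.\<close>
  have hb: "h \<gamma>h rh \<in> ball u s"
    using h_ball[OF hat] ball_mono_width[OF u\<Gamma> hat(1) \<open>u \<le> \<gamma>h\<close> R0[OF hat(2)]] ball_mono_radius[OF s(3), of u] by blast
  have fb: "f \<in> ball u s" using f ball_mono_radius[OF s(2)] by blast
  have qs: "q = \<tau> * s / sqrt (real n)" by (simp add: q_def s_def)
  have q0: "q \<ge> 0" using \<tau>0 s0 by (simp add: qs)
  have "rate n t * (s * w u) \<le> 151 * C * w u / a * q + 8 * C * w u / (3 * a\<^sup>2) * (\<tau> * q / sqrt (real n))"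
  proof -
    have "151 * J * C * sqrt t / sqrt (real n) * (s * w u) = 151 * C * w u / a * q"
      using J a by (simp add: st qs)
    moreover have "8 * C * t / (3 * real n) * (s * w u) \<le> 8 * C * w u / (3 * a\<^sup>2) * (\<tau> * q / sqrt (real n))"
    proof -
      \<comment> \<open>J \<ge> 1 removes J from the denominator.\<close>
      have "\<tau> / (a * J) \<le> \<tau> / a" using aJ_ge a \<tau>0 by (intro divide_left_mono) auto
      hence "t \<le> (\<tau> / a)\<^sup>2"
        unfolding t aJ using \<tau>0 a J by (intro power_mono) auto
      hence "8 * C * t / (3 * real n) * (s * w u) \<le> 8 * C * (\<tau> / a)\<^sup>2 / (3 * real n) * (s * w u)"
        using C s0 wu n by (intro mult_right_mono divide_right_mono mult_left_mono) auto
      also have "\<dots> = 8 * C * w u / (3 * a\<^sup>2) * (\<tau> * (\<tau> * s) / real n)"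
        by (simp add: power_divide power2_eq_square mult_ac)
      also have "\<tau> * (\<tau> * s) / real n = \<tau> * q / sqrt (real n)"
        unfolding qs by simp
      finally show ?thesis .
    qed
    ultimately show ?thesis unfolding rate_def distrib_right by linarith
  qed
  also have "\<dots> \<le> 151 * C * w u / a * (K1 * E) + 8 * C * w u / (3 * a\<^sup>2) * (\<tau> * (K1 * E) / sqrt (real n))"
    using q_le C wu a \<tau>0 by (intro add_mono mult_left_mono divide_right_mono) auto
  finally have rate_le: "rate n t * (s * w u) \<le> 151 * C * w u / a * (K1 * E) + 8 * C * w u / (3 * a\<^sup>2) * (\<tau> * (K1 * E) / sqrt (real n))" .
  have dev_le: "L2_norm2 P ((clip C \<circ> h \<gamma>h rh) - (clip C \<circ> f)) \<le> emp_norm2 n x ((clip C \<circ> h \<gamma>h rh) - (clip C \<circ> f)) + rate n t * (s * w u)"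
    using ev4[OF u\<Gamma> s0 hb fb] unfolding emp_norm2_sqd L2_norm2_sqd dev_def by linarith
  have "emp_norm2 n x ((clip C \<circ> h \<gamma>h rh) - (clip C \<circ> f)) \<le> K2 * E"
    by (rule order_trans[OF emp_norm2_clip_le emp_le])
  hence L2: "L2_norm2 P ((clip C \<circ> h \<gamma>h rh) - (clip C \<circ> f))
      \<le> K2 * E + (151 * C * w u / a * (K1 * E) + 8 * C * w u / (3 * a\<^sup>2) * (\<tau> * (K1 * E) / sqrt (real n)))"
    using dev_le rate_le by linarith
  have fg: "\<bar>f z - g z\<bar> \<le> sup_norm S (f - g)" if z: "z \<in> S" for z
  proof -
    have "\<bar>(f - g) z'\<bar> \<le> r * w u + C" if "z' \<in> S" for z'
      using ball_abs_le[OF u\<Gamma> f that] g(2)[OF that] by simp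
    from abs_le_sup_norm[of S "f - g", OF this z] show ?thesis by simp
  qed
  have "L2_norm2 P ((clip C \<circ> h \<gamma>h rh) - g) \<le> 2 * L2_norm2 P ((clip C \<circ> h \<gamma>h rh) - (clip C \<circ> f)) + 2 * (sup_norm S (f - g))\<^sup>2"
  proof (rule L2_norm2_triangle_le[where b=C])
    show "clip C \<circ> h \<gamma>h rh \<in> borel_measurable P" "clip C \<circ> f \<in> borel_measurable P"
      unfolding comp_def by (intro clip_measurable ball_measurable[OF u\<Gamma> hb] ball_measurable[OF u\<Gamma> fb])+
    fix z assume z: "z \<in> S"
    show "\<bar>(clip C \<circ> h \<gamma>h rh) z\<bar> \<le> C" "\<bar>(clip C \<circ> f) z\<bar> \<le> C"
      using abs_clip_le C by simp_all
    have "clip C (g z) = g z" by (rule clip_eq[OF g(2)[OF z]])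
    thus "\<bar>(clip C \<circ> f) z - g z\<bar> \<le> sup_norm S (f - g)"
      using abs_clip_diff_le[of C "f z" "g z"] fg[OF z] by simp
  qed (rule g; assumption)+
  also have "\<dots> \<le> 2 * (K2 * E + (151 * C * w u / a * (K1 * E) + 8 * C * w u / (3 * a\<^sup>2) * (\<tau> * (K1 * E) / sqrt (real n)))) + 2 * e2"
    unfolding e2_def by (intro add_right_mono mult_left_mono L2) simp
  also have "\<dots> = 2 * (K2 + 151 * C * w u / a * K1) * E + 2 * (8 * C * w u / (3 * a\<^sup>2) * K1) * (\<tau> * E / sqrt (real n)) + 2 * e2"
    by (simp add: distrib_left distrib_right mult_ac)
  finally show ?thesis by (simp only: a_def)
qed

section \<open>Choice of constants, approximant and radius\<close>

theorem corollary9: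
  fixes S :: "(real^'d) set"
    and Q :: "((real^'d) \<times> real) measure"
    and P :: "(real^'d) measure"
    and g :: "real^'d \<Rightarrow> real"
    and \<Gamma> :: "real set"
    and H :: "real \<Rightarrow> (real^'d \<Rightarrow> real) set"
    and ip :: "real \<Rightarrow> (real^'d \<Rightarrow> real) \<Rightarrow> (real^'d \<Rightarrow> real) \<Rightarrow> real"
    and C \<sigma> u v \<alpha> \<beta> B \<nu> a b c :: real
  assumes P_def: "P = distr Q (borel_on S) fst"
    and g_meas: "g \<in> borel_measurable (borel_on S)"
    and C_pos: "C > 0" and g_bdd: "\<forall>x\<in>S. \<bar>g x\<bar> \<le> C"
    and sigma_pos: "\<sigma> > 0"
    and uv: "0 < u" "u \<le> v"
    and Gamma: "\<Gamma> \<noteq> {}" "\<Gamma> \<subseteq> {u..v}"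
    and rkhs: "\<forall>\<gamma>\<in>{u..v}. is_rkhs S (gauss_kernel \<gamma>) (H \<gamma>) (ip \<gamma>)"
    and params: "\<alpha> \<in> {u..v}" "\<beta> \<in> {0<..<1}" "B > 0"
    and dense: "dense_subset (sup_norm S) (cont_funs S) (H \<alpha>)"
    and g_interp: "g \<in> interp_space (sup_norm S) (cont_funs S) (H \<alpha>) (ip_norm (ip \<alpha>)) \<beta>"
    and g_interp_norm: "interp_norm (sup_norm S) (H \<alpha>) (ip_norm (ip \<alpha>)) \<beta> g \<le> ennreal B"
    and nu_pos: "\<nu> > 0"
  shows "\<exists>D1>0. \<exists>D2>0. \<forall>n\<ge>1. \<forall>\<tau> t.
    \<tau> \<ge> 84 * complexity_J S \<Gamma> * \<sigma> \<longrightarrow> t = (\<tau> / (84 * complexity_J S \<Gamma> * \<sigma>))\<^sup>2 \<longrightarrow>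
    (\<forall>(M :: 'w measure) (X :: nat \<Rightarrow> 'w \<Rightarrow> real^'d) (Y :: nat \<Rightarrow> 'w \<Rightarrow> real)
       (R :: real set) (hhat :: 'w \<Rightarrow> real \<Rightarrow> real \<Rightarrow> real^'d \<Rightarrow> real)
       (ghat :: 'w \<Rightarrow> real) (rhat :: 'w \<Rightarrow> real) (A3 :: 'w set).
       regression_sample M S Q g n X Y \<longrightarrow>
       (\<forall>i\<in>{1..n}. subgaussian_given M (borel_on S) (\<sigma>\<^sup>2) (\<lambda>\<omega>. Y i \<omega> - g (X i \<omega>)) (X i)) \<longrightarrow>
       (\<forall>\<omega>\<in>space M. \<forall>\<gamma>\<in>\<Gamma>. \<forall>r\<ge>0.
          is_constrained_lse S (gauss_kernel \<gamma>) (H \<gamma>) (ip \<gamma>) n (\<lambda>i. X i \<omega>) (\<lambda>i. Y i \<omega>) r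
            (hhat \<omega> \<gamma> r)) \<longrightarrow>
       (\<forall>\<omega>\<in>space M.
          is_gl_minimiser \<Gamma> R \<tau> \<nu> n (\<lambda>i. X i \<omega>) (hhat \<omega>) (ghat \<omega>) (rhat \<omega>)) \<longrightarrow>
       (R = {0..} \<and> \<Gamma> = {u..v} \<and>
          rhat \<in> borel_measurable M \<and> ghat \<in> borel_measurable M
        \<or> a > 0 \<and> b > 0 \<and> c > 1 \<and> R = radius_grid a b n \<and> \<Gamma> = width_grid u v c) \<longrightarrow>
       A3 \<in> sets M \<longrightarrow> measure M A3 \<ge> 1 - exp (- t) \<longrightarrow>
       (\<forall>\<omega>\<in>A3. event3_bound S \<Gamma> H ip g \<sigma> n t (\<lambda>i. X i \<omega>) (hhat \<omega>)) \<longrightarrow>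
       (A3 \<inter> event4 M S P \<Gamma> H ip C n t X \<in> sets M \<and>
        measure M (A3 \<inter> event4 M S P \<Gamma> H ip C n t X) \<ge> 1 - 2 * exp (- t) \<and>
        (\<forall>\<omega>\<in>A3 \<inter> event4 M S P \<Gamma> H ip C n t X.
           L2_norm2 P ((clip C \<circ> hhat \<omega> (ghat \<omega>) (rhat \<omega>)) - g)
             \<le> D1 * \<tau> * real n powr (- \<beta> / (1 + \<beta>))
                + D2 * \<tau>\<^sup>2 * real n powr (- (1 + 3 * \<beta>) / (2 * (1 + \<beta>))))))"
proof -
  define w where "w \<gamma> = \<gamma> powr (- real CARD('d) / 2)" for \<gamma> :: real
  define a' where "a' = 84 * \<sigma>"
  define K0 where "K0 = 16 + 2 * (1 + \<nu>) * w u"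
  define K1 where "K1 = 1 + K0 / (2 * \<nu> * w v)"
  define K2 where "K2 = 2 * K0 + 5 / 2 * w u * K1 + 8"
  \<comment> \<open>The constant in \<open>E \<le> K3 * (\<tau> * N)\<close>: squared bias,
    converted with \<tau> \<ge> a'; the radius r0; and the rounding of the radius by at most
    |b|.\<close>
  define K3 where "K3 = 4 * B\<^sup>2 / a' + 2 * B + \<bar>b\<bar>"
  define c1 where "c1 = 2 * (K2 + 151 * C * w u / a' * K1)"
  define c2 where "c2 = 2 * (8 * C * w u / (3 * a'\<^sup>2) * K1)"
  \<comment> \<open>The term with C^2 B covers the n for which the radius grid does not reach r0.
    Absolute values appear because a and b have no sign in the continuous setting; for a = 0 the
    quotient is 0 by convention.\<close>
  define D1 where "D1 = c1 * K3 + 8 * B\<^sup>2 / a' + 8 * C\<^sup>2 * B / (\<bar>a\<bar> * a') + 1"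
  define D2 where "D2 = c2 * K3 + 1"
  have a': "a' > 0" using sigma_pos by (simp add: a'_def)
  have wuv: "w u > 0" "w v > 0" using uv by (simp_all add: w_def)
  have B: "B > 0" and \<beta>: "\<beta> \<in> {0<..<1}" and \<alpha>: "\<alpha> \<in> {u..v}" using params by auto
  have K0: "K0 > 0" using wuv nu_pos by (simp add: K0_def add_pos_pos)
  have K1: "K1 > 0" using K0 wuv nu_pos by (simp add: K1_def add_pos_pos)
  have K2: "K2 > 0" using K0 K1 wuv by (simp add: K2_def add_pos_pos)
  have K3: "K3 > 0" using B a' by (simp add: K3_def add_pos_nonneg)
  have c1: "c1 > 0" using K2 K1 wuv a' C_pos by (simp add: c1_def add_pos_pos)
  have c2: "c2 > 0" using K1 wuv a' C_pos by (simp add: c2_def)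
  have extra: "0 \<le> 8 * B\<^sup>2 / a'" "0 \<le> 8 * C\<^sup>2 * B / (\<bar>a\<bar> * a')" using B a' by simp_all
  have D1: "D1 > 0"
    using mult_pos_pos[OF c1 K3] extra unfolding D1_def by linarith
  have D2: "D2 > 0"
    using mult_pos_pos[OF c2 K3] unfolding D2_def by linarith
  show ?thesis
  proof (rule exI[of _ D1], rule conjI[OF D1], rule exI[of _ D2], rule conjI[OF D2], intro allI impI)
    fix n :: nat and \<tau> t :: real and M :: "'w measure" and X :: "nat \<Rightarrow> 'w \<Rightarrow> real^'d" and Y :: "nat \<Rightarrow> 'w \<Rightarrow> real"
      and R :: "real set" and hhat :: "'w \<Rightarrow> real \<Rightarrow> real \<Rightarrow> real^'d \<Rightarrow> real" and ghat rhat :: "'w \<Rightarrow> real" and A3 :: "'w set"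
    assume n: "n \<ge> 1" and \<tau>: "\<tau> \<ge> 84 * complexity_J S \<Gamma> * \<sigma>" and t: "t = (\<tau> / (84 * complexity_J S \<Gamma> * \<sigma>))\<^sup>2"
      and sample: "regression_sample M S Q g n X Y"
      and lse: "\<forall>\<omega>\<in>space M. \<forall>\<gamma>\<in>\<Gamma>. \<forall>r\<ge>0. is_constrained_lse S (gauss_kernel \<gamma>) (H \<gamma>) (ip \<gamma>) n (\<lambda>i. X i \<omega>) (\<lambda>i. Y i \<omega>) r (hhat \<omega> \<gamma> r)"
      and gl: "\<forall>\<omega>\<in>space M. is_gl_minimiser \<Gamma> R \<tau> \<nu> n (\<lambda>i. X i \<omega>) (hhat \<omega>) (ghat \<omega>) (rhat \<omega>)"
      and RG: "R = {0..} \<and> \<Gamma> = {u..v} \<and> rhat \<in> borel_measurable M \<and> ghat \<in> borel_measurable M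
        \<or> a > 0 \<and> b > 0 \<and> c > 1 \<and> R = radius_grid a b n \<and> \<Gamma> = width_grid u v c"
      and A3: "A3 \<in> sets M" "measure M A3 \<ge> 1 - exp (- t)"
      and ev3: "\<forall>\<omega>\<in>A3. event3_bound S \<Gamma> H ip g \<sigma> n t (\<lambda>i. X i \<omega>) (hhat \<omega>)"
    interpret M: prob_space M using sample by (simp add: regression_sample_def)
    have X_m: "X i \<in> measurable M (borel_on S)" if i: "i \<in> {1..n}" for i
    proof -
      have "(\<lambda>\<omega>. (X i \<omega>, Y i \<omega>)) \<in> measurable M (borel_on S \<Otimes>\<^sub>M borel)"
        using sample i unfolding regression_sample_def M.indep_vars_def by blast
      from measurable_compose[OF this measurable_fst] show ?thesis by simp
    qed
    have XS: "X i \<omega> \<in> S" if "i \<in> {1..n}" "\<omega> \<in> space M" for i \<omega>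
      using measurable_space[OF X_m[OF that(1)] that(2)] by (simp add: space_restrict_space)
    obtain \<omega>0 where "\<omega>0 \<in> space M" using M.not_empty by blast
    hence S_ne: "S \<noteq> {}" using XS[of 1 \<omega>0] n by auto
    have one: "1 \<in> {1..n}" using n by simp
    have prob_P: "prob_space P"
    proof -
      have m: "(\<lambda>\<omega>. (X 1 \<omega>, Y 1 \<omega>)) \<in> measurable M (borel_on S \<Otimes>\<^sub>M borel)"
        using sample one unfolding regression_sample_def M.indep_vars_def by blast
      have "distr M (borel_on S \<Otimes>\<^sub>M borel) (\<lambda>\<omega>. (X 1 \<omega>, Y 1 \<omega>)) = Q"
        using sample one unfolding regression_sample_def by blast
      hence "prob_space Q" using M.prob_space_distr[OF m] by simp
      moreover have "fst \<in> measurable Q (borel_on S)"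
        using \<open>distr M (borel_on S \<Otimes>\<^sub>M borel) (\<lambda>\<omega>. (X 1 \<omega>, Y 1 \<omega>)) = Q\<close> by (metis measurable_distr_eq1 measurable_fst)
      ultimately show ?thesis unfolding P_def by (rule prob_space.prob_space_distr)
    qed
    have sets_P: "sets P = sets (borel_on S)" by (simp add: P_def)
    have u\<Gamma>: "u \<in> \<Gamma>" using RG uv left_mem_width_grid[of u v c] by auto
    have R0: "R \<subseteq> {0..}" using RG radius_grid_nonneg[of a b n] by auto
    \<comment> \<open>Rationals for the full interval; a finite grid serves as its own approximating
      set.\<close>
    obtain \<Gamma>0 where \<Gamma>0: "countable \<Gamma>0" "\<Gamma>0 \<subseteq> \<Gamma>" "\<And>\<gamma>. \<gamma> \<in> \<Gamma> \<Longrightarrow> \<exists>s. (\<forall>m::nat. s m \<in> \<Gamma>0 \<and> s m \<le> \<gamma>) \<and> s \<longlonglongrightarrow> \<gamma>"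
    proof (cases "\<Gamma> = {u..v}")
      case True
      show ?thesis
        by (rule countable_left_dense_interval[OF uv(2)]) (rule that, simp_all add: True)
    next
      case False
      hence "countable \<Gamma>" using RG finite_width_grid by (auto intro: countable_finite)
      moreover have "\<exists>s. (\<forall>m::nat. s m \<in> \<Gamma> \<and> s m \<le> \<gamma>) \<and> s \<longlonglongrightarrow> \<gamma>" if "\<gamma> \<in> \<Gamma>" for \<gamma>
        using that by (intro exI[of _ "\<lambda>_. \<gamma>"]) simp
      ultimately show ?thesis by (intro that) auto
    qed
    interpret gc: gaussian_class S \<Gamma> u v P H ip C \<Gamma>0
    proof (intro gaussian_class.intro kernel_covering.intro gaussian_class_axioms.intro)
      show "is_rkhs S (gauss_kernel \<gamma>) (H \<gamma>) (ip \<gamma>)" if "\<gamma> \<in> \<Gamma>" for \<gamma>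
        using rkhs Gamma(2) that by blast
    qed (fact S_ne Gamma uv(1) prob_P sets_P C_pos \<Gamma>0)+
    have w: "gc.w = w" by (rule ext) (simp add: gc.w_def w_def)
    have J: "complexity_J S \<Gamma> \<ge> 1" by (rule gc.J_ge_1)
    have aJ: "84 * complexity_J S \<Gamma> * \<sigma> = a' * complexity_J S \<Gamma>" by (simp add: a'_def)
    have "a' * 1 \<le> a' * complexity_J S \<Gamma>" using J a' by (intro mult_left_mono) auto
    hence \<tau>a: "\<tau> \<ge> a'" using \<tau> unfolding aJ by linarith
    have \<tau>0: "\<tau> > 0" using \<tau>a a' by linarith
    have "1 \<le> \<tau> / (84 * complexity_J S \<Gamma> * \<sigma>)"
      using \<tau> J a' unfolding aJ by (simp add: pos_le_divide_eq)
    hence t1: "t \<ge> 1" unfolding t by simp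
    define A4 where "A4 = event4 M S P \<Gamma> H ip C n t X"
    have A4: "A4 \<in> sets M" "measure M A4 \<ge> 1 - exp (- t)"
      unfolding A4_def using gc.event4_prob[OF sample P_def n t1] by auto
    have inter: "A3 \<inter> A4 \<in> sets M" using A3(1) A4(1) by (rule sets.Int)
    \<comment> \<open>Inclusion--exclusion with the probability of the union at most 1.\<close>
    have "measure M (A3 \<inter> A4) \<ge> 1 - 2 * exp (- t)"
    proof -
      have "measure M (A3 \<union> A4) = measure M A3 + measure M A4 - measure M (A3 \<inter> A4)"
        by (rule measure_Un3) (use A3(1) A4(1) in \<open>simp_all add: M.fmeasurable_eq_sets\<close>)
      thus ?thesis using A3(2) A4(2) M.prob_le_1[of "A3 \<union> A4"] by linarith
    qed
    moreover have "L2_norm2 P ((clip C \<circ> hhat \<omega> (ghat \<omega>) (rhat \<omega>)) - g)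
        \<le> D1 * \<tau> * real n powr (- \<beta> / (1 + \<beta>)) + D2 * \<tau>\<^sup>2 * real n powr (- (1 + 3 * \<beta>) / (2 * (1 + \<beta>)))"
      if \<omega>: "\<omega> \<in> A3 \<inter> A4" for \<omega>
    proof -
      have \<omega>M: "\<omega> \<in> space M" using \<omega> A3(1) sets.sets_into_space by blast
      define h where "h = hhat \<omega>"
      define N where "N = real n powr (- \<beta> / (1 + \<beta>))"
      define s where "s = real n powr (- 1 / (2 * (1 + \<beta>)))"
      note ex = rate_exponents[OF n \<beta>, folded N_def s_def]
      have n0: "real n > 0" using n by simp
      have N: "N > 0" "s > 0" using n0 by (simp_all add: N_def s_def)
      have hatR: "rhat \<omega> \<in> R" "ghat \<omega> \<in> \<Gamma>" using gl \<omega>M by (auto simp: is_gl_minimiser_def)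
      have g_m: "g \<in> borel_measurable P"
        using g_meas by (simp only: measurable_cong_sets[OF sets_P refl])
      have gC: "\<bar>g z\<bar> \<le> C" if "z \<in> S" for z using g_bdd that by blast
      interpret \<alpha>: rkhs S "gauss_kernel \<alpha>" "H \<alpha>" "ip \<alpha>"
        using rkhs \<alpha> by unfold_locales blast
      \<comment> \<open>g and the members of \<open>H \<alpha>\<close> are bounded, so the real
        supremum dominates an absolute value.\<close>
      have sup_nonneg: "0 \<le> sup_norm S (g - f)" if f: "f \<in> H \<alpha>" for f
      proof -
        obtain z where z: "z \<in> S" using S_ne by blast
        have "\<bar>(g - f) y\<bar> \<le> C + ip_norm (ip \<alpha>) f * \<alpha> powr (- real CARD('d) / 2)" if "y \<in> S" for y
        proof -
          have "sqrt (gauss_kernel \<alpha> y y) = \<alpha> powr (- real CARD('d) / 2)"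
            using \<alpha> uv by (simp add: gauss_kernel_def powr_half_sqrt[symmetric] powr_powr)
          thus ?thesis using \<alpha>.abs_le[OF f that] gC[OF that] by simp
        qed
        from abs_le_sup_norm[of S "g - f", OF this z] show ?thesis by linarith
      qed
      obtain f where f: "f \<in> H \<alpha>" "sup_norm S (g - f) \<le> 2 * B * s powr \<beta>" "ip_norm (ip \<alpha>) f \<le> 2 * B * s powr (\<beta> - 1)"
      proof (rule interpolation_approx[OF g_interp_norm B N(2)])
        show "H \<alpha> \<noteq> {}" using \<alpha>.zero_mem by blast
        show "0 \<le> sup_norm S (g - f)" if "f \<in> H \<alpha>" for f by (rule sup_nonneg[OF that])
        show "0 \<le> ip_norm (ip \<alpha>) f" if "f \<in> H \<alpha>" for f by (rule \<alpha>.ip_norm_nonneg[OF that])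
      qed
      \<comment> \<open>The bound on the norm of the approximant; divided by sqrt n it is
        \<open>2 * B * N\<close>.\<close>
      define r0 where "r0 = 2 * B * s powr (\<beta> - 1)"
      have r0: "r0 \<ge> 0" using B by (simp add: r0_def)
      have r0N: "r0 / sqrt (real n) = 2 * B * N"
        using n0 by (simp add: r0_def ex(2))
      \<comment> \<open>\<alpha> need not belong to \<Gamma>, so the approximant is moved to the
        width u, which does.\<close>
      have "rkhs_ball (H \<alpha>) (ip \<alpha>) r0 \<subseteq> rkhs_ball (H u) (ip u) r0"
      proof (rule rkhs_ball_mono_kernel[OF \<alpha>.rkhs_axioms gc.rkhs'[OF u\<Gamma>] r0])
        show "(\<Sum>p\<leftarrow>l. \<Sum>q\<leftarrow>l. fst p * fst q * gauss_kernel \<alpha> (snd p) (snd q)) \<le> (\<Sum>p\<leftarrow>l. \<Sum>q\<leftarrow>l. fst p * fst q * gauss_kernel u (snd p) (snd q))" for l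
          by (rule gauss_kernel_order[OF uv(1)]) (use \<alpha> in simp)
      qed
      hence fu: "f \<in> rkhs_ball (H u) (ip u) r0"
        using f by (auto simp: rkhs_ball_def r0_def)
      define e2 where "e2 = (sup_norm S (f - g))\<^sup>2"
      have e2N: "e2 \<le> 4 * B\<^sup>2 * N"
      proof -
        have "sup_norm S (f - g) = sup_norm S (g - f)"
          by (simp add: sup_norm_def abs_minus_commute)
        hence "e2 \<le> (2 * B * s powr \<beta>)\<^sup>2"
          unfolding e2_def using f(2) sup_nonneg[OF f(1)] by (intro power_mono) auto
        also have "\<dots> = 4 * B\<^sup>2 * N" by (simp add: power_mult_distrib ex(1)[symmetric])
        finally show ?thesis .
      qed
      \<comment> \<open>Any available radius between r0 and r0 + |b| suffices; r0 itself is taken in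
        the continuous setting and its rounding on the grid.\<close>
      have good: "L2_norm2 P ((clip C \<circ> h (ghat \<omega>) (rhat \<omega>)) - g) \<le> D1 * \<tau> * N + D2 * \<tau>\<^sup>2 * (N / sqrt (real n))"
        if r: "r \<in> R" "r0 \<le> r" "r \<le> r0 + \<bar>b\<bar>" for r
      proof -
        define E where "E = e2 + \<tau> * r / sqrt (real n)"
        have fr: "f \<in> rkhs_ball (H u) (ip u) r" using fu r(2) by (auto simp: rkhs_ball_def)
        have ev4: "\<bar>gc.dev n (\<lambda>i. X i \<omega>) f1 f2\<bar> \<le> gc.rate n t * (r * gc.w \<gamma>)"
          if "\<gamma> \<in> \<Gamma>" "r \<ge> 0" "f1 \<in> rkhs_ball (H \<gamma>) (ip \<gamma>) r" "f2 \<in> rkhs_ball (H \<gamma>) (ip \<gamma>) r" for \<gamma> r f1 f2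
        proof -
          have "(SUP (f1, f2)\<in>rkhs_ball (H \<gamma>) (ip \<gamma>) r \<times> rkhs_ball (H \<gamma>) (ip \<gamma>) r.
              \<bar>emp_norm2 n (\<lambda>i. X i \<omega>) ((clip C \<circ> f1) - (clip C \<circ> f2)) - L2_norm2 P ((clip C \<circ> f1) - (clip C \<circ> f2))\<bar>)
              \<le> gc.rate n t * (r * gc.w \<gamma>)"
            using \<omega> that(1,2) unfolding A4_def event4_def gc.deviation_bound_eq by blast
          thus ?thesis
            unfolding gc.SUP_deviation_le_iff[OF n that(1,2)] using that(3,4) by blast
        qed
        have "L2_norm2 P ((clip C \<circ> h (ghat \<omega>) (rhat \<omega>)) - g) \<le> c1 * E + c2 * (\<tau> * E / sqrt (real n)) + 2 * e2"
          unfolding c1_def c2_def E_def e2_def K2_def K1_def K0_def a'_def w[symmetric]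
        proof (rule gc.risk_bound[OF u\<Gamma> R0 n sigma_pos nu_pos \<tau> t, where y="\<lambda>i. Y i \<omega>" and x="\<lambda>i. X i \<omega>"])
          show "is_constrained_lse S (gauss_kernel \<gamma>) (H \<gamma>) (ip \<gamma>) n (\<lambda>i. X i \<omega>) (\<lambda>i. Y i \<omega>) r (h \<gamma> r)" if "\<gamma> \<in> \<Gamma>" "r \<ge> 0" for \<gamma> r
            using lse \<omega>M that unfolding h_def by blast
          show "is_gl_minimiser \<Gamma> R \<tau> \<nu> n (\<lambda>i. X i \<omega>) h (ghat \<omega>) (rhat \<omega>)"
            using gl \<omega>M unfolding h_def by blast
          show "event3_bound S \<Gamma> H ip g \<sigma> n t (\<lambda>i. X i \<omega>) h"
            using ev3 \<omega> unfolding h_def by blast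
        qed (fact ev4 g_m gC fr r(1))+
        moreover have EN: "E \<le> K3 * (\<tau> * N)"
        proof -
          have "e2 \<le> 4 * B\<^sup>2 / a' * (\<tau> * N)"
          proof -
            have "4 * B\<^sup>2 * N * a' \<le> 4 * B\<^sup>2 * N * \<tau>"
              using \<tau>a N by (intro mult_left_mono) auto
            hence "4 * B\<^sup>2 * N \<le> 4 * B\<^sup>2 * N * \<tau> / a'"
              using a' by (simp add: pos_le_divide_eq)
            thus ?thesis using e2N by (simp add: mult_ac)
          qed
          moreover have "\<tau> * r / sqrt (real n) \<le> (2 * B + \<bar>b\<bar>) * (\<tau> * N)"
          proof -
            have "r / sqrt (real n) \<le> (r0 + \<bar>b\<bar>) / sqrt (real n)"
              using r(3) by (intro divide_right_mono) auto
            also have "\<dots> = 2 * B * N + \<bar>b\<bar> * (1 / sqrt (real n))"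
              by (simp add: add_divide_distrib r0N)
            also have "\<dots> \<le> 2 * B * N + \<bar>b\<bar> * N"
              using ex(3) by (intro add_left_mono mult_left_mono) auto
            finally have "\<tau> * (r / sqrt (real n)) \<le> \<tau> * (2 * B * N + \<bar>b\<bar> * N)"
              using \<tau>0 by (intro mult_left_mono) auto
            thus ?thesis by (simp add: algebra_simps)
          qed
          ultimately show ?thesis unfolding E_def K3_def by (simp add: distrib_right)
        qed
        have "c1 * E \<le> c1 * (K3 * (\<tau> * N))" using EN c1 by (intro mult_left_mono) auto
        moreover have "c2 * (\<tau> * E / sqrt (real n)) \<le> c2 * (\<tau> * (K3 * (\<tau> * N)) / sqrt (real n))"
          using EN c2 \<tau>0 by (intro mult_left_mono divide_right_mono) auto
        moreover have "2 * e2 \<le> 8 * B\<^sup>2 / a' * (\<tau> * N)"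
        proof -
          have "8 * B\<^sup>2 * N * a' \<le> 8 * B\<^sup>2 * N * \<tau>"
            using \<tau>a N by (intro mult_left_mono) auto
          hence "8 * B\<^sup>2 * N \<le> 8 * B\<^sup>2 * N * \<tau> / a'"
            using a' by (simp add: pos_le_divide_eq)
          thus ?thesis using e2N by (simp add: mult_ac)
        qed
        ultimately have "L2_norm2 P ((clip C \<circ> h (ghat \<omega>) (rhat \<omega>)) - g)
            \<le> c1 * (K3 * (\<tau> * N)) + c2 * (\<tau> * (K3 * (\<tau> * N)) / sqrt (real n)) + 8 * B\<^sup>2 / a' * (\<tau> * N)"
          by linarith
        also have "\<dots> = (c1 * K3 + 8 * B\<^sup>2 / a') * (\<tau> * N) + (c2 * K3) * (\<tau>\<^sup>2 * (N / sqrt (real n)))"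
          by (simp add: power2_eq_square algebra_simps)
        also have "\<dots> \<le> D1 * (\<tau> * N) + D2 * (\<tau>\<^sup>2 * (N / sqrt (real n)))"
          using extra N \<tau>0 n0 by (intro add_mono mult_right_mono) (auto simp: D1_def D2_def)
        finally show ?thesis by (simp only: mult.assoc)
      qed
      have "L2_norm2 P ((clip C \<circ> h (ghat \<omega>) (rhat \<omega>)) - g) \<le> D1 * \<tau> * N + D2 * \<tau>\<^sup>2 * (N / sqrt (real n))"
      proof (cases "R = {0..}")
        case True
        thus ?thesis using r0 by (intro good[of r0]) auto
      next
        case False
        hence grid: "a > 0" "b > 0" "R = radius_grid a b n" using RG by auto
        show ?thesis
        proof (cases "r0 \<le> a * sqrt (real n)")
          case True
          obtain r where "r \<in> radius_grid a b n" "r0 \<le> r" "r \<le> r0 + b"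
            by (rule radius_grid_approx[OF grid(1,2) r0 True])
          thus ?thesis using grid by (intro good[of r]) auto
        next
          case False
          \<comment> \<open>When the grid ends before r0, N exceeds a / (2 B), and the trivial risk
            bound 4 C^2 is absorbed into a multiple of \<tau> N.\<close>
          have "a < r0 / sqrt (real n)" using False n0 by (simp add: pos_less_divide_eq)
          hence aN: "a < 2 * B * N" by (simp only: r0N)
          have "h (ghat \<omega>) (rhat \<omega>) \<in> rkhs_ball (H (ghat \<omega>)) (ip (ghat \<omega>)) (rhat \<omega>)"
            using constrained_lse_emp_norm2_le(2)[OF gc.rkhs'[OF hatR(2)]] lse \<omega>M hatR R0 unfolding h_def by blast
          hence hm: "h (ghat \<omega>) (rhat \<omega>) \<in> borel_measurable P"
            by (rule gc.ball_measurable[OF hatR(2)])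
          have "\<bar>L2_norm2 P ((clip C \<circ> h (ghat \<omega>) (rhat \<omega>)) - g)\<bar> \<le> 4 * C\<^sup>2"
            unfolding L2_norm2_def
          proof (rule prob_space.abs_expectation_le[OF prob_P])
            show "(\<lambda>z. (((clip C \<circ> h (ghat \<omega>) (rhat \<omega>)) - g) z)\<^sup>2) \<in> borel_measurable P"
              using gc.clip_measurable[OF hm] g_m by simp
            fix z assume "z \<in> space P"
            hence z: "z \<in> S" by (simp add: gc.space_P)
            have "\<bar>clip C (h (ghat \<omega>) (rhat \<omega>) z) - g z\<bar> \<le> 2 * C"
              using abs_clip_le[of C "h (ghat \<omega>) (rhat \<omega>) z"] gC[OF z] C_pos by linarith
            hence "\<bar>clip C (h (ghat \<omega>) (rhat \<omega>) z) - g z\<bar>\<^sup>2 \<le> (2 * C)\<^sup>2"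
              by (intro power_mono) auto
            thus "\<bar>(((clip C \<circ> h (ghat \<omega>) (rhat \<omega>)) - g) z)\<^sup>2\<bar> \<le> 4 * C\<^sup>2"
              by (simp add: power_mult_distrib)
          qed
          hence "L2_norm2 P ((clip C \<circ> h (ghat \<omega>) (rhat \<omega>)) - g) \<le> 4 * C\<^sup>2" by linarith
          also have "\<dots> \<le> 8 * C\<^sup>2 * B / (\<bar>a\<bar> * a') * (\<tau> * N)"
          proof -
            have "a * a' \<le> (2 * B * N) * \<tau>"
              using aN \<tau>a a' grid(1) by (intro mult_mono) auto
            hence "4 * C\<^sup>2 * (a * a') \<le> 4 * C\<^sup>2 * ((2 * B * N) * \<tau>)"
              by (intro mult_left_mono) auto
            moreover have "a * a' > 0" using grid(1) a' by simp
            ultimately have "4 * C\<^sup>2 \<le> 4 * C\<^sup>2 * ((2 * B * N) * \<tau>) / (a * a')"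
              by (simp only: pos_le_divide_eq)
            thus ?thesis using grid(1) by (simp add: mult_ac)
          qed
          also have "\<dots> \<le> D1 * (\<tau> * N)"
            using extra mult_pos_pos[OF c1 K3] N \<tau>0 by (intro mult_right_mono) (auto simp: D1_def)
          also have "\<dots> \<le> D1 * (\<tau> * N) + D2 * (\<tau>\<^sup>2 * (N / sqrt (real n)))"
            using D2 N n0 by simp
          finally show ?thesis by (simp only: mult.assoc)
        qed
      qed
      thus ?thesis using ex(4) by (simp only: h_def N_def)
    qed
    ultimately show "A3 \<inter> event4 M S P \<Gamma> H ip C n t X \<in> sets M \<and>
        measure M (A3 \<inter> event4 M S P \<Gamma> H ip C n t X) \<ge> 1 - 2 * exp (- t) \<and>
        (\<forall>\<omega>\<in>A3 \<inter> event4 M S P \<Gamma> H ip C n t X.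
           L2_norm2 P ((clip C \<circ> hhat \<omega> (ghat \<omega>) (rhat \<omega>)) - g)
             \<le> D1 * \<tau> * real n powr (- \<beta> / (1 + \<beta>)) + D2 * \<tau>\<^sup>2 * real n powr (- (1 + 3 * \<beta>) / (2 * (1 + \<beta>))))"
      using inter unfolding A4_def by blast
  qed
qed

end
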